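(* Let $a,b>-1$, $c\in[0,\infty)$ and $T>0$ be fixed. For each $N\ge1$ let $\beta=\beta_N>0$ with $\beta_N N\to 2c$ as $N\to\infty$, and let $\{\lambda_i(t)\}_{i=1,\dots,N}$ be the beta Jacobi process with parameters $a,b,\beta_N$ and (deterministic) initial data $\{\lambda_0^{(N,i)}\}_{i=1}^N$, $0\le\lambda_0^{(N,1)}\le\cdots\le\lambda_0^{(N,N)}\le1$. Put $\mu_t^{(N)}=\frac1N\sum_{i=1}^N\delta_{\lambda_i(t)}$ and $S_k^{(N)}(t)=\int x^k\,d\mu_t^{(N)}(x)=\frac1N\sum_{i=1}^N\lambda_i(t)^k$. Assume that $\mu_0^{(N)}=\frac1N\sum_{i=1}^N\delta_{\lambda_0^{(N,i)}}$ converges weakly to a probability measure $\mu_0$ as $N\to\infty$. Then the following hold. (i) For each $k=1,2,\dots$, the sequence $S_k^{(N)}$, as random elements of $\mathcal C([0,T],\mathbb R)$ with the uniform norm, converges in probability as $N\to\infty$ to a deterministic limit $m_k(t)$, defined inductively (with $m_0(t)\equiv1$) as the solution of the initial value problem $$m_k'(t)=-k(2c+a+b+k+1)m_k(t)+k(a+k)m_{k-1}(t)+ck\sum_{i=0}^{k-1}m_i(t)m_{k-1-i}(t)-ck\sum_{j=1}^{k-1}m_j(t)m_{k-j}(t),$$ $$m_k(0)=\lim_{N\to\infty}\int x^k\,d\mu_0^{(N)}(x).$$ (ii) Let $\{u_k\}$ be defined by $u_0=1$ and $$u_k=\frac{1}{2c+a+b+k+1}\Big((a+k)u_{k-1}+c\sum_{i=0}^{k-1}u_iu_{k-1-i}-c\sum_{j=1}^{k-1}u_ju_{k-j}\Big),\qquad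 k=1,2,\dots.$$ Then $\lim_{t\to\infty}m_k(t)=u_k$ for every $k$. (iii) For any $t\ge0$ let $\mu_t$ be the unique measure with moments $\{m_k(t)\}_{k\ge0}$. Then the sequence of empirical measure processes $(\mu_t^{(N)})_{0\le t\le T}$ converges in probability to $(\mu_t)_{0\le t\le T}$ as random elements of $\mathcal C([0,T],\mathcal P([0,1]))$. Moreover, the continuous probability-measure-valued process $\mu_t$ converges weakly to $\nu_{a,b,c}$ as $t\to\infty$.
   Context: Beta Jacobi process: for $a>-1$, $b>-1$, $\beta>0$, a continuous process $(\lambda_1(t),\dots,\lambda_N(t))$ in $W=\{x\in\mathbb R^N:0\le x_1\le\cdots\le x_N\le1\}$ satisfying, for $i=1,\dots,N$, $$d\lambda_i=\sqrt{2\lambda_i(1-\lambda_i)}\,db_i+\Big(a+1-(a+b+2)\lambda_i+\frac\beta2\sum_{j\ne i}\frac{2\lambda_i(1-\lambda_i)}{\lambda_i-\lambda_j}\Big)dt,\qquad \lambda_i(0)=\lambda_0^{(N,i)},$$ where $b_1,\dots,b_N$ are independent standard Brownian motions. Particles may collide when $0<\beta<1$, but almost surely the set of times $t$ at which $\lambda_i(t)=\lambda_j(t)$ for some $i\ne j$ has Lebesgue measure zero. $\mathcal P([0,1])$ is the space of probability measures on $[0,1]$ with the topology of weak convergence, and $\mathcal C([0,T],\mathcal P([0,1]))$ is the space of continuous maps $[0,T]\to\mathcal P([0,1])$ with the topology of uniform convergence. The measure $\nu_{a,b,c}$ is the spectral measure of the infinite Jacobi (symmetric tridiagonal) matrix $J$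 with diagonal entries $\hat\lambda_0,\ \lambda_1+\mu_1,\ \lambda_2+\mu_2,\dots$ and off-diagonal entries $\sqrt{\hat\lambda_0\mu_1},\sqrt{\lambda_1\mu_2},\sqrt{\lambda_2\mu_3},\dots$, i.e. the unique probability measure on $\mathbb R$ with $\int x^k\,d\nu_{a,b,c}(x)=J^k(1,1)$ for all $k\ge0$, where $$\hat\lambda_0=\frac{c+a+1}{2c+a+b+2},\quad \lambda_n=\frac{n+c+a+1}{2n+2c+a+b+2}\cdot\frac{n+c+a+b+1}{2n+2c+a+b+1},\quad \mu_n=\frac{n+c}{2n+2c+a+b+1}\cdot\frac{n+c+b}{2n+2c+a+b}\quad(n\ge1).$$ *)

theory Defs
  imports "HOL-Probability.Probability"
begin

section \<open>Stochastic differential equation\<close>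

definition brownian_motion ::
  "'w measure \<Rightarrow> (real \<Rightarrow> 'w measure) \<Rightarrow> nat \<Rightarrow> (nat \<Rightarrow> real \<Rightarrow> 'w \<Rightarrow> real) \<Rightarrow> bool" where
  "brownian_motion M F n B \<longleftrightarrow>
     (\<forall>i<n. \<forall>t\<ge>0. B i t \<in> borel_measurable (F t)) \<and>
     (\<forall>i<n. AE \<omega> in M. B i 0 \<omega> = 0 \<and> continuous_on {0..} (\<lambda>t. B i t \<omega>)) \<and>
     (\<forall>s t. 0 \<le> s \<and> s < t \<longrightarrow>
        (\<forall>i<n. distributed M lborel (\<lambda>\<omega>. B i t \<omega> - B i s \<omega>)
                 (\<lambda>x. ennreal (normal_density 0 (sqrt (t - s)) x))) \<and>
        prob_space.indep_vars M (\<lambda>_. borel) (\<lambda>i \<omega>. B i t \<omega> - B i s \<omega>) {..<n} \<and>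
        prob_space.indep_set M (sets (F s))
          (sets (vimage_algebra (space M) (\<lambda>\<omega>. \<lambda>i\<in>{..<n}. B i t \<omega> - B i s \<omega>)
             (\<Pi>\<^sub>M i\<in>{..<n}. borel))))"

text \<open>
  A triple (n, tau, xi) encodes the elementary process that equals xi j on the interval
  from tau j (exclusive) to tau (j + 1) (inclusive), for j < n.
\<close>

type_synonym 'w elementary = "nat \<times> (nat \<Rightarrow> real) \<times> (nat \<Rightarrow> 'w \<Rightarrow> real)"

definition elementary :: "'w measure \<Rightarrow> (real \<Rightarrow> 'w measure) \<Rightarrow> real \<Rightarrow> 'w elementary \<Rightarrow> bool" where
  "elementary M F t = (\<lambda>(n, \<tau>, \<xi>).
     0 \<le> \<tau> 0 \<and> \<tau> n \<le> t \<and> (\<forall>j<n. \<tau> j \<le> \<tau> (Suc j)) \<and>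
     (\<forall>j<n. \<xi> j \<in> borel_measurable (F (\<tau> j))) \<and>
     (\<exists>C. \<forall>j<n. \<forall>\<omega>\<in>space M. \<bar>\<xi> j \<omega>\<bar> \<le> C))"

definition elementary_process :: "'w elementary \<Rightarrow> real \<Rightarrow> 'w \<Rightarrow> real" where
  "elementary_process = (\<lambda>(n, \<tau>, \<xi>) s \<omega>. \<Sum>j<n. \<xi> j \<omega> * indicator {\<tau> j<..\<tau> (Suc j)} s)"

definition elementary_integral :: "(real \<Rightarrow> 'w \<Rightarrow> real) \<Rightarrow> 'w elementary \<Rightarrow> 'w \<Rightarrow> real" where
  "elementary_integral B = (\<lambda>(n, \<tau>, \<xi>) \<omega>. \<Sum>j<n. \<xi> j \<omega> * (B (\<tau> (Suc j)) \<omega> - B (\<tau> j) \<omega>))"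

text \<open>
  X is a version of the Ito integral of H against the Brownian motion B over the time interval
  from 0 to t: H is the limit, in the mean square on the product of the time interval with M, of
  elementary processes whose elementary integrals converge to X in mean square.
\<close>

definition has_ito_integral ::
  "'w measure \<Rightarrow> (real \<Rightarrow> 'w measure) \<Rightarrow> (real \<Rightarrow> 'w \<Rightarrow> real) \<Rightarrow> (real \<Rightarrow> 'w \<Rightarrow> real) \<Rightarrow>
   real \<Rightarrow> ('w \<Rightarrow> real) \<Rightarrow> bool" where
  "has_ito_integral M F B H t X \<longleftrightarrow>
     (\<lambda>(s, \<omega>). H s \<omega>) \<in> borel_measurable (restrict_space borel {0..t} \<Otimes>\<^sub>M M) \<and>
     (\<forall>s\<in>{0..t}. H s \<in> borel_measurable (F s)) \<and>
     X \<in> borel_measurable M \<and>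
     (\<exists>\<phi>. (\<forall>n. elementary M F t (\<phi> n)) \<and>
        (\<lambda>n. \<integral>\<^sup>+\<omega>. (\<integral>\<^sup>+s\<in>{0..t}. ennreal ((elementary_process (\<phi> n) s \<omega> - H s \<omega>)\<^sup>2) \<partial>lborel) \<partial>M)
          \<longlonglongrightarrow> 0 \<and>
        (\<lambda>n. \<integral>\<^sup>+\<omega>. ennreal ((elementary_integral B (\<phi> n) \<omega> - X \<omega>)\<^sup>2) \<partial>M) \<longlonglongrightarrow> 0)"

text \<open>
  Particles are numbered 0, ..., N - 1.  At collision times the singular quotients below are 0 by
  the convention for division; by the condition on collisions in the next definition, these times
  do not contribute to the drift integral.
\<close>

definition jacobi_drift :: "real \<Rightarrow> real \<Rightarrow> real \<Rightarrow> nat \<Rightarrow> (nat \<Rightarrow> real) \<Rightarrow> nat \<Rightarrow> real" where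
  "jacobi_drift a b \<beta> N x i =
     a + 1 - (a + b + 2) * x i +
     \<beta> / 2 * (\<Sum>j\<in>{..<N} - {i}. 2 * x i * (1 - x i) / (x i - x j))"

definition beta_jacobi_process ::
  "real \<Rightarrow> real \<Rightarrow> real \<Rightarrow> nat \<Rightarrow> (nat \<Rightarrow> real) \<Rightarrow>
   'w measure \<Rightarrow> (real \<Rightarrow> 'w measure) \<Rightarrow> (nat \<Rightarrow> real \<Rightarrow> 'w \<Rightarrow> real) \<Rightarrow>
   (nat \<Rightarrow> real \<Rightarrow> 'w \<Rightarrow> real) \<Rightarrow> bool" where
  "beta_jacobi_process a b \<beta> N x0 M F B \<Lambda> \<longleftrightarrow>
     prob_space M \<and> filtration (space M) F \<and> (\<forall>t\<ge>0. subalgebra M (F t)) \<and>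
     brownian_motion M F N B \<and>
     (\<forall>i<N. \<forall>t\<ge>0. \<Lambda> i t \<in> borel_measurable (F t)) \<and>
     (\<forall>\<omega>\<in>space M. \<forall>i<N. continuous_on {0..} (\<lambda>t. \<Lambda> i t \<omega>)) \<and>
     (\<forall>\<omega>\<in>space M. \<forall>t\<ge>0. mono_on {..<N} (\<lambda>i. \<Lambda> i t \<omega>) \<and> (\<forall>i<N. \<Lambda> i t \<omega> \<in> {0..1})) \<and>
     (AE \<omega> in M. \<forall>i<N. \<Lambda> i 0 \<omega> = x0 i) \<and>
     (AE \<omega> in M. {t. 0 \<le> t \<and> (\<exists>i<N. \<exists>j<N. i \<noteq> j \<and> \<Lambda> i t \<omega> = \<Lambda> j t \<omega>)} \<in> null_sets lborel) \<and>
     (\<forall>i<N. \<forall>t\<ge>0.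
        (AE \<omega> in M. set_integrable lborel {0..t} (\<lambda>s. jacobi_drift a b \<beta> N (\<lambda>j. \<Lambda> j s \<omega>) i)) \<and>
        has_ito_integral M F (B i) (\<lambda>s \<omega>. sqrt (2 * \<Lambda> i s \<omega> * (1 - \<Lambda> i s \<omega>))) t
          (\<lambda>\<omega>. \<Lambda> i t \<omega> - x0 i - (LBINT s:{0..t}. jacobi_drift a b \<beta> N (\<lambda>j. \<Lambda> j s \<omega>) i)))"

section \<open>Probability measures on the unit interval and path spaces\<close>

definition empirical_measure :: "nat \<Rightarrow> (nat \<Rightarrow> real) \<Rightarrow> real measure" where
  "empirical_measure N x = distr (uniform_count_measure {..<N}) borel x"

definition prob01 :: "real measure set" where
  "prob01 = {\<mu>. real_distribution \<mu> \<and> measure \<mu> {0..1} = 1}"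

definition bl_unit_ball :: "(real \<Rightarrow> real) set" where
  "bl_unit_ball = {f. 1-lipschitz_on UNIV f \<and> (\<forall>x. \<bar>f x\<bar> \<le> 1)}"

text \<open>
  The bounded Lipschitz (Fortet--Mourier, Dudley) metric, which metrizes weak convergence.  As the
  space of probability measures on the unit interval is weakly compact, its weak topology comes
  from a unique uniformity, so the topology of uniform convergence of paths and the notion of
  convergence in probability do not depend on the choice of the metric.
\<close>

definition bl_dist :: "real measure \<Rightarrow> real measure \<Rightarrow> real" where
  "bl_dist \<mu> \<nu> =
     (if \<mu> \<in> prob01 \<and> \<nu> \<in> prob01
      then SUP f\<in>bl_unit_ball. \<bar>(\<integral>x. f x \<partial>\<mu>) - (\<integral>x. f x \<partial>\<nu>)\<bar> else 0)"

lemma zero_in_bl_unit_ball: "(\<lambda>_. 0) \<in> bl_unit_ball"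
  by (auto simp: bl_unit_ball_def intro!: lipschitz_onI)

lemma bl_unit_ball_integral_le:
  assumes "real_distribution \<mu>" "f \<in> bl_unit_ball"
  shows "\<bar>\<integral>x. f x \<partial>\<mu>\<bar> \<le> 1"
proof -
  interpret real_distribution \<mu> by fact
  have "continuous_on UNIV f"
    using assms(2) by (auto simp: bl_unit_ball_def intro: lipschitz_on_continuous_on)
  hence "f \<in> borel_measurable \<mu>"
    using borel_measurable_continuous_onI by (simp add: measurable_def)
  hence "integrable \<mu> f"
    using assms(2) by (intro integrable_const_bound[of _ 1]) (auto simp: bl_unit_ball_def)
  hence "\<bar>\<integral>x. f x \<partial>\<mu>\<bar> \<le> (\<integral>x. 1 \<partial>\<mu>)"
    using assms(2) by (intro integral_abs_bound[THEN order_trans] integral_mono)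
      (auto simp: bl_unit_ball_def)
  moreover have "(\<integral>x. 1 \<partial>\<mu>) = (1::real)" using prob_space by simp
  ultimately show ?thesis by simp
qed

lemma bl_bdd_above:
  assumes "real_distribution \<mu>" "real_distribution \<nu>"
  shows "bdd_above ((\<lambda>f. \<bar>(\<integral>x. f x \<partial>\<mu>) - (\<integral>x. f x \<partial>\<nu>)\<bar>) ` bl_unit_ball)"
proof (rule bdd_aboveI2[where M = 2])
  fix f assume "f \<in> bl_unit_ball"
  thus "\<bar>(\<integral>x. f x \<partial>\<mu>) - (\<integral>x. f x \<partial>\<nu>)\<bar> \<le> 2"
    using bl_unit_ball_integral_le[OF assms(1)] bl_unit_ball_integral_le[OF assms(2)]
    by (smt (verit))
qed

lemma cts_step_scaled_in_bl_unit_ball: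
  assumes "x < y"
  shows "(\<lambda>z. min 1 (y - x) * cts_step x y z) \<in> bl_unit_ball"
proof -
  define h where "h = min 1 (y - x)"
  have h: "0 < h" "h \<le> 1" "h \<le> y - x" using assms by (auto simp: h_def)
  have step: "cts_step x y z = max 0 (min 1 ((y - z) / (y - x)))" for z
    using assms by (auto simp: cts_step_def divide_simps)
  have "\<bar>h * cts_step x y z - h * cts_step x y w\<bar> \<le> \<bar>z - w\<bar>" for z w
  proof -
    have "\<bar>cts_step x y z - cts_step x y w\<bar> \<le> \<bar>(y - z) / (y - x) - (y - w) / (y - x)\<bar>"
      unfolding step by (auto simp: min_def max_def)
    also have "\<dots> = \<bar>z - w\<bar> / (y - x)"
      using assms by (simp add: diff_divide_distrib[symmetric] abs_minus_commute)
    finally have "h * \<bar>cts_step x y z - cts_step x y w\<bar> \<le> h * (\<bar>z - w\<bar> / (y - x))"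
      using h by (intro mult_left_mono) auto
    also have "\<dots> \<le> (y - x) * (\<bar>z - w\<bar> / (y - x))"
      using h assms by (intro mult_right_mono) auto
    also have "\<dots> = \<bar>z - w\<bar>" using assms by simp
    finally show ?thesis
      using h by (simp add: right_diff_distrib[symmetric] abs_mult)
  qed
  moreover have "\<bar>h * cts_step x y z\<bar> \<le> 1" for z
    using h by (auto simp: step abs_mult intro!: mult_le_one)
  ultimately show ?thesis
    by (auto simp: bl_unit_ball_def dist_real_def h_def intro!: lipschitz_onI)
qed

lemma Metric_space_bl_dist: "Metric_space prob01 bl_dist"
proof
  fix \<mu> \<nu> :: "real measure"
  show "0 \<le> bl_dist \<mu> \<nu>"
    by (auto simp: bl_dist_def prob01_def
        intro!: cSUP_upper2[OF _ zero_in_bl_unit_ball] bl_bdd_above)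
  show "bl_dist \<mu> \<nu> = bl_dist \<nu> \<mu>"
    by (auto simp: bl_dist_def abs_minus_commute)
next
  fix \<mu> \<nu> assume \<mu>\<nu>: "\<mu> \<in> prob01" "\<nu> \<in> prob01"
  hence rd: "real_distribution \<mu>" "real_distribution \<nu>" by (auto simp: prob01_def)
  show "bl_dist \<mu> \<nu> = 0 \<longleftrightarrow> \<mu> = \<nu>"
  proof
    assume 0: "bl_dist \<mu> \<nu> = 0"
    have eq: "(\<integral>z. f z \<partial>\<mu>) = (\<integral>z. f z \<partial>\<nu>)" if "f \<in> bl_unit_ball" for f
      using cSUP_upper[OF that bl_bdd_above[OF rd]] 0 \<mu>\<nu> by (simp add: bl_dist_def)
    have cts: "(\<integral>z. cts_step x y z \<partial>\<mu>) = (\<integral>z. cts_step x y z \<partial>\<nu>)" if "x < y" for x y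
      using eq[OF cts_step_scaled_in_bl_unit_ball[OF that]] that by (simp add: min_def split: if_splits)
    have le: "cdf \<mu>1 x \<le> cdf \<mu>2 x"
      if rd12: "real_distribution \<mu>1" "real_distribution \<mu>2"
        and e: "\<And>x y. x < y \<Longrightarrow> (\<integral>z. cts_step x y z \<partial>\<mu>1) = (\<integral>z. cts_step x y z \<partial>\<mu>2)"
      for \<mu>1 \<mu>2 :: "real measure" and x
    proof (rule tendsto_lowerbound)
      have "finite_borel_measure \<mu>2"
        using rd12(2) by (rule real_distribution.finite_borel_measure_M)
      thus "(cdf \<mu>2 \<longlongrightarrow> cdf \<mu>2 x) (at_right x)"
        using finite_borel_measure.cdf_is_right_cont continuous_within by blast
      have "cdf \<mu>1 x \<le> cdf \<mu>2 y" if "x < y" for y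
        using real_distribution.cdf_cts_step[OF rd12(1) that]
          real_distribution.cdf_cts_step[OF rd12(2) that] e[OF that] by linarith
      thus "\<forall>\<^sub>F y in at_right x. cdf \<mu>1 x \<le> cdf \<mu>2 y"
        by (auto simp: eventually_at_right[of x "x + 1"] intro: exI[of _ "x + 1"])
    qed simp
    have "cdf \<mu> = cdf \<nu>"
      using le[OF rd cts] le[OF rd(2,1) cts[symmetric]] by (intro ext antisym) auto
    thus "\<mu> = \<nu>" by (rule cdf_unique[OF rd])
  next
    assume "\<mu> = \<nu>"
    moreover have "bl_unit_ball \<noteq> {}" using zero_in_bl_unit_ball by blast
    ultimately show "bl_dist \<mu> \<nu> = 0" by (simp add: bl_dist_def)
  qed
next
  fix \<mu> \<nu> \<rho> assume in01: "\<mu> \<in> prob01" "\<nu> \<in> prob01" "\<rho> \<in> prob01"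
  hence rd: "real_distribution \<mu>" "real_distribution \<nu>" "real_distribution \<rho>"
    by (auto simp: prob01_def)
  have "bl_unit_ball \<noteq> {}" using zero_in_bl_unit_ball by blast
  moreover have "\<bar>(\<integral>x. f x \<partial>\<mu>) - (\<integral>x. f x \<partial>\<rho>)\<bar> \<le> bl_dist \<mu> \<nu> + bl_dist \<nu> \<rho>"
    if "f \<in> bl_unit_ball" for f
    using cSUP_upper[OF that bl_bdd_above[OF rd(1,2)]] cSUP_upper[OF that bl_bdd_above[OF rd(2,3)]]
      in01 by (simp add: bl_dist_def)
  ultimately have "(SUP f\<in>bl_unit_ball. \<bar>(\<integral>x. f x \<partial>\<mu>) - (\<integral>x. f x \<partial>\<rho>)\<bar>)
      \<le> bl_dist \<mu> \<nu> + bl_dist \<nu> \<rho>"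
    by (intro cSUP_least) auto
  thus "bl_dist \<mu> \<rho> \<le> bl_dist \<mu> \<nu> + bl_dist \<nu> \<rho>"
    using in01 by (simp add: bl_dist_def)
qed

definition prob01_metric :: "real measure metric" where
  "prob01_metric = metric (prob01, bl_dist)"

lemma mspace_prob01_metric [simp]: "mspace prob01_metric = prob01"
  by (simp add: prob01_metric_def Metric_space.mspace_metric[OF Metric_space_bl_dist])

lemma mdist_prob01_metric [simp]: "mdist prob01_metric = bl_dist"
  by (simp add: prob01_metric_def Metric_space.mdist_metric[OF Metric_space_bl_dist])

text \<open>Continuous paths on the interval from 0 to T, with the metric of uniform convergence.\<close>

definition path_metric :: "real \<Rightarrow> 'e metric \<Rightarrow> (real \<Rightarrow> 'e) metric" where
  "path_metric T m = cfunspace (top_of_set {0..T}) m"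

definition metric_borel :: "'e metric \<Rightarrow> 'e measure" where
  "metric_borel m = sigma (mspace m) {U. openin (mtopology_of m) U}"

text \<open>The random elements X N may live on different probability spaces M N, for N = 1, 2, ....\<close>

definition converges_in_prob ::
  "'e metric \<Rightarrow> (nat \<Rightarrow> 'w measure) \<Rightarrow> (nat \<Rightarrow> 'w \<Rightarrow> 'e) \<Rightarrow> 'e \<Rightarrow> bool" where
  "converges_in_prob m M X x \<longleftrightarrow>
     x \<in> mspace m \<and>
     (\<forall>N\<ge>1. X N \<in> M N \<rightarrow>\<^sub>M metric_borel m) \<and>
     (\<forall>\<epsilon>>0. (\<lambda>N. measure (M N) {\<omega> \<in> space (M N). mdist m (X N \<omega>) x > \<epsilon>}) \<longlonglongrightarrow> 0)"

section \<open>Moments\<close>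

text \<open>
  No finiteness of the measure has to be required: it is the integrability of the 0-th power.
\<close>

definition has_moments :: "real measure \<Rightarrow> (nat \<Rightarrow> real) \<Rightarrow> bool" where
  "has_moments \<mu> s \<longleftrightarrow>
     sets \<mu> = sets borel \<and> (\<forall>k. integrable \<mu> (\<lambda>x. x ^ k) \<and> (\<integral>x. x ^ k \<partial>\<mu>) = s k)"

text \<open>Here S0 N k is the k-th moment of the N-th initial empirical measure.\<close>

definition moment_ivp ::
  "real \<Rightarrow> real \<Rightarrow> real \<Rightarrow> (nat \<Rightarrow> nat \<Rightarrow> real) \<Rightarrow> (nat \<Rightarrow> real \<Rightarrow> real) \<Rightarrow> bool" where
  "moment_ivp a b c S0 m \<longleftrightarrow>
     (\<forall>t\<ge>0. m 0 t = 1) \<and>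
     (\<forall>k\<ge>1. (\<lambda>N. S0 N k) \<longlonglongrightarrow> m k 0) \<and>
     (\<forall>k\<ge>1. \<forall>t\<ge>0.
        (m k has_real_derivative
           - real k * (2 * c + a + b + real k + 1) * m k t
           + real k * (a + real k) * m (k - 1) t
           + c * real k * (\<Sum>i<k. m i t * m (k - 1 - i) t)
           - c * real k * (\<Sum>j\<in>{1..<k}. m j t * m (k - j) t))
        (at t within {0..}))"

function limit_moment :: "real \<Rightarrow> real \<Rightarrow> real \<Rightarrow> nat \<Rightarrow> real" where
  "limit_moment a b c k =
     (if k = 0 then 1
      else 1 / (2 * c + a + b + real k + 1) *
        ((a + real k) * limit_moment a b c (k - 1)
         + c * (\<Sum>i\<in>{..<k}. limit_moment a b c i * limit_moment a b c (k - 1 - i))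
         - c * (\<Sum>j\<in>{1..<k}. limit_moment a b c j * limit_moment a b c (k - j))))"
  by auto
termination
  by (relation "Wellfounded.measure (\<lambda>(a, b, c, k). k)") auto

declare limit_moment.simps [simp del]

section \<open>The Jacobi matrix and its spectral measure\<close>

definition jacobi_lambda :: "real \<Rightarrow> real \<Rightarrow> real \<Rightarrow> nat \<Rightarrow> real" where
  "jacobi_lambda a b c n =
     (if n = 0 then (c + a + 1) / (2 * c + a + b + 2)
      else (n + c + a + 1) / (2 * n + 2 * c + a + b + 2) *
           ((n + c + a + b + 1) / (2 * n + 2 * c + a + b + 1)))"

definition jacobi_mu :: "real \<Rightarrow> real \<Rightarrow> real \<Rightarrow> nat \<Rightarrow> real" where
  "jacobi_mu a b c n =
     (n + c) / (2 * n + 2 * c + a + b + 1) * ((n + c + b) / (2 * n + 2 * c + a + b))"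

text \<open>Rows and columns are numbered from 0, so that the (1,1) entry has indices 0 and 0.\<close>

definition jacobi_matrix :: "real \<Rightarrow> real \<Rightarrow> real \<Rightarrow> nat \<Rightarrow> nat \<Rightarrow> real" where
  "jacobi_matrix a b c i j =
     (if i = j then (if i = 0 then jacobi_lambda a b c 0 else jacobi_lambda a b c i + jacobi_mu a b c i)
      else if j = Suc i then sqrt (jacobi_lambda a b c i * jacobi_mu a b c j)
      else if i = Suc j then sqrt (jacobi_lambda a b c j * jacobi_mu a b c i)
      else 0)"

text \<open>
  Power of an infinite matrix whose entries (i, l) with l > i + 1 vanish, so that the finite sum
  is the whole matrix product.
\<close>

fun band_matrix_power :: "(nat \<Rightarrow> nat \<Rightarrow> real) \<Rightarrow> nat \<Rightarrow> nat \<Rightarrow> nat \<Rightarrow> real" where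
  "band_matrix_power J 0 i j = (if i = j then 1 else 0)"
| "band_matrix_power J (Suc k) i j = (\<Sum>l\<le>Suc i. J i l * band_matrix_power J k l j)"

definition is_spectral_measure :: "(nat \<Rightarrow> nat \<Rightarrow> real) \<Rightarrow> real measure \<Rightarrow> bool" where
  "is_spectral_measure J \<nu> \<longleftrightarrow>
     real_distribution \<nu> \<and> has_moments \<nu> (\<lambda>k. band_matrix_power J k 0 0)"

definition nu_measure :: "real \<Rightarrow> real \<Rightarrow> real \<Rightarrow> real measure" where
  "nu_measure a b c = (THE \<nu>. is_spectral_measure (jacobi_matrix a b c) \<nu>)"

end

theory Submission
  imports Defs
begin

text \<open>
  Ito's formula for the power sums S k turns the singular repulsion into a polynomial in
  S 0, ..., S k: after symmetrization, each quotient by the difference of two particles becomes a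
  divided difference of a power.  Hence S k = S k(0) + Y k + (time integral of a polynomial), where
  Y k is a martingale with E (Y k(T))^2 at most k^2 T / N.  By the maximal inequality Y k tends to 0
  uniformly on compact time intervals, and Gronwall's inequality gives the convergence to the
  solution of the moment hierarchy, by induction on k.  This hierarchy is triangular and its linear
  part is stable, which gives the limit of the moments as time tends to infinity.  By Bernstein
  approximation, finitely many moments control the bounded Lipschitz distance on the unit interval,
  so convergence of moments is convergence of measures.

  For the spectral measure, the recursion of the limit moments is a Riccati equation for their
  generating function.  Expanding it as an S-fraction preserves the shape of the equation, and the
  Jacobi matrix belongs to the even contraction of that fraction.
\<close>

section \<open>The moment hierarchy\<close>

text \<open>The stochastic calculus is rebuilt from the mean-square definition of the integral, and
  only as far as powers of a single particle require. Two obstacles shape it. The repulsive drift is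
  singular: all that is known is that it is integrable in time along almost every path. It is
  therefore never estimated in mean; the Ito formula is proved path by path along grids, and the
  drift enters through the integral of its absolute value. The filtration is not complete, so an
  almost sure limit need not be adapted. Martingale parts are therefore defined by explicit
  formulas, which give adaptedness, and limits only identify them.

  The factor 1/N has its origin in the orthogonality of the N driving motions, each of which enters
  S k with weight at most k/N.

  Both kinds of limit measures come from the dynamics by compactness: those with moments m k(t) from
  empirical measures at sample points, the spectral measure from these as time grows. No spectral
  theory is involved; the Riccati equation only identifies the moments.\<close>

lemma gronwall:
  fixes u :: "real \<Rightarrow> real"
  assumes cont: "continuous_on {0..T} u" and A: "A \<ge> 0"
    and le: "\<And>t. t \<in> {0..T} \<Longrightarrow> u t \<le> \<alpha> + A * integral {0..t} u"
    and t: "t \<in> {0..T}"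
  shows "u t \<le> \<alpha> * exp (A * t)"
proof -
  define v where "v t = integral {0..t} u" for t
  \<comment> \<open>The exponential weight turns the integral inequality into a sign of the
    derivative: \<open>w\<close> is nonincreasing and starts at \<alpha>.\<close>
  define w where "w t = exp (- A * t) * (\<alpha> + A * v t)" for t
  have dv: "(v has_real_derivative u s) (at s within {0..T})" if "s \<in> {0..T}" for s
    unfolding v_def by (rule integral_has_real_derivative[OF cont that])
  have dw: "(w has_real_derivative exp (- A * s) * (A * (u s - (\<alpha> + A * v s)))) (at s within {0..T})"
    if "s \<in> {0..T}" for s
    unfolding w_def by (rule derivative_eq_intros dv[OF that] refl | simp add: algebra_simps)+
  have "w t \<le> w 0"
  proof (rule DERIV_nonpos_imp_decreasing_open[where f = w])
    show "0 \<le> t" using t by simp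
    fix s assume s: "0 < s" "s < t"
    hence "at s within {0..T} = at s" using t by (intro at_within_interior) auto
    hence "DERIV w s :> exp (- A * s) * (A * (u s - (\<alpha> + A * v s)))" using dw[of s] s t by simp
    moreover have "exp (- A * s) * (A * (u s - (\<alpha> + A * v s))) \<le> 0"
      using le[of s] s t A by (intro mult_nonneg_nonpos) (auto simp: v_def mult_le_0_iff)
    ultimately show "\<exists>y. DERIV w s :> y \<and> y \<le> 0" by blast
  next
    have "continuous_on {0..T} w" using DERIV_continuous_on[OF dw] by simp
    thus "continuous_on {0..t} w" by (rule continuous_on_subset) (use t in auto)
  qed
  hence "exp (- A * t) * (\<alpha> + A * v t) \<le> \<alpha>" by (simp add: w_def v_def)
  hence "exp (A * t) * (exp (- A * t) * (\<alpha> + A * v t)) \<le> exp (A * t) * \<alpha>"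
    by (intro mult_left_mono) auto
  moreover have "exp (A * t) * (exp (- A * t) * (\<alpha> + A * v t)) = \<alpha> + A * v t"
    by (simp add: mult.assoc[symmetric] exp_add[symmetric])
  ultimately have "\<alpha> + A * v t \<le> exp (A * t) * \<alpha>" by (simp only:)
  thus ?thesis using le[OF t] by (simp add: v_def mult.commute)
qed

section \<open>Scalar linear differential equations on the half-line\<close>

lemma at_within_Icc_eq_Ici: "0 \<le> t \<Longrightarrow> at t within {0..t + 1} = at (t::real) within {0..}"
  by (rule at_within_nhd[where S = "{..<t + 1}"]) auto

text \<open>Variation of constants. At time 0 only a one-sided derivative makes sense, hence the
  derivative within the half-line.\<close>

lemma linear_ode_solution:
  fixes g :: "real \<Rightarrow> real"
  assumes g: "continuous_on {0..} g" and t: "t \<ge> 0"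
  shows "((\<lambda>t. exp (- A * t) * (y0 + integral {0..t} (\<lambda>s. exp (A * s) * g s)))
     has_real_derivative - A * (exp (- A * t) * (y0 + integral {0..t} (\<lambda>s. exp (A * s) * g s))) + g t)
     (at t within {0..})"
proof -
  \<comment> \<open>The interval reaches past t, so that the derivative within it agrees with the
    one within the half-line.\<close>
  have "continuous_on {0..t + 1} (\<lambda>s. exp (A * s) * g s)"
    by (intro continuous_intros continuous_on_subset[OF g]) auto
  hence "((\<lambda>t. integral {0..t} (\<lambda>s. exp (A * s) * g s)) has_real_derivative exp (A * t) * g t)
      (at t within {0..t + 1})"
    by (rule integral_has_real_derivative) (use t in auto)
  hence d: "((\<lambda>t. integral {0..t} (\<lambda>s. exp (A * s) * g s)) has_real_derivative exp (A * t) * g t)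
      (at t within {0..})"
    using at_within_Icc_eq_Ici[OF t] by simp
  define I where "I t = integral {0..t} (\<lambda>s. exp (A * s) * g s)" for t
  have "((\<lambda>t. exp (- A * t) * (y0 + I t)) has_real_derivative
      exp (- A * t) * (exp (A * t) * g t) + exp (- A * t) * - A * (y0 + I t)) (at t within {0..})"
    using d unfolding I_def[symmetric]
    by (auto intro!: derivative_eq_intros)
  moreover have "exp (- A * t) * (exp (A * t) * g t) = g t"
    by (simp add: mult.assoc[symmetric] flip: exp_add)
  ultimately have "((\<lambda>t. exp (- A * t) * (y0 + I t)) has_real_derivative
      g t + exp (- A * t) * - A * (y0 + I t)) (at t within {0..})" by (simp only:)
  thus ?thesis
    unfolding I_def[symmetric] by (rule DERIV_cong) simp
qed

text \<open>In the difference the forcing cancels, and the factor exp (A t) removes the linear term;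
  what is left has derivative 0.\<close>

lemma linear_ode_unique:
  fixes y z :: "real \<Rightarrow> real"
  assumes y: "\<And>t. t \<ge> 0 \<Longrightarrow> (y has_real_derivative - A * y t + g t) (at t within {0..})"
    and z: "\<And>t. t \<ge> 0 \<Longrightarrow> (z has_real_derivative - A * z t + g t) (at t within {0..})"
    and "y 0 = z 0" "t \<ge> 0"
  shows "y t = z t"
proof -
  define w where "w t = exp (A * t) * (y t - z t)" for t
  have "(w has_real_derivative 0) (at t within {0..})" if "t \<in> {0..}" for t
  proof -
    have "t \<ge> 0" using that by simp
    show ?thesis unfolding w_def
      by (auto intro!: derivative_eq_intros y[OF \<open>t \<ge> 0\<close>] z[OF \<open>t \<ge> 0\<close>] simp: algebra_simps)
  qed
  then obtain k where k: "\<And>t. t \<in> {0..} \<Longrightarrow> w t = k"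
    using has_field_derivative_zero_constant[of "{0..}" w] by auto
  have "w t = w 0" using k[of t] k[of 0] assms by simp
  thus ?thesis using assms by (simp add: w_def)
qed

text \<open>L'Hospital's rule for exp (A t) y(t) over exp (A t): the quotient of the derivatives is
  g(t) / A, and the denominator diverges because A > 0.\<close>

lemma linear_ode_limit:
  fixes y g :: "real \<Rightarrow> real"
  assumes y: "\<And>t. t \<ge> 0 \<Longrightarrow> (y has_real_derivative - A * y t + g t) (at t within {0..})"
    and A: "A > 0" and g: "(g \<longlongrightarrow> G) at_top"
  shows "(y \<longlongrightarrow> G / A) at_top"
proof -
  have "((\<lambda>t. (exp (A * t) * y t) / exp (A * t)) \<longlongrightarrow> G / A) at_top"
  proof (rule lhospital_at_top_at_top)
    show "LIM t at_top. exp (A * t) :> at_top"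
      using A by (intro filterlim_compose[OF exp_at_top] filterlim_tendsto_pos_mult_at_top[OF tendsto_const]
          filterlim_ident)
    show "\<forall>\<^sub>F t in at_top. A * exp (A * t) \<noteq> 0" using A by simp
    show "\<forall>\<^sub>F t in at_top. ((\<lambda>t. exp (A * t) * y t) has_real_derivative exp (A * t) * g t) (at t)"
      using eventually_gt_at_top[of 0]
    proof eventually_elim
      case (elim t)
      have "at t within {0..} = at t" using elim by (intro at_within_interior) auto
      hence "(y has_real_derivative - A * y t + g t) (at t)" using y[of t] elim by simp
      thus ?case by (auto intro!: derivative_eq_intros simp: algebra_simps)
    qed
    show "\<forall>\<^sub>F t in at_top. ((\<lambda>t. exp (A * t)) has_real_derivative A * exp (A * t)) (at t)"
      by (intro always_eventually allI) (auto intro!: derivative_eq_intros)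
    show "((\<lambda>t. exp (A * t) * g t / (A * exp (A * t))) \<longlongrightarrow> G / A) at_top"
      using tendsto_divide[OF g tendsto_const, of A] A by (simp add: mult.commute)
  qed
  thus ?thesis by simp
qed

section \<open>The hierarchy as a triangular system of scalar equations\<close>

definition moment_rate :: "real \<Rightarrow> real \<Rightarrow> real \<Rightarrow> nat \<Rightarrow> real" where
  "moment_rate a b c k = real k * (2 * c + a + b + real k + 1)"

text \<open>Together with \<open>moment_rate\<close> this splits the right-hand side so that level k
  becomes a scalar linear equation: for k at least 1 the k-th moment occurs in the linear term only,
  and the forcing reads entries below k. Every induction over k rests on this.\<close>

definition moment_forcing :: "real \<Rightarrow> real \<Rightarrow> nat \<Rightarrow> (nat \<Rightarrow> real) \<Rightarrow> real" where
  "moment_forcing a c k x = real k * (a + real k) * x (k - 1)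
     + c * real k * (\<Sum>i<k. x i * x (k - 1 - i)) - c * real k * (\<Sum>j\<in>{1..<k}. x j * x (k - j))"

lemma moment_rate_pos: "a > -1 \<Longrightarrow> b > -1 \<Longrightarrow> c \<ge> 0 \<Longrightarrow> k \<ge> 1 \<Longrightarrow> moment_rate a b c k > 0"
  by (auto simp: moment_rate_def intro!: mult_pos_pos)

lemma moment_forcing_cong:
  assumes "k \<ge> 1" "\<And>i. i < k \<Longrightarrow> x i = y i"
  shows "moment_forcing a c k x = moment_forcing a c k y"
proof -
  have "(\<Sum>i<k. x i * x (k - 1 - i)) = (\<Sum>i<k. y i * y (k - 1 - i))"
    by (rule sum.cong) (use assms in auto)
  moreover have "(\<Sum>j\<in>{1..<k}. x j * x (k - j)) = (\<Sum>j\<in>{1..<k}. y j * y (k - j))"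
    by (rule sum.cong) (use assms in auto)
  moreover have "x (k - 1) = y (k - 1)" using assms by simp
  ultimately show ?thesis by (simp only: moment_forcing_def)
qed

lemma tendsto_moment_forcing:
  assumes "k \<ge> 1" "\<And>i. i < k \<Longrightarrow> ((\<lambda>t. x t i) \<longlongrightarrow> y i) F"
  shows "((\<lambda>t. moment_forcing a c k (x t)) \<longlongrightarrow> moment_forcing a c k y) F"
  unfolding moment_forcing_def
proof (intro tendsto_add tendsto_diff tendsto_mult tendsto_const tendsto_sum)
qed (use assms in auto)

lemma continuous_on_moment_forcing:
  assumes "k \<ge> 1" "\<And>i. i < k \<Longrightarrow> continuous_on S (\<lambda>t. x t i)"
  shows "continuous_on S (\<lambda>t. moment_forcing a c k (x t))"
  unfolding continuous_on_def
proof
  fix t assume "t \<in> S"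
  thus "((\<lambda>t. moment_forcing a c k (x t)) \<longlongrightarrow> moment_forcing a c k (x t)) (at t within S)"
    using assms(2) by (intro tendsto_moment_forcing[OF assms(1)]) (simp add: continuous_on_def)
qed

lemma moment_ivp_iff:
  "moment_ivp a b c S0 m \<longleftrightarrow> (\<forall>t\<ge>0. m 0 t = 1) \<and> (\<forall>k\<ge>1. (\<lambda>N. S0 N k) \<longlonglongrightarrow> m k 0) \<and>
     (\<forall>k\<ge>1. \<forall>t\<ge>0. (m k has_real_derivative
        - moment_rate a b c k * m k t + moment_forcing a c k (\<lambda>i. m i t)) (at t within {0..}))"
proof -
  have "- real k * (2 * c + a + b + real k + 1) * m k t + real k * (a + real k) * m (k - 1) t
       + c * real k * (\<Sum>i<k. m i t * m (k - 1 - i) t) - c * real k * (\<Sum>j\<in>{1..<k}. m j t * m (k - j) t)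
      = - moment_rate a b c k * m k t + moment_forcing a c k (\<lambda>i. m i t)" for k t
    by (simp add: moment_rate_def moment_forcing_def)
  thus ?thesis unfolding moment_ivp_def by simp
qed

text \<open>The test i < k serves the termination proof only.\<close>

function moment_sol :: "real \<Rightarrow> real \<Rightarrow> real \<Rightarrow> (nat \<Rightarrow> real) \<Rightarrow> nat \<Rightarrow> real \<Rightarrow> real" where
  "moment_sol a b c s k = (\<lambda>t. if k = 0 then 1 else
     exp (- moment_rate a b c k * t) * (s k + integral {0..t} (\<lambda>r. exp (moment_rate a b c k * r) *
       moment_forcing a c k (\<lambda>i. if i < k then moment_sol a b c s i r else 0))))"
  by auto
termination by (relation "Wellfounded.measure (\<lambda>(a, b, c, s, k). k)") auto

declare moment_sol.simps [simp del]

lemma moment_ivp_continuous_on: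
  assumes "moment_ivp a b c S0 m"
  shows "continuous_on {0..} (m k)"
proof (cases "k \<ge> 1")
  case True
  thus ?thesis using assms by (auto simp: moment_ivp_iff intro!: DERIV_continuous_on)
next
  case False
  hence "k = 0" by simp
  hence "continuous_on {0..} (m k) \<longleftrightarrow> continuous_on {0..} (\<lambda>t::real. 1::real)"
    using assms by (intro continuous_on_cong) (simp_all add: moment_ivp_iff)
  thus ?thesis by simp
qed

lemma moment_ivp_exists:
  assumes "\<And>k. k \<ge> 1 \<Longrightarrow> (\<lambda>N. S0 N k) \<longlonglongrightarrow> s k"
  shows "moment_ivp a b c S0 (moment_sol a b c s)"
proof -
  have d: "(moment_sol a b c s k has_real_derivative - moment_rate a b c k * moment_sol a b c s k t
      + moment_forcing a c k (\<lambda>i. moment_sol a b c s i t)) (at t within {0..})"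
    if "k \<ge> 1" "t \<ge> 0" for k t
    using that
  proof (induction k arbitrary: t rule: less_induct)
    case (less k)
    have cont: "continuous_on {0..} (moment_sol a b c s i)" if "i < k" for i
    proof (cases "i = 0")
      case True thus ?thesis by (simp add: moment_sol.simps)
    next
      case False
      thus ?thesis using less.IH[OF that] by (auto intro!: DERIV_continuous_on)
    qed
    define g where "g r = moment_forcing a c k (\<lambda>i. if i < k then moment_sol a b c s i r else 0)" for r
    \<comment> \<open>The guard in the definition may be dropped, because the forcing reads only
      entries below k.\<close>
    have g: "g r = moment_forcing a c k (\<lambda>i. moment_sol a b c s i r)" for r
      unfolding g_def using less.prems by (intro moment_forcing_cong) auto
    have "continuous_on {0..} g"
      unfolding g_def using less.prems cont by (intro continuous_on_moment_forcing) auto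
    from linear_ode_solution[OF this less.prems(2), of "moment_rate a b c k" "s k"]
    have "(moment_sol a b c s k has_real_derivative - moment_rate a b c k * moment_sol a b c s k t
        + g t) (at t within {0..})"
      using less.prems(1) by (simp add: moment_sol.simps[of a b c s k] flip: g_def)
    thus ?case by (simp add: g)
  qed
  have "moment_sol a b c s k 0 = s k" if "k \<ge> 1" for k
    using that by (simp add: moment_sol.simps[of a b c s k])
  thus ?thesis using d assms by (simp add: moment_ivp_iff moment_sol.simps[of a b c s 0])
qed

text \<open>Once the lower moments agree, both functions solve the same scalar equation, and their
  initial values agree as limits of one sequence.\<close>

lemma moment_ivp_unique:
  assumes m: "moment_ivp a b c S0 m" and m': "moment_ivp a b c S0 m'" and "t \<ge> 0"
  shows "m' k t = m k t"
  using \<open>t \<ge> 0\<close>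
proof (induction k arbitrary: t rule: less_induct)
  case (less k)
  show ?case
  proof (cases "k = 0")
    case True
    thus ?thesis using assms less by (simp add: moment_ivp_iff)
  next
    case False
    hence k: "k \<ge> 1" by simp
    have eq: "moment_forcing a c k (\<lambda>i. m' i r) = moment_forcing a c k (\<lambda>i. m i r)" if "r \<ge> 0" for r
      using k less.IH that by (intro moment_forcing_cong) auto
    show ?thesis
    proof (rule linear_ode_unique[where y = "m' k" and z = "m k" and A = "moment_rate a b c k" and g =
        "\<lambda>t. moment_forcing a c k (\<lambda>i. m i t)"])
      show "m' k 0 = m k 0" using m m' k by (auto simp: moment_ivp_iff intro: LIMSEQ_unique)
    qed (use m m' k less.prems in \<open>auto simp: moment_ivp_iff simp flip: eq\<close>)
  qed
qed

text \<open>The forcing converges by the induction hypothesis, so level k tends to limiting forcing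
  over rate. The factor k common to both cancels, which leaves the recursion of
  \<open>limit_moment\<close>.\<close>

lemma moment_ivp_tendsto_limit_moment:
  assumes ab: "a > -1" "b > -1" "c \<ge> 0" and m: "moment_ivp a b c S0 m"
  shows "(m k \<longlongrightarrow> limit_moment a b c k) at_top"
proof (induction k rule: less_induct)
  case (less k)
  show ?case
  proof (cases "k = 0")
    case True
    have "\<forall>\<^sub>F t in at_top. m 0 t = 1"
      using eventually_ge_at_top[of 0] by eventually_elim (use m in \<open>auto simp: moment_ivp_iff\<close>)
    thus ?thesis using True by (simp add: limit_moment.simps[of a b c 0] tendsto_eventually)
  next
    case False
    hence k: "k \<ge> 1" by simp
    have "((\<lambda>t. moment_forcing a c k (\<lambda>i. m i t)) \<longlongrightarrow> moment_forcing a c k (limit_moment a b c)) at_top"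
      using k less by (intro tendsto_moment_forcing)
    hence "(m k \<longlongrightarrow> moment_forcing a c k (limit_moment a b c) / moment_rate a b c k) at_top"
      using m k by (intro linear_ode_limit[OF _ moment_rate_pos[OF ab k]]) (auto simp: moment_ivp_iff)
    also have "moment_forcing a c k (limit_moment a b c) / moment_rate a b c k = limit_moment a b c k"
    proof -
      define p where "p = (a + real k) * limit_moment a b c (k - 1)
         + c * (\<Sum>i\<in>{..<k}. limit_moment a b c i * limit_moment a b c (k - 1 - i))
         - c * (\<Sum>j\<in>{1..<k}. limit_moment a b c j * limit_moment a b c (k - j))"
      have "moment_forcing a c k (limit_moment a b c) = real k * p"
        by (simp add: moment_forcing_def p_def algebra_simps)
      moreover have "limit_moment a b c k = 1 / (2 * c + a + b + real k + 1) * p"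
        using k unfolding p_def by (subst limit_moment.simps) simp
      moreover have "real k \<noteq> 0" using k by simp
      ultimately show ?thesis
        by (simp add: moment_rate_def)
    qed
    finally show ?thesis .
  qed
qed

section \<open>Measures on the unit interval and their moments\<close>

lemma prob01_imp_real_distribution: "\<mu> \<in> prob01 \<Longrightarrow> real_distribution \<mu>"
  by (simp add: prob01_def)

lemma AE_prob01:
  assumes "\<mu> \<in> prob01"
  shows "AE x in \<mu>. x \<in> {0..1}"
proof -
  interpret real_distribution \<mu> using assms by (simp add: prob01_def)
  show ?thesis
    using assms AE_in_set_eq_1[of "{0..1}"] by (simp add: prob01_def)
qed

lemma prob01I:
  assumes "real_distribution \<mu>" "AE x in \<mu>. x \<in> {0..1}"
  shows "\<mu> \<in> prob01"
proof -
  interpret real_distribution \<mu> by fact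
  show ?thesis
    using assms AE_in_set_eq_1[of "{0..1}"] by (simp add: prob01_def)
qed

lemma integrable_prob01:
  fixes f :: "real \<Rightarrow> real"
  assumes "\<mu> \<in> prob01" and [measurable]: "f \<in> borel_measurable borel"
    and "\<And>x. x \<in> {0..1} \<Longrightarrow> \<bar>f x\<bar> \<le> C"
  shows "integrable \<mu> f"
proof -
  interpret real_distribution \<mu> using assms by (simp add: prob01_def)
  show ?thesis
    by (rule integrable_const_bound[of _ C]) (use AE_prob01[OF assms(1)] assms(3) in auto)
qed

lemma integral_prob01_le:
  fixes f :: "real \<Rightarrow> real"
  assumes "\<mu> \<in> prob01" and [measurable]: "f \<in> borel_measurable borel"
    and "\<And>x. x \<in> {0..1} \<Longrightarrow> \<bar>f x\<bar> \<le> C"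
  shows "\<bar>\<integral>x. f x \<partial>\<mu>\<bar> \<le> C"
proof -
  interpret real_distribution \<mu> using assms by (simp add: prob01_def)
  have "\<bar>\<integral>x. f x \<partial>\<mu>\<bar> \<le> (\<integral>x. \<bar>f x\<bar> \<partial>\<mu>)" by (rule integral_abs_bound)
  also have "\<dots> \<le> (\<integral>x. C \<partial>\<mu>)"
    by (rule integral_mono_AE) (use integrable_prob01[OF assms] AE_prob01[OF assms(1)] assms(3) in auto)
  also have "\<dots> = C" using prob_space by simp
  finally show ?thesis .
qed

lemma integrable_power_prob01: "\<mu> \<in> prob01 \<Longrightarrow> integrable \<mu> (\<lambda>x. x ^ k)"
  by (rule integrable_prob01[of _ _ 1]) (auto simp: power_abs intro: power_le_one)

section \<open>Bernstein approximation and the bounded Lipschitz distance\<close>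

lemma Bernstein_expand:
  "Bernstein n j x = (\<Sum>i\<le>n - j. real (n choose j) * real ((n - j) choose i) * (- 1) ^ i * x ^ (i + j))"
proof -
  have "(1 - x) ^ (n - j) = (\<Sum>i\<le>n - j. real ((n - j) choose i) * (- 1) ^ i * x ^ i)"
    using binomial_ring[of "- x" 1 "n - j"] by (simp add: power_minus[of x] mult.assoc)
  thus ?thesis by (simp add: Bernstein_def sum_distrib_left power_add algebra_simps)
qed

text \<open>The mean of |x - j/n| under the binomial weights is controlled through the variance x (1
  - x) / n. The free parameter \<eta> trades the linear against the quadratic term and replaces a
  split into near and far indices.\<close>

lemma Bernstein_lipschitz_error:
  fixes f :: "real \<Rightarrow> real"
  assumes f: "1-lipschitz_on UNIV f" and x: "x \<in> {0..1}" and n: "n \<ge> 1" and \<eta>: "\<eta> > 0"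
  shows "\<bar>f x - (\<Sum>j\<le>n. f (real j / real n) * Bernstein n j x)\<bar> \<le> \<eta> + 1 / (4 * \<eta> * n)"
proof -
  have Bn: "Bernstein n j x \<ge> 0" for j using x by (auto intro: Bernstein_nonneg)
  have sq: "(\<Sum>j\<le>n. (x - real j / real n)\<^sup>2 * Bernstein n j x) = x * (1 - x) / n"
  proof -
    \<comment> \<open>The square is written in 1, j and j (j - 1), the combinations whose Bernstein
      sums are known.\<close>
    have "(x - real j / real n)\<^sup>2 * Bernstein n j x = x\<^sup>2 * Bernstein n j x
        + (1 - 2 * n * x) / n\<^sup>2 * (real j * Bernstein n j x)
        + 1 / n\<^sup>2 * (real j * (real j - 1) * Bernstein n j x)" for j
      using n by (simp add: power2_eq_square field_simps)
    hence "(\<Sum>j\<le>n. (x - real j / real n)\<^sup>2 * Bernstein n j x) =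
        x\<^sup>2 + (1 - 2 * n * x) / n\<^sup>2 * (n * x) + 1 / n\<^sup>2 * (n * (real n - 1) * x\<^sup>2)"
      by (simp only: sum.distrib sum_distrib_left[symmetric] sum_Bernstein sum_k_Bernstein sum_kk_Bernstein
          mult_1_right)
    also have "\<dots> = x * (1 - x) / n"
      using n by (simp add: power2_eq_square field_simps)
    finally show ?thesis .
  qed
  have "\<bar>f x - (\<Sum>j\<le>n. f (real j / real n) * Bernstein n j x)\<bar>
      = \<bar>\<Sum>j\<le>n. (f x - f (real j / real n)) * Bernstein n j x\<bar>"
    by (simp add: left_diff_distrib sum_subtractf flip: sum_distrib_left)
  also have "\<dots> \<le> (\<Sum>j\<le>n. \<bar>(f x - f (real j / real n)) * Bernstein n j x\<bar>)" by (rule sum_abs)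
  also have "\<dots> \<le> (\<Sum>j\<le>n. (\<eta> + (x - real j / real n)\<^sup>2 / (4 * \<eta>)) * Bernstein n j x)"
  proof (rule sum_mono)
    fix j
    have "\<bar>f x - f (real j / real n)\<bar> \<le> \<bar>x - real j / real n\<bar>"
      using lipschitz_onD[OF f, of x "real j / real n"] by (simp add: dist_real_def)
    also have "\<dots> \<le> \<eta> + (x - real j / real n)\<^sup>2 / (4 * \<eta>)"
    proof -
      define y where "y = x - real j / real n"
      \<comment> \<open>This square is chosen so that expanding it gives |y| <= \<eta> + y^2 / (4
        \<eta>).\<close>
      have "0 \<le> (\<bar>y\<bar> - 2 * \<eta>)\<^sup>2" by simp
      hence "\<bar>y\<bar> * (4 * \<eta>) \<le> 4 * \<eta>\<^sup>2 + y\<^sup>2" by (simp add: power2_eq_square algebra_simps)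
      hence "\<bar>y\<bar> \<le> \<eta> + y\<^sup>2 / (4 * \<eta>)"
        using \<eta> by (simp add: field_simps power2_eq_square)
      thus ?thesis by (simp add: y_def)
    qed
    finally show "\<bar>(f x - f (real j / real n)) * Bernstein n j x\<bar>
        \<le> (\<eta> + (x - real j / real n)\<^sup>2 / (4 * \<eta>)) * Bernstein n j x"
      using Bn[of j] by (simp add: abs_mult mult_right_mono)
  qed
  also have "\<dots> = \<eta> + x * (1 - x) / n / (4 * \<eta>)"
    by (simp add: distrib_right sum.distrib sq flip: sum_distrib_left sum_divide_distrib)
  also have "\<dots> \<le> \<eta> + 1 / (4 * \<eta> * n)"
  proof -
    have "x * (1 - x) \<le> 1" using x by (auto intro: mult_le_one)
    hence "x * (1 - x) / (n * (4 * \<eta>)) \<le> 1 / (n * (4 * \<eta>))"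
      using n \<eta> by (intro divide_right_mono) auto
    thus ?thesis by (simp add: mult_ac)
  qed
  finally show ?thesis .
qed

lemma bl_dist_le:
  assumes "\<mu> \<in> prob01" "\<nu> \<in> prob01"
    and "\<And>f. f \<in> bl_unit_ball \<Longrightarrow> \<bar>(\<integral>x. f x \<partial>\<mu>) - (\<integral>x. f x \<partial>\<nu>)\<bar> \<le> e"
  shows "bl_dist \<mu> \<nu> \<le> e"
  using assms zero_in_bl_unit_ball by (auto simp: bl_dist_def intro!: cSUP_least)

lemma bl_unit_ball_measurable: "f \<in> bl_unit_ball \<Longrightarrow> f \<in> borel_measurable borel"
  by (auto simp: bl_unit_ball_def intro!: borel_measurable_continuous_onI lipschitz_on_continuous_on)

text \<open>All functions of the unit ball share the Lipschitz constant 1 and the bound 1. Hence one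
  degree n and one bound on the coefficients serve the whole ball, and the estimate is uniform in
  the test function as well as in the two measures.\<close>

lemma bl_dist_small_of_moments:
  assumes "\<epsilon> > 0"
  shows "\<exists>n. \<exists>\<delta>>0. \<forall>\<mu>\<in>prob01. \<forall>\<nu>\<in>prob01.
     (\<forall>k\<le>n. \<bar>(\<integral>x. x ^ k \<partial>\<mu>) - (\<integral>x. x ^ k \<partial>\<nu>)\<bar> \<le> \<delta>) \<longrightarrow> bl_dist \<mu> \<nu> \<le> \<epsilon>"
proof -
  \<comment> \<open>The approximation error 2 \<eta> occurs once for each measure, \<epsilon> / 2 in
    total; the other half is left to the difference of the moments.\<close>
  define \<eta> where "\<eta> = \<epsilon> / 8"
  have \<eta>: "\<eta> > 0" using assms by (simp add: \<eta>_def)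
  obtain n where n: "real n > 1 / (4 * \<eta> * \<eta>)" using reals_Archimedean2 by blast
  have "0 < 1 / (4 * \<eta> * \<eta>)" using \<eta> by simp
  hence n1: "n \<ge> 1" using n by (cases n) auto
  have err: "1 / (4 * \<eta> * n) \<le> \<eta>" using n n1 \<eta> by (simp add: field_simps)
  \<comment> \<open>As |f| <= 1, this bounds the absolute sum of the coefficients of the Bernstein
    polynomial in terms of monomials.\<close>
  define C where "C = (\<Sum>j\<le>n. \<Sum>i\<le>n - j. real (n choose j) * real ((n - j) choose i))"
  have C: "C \<ge> 0" unfolding C_def by (intro sum_nonneg) auto
  define \<delta> where "\<delta> = \<epsilon> / (2 * (C + 1))"
  have \<delta>: "\<delta> > 0" using assms C by (simp add: \<delta>_def)
  have "C * \<delta> \<le> \<epsilon> / 2" using assms C by (simp add: \<delta>_def field_simps)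
  have "bl_dist \<mu> \<nu> \<le> \<epsilon>"
    if \<mu>: "\<mu> \<in> prob01" and \<nu>: "\<nu> \<in> prob01"
      and mom: "\<forall>k\<le>n. \<bar>(\<integral>x. x ^ k \<partial>\<mu>) - (\<integral>x. x ^ k \<partial>\<nu>)\<bar> \<le> \<delta>" for \<mu> \<nu>
  proof (rule bl_dist_le[OF \<mu> \<nu>])
    fix f assume f: "f \<in> bl_unit_ball"
    hence [measurable]: "f \<in> borel_measurable borel" by (rule bl_unit_ball_measurable)
    have f1: "\<bar>f x\<bar> \<le> 1" for x using f by (auto simp: bl_unit_ball_def)
    have lip: "1-lipschitz_on UNIV f" using f by (auto simp: bl_unit_ball_def)
    define p where "p x = (\<Sum>j\<le>n. f (real j / real n) * Bernstein n j x)" for x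
    have [measurable]: "p \<in> borel_measurable borel" "Bernstein n j \<in> borel_measurable borel" for j
      unfolding p_def[abs_def] Bernstein_def[abs_def] by measurable
    have close: "\<bar>f x - p x\<bar> \<le> 2 * \<eta>" if "x \<in> {0..1}" for x
      using Bernstein_lipschitz_error[OF lip that n1 \<eta>] err by (simp add: p_def)
    have p1: "\<bar>p x\<bar> \<le> 1 + 2 * \<eta>" if "x \<in> {0..1}" for x
      using close[OF that] f1[of x] by linarith
    have fp: "\<bar>(\<integral>x. f x \<partial>\<rho>) - (\<integral>x. p x \<partial>\<rho>)\<bar> \<le> 2 * \<eta>" if "\<rho> \<in> prob01" for \<rho>
    proof -
      have "integrable \<rho> f" by (rule integrable_prob01[OF that, where C = 1]) (use f1 in auto)
      moreover have "integrable \<rho> p"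
        by (rule integrable_prob01[OF that, where C = "1 + 2 * \<eta>"]) (use p1 in auto)
      moreover have "\<bar>\<integral>x. f x - p x \<partial>\<rho>\<bar> \<le> 2 * \<eta>"
        by (rule integral_prob01_le[OF that]) (use close in auto)
      ultimately show ?thesis by simp
    qed
    have ip: "(\<integral>x. p x \<partial>\<rho>)
        = (\<Sum>j\<le>n. \<Sum>i\<le>n - j. f (real j / real n) * (real (n choose j) * real ((n - j) choose i) * (- 1) ^ i) *
            (\<integral>x. x ^ (i + j) \<partial>\<rho>))"
      if "\<rho> \<in> prob01" for \<rho>
      unfolding p_def Bernstein_expand
      by (simp add: integrable_power_prob01[OF that] sum_distrib_left mult.assoc)
    have "\<bar>(\<integral>x. p x \<partial>\<mu>) - (\<integral>x. p x \<partial>\<nu>)\<bar> \<le>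
       (\<Sum>j\<le>n. \<Sum>i\<le>n - j. \<bar>f (real j / real n) * (real (n choose j) * real ((n - j) choose i) * (- 1) ^ i)
           * ((\<integral>x. x ^ (i + j) \<partial>\<mu>) - (\<integral>x. x ^ (i + j) \<partial>\<nu>))\<bar>)"
      unfolding ip[OF \<mu>] ip[OF \<nu>] sum_subtractf[symmetric] right_diff_distrib
      by (intro order_trans[OF sum_abs] sum_mono) (simp add: order_trans[OF sum_abs])
    also have "\<dots> \<le> (\<Sum>j\<le>n. \<Sum>i\<le>n - j. real (n choose j) * real ((n - j) choose i) * \<delta>)"
    proof (intro sum_mono)
      fix j i assume "j \<in> {..n}" "i \<in> {..n - j}"
      hence "\<bar>(\<integral>x. x ^ (i + j) \<partial>\<mu>) - (\<integral>x. x ^ (i + j) \<partial>\<nu>)\<bar> \<le> \<delta>" using mom by auto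
      moreover have "\<bar>f (real j / real n)\<bar> * (real (n choose j) * real ((n - j) choose i))
          \<le> 1 * (real (n choose j) * real ((n - j) choose i))"
        by (rule mult_right_mono[OF f1]) auto
      ultimately have "(\<bar>f (real j / real n)\<bar> * (real (n choose j) * real ((n - j) choose i))) *
          \<bar>(\<integral>x. x ^ (i + j) \<partial>\<mu>) - (\<integral>x. x ^ (i + j) \<partial>\<nu>)\<bar>
         \<le> (1 * (real (n choose j) * real ((n - j) choose i))) * \<delta>"
        using \<delta> by (intro mult_mono[OF _ \<open>\<bar>(\<integral>x. x ^ (i + j) \<partial>\<mu>) - (\<integral>x. x ^ (i + j) \<partial>\<nu>)\<bar> \<le> \<delta>\<close>]) simp_all
      thus "\<bar>f (real j / real n) * (real (n choose j) * real ((n - j) choose i) * (- 1) ^ i)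
           * ((\<integral>x. x ^ (i + j) \<partial>\<mu>) - (\<integral>x. x ^ (i + j) \<partial>\<nu>))\<bar> \<le> real (n choose j) * real
               ((n - j) choose i) * \<delta>"
        by (simp add: abs_mult power_abs)
    qed
    also have "\<dots> = C * \<delta>" by (simp add: C_def sum_distrib_right)
    finally have "\<bar>(\<integral>x. p x \<partial>\<mu>) - (\<integral>x. p x \<partial>\<nu>)\<bar> \<le> \<epsilon> / 2" using \<open>C * \<delta> \<le> \<epsilon> / 2\<close> by linarith
    thus "\<bar>(\<integral>x. f x \<partial>\<mu>) - (\<integral>x. f x \<partial>\<nu>)\<bar> \<le> \<epsilon>"
      using fp[OF \<mu>] fp[OF \<nu>] unfolding \<eta>_def abs_le_iff by linarith
  qed
  with \<delta> show ?thesis by blast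
qed

lemma bl_dist_nonneg: "bl_dist \<mu> \<nu> \<ge> 0"
  by (rule Metric_space.nonneg[OF Metric_space_bl_dist])

text \<open>Stated for an arbitrary filter, since the limit is taken along sequences as well as at a
  point of time.\<close>

lemma bl_dist_tendsto_zero_of_moments:
  assumes "\<And>n. \<mu> n \<in> prob01" "\<nu> \<in> prob01" "\<And>k. ((\<lambda>n. \<integral>x. x ^ k \<partial>\<mu> n) \<longlongrightarrow> (\<integral>x. x ^ k \<partial>\<nu>)) G"
  shows "((\<lambda>n. bl_dist (\<mu> n) \<nu>) \<longlongrightarrow> 0) G"
proof (rule tendstoI)
  fix e :: real assume e: "e > 0"
  then obtain n \<delta> where \<delta>: "\<delta> > 0" and *: "\<forall>\<mu>\<in>prob01. \<forall>\<nu>\<in>prob01.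
     (\<forall>k\<le>n. \<bar>(\<integral>x. x ^ k \<partial>\<mu>) - (\<integral>x. x ^ k \<partial>\<nu>)\<bar> \<le> \<delta>) \<longrightarrow> bl_dist \<mu> \<nu> \<le> e / 2"
    using bl_dist_small_of_moments[of "e / 2"] by auto
  have "\<forall>\<^sub>F i in G. \<forall>k\<in>{..n}. \<bar>(\<integral>x. x ^ k \<partial>\<mu> i) - (\<integral>x. x ^ k \<partial>\<nu>)\<bar> \<le> \<delta>"
  proof (intro eventually_ball_finite ballI)
    fix k
    show "\<forall>\<^sub>F i in G. \<bar>(\<integral>x. x ^ k \<partial>\<mu> i) - (\<integral>x. x ^ k \<partial>\<nu>)\<bar> \<le> \<delta>"
      using tendstoD[OF assms(3) \<delta>, of k] by eventually_elim (simp add: dist_real_def)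
  qed simp
  thus "\<forall>\<^sub>F i in G. dist (bl_dist (\<mu> i) \<nu>) 0 < e"
  proof (rule eventually_mono)
    fix i assume "\<forall>k\<in>{..n}. \<bar>(\<integral>x. x ^ k \<partial>\<mu> i) - (\<integral>x. x ^ k \<partial>\<nu>)\<bar> \<le> \<delta>"
    hence "bl_dist (\<mu> i) \<nu> \<le> e / 2" using *[rule_format, OF assms(1,2)] by simp
    thus "dist (bl_dist (\<mu> i) \<nu>) 0 < e"
      using bl_dist_nonneg[of "\<mu> i" \<nu>] e by (simp add: dist_real_def)
  qed
qed

lemma prob01_eq_of_moments:
  assumes "\<mu> \<in> prob01" "\<nu> \<in> prob01" "\<And>k. (\<integral>x. x ^ k \<partial>\<mu>) = (\<integral>x. x ^ k \<partial>\<nu>)"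
  shows "\<mu> = \<nu>"
proof -
  have "((\<lambda>n::nat. bl_dist \<mu> \<nu>) \<longlongrightarrow> 0) sequentially"
    by (rule bl_dist_tendsto_zero_of_moments) (use assms in auto)
  hence "bl_dist \<mu> \<nu> = 0" by (simp add: LIMSEQ_const_iff)
  thus ?thesis using Metric_space.zero[OF Metric_space_bl_dist] assms by blast
qed

text \<open>Integrals of continuous step functions decide weak convergence, and a positive multiple
  of each such function lies in the unit ball.\<close>

lemma weak_conv_m_of_bl_dist:
  assumes "\<And>n. \<mu> n \<in> prob01" "\<nu> \<in> prob01" "(\<lambda>n. bl_dist (\<mu> n) \<nu>) \<longlonglongrightarrow> 0"
  shows "weak_conv_m \<mu> \<nu>"
proof (rule integral_cts_step_conv_imp_weak_conv)
  show "real_distribution (\<mu> n)" for n using assms by (simp add: prob01_def)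
  show "real_distribution \<nu>" using assms by (simp add: prob01_def)
  fix x y :: real assume xy: "x < y"
  define h where "h = min 1 (y - x)"
  have h: "h > 0" using xy by (simp add: h_def)
  have "\<bar>h * (\<integral>z. cts_step x y z \<partial>\<mu> n) - h * (\<integral>z. cts_step x y z \<partial>\<nu>)\<bar> \<le> bl_dist (\<mu> n) \<nu>" for n
    using cSUP_upper[OF cts_step_scaled_in_bl_unit_ball[OF xy] bl_bdd_above[of "\<mu> n" \<nu>]] assms(1)[of n]
        assms(2)
    by (simp add: prob01_def bl_dist_def h_def)
  hence "(\<lambda>n. h * (\<integral>z. cts_step x y z \<partial>\<mu> n) - h * (\<integral>z. cts_step x y z \<partial>\<nu>)) \<longlonglongrightarrow> 0"
    by (intro Lim_null_comparison[OF _ assms(3)]) auto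
  hence "(\<lambda>n. (h * (\<integral>z. cts_step x y z \<partial>\<mu> n) - h * (\<integral>z. cts_step x y z \<partial>\<nu>)) / h) \<longlonglongrightarrow> 0 / h"
    by (intro tendsto_divide) (use h in auto)
  hence "(\<lambda>n. (\<integral>z. cts_step x y z \<partial>\<mu> n) - (\<integral>z. cts_step x y z \<partial>\<nu>)) \<longlonglongrightarrow> 0"
    using h by (simp add: diff_divide_distrib)
  thus "(\<lambda>n. integral\<^sup>L (\<mu> n) (cts_step x y)) \<longlonglongrightarrow> integral\<^sup>L \<nu> (cts_step x y)"
    by (simp add: LIM_zero_iff)
qed

text \<open>The Hausdorff moment problem by compactness. Measures on the unit interval are tight, so
  a subsequence converges weakly; its limit has the prescribed moments because these converge along
  the whole sequence.\<close>

lemma prob01_limit_of_moments: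
  assumes \<mu>: "\<And>n. \<mu> n \<in> prob01" and s: "\<And>k. (\<lambda>n. \<integral>x. x ^ k \<partial>\<mu> n) \<longlonglongrightarrow> s k"
  shows "\<exists>\<nu>\<in>prob01. \<forall>k. (\<integral>x. x ^ k \<partial>\<nu>) = s k"
proof -
  have rd: "real_distribution (\<mu> n)" for n using \<mu> by (simp add: prob01_def)
  have "tight \<mu>"
    unfolding tight_def
  proof (intro conjI allI impI exI)
    show "(-1::real) < 1" by simp
    fix \<epsilon> :: real and n assume "\<epsilon> > 0"
    interpret real_distribution "\<mu> n" by (rule rd)
    have "prob {0..1} \<le> prob {-1<..1}" by (rule finite_measure_mono) auto
    thus "1 - \<epsilon> < prob {-1<..1}" using \<mu>[of n] \<open>\<epsilon> > 0\<close> by (simp add: prob01_def)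
  qed (rule rd)
  then obtain r \<nu> where r: "strict_mono (r::nat\<Rightarrow>nat)" and \<nu>: "real_distribution \<nu>"
    and wc: "weak_conv_m (\<mu> \<circ> r) \<nu>"
    using tight_imp_convergent_subsubsequence[of \<mu> id] strict_mono_id by auto
  interpret \<nu>: real_distribution \<nu> by fact
  have rd': "real_distribution ((\<mu> \<circ> r) n)" for n using rd by simp
  note conv = weak_conv_imp_integral_bdd_continuous_conv[OF rd' \<nu> wc]
  \<comment> \<open>A bounded continuous function that vanishes exactly on the unit interval. Its
    integral is 0 for each measure of the sequence, hence for the limit, which therefore lives on
    the interval.\<close>
  define f where "f x = min 1 (infdist x {0..1::real})" for x
  have fcont: "continuous_on UNIV f" unfolding f_def by (intro continuous_intros)
  hence [measurable]: "f \<in> borel_measurable borel" by (rule borel_measurable_continuous_onI)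
  have fb: "norm (f x) \<le> 1" for x by (simp add: f_def infdist_nonneg)
  have f0: "x \<in> {0..1} \<longleftrightarrow> f x = 0" for x
    using in_closed_iff_infdist_zero[of "{0..1::real}" x] by (auto simp: f_def)
  have "(\<integral>x. f x \<partial>(\<mu> \<circ> r) n) = 0" for n
  proof (rule integral_eq_zero_AE)
    show "AE x in (\<mu> \<circ> r) n. f x = 0"
      using AE_prob01[OF \<mu>[of "r n"]] by (simp only: f0 o_def)
  qed
  moreover have "(\<lambda>n. \<integral>x. f x \<partial>(\<mu> \<circ> r) n) \<longlonglongrightarrow> (\<integral>x. f x \<partial>\<nu>)"
    using fcont fb by (intro conv) (auto simp: continuous_on_eq_continuous_at)
  ultimately have "(\<integral>x. f x \<partial>\<nu>) = 0" by (simp add: LIMSEQ_const_iff)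
  moreover have "integrable \<nu> f" using fb by (intro \<nu>.integrable_const_bound[of _ 1]) auto
  ultimately have "AE x in \<nu>. f x = 0"
    by (subst (asm) integral_nonneg_eq_0_iff_AE) (auto simp: f_def infdist_nonneg)
  hence \<nu>01: "\<nu> \<in> prob01" by (intro prob01I[OF \<nu>]) (simp only: f0)
  have "(\<integral>x. x ^ k \<partial>\<nu>) = s k" for k
  proof -
    \<comment> \<open>The power is clipped outside the unit interval, so that it becomes bounded and
      continuous on the line.\<close>
    define g where "g x = (min 1 (max 0 x)) ^ k" for x :: real
    have "continuous_on UNIV g" unfolding g_def by (intro continuous_intros)
    hence cg: "isCont g x" for x by (auto simp: continuous_on_eq_continuous_at)
    have gb: "norm (g x) \<le> 1" for x by (simp add: g_def power_abs power_le_one)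
    have gi: "(\<integral>x. g x \<partial>\<rho>) = (\<integral>x. x ^ k \<partial>\<rho>)" if "\<rho> \<in> prob01" for \<rho>
    proof (rule integral_cong_AE)
      have "sets \<rho> = sets borel" using that by (simp add: prob01_def real_distribution.events_eq_borel)
      thus "g \<in> borel_measurable \<rho>" "(\<lambda>x. x ^ k) \<in> borel_measurable \<rho>"
        unfolding g_def measurable_cong_sets[OF \<open>sets \<rho> = sets borel\<close> refl] by measurable
      show "AE x in \<rho>. g x = x ^ k" using AE_prob01[OF that] by eventually_elim (simp add: g_def)
    qed
    have "(\<lambda>n. \<integral>x. g x \<partial>(\<mu> \<circ> r) n) \<longlonglongrightarrow> (\<integral>x. g x \<partial>\<nu>)" by (rule conv[OF cg gb])
    moreover have "(\<lambda>n. \<integral>x. g x \<partial>(\<mu> \<circ> r) n) \<longlonglongrightarrow> s k"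
      using LIMSEQ_subseq_LIMSEQ[OF s r, of k] by (simp add: o_def gi[OF \<mu>])
    ultimately show ?thesis using LIMSEQ_unique gi[OF \<nu>01] by metis
  qed
  with \<nu>01 show ?thesis by blast
qed

text \<open>Markov's inequality for all even powers: r^(2k) P(|f| > r) <= 1 for every k is
  impossible for r > 1 unless the probability is 0.\<close>

lemma (in prob_space) AE_abs_le_1_of_even_moments:
  fixes f :: "'a \<Rightarrow> real"
  assumes [measurable]: "f \<in> borel_measurable M"
    and int: "\<And>k. integrable M (\<lambda>x. f x ^ (2 * k))" and le: "\<And>k. (\<integral>x. f x ^ (2 * k) \<partial>M) \<le> 1"
  shows "AE x in M. \<bar>f x\<bar> \<le> 1"
proof -
  have "AE x in M. \<bar>f x\<bar> \<le> 1 + 1 / Suc n" for n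
  proof -
    define r where "r = 1 + 1 / Suc n"
    have r: "r > 1" by (simp add: r_def)
    define p where "p = prob {x\<in>space M. r < \<bar>f x\<bar>}"
    have "p \<le> (1 / r\<^sup>2) ^ k" for k
    proof -
      have "p * r ^ (2 * k) = (\<integral>x. indicator {x\<in>space M. r < \<bar>f x\<bar>} x * r ^ (2 * k) \<partial>M)"
        by (simp add: p_def)
      also have "\<dots> \<le> (\<integral>x. f x ^ (2 * k) \<partial>M)"
      proof (rule integral_mono[OF _ int])
        fix x assume "x \<in> space M"
        show "indicator {x\<in>space M. r < \<bar>f x\<bar>} x * r ^ (2 * k) \<le> f x ^ (2 * k)"
          using r power_mono[of r "\<bar>f x\<bar>" "2 * k"] by (auto simp: indicator_def power_even_abs)
      qed (auto intro!: integrable_mult_left integrable_real_indicator simp: emeasure_finite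
          less_top[symmetric])
      also have "\<dots> \<le> 1" by (rule le)
      finally show ?thesis using r by (simp add: power_one_over field_simps flip: power_mult)
    qed
    moreover have "(\<lambda>k. (1 / r\<^sup>2) ^ k) \<longlonglongrightarrow> 0"
      using r by (intro LIMSEQ_realpow_zero) (auto simp: power2_eq_square less_1_mult)
    ultimately have "p \<le> 0" by (intro LIMSEQ_le_const[of _ 0 p]) auto
    hence "p = 0" by (simp add: p_def measure_le_0_iff)
    hence "AE x in M. \<not> (r < \<bar>f x\<bar>)"
      unfolding p_def by (subst (asm) prob_eq_0) auto
    thus ?thesis by (simp add: r_def not_less)
  qed
  hence "AE x in M. \<forall>n. \<bar>f x\<bar> \<le> 1 + 1 / Suc n" by (simp add: AE_all_countable)
  thus ?thesis
  proof eventually_elim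
    case (elim x)
    have "(\<lambda>n. 1 + 1 / real (Suc n)) \<longlonglongrightarrow> 1 + 0"
      by (intro tendsto_intros LIMSEQ_Suc[OF lim_1_over_n])
    thus ?case using elim by (intro LIMSEQ_le_const[of _ 1]) auto
  qed
qed

text \<open>The competitor is a measure on the whole line. Its moments force its support: the even
  moments of x and of 1 - x equal those of a measure on the unit interval, so they are at most 1,
  and |x| <= 1 and |1 - x| <= 1 hold almost everywhere. On the interval the moments determine the
  measure.\<close>

lemma has_moments_unique_prob01:
  assumes \<mu>: "\<mu> \<in> prob01" "\<And>k. (\<integral>x. x ^ k \<partial>\<mu>) = s k" and \<nu>: "has_moments \<nu> s"
  shows "\<nu> = \<mu>"
proof -
  have sets: "sets \<nu> = sets borel" and int: "integrable \<nu> (\<lambda>x. x ^ k)"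
    and mom: "(\<integral>x. x ^ k \<partial>\<nu>) = s k" for k
    using \<nu> by (auto simp: has_moments_def)
  have sp: "space \<nu> = UNIV" using sets_eq_imp_space_eq[OF sets] by simp
  have s0: "s 0 = 1"
  proof -
    interpret real_distribution \<mu> using \<mu> by (simp add: prob01_def)
    show ?thesis using \<mu>(2)[of 0] prob_space by simp
  qed
  have fin: "emeasure \<nu> (space \<nu>) < \<infinity>"
    using int[of 0] by (simp add: integrable_iff_bounded)
  interpret finite_measure \<nu> by (rule finite_measureI) (use fin in auto)
  have "measure \<nu> (space \<nu>) = 1" using mom[of 0] s0 by simp
  hence "prob_space \<nu>" by (intro prob_spaceI) (simp add: emeasure_eq_measure)
  then interpret prob_space \<nu> .
  have rd: "real_distribution \<nu>"
    by (simp add: real_distribution_def real_distribution_axioms_def \<open>prob_space \<nu>\<close> sets)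
  have [measurable_cong]: "sets \<nu> = sets borel" by (rule sets)
  have 1: "AE x in \<nu>. \<bar>x\<bar> \<le> 1"
  proof (rule AE_abs_le_1_of_even_moments)
    fix k
    have "\<bar>\<integral>x. x ^ (2 * k) \<partial>\<mu>\<bar> \<le> 1"
      by (rule integral_prob01_le[OF \<mu>(1)]) (auto simp: power_abs power_le_one)
    thus "(\<integral>x. x ^ (2 * k) \<partial>\<nu>) \<le> 1" using mom \<mu>(2) by simp
  qed (use int in auto)
  have 2: "AE x in \<nu>. \<bar>1 - x\<bar> \<le> 1"
  proof (rule AE_abs_le_1_of_even_moments)
    fix k
    have ex: "(1 - x) ^ n = (\<Sum>i\<le>n. real (n choose i) * (- 1) ^ i * x ^ i)" for n and x :: real
      using binomial_ring[of "- x" 1 n] by (simp add: power_minus[of x] mult.assoc)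
    show "integrable \<nu> (\<lambda>x. (1 - x) ^ (2 * k))"
      unfolding ex by (intro Bochner_Integration.integrable_sum integrable_mult_right int)
    have "\<bar>\<integral>x. (1 - x) ^ (2 * k) \<partial>\<mu>\<bar> \<le> 1"
      by (rule integral_prob01_le[OF \<mu>(1)]) (auto simp: power_abs power_le_one)
    moreover have "(\<integral>x. (1 - x) ^ (2 * k) \<partial>\<nu>) = (\<integral>x. (1 - x) ^ (2 * k) \<partial>\<mu>)"
      unfolding ex by (simp add: int mom \<mu>(2) integrable_power_prob01[OF \<mu>(1)])
    ultimately show "(\<integral>x. (1 - x) ^ (2 * k) \<partial>\<nu>) \<le> 1" by simp
  qed simp
  have "AE x in \<nu>. x \<in> {0..1}" using 1 2 by eventually_elim auto
  hence "\<nu> \<in> prob01" by (rule prob01I[OF rd])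
  thus ?thesis by (rule prob01_eq_of_moments) (simp_all add: \<mu> mom)
qed

lemma has_moments_prob01: "\<mu> \<in> prob01 \<Longrightarrow> (\<And>k. (\<integral>x. x ^ k \<partial>\<mu>) = s k) \<Longrightarrow> has_moments \<mu> s"
  by (auto simp: has_moments_def integrable_power_prob01 prob01_def real_distribution.events_eq_borel)

section \<open>Empirical measures\<close>

lemma integral_empirical_measure:
  fixes f :: "real \<Rightarrow> real"
  assumes "f \<in> borel_measurable borel"
  shows "(\<integral>x. f x \<partial>empirical_measure N y) = (\<Sum>i<N. f (y i)) / N"
proof -
  have "(\<integral>x. f x \<partial>empirical_measure N y) = (\<integral>i. f (y i) \<partial>uniform_count_measure {..<N})"
    unfolding empirical_measure_def
    by (rule integral_distr) (use assms in \<open>auto simp: measurable_def uniform_count_measure_def\<close>)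
  thus ?thesis by (simp add: integral_uniform_count_measure)
qed

lemma empirical_measure_prob01:
  assumes "N \<ge> 1" "\<And>i. i < N \<Longrightarrow> y i \<in> {0..1}"
  shows "empirical_measure N y \<in> prob01"
proof (rule prob01I)
  interpret U: prob_space "uniform_count_measure {..<N}"
    using assms by (intro prob_space_uniform_count_measure) (auto simp: lessThan_empty_iff)
  have m: "y \<in> uniform_count_measure {..<N} \<rightarrow>\<^sub>M borel"
    by (auto simp: measurable_def uniform_count_measure_def)
  show "real_distribution (empirical_measure N y)"
    unfolding real_distribution_def real_distribution_axioms_def empirical_measure_def
    using U.prob_space_distr[OF m] by simp
  show "AE x in empirical_measure N y. x \<in> {0..1}"
    unfolding empirical_measure_def
    by (subst AE_distr_iff[OF m]) (use assms in \<open>auto simp: space_uniform_count_measure intro!: AE_I2\<close>)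
qed

text \<open>The particles are coupled by their index, so each atom is moved by at most r.\<close>

lemma bl_dist_empirical_measure_le:
  assumes "N \<ge> 1" "\<And>i. i < N \<Longrightarrow> x i \<in> {0..1}" "\<And>i. i < N \<Longrightarrow> y i \<in> {0..1}"
    and r: "\<And>i. i < N \<Longrightarrow> \<bar>x i - y i\<bar> \<le> r"
  shows "bl_dist (empirical_measure N x) (empirical_measure N y) \<le> r"
proof (rule bl_dist_le)
  fix f assume f: "f \<in> bl_unit_ball"
  have "\<bar>\<Sum>i<N. f (x i) - f (y i)\<bar> \<le> (\<Sum>i<N. r)"
  proof (rule order_trans[OF sum_abs], rule sum_mono)
    fix i assume "i \<in> {..<N}"
    thus "\<bar>f (x i) - f (y i)\<bar> \<le> r"
      using lipschitz_onD[of 1 UNIV f "x i" "y i"] f r[of i] by (auto simp: bl_unit_ball_def dist_real_def)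
  qed
  thus "\<bar>(\<integral>z. f z \<partial>empirical_measure N x) - (\<integral>z. f z \<partial>empirical_measure N y)\<bar> \<le> r"
    using assms(1) bl_unit_ball_measurable[OF f]
    by (simp add: integral_empirical_measure sum_subtractf field_simps flip: diff_divide_distrib)
qed (use assms in \<open>auto intro!: empirical_measure_prob01\<close>)

section \<open>Measurability of path-valued maps\<close>

lemma continuous_le_of_rationals:
  fixes h :: "real \<Rightarrow> real"
  assumes cont: "continuous_on {a..b} h" and "a < b"
    and le: "\<And>t. t \<in> {a..b} \<Longrightarrow> t \<in> \<rat> \<Longrightarrow> h t \<le> r" and x: "x \<in> {a..b}"
  shows "h x \<le> r"
proof (rule ccontr)
  assume "\<not> h x \<le> r"
  hence "h x - r > 0" by simp
  then obtain d where d: "d > 0" "\<And>t. t \<in> {a..b} \<Longrightarrow> dist t x < d \<Longrightarrow> dist (h t) (h x) < h x - r"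
    using cont x unfolding continuous_on_iff by meson
  have "max a (x - d) < min b (x + d)" using \<open>a < b\<close> x d by auto
  then obtain q where q: "q \<in> \<rat>" "max a (x - d) < q" "q < min b (x + d)"
    using Rats_dense_in_real by blast
  hence "dist (h q) (h x) < h x - r" by (intro d) (auto simp: dist_real_def)
  moreover have "h q \<le> r" using q by (intro le) auto
  ultimately show False by (simp add: dist_real_def abs_if split: if_splits)
qed

lemma grid_cell_exists:
  fixes T t :: real
  assumes "t \<in> {0..T}" "n \<ge> 1" "T > 0"
  shows "\<exists>j<n. t \<in> {real j * T / real n .. real (Suc j) * T / real n}"
proof (cases "t = T")
  case True
  have "t \<in> {real (n - 1) * T / real n .. real (Suc (n - 1)) * T / real n}"
    using assms True by (auto simp: field_simps)
  thus ?thesis using assms by (intro exI[of _ "n - 1"]) auto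
next
  case False
  define y where "y = t * real n / T"
  have y: "0 \<le> y" "y < real n" using assms False by (auto simp: y_def field_simps)
  define j where "j = nat \<lfloor>y\<rfloor>"
  have j: "real j \<le> y" "y \<le> real (Suc j)" using y by (auto simp: j_def) linarith
  have ty: "t = y * T / real n" using assms by (simp add: y_def)
  have "real j * T \<le> y * T" "y * T \<le> real (Suc j) * T"
    using j assms by (auto intro: mult_right_mono simp del: of_nat_Suc)
  hence "t \<in> {real j * T / real n .. real (Suc j) * T / real n}"
    unfolding ty using assms by (auto intro: divide_right_mono simp del: of_nat_Suc)
  moreover have "j < n" using j y by linarith
  ultimately show ?thesis by blast
qed

context
  fixes m :: "'e metric" and g :: "(nat \<Rightarrow> real) \<Rightarrow> 'e" and N :: nat and L T :: real
  assumes g_mspace: "\<And>x. \<forall>i<N. x i \<in> {0..1} \<Longrightarrow> g x \<in> mspace m"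
    and g_lipschitz: "\<And>x y r. \<forall>i<N. x i \<in> {0..1} \<Longrightarrow> \<forall>i<N. y i \<in> {0..1} \<Longrightarrow> \<forall>i<N. \<bar>x i - y i\<bar> \<le> r
        \<Longrightarrow> mdist m (g x) (g y) \<le> L * r"
    and L_pos: "L > 0" and T_pos: "T > 0"
begin

text \<open>The map \<open>g\<close> stands for a power sum or for the empirical measure. Both have
  values in the given space and are Lipschitz in the largest displacement of a particle, and the
  path space arguments use no more than that.\<close>

lemma lipschitz_image_path_in_mspace:
  assumes cont: "\<And>i. i < N \<Longrightarrow> continuous_on {0..T} (y i)"
    and y01: "\<And>i t. i < N \<Longrightarrow> t \<in> {0..T} \<Longrightarrow> y i t \<in> {0..1}"
  shows "(\<lambda>t\<in>{0..T}. g (\<lambda>i. y i t)) \<in> mspace (path_metric T m)"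
proof -
  interpret Metric_space "mspace m" "mdist m" by simp
  have gm: "g (\<lambda>i. y i t) \<in> mspace m" if "t \<in> {0..T}" for t
    using that y01 by (intro g_mspace) auto
  have "mbounded ((\<lambda>t\<in>{0..T}. g (\<lambda>i. y i t)) ` {0..T})"
    unfolding mbounded_alt
  proof (intro conjI exI[of _ "L * 1"] ballI)
    show "(\<lambda>t\<in>{0..T}. g (\<lambda>i. y i t)) ` {0..T} \<subseteq> mspace m" using gm by auto
    fix u v assume "u \<in> (\<lambda>t\<in>{0..T}. g (\<lambda>i. y i t)) ` {0..T}" "v \<in> (\<lambda>t\<in>{0..T}. g (\<lambda>i. y i t)) ` {0..T}"
    then obtain s t where st: "s \<in> {0..T}" "u = g (\<lambda>i. y i s)" "t \<in> {0..T}" "v = g (\<lambda>i. y i t)" by auto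
    have "\<bar>y i s - y i t\<bar> \<le> 1" if "i < N" for i
      using y01[OF that st(1)] y01[OF that st(3)] by auto
    thus "mdist m u v \<le> L * 1" unfolding st using st y01 by (intro g_lipschitz) auto
  qed
  moreover have "continuous_map (top_of_set {0..T}) mtopology (\<lambda>t\<in>{0..T}. g (\<lambda>i. y i t))"
    unfolding continuous_map_to_metric
  proof (intro ballI allI impI)
    fix x and \<epsilon> :: real assume x: "x \<in> topspace (top_of_set {0..T})" and "\<epsilon> > 0"
    define \<delta> where "\<delta> = \<epsilon> / (2 * L)"
    have \<delta>: "\<delta> > 0" using \<open>\<epsilon> > 0\<close> L_pos by (simp add: \<delta>_def)
    have "\<exists>d>0. \<forall>t\<in>{0..T}. dist t x < d \<longrightarrow> \<bar>y i t - y i x\<bar> < \<delta>" if "i < N" for i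
      using cont[OF that] x \<delta> unfolding continuous_on_iff dist_real_def by simp
    then obtain d where d: "\<And>i. i < N \<Longrightarrow> d i > 0"
      "\<And>i t. i < N \<Longrightarrow> t \<in> {0..T} \<Longrightarrow> dist t x < d i \<Longrightarrow> \<bar>y i t - y i x\<bar> < \<delta>" by metis
    define D where "D = Min (insert 1 (d ` {..<N}))"
    have D: "D > 0" using d by (auto simp: D_def)
    have Dd: "D \<le> d i" if "i < N" for i using that by (auto simp: D_def)
    show "\<exists>U. openin (top_of_set {0..T}) U \<and> x \<in> U \<and>
       (\<forall>t\<in>U. (\<lambda>t\<in>{0..T}. g (\<lambda>i. y i t)) t \<in> mball ((\<lambda>t\<in>{0..T}. g (\<lambda>i. y i t)) x) \<epsilon>)"
    proof (intro exI conjI ballI)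
      show "openin (top_of_set {0..T}) ({0..T} \<inter> ball x D)" by (intro openin_open_Int) auto
      show "x \<in> {0..T} \<inter> ball x D" using x D by simp
      fix t assume t: "t \<in> {0..T} \<inter> ball x D"
      have "\<bar>y i x - y i t\<bar> \<le> \<delta>" if "i < N" for i
        using d(2)[OF that, of t] t Dd[OF that] by (auto simp: dist_commute abs_minus_commute)
      hence "mdist m (g (\<lambda>i. y i x)) (g (\<lambda>i. y i t)) \<le> L * \<delta>"
        using y01 x t by (intro g_lipschitz) auto
      also have "\<dots> < \<epsilon>" using \<open>\<epsilon> > 0\<close> L_pos by (simp add: \<delta>_def)
      finally show "(\<lambda>t\<in>{0..T}. g (\<lambda>i. y i t)) t \<in> mball ((\<lambda>t\<in>{0..T}. g (\<lambda>i. y i t)) x) \<epsilon>"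
        using t x gm by simp
    qed
  qed
  ultimately show ?thesis using gm by (auto simp: path_metric_def mtopology_of_def)
qed

text \<open>The path space need not be known to be separable: an open set is reached through countably
  many tubes around step functions with rational values.\<close>

lemma lipschitz_image_path_measurable:
  fixes \<Lambda> :: "nat \<Rightarrow> real \<Rightarrow> 'w \<Rightarrow> real"
  assumes meas: "\<And>i t. i < N \<Longrightarrow> t \<ge> 0 \<Longrightarrow> \<Lambda> i t \<in> borel_measurable M"
    and cont: "\<And>i \<omega>. i < N \<Longrightarrow> \<omega> \<in> space M \<Longrightarrow> continuous_on {0..T} (\<lambda>t. \<Lambda> i t \<omega>)"
    and L01: "\<And>i t \<omega>. i < N \<Longrightarrow> t \<in> {0..T} \<Longrightarrow> \<omega> \<in> space M \<Longrightarrow> \<Lambda> i t \<omega> \<in> {0..1}"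
  shows "(\<lambda>\<omega>. \<lambda>t\<in>{0..T}. g (\<lambda>i. \<Lambda> i t \<omega>)) \<in> M \<rightarrow>\<^sub>M metric_borel (path_metric T m)"
  unfolding metric_borel_def
proof (rule measurable_measure_of)
  let ?pm = "path_metric T m"
  define P where "P y = (\<lambda>t\<in>{0..T}. g (\<lambda>i. y i t))" for y :: "nat \<Rightarrow> real \<Rightarrow> real"
  define path where "path y \<longleftrightarrow> (\<forall>i<N. continuous_on {0..T} (y i) \<and> (\<forall>t\<in>{0..T}. y i t \<in> {0..1}))"
    for y :: "nat \<Rightarrow> real \<Rightarrow> real"
  have P_in: "P y \<in> mspace ?pm" if "path y" for y
    unfolding P_def using that by (intro lipschitz_image_path_in_mspace) (auto simp: path_def)
  have path\<Lambda>: "path (\<lambda>i t. \<Lambda> i t \<omega>)" if "\<omega> \<in> space M" for \<omega>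
    using that cont L01 by (auto simp: path_def)
  show "{U. openin (mtopology_of ?pm) U} \<subseteq> Pow (mspace ?pm)"
    using openin_subset[of "mtopology_of ?pm"] by auto
  show "(\<lambda>\<omega>. \<lambda>t\<in>{0..T}. g (\<lambda>i. \<Lambda> i t \<omega>)) \<in> space M \<rightarrow> mspace ?pm"
    using P_in[OF path\<Lambda>] by (auto simp: P_def)
  fix U assume "U \<in> {U. openin (mtopology_of ?pm) U}"
  hence U: "openin (mtopology_of ?pm) U" by simp
  define cell where "cell n j = {real j * T / real n .. real (Suc j) * T / real n}" for n j :: nat
  have cell_sub: "cell n j \<subseteq> {0..T}" if "j < n" for n j
  proof -
    have "real (Suc j) * T \<le> real n * T" using that T_pos by (intro mult_right_mono) auto
    hence "real (Suc j) * T / real n \<le> T" using that by (simp add: field_simps)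
    thus ?thesis using T_pos by (auto simp: cell_def intro: order_trans)
  qed
  \<comment> \<open>A tube is the neighbourhood of radius r of a step function \<open>q\<close> on n
    cells; with rational data there are countably many of them.\<close>
  define tube where "tube n q r y \<longleftrightarrow> (\<forall>i<N. \<forall>j<n. \<forall>t\<in>cell n j. \<bar>y i t - q (i, j)\<bar> \<le> r)"
    for n and q :: "nat \<times> nat \<Rightarrow> real" and r :: real and y :: "nat \<Rightarrow> real \<Rightarrow> real"
  \<comment> \<open>The quantifier over all paths is harmless for measurability: goodness merely
    selects the countable index set \<open>J\<close>, and only the event of lying in one given tube
    has to be measurable.\<close>
  define good where "good n q r \<longleftrightarrow> (\<forall>y. path y \<and> tube n q r y \<longrightarrow> P y \<in> U)" for n q r
  define I where "I = (SIGMA n:{1::nat..}. (PiE ({..<N} \<times> {..<n}) (\<lambda>_. \<rat> :: real set)) \<times> (\<rat>::real set))"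
  have "countable I"
    unfolding I_def by (intro countable_SIGMA countable_PiE) (auto simp: countable_rat)
  define J where "J = {(n, q, r). (n, q, r) \<in> I \<and> good n q r}"
  have "countable J" using \<open>countable I\<close> by (rule countable_subset[rotated]) (auto simp: J_def)
  have eq: "(\<lambda>\<omega>. \<lambda>t\<in>{0..T}. g (\<lambda>i. \<Lambda> i t \<omega>)) -` U \<inter> space M =
     (\<Union>(n, q, r)\<in>J. {\<omega>\<in>space M. tube n q r (\<lambda>i t. \<Lambda> i t \<omega>)})" (is "?A = ?B")
  proof (intro equalityI subsetI)
    fix \<omega> assume "\<omega> \<in> ?B"
    thus "\<omega> \<in> ?A" using path\<Lambda>[of \<omega>] by (auto simp: J_def good_def P_def)
  next
    fix \<omega> assume \<omega>: "\<omega> \<in> ?A"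
    hence sp: "\<omega> \<in> space M" and inU: "P (\<lambda>i t. \<Lambda> i t \<omega>) \<in> U" by (auto simp: P_def)
    interpret PM: Metric_space "mspace ?pm" "mdist ?pm" by simp
    obtain \<rho> where \<rho>: "\<rho> > 0" "PM.mball (P (\<lambda>i t. \<Lambda> i t \<omega>)) \<rho> \<subseteq> U"
      using U inU unfolding mtopology_of_def PM.openin_mtopology by blast
    \<comment> \<open>Two paths in one tube of radius below 3 \<delta> differ by at most 6 \<delta>,
      hence their images by at most 6 L \<delta>, which is less than \<rho>.\<close>
    define \<delta> where "\<delta> = \<rho> / (8 * L)"
    have \<delta>: "\<delta> > 0" using \<rho> L_pos by (simp add: \<delta>_def)
    have "\<exists>d>0. \<forall>s\<in>{0..T}. \<forall>t\<in>{0..T}. dist s t < d \<longrightarrow> \<bar>\<Lambda> i s \<omega> - \<Lambda> i t \<omega>\<bar> < \<delta>" if "i < N" for i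
      using compact_uniformly_continuous[OF cont[OF that sp] compact_Icc] \<delta>
      unfolding uniformly_continuous_on_def dist_real_def by (metis abs_minus_commute)
    then obtain d where d: "\<And>i. i < N \<Longrightarrow> d i > 0"
      "\<And>i s t. i < N \<Longrightarrow> s \<in> {0..T} \<Longrightarrow> t \<in> {0..T} \<Longrightarrow> dist s t < d i \<Longrightarrow> \<bar>\<Lambda> i s \<omega> - \<Lambda> i t \<omega>\<bar> < \<delta>"
      by metis
    define D where "D = Min (insert 1 (d ` {..<N}))"
    have D: "D > 0" using d by (auto simp: D_def)
    have Dd: "D \<le> d i" if "i < N" for i using that by (auto simp: D_def)
    obtain n where n: "real n > T / D" using reals_Archimedean2 by blast
    have "T / D > 0" using T_pos D by simp
    hence n1: "n \<ge> 1" using n by (cases n) auto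
    have TnD: "T / real n < D" using n n1 D by (simp add: field_simps)
    have "\<exists>q\<in>\<rat>. \<bar>\<Lambda> i (real j * T / real n) \<omega> - q\<bar> < \<delta>" for i j
    proof -
      have "\<Lambda> i (real j * T / real n) \<omega> - \<delta> < \<Lambda> i (real j * T / real n) \<omega>" using \<delta> by simp
      from Rats_dense_in_real[OF this] show ?thesis by (auto simp: abs_less_iff intro!: bexI)
    qed
    then obtain q0 where q0: "\<And>i j. q0 i j \<in> \<rat>" "\<And>i j. \<bar>\<Lambda> i (real j * T / real n) \<omega> - q0 i j\<bar> < \<delta>"
      by metis
    define q where "q = (\<lambda>p\<in>{..<N} \<times> {..<n}. q0 (fst p) (snd p))"
    \<comment> \<open>The radius exceeds 2 \<delta>: one \<delta> for the oscillation of the path on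
      a cell, one for rounding its value at the left end to a rational number.\<close>
    have "2 * \<delta> < 3 * \<delta>" using \<delta> by simp
    from Rats_dense_in_real[OF this] obtain r where r: "r \<in> \<rat>" "2 * \<delta> < r" "r < 3 * \<delta>" by blast
    have tube\<Lambda>: "tube n q r (\<lambda>i t. \<Lambda> i t \<omega>)"
      unfolding tube_def
    proof (intro allI impI ballI)
      fix i j t assume i: "i < N" and j: "j < n" and t: "t \<in> cell n j"
      have s: "real j * T / real n \<in> cell n j"
        using T_pos by (auto simp: cell_def divide_right_mono)
      have "dist t (real j * T / real n) \<le> T / real n"
        using t by (auto simp: cell_def dist_real_def algebra_simps add_divide_distrib)
      also have "\<dots> < d i" using TnD Dd[OF i] by simp
      finally have "\<bar>\<Lambda> i t \<omega> - \<Lambda> i (real j * T / real n) \<omega>\<bar> < \<delta>"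
        using cell_sub[OF j] s t by (intro d(2)[OF i]) auto
      thus "\<bar>\<Lambda> i t \<omega> - q (i, j)\<bar> \<le> r"
        using q0(2)[of i j] r i j by (simp add: q_def)
    qed
    have "good n q r"
      unfolding good_def
    proof (intro allI impI, elim conjE)
      fix y assume y: "path y" "tube n q r y"
      have "mdist m (P (\<lambda>i t. \<Lambda> i t \<omega>) t) (P y t) \<le> L * (6 * \<delta>)" if t: "t \<in> {0..T}" for t
      proof -
        obtain j where j: "j < n" "t \<in> cell n j"
          using grid_cell_exists[OF t n1 T_pos] by (auto simp: cell_def)
        have "\<bar>\<Lambda> i t \<omega> - y i t\<bar> \<le> 6 * \<delta>" if "i < N" for i
        proof -
          have "\<bar>\<Lambda> i t \<omega> - q (i, j)\<bar> \<le> r" "\<bar>y i t - q (i, j)\<bar> \<le> r"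
            using tube\<Lambda> y j that by (auto simp: tube_def)
          thus ?thesis using r by linarith
        qed
        thus ?thesis unfolding P_def using t y path\<Lambda>[OF sp]
          by (auto simp: path_def intro!: g_lipschitz)
      qed
      hence "mdist ?pm (P (\<lambda>i t. \<Lambda> i t \<omega>)) (P y) \<le> L * (6 * \<delta>)"
        unfolding path_metric_def using L_pos \<delta> by (intro mdist_cfunspace_le) auto
      also have "\<dots> < \<rho>" using \<rho> L_pos by (simp add: \<delta>_def)
      finally show "P y \<in> U" using \<rho>(2) P_in[OF y(1)] P_in[OF path\<Lambda>[OF sp]] by auto
    qed
    moreover have "(n, q, r) \<in> I" using n1 q0 r by (auto simp: I_def q_def)
    ultimately show "\<omega> \<in> ?B" using sp tube\<Lambda> by (auto simp: J_def)
  qed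
  have "{\<omega>\<in>space M. tube n q r (\<lambda>i t. \<Lambda> i t \<omega>)} \<in> sets M" if "(n, q, r) \<in> J" for n q r
  proof -
    have n: "n \<ge> 1" using that by (auto simp: J_def I_def)
    \<comment> \<open>By continuity a cell is controlled by its rational times, which makes the tube
      event a countable intersection.\<close>
    have "{\<omega>\<in>space M. tube n q r (\<lambda>i t. \<Lambda> i t \<omega>)} =
       {\<omega>\<in>space M. \<forall>i\<in>{..<N}. \<forall>j\<in>{..<n}. \<forall>t\<in>cell n j \<inter> \<rat>. \<bar>\<Lambda> i t \<omega> - q (i, j)\<bar> \<le> r}" (is "_ = ?C")
    proof (intro equalityI subsetI)
      fix \<omega> assume \<omega>: "\<omega> \<in> ?C"
      have "\<bar>\<Lambda> i t \<omega> - q (i, j)\<bar> \<le> r" if "i < N" "j < n" "t \<in> cell n j" for i j t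
      proof (rule continuous_le_of_rationals[where h = "\<lambda>t. \<bar>\<Lambda> i t \<omega> - q (i, j)\<bar>" and x = t and a =
          "real j * T / real n" and b = "real (Suc j) * T / real n"])
        show "real j * T / real n < real (Suc j) * T / real n"
          using T_pos n by (intro divide_strict_right_mono mult_strict_right_mono) auto
        have "continuous_on {real j * T / real n .. real (Suc j) * T / real n} (\<lambda>t. \<Lambda> i t \<omega>)"
          using continuous_on_subset[OF cont[OF that(1)] cell_sub[OF that(2)]] \<omega> unfolding cell_def
          by blast
        thus "continuous_on {real j * T / real n .. real (Suc j) * T / real n} (\<lambda>t. \<bar>\<Lambda> i t \<omega> - q (i, j)\<bar>)"
          by (intro continuous_intros)
      qed (use \<omega> that in \<open>auto simp: cell_def\<close>)
      thus "\<omega> \<in> {\<omega>\<in>space M. tube n q r (\<lambda>i t. \<Lambda> i t \<omega>)}" using \<omega> by (auto simp: tube_def)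
    qed (auto simp: tube_def)
    also have "\<dots> \<in> sets M"
    proof (intro sets.sets_Collect_countable_All')
      fix i j t assume "i \<in> {..<N}" "j \<in> {..<n}" "t \<in> cell n j \<inter> \<rat>"
      hence [measurable]: "\<Lambda> i t \<in> borel_measurable M"
        using cell_sub[of j n] by (intro meas) auto
      show "{\<omega>\<in>space M. \<bar>\<Lambda> i t \<omega> - q (i, j)\<bar> \<le> r} \<in> sets M" by measurable
    qed (use countable_rat in \<open>auto intro: countable_Int2 countable_finite\<close>)
    finally show ?thesis .
  qed
  thus "(\<lambda>\<omega>. \<lambda>t\<in>{0..T}. g (\<lambda>i. \<Lambda> i t \<omega>)) -` U \<inter> space M \<in> sets M"
    unfolding eq using \<open>countable J\<close> by (intro sets.countable_UN'') auto
qed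

end

text \<open>The path is sampled at the last multiple of 1/(n+1) before s. These times are countably
  many, and continuity gives the limit. Times are clamped to [0,T], so only variables up to time T
  are used; with the sigma-algebra at T in the place of \<open>G\<close> this is progressive
  measurability.\<close>

lemma continuous_process_jointly_measurable:
  fixes X :: "real \<Rightarrow> 'w \<Rightarrow> real"
  assumes meas: "\<And>t. t \<in> {0..T} \<Longrightarrow> X t \<in> borel_measurable G" and "T \<ge> 0"
    and cont: "\<And>\<omega>. \<omega> \<in> space G \<Longrightarrow> continuous_on {0..T} (\<lambda>t. X t \<omega>)"
  shows "(\<lambda>(\<omega>, s). X (max 0 (min T s)) \<omega>) \<in> borel_measurable (G \<Otimes>\<^sub>M borel)"
proof (rule borel_measurable_LIMSEQ_real)
  define cl where "cl s = max 0 (min T s)" for s :: real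
  have cl: "cl s \<in> {0..T}" for s using \<open>T \<ge> 0\<close> by (auto simp: cl_def)
  show "(\<lambda>n. (\<lambda>(\<omega>, s). X (cl (of_int \<lfloor>real (Suc n) * s\<rfloor> / real (Suc n))) \<omega>) p)
     \<longlonglongrightarrow> (case p of (\<omega>, s) \<Rightarrow> X (max 0 (min T s)) \<omega>)" if "p \<in> space (G \<Otimes>\<^sub>M borel)" for p
  proof -
    obtain \<omega> s where p1: "p = (\<omega>, s)" by (cases p)
    have p: "p = (\<omega>, s)" "\<omega> \<in> space G" using that p1 by (auto simp: space_pair_measure)
    have "\<bar>of_int \<lfloor>real (Suc n) * s\<rfloor> / real (Suc n) - s\<bar> \<le> 1 / real (Suc n)" for n
    proof -
      have "\<bar>of_int \<lfloor>real (Suc n) * s\<rfloor> - real (Suc n) * s\<bar> \<le> 1" by linarith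
      hence "\<bar>of_int \<lfloor>real (Suc n) * s\<rfloor> - real (Suc n) * s\<bar> / real (Suc n) \<le> 1 / real (Suc n)"
        by (intro divide_right_mono) auto
      also have "\<bar>of_int \<lfloor>real (Suc n) * s\<rfloor> - real (Suc n) * s\<bar> / real (Suc n)
          = \<bar>(of_int \<lfloor>real (Suc n) * s\<rfloor> - real (Suc n) * s) / real (Suc n)\<bar>" by simp
      finally show ?thesis by (simp only: diff_divide_distrib) simp
    qed
    hence "(\<lambda>n. of_int \<lfloor>real (Suc n) * s\<rfloor> / real (Suc n) - s) \<longlonglongrightarrow> 0"
      by (intro Lim_null_comparison[OF _ LIMSEQ_Suc[OF lim_1_over_n]]) auto
    hence "(\<lambda>n. of_int \<lfloor>real (Suc n) * s\<rfloor> / real (Suc n)) \<longlonglongrightarrow> s" by (simp only: LIM_zero_iff)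
    hence "(\<lambda>n. cl (of_int \<lfloor>real (Suc n) * s\<rfloor> / real (Suc n))) \<longlonglongrightarrow> cl s"
      unfolding cl_def by (intro tendsto_intros)
    hence "(\<lambda>n. X (cl (of_int \<lfloor>real (Suc n) * s\<rfloor> / real (Suc n))) \<omega>) \<longlonglongrightarrow> X (cl s) \<omega>"
      using cl by (intro continuous_on_tendsto_compose[OF cont[OF p(2)]]) auto
    thus ?thesis by (simp add: p cl_def)
  qed
  show "(\<lambda>(\<omega>, s). X (cl (of_int \<lfloor>real (Suc n) * s\<rfloor> / real (Suc n))) \<omega>) \<in> borel_measurable (G \<Otimes>\<^sub>M borel)"
      for n
  proof -
    have "(\<lambda>p. X (cl (of_int \<lfloor>real (Suc n) * snd p\<rfloor> / real (Suc n))) (fst p))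
        \<in> borel_measurable (G \<Otimes>\<^sub>M borel)"
    proof (rule measurable_compose_countable'[where g = "\<lambda>p. \<lfloor>real (Suc n) * snd p\<rfloor>" and I = UNIV
         and f = "\<lambda>z p. X (cl (of_int z / real (Suc n))) (fst p)"])
      fix z :: int
      have [measurable]: "X (cl (of_int z / real (Suc n))) \<in> borel_measurable G" using cl by (intro meas)
      show "(\<lambda>p. X (cl (of_int z / real (Suc n))) (fst p)) \<in> borel_measurable (G \<Otimes>\<^sub>M borel)" by measurable
      show "(\<lambda>p. \<lfloor>real (Suc n) * snd p\<rfloor>) \<in> G \<Otimes>\<^sub>M borel \<rightarrow>\<^sub>M count_space UNIV"
        by (rule measurable_compose[OF _ measurable_real_floor]) measurable
    qed auto
    thus ?thesis by (simp add: case_prod_beta')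
  qed
qed

section \<open>Square integrable functions\<close>

text \<open>The integral of (f + l g)^2 is a nonnegative quadratic polynomial in l. The product is
  integrable because |u v| <= u^2 + v^2.\<close>

lemma Cauchy_Schwarz_integral:
  fixes f g :: "'a \<Rightarrow> real"
  assumes [measurable]: "f \<in> borel_measurable M" "g \<in> borel_measurable M"
    and f: "integrable M (\<lambda>x. (f x)\<^sup>2)" and g: "integrable M (\<lambda>x. (g x)\<^sup>2)"
  shows "integrable M (\<lambda>x. f x * g x)"
    and "\<bar>\<integral>x. f x * g x \<partial>M\<bar> \<le> sqrt (\<integral>x. (f x)\<^sup>2 \<partial>M) * sqrt (\<integral>x. (g x)\<^sup>2 \<partial>M)"
proof -
  have ineq: "\<bar>u * v\<bar> \<le> u\<^sup>2 + v\<^sup>2" for u v :: real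
  proof -
    have "2 * (\<bar>u\<bar> * \<bar>v\<bar>) \<le> u\<^sup>2 + v\<^sup>2"
      using sum_squares_bound[of "\<bar>u\<bar>" "\<bar>v\<bar>"] by (simp add: mult.assoc)
    moreover have "0 \<le> \<bar>u\<bar> * \<bar>v\<bar>" by simp
    ultimately show ?thesis unfolding abs_mult by linarith
  qed
  show int: "integrable M (\<lambda>x. f x * g x)"
    by (rule Bochner_Integration.integrable_bound[OF Bochner_Integration.integrable_add[OF f g]])
      (auto intro: ineq)
  define A where "A = (\<integral>x. (f x)\<^sup>2 \<partial>M)"
  define B where "B = (\<integral>x. f x * g x \<partial>M)"
  define C where "C = (\<integral>x. (g x)\<^sup>2 \<partial>M)"
  have A0: "A \<ge> 0" "C \<ge> 0" by (simp_all add: A_def C_def)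
  have q: "0 \<le> A + 2 * l * B + l\<^sup>2 * C" for l
  proof -
    have "0 \<le> (\<integral>x. (f x + l * g x)\<^sup>2 \<partial>M)" by simp
    also have "(\<integral>x. (f x + l * g x)\<^sup>2 \<partial>M) = (\<integral>x. (f x)\<^sup>2 + 2 * l * (f x * g x) + l\<^sup>2 * (g x)\<^sup>2 \<partial>M)"
      by (intro Bochner_Integration.integral_cong) (auto simp: power2_eq_square algebra_simps)
    also have "\<dots> = A + 2 * l * B + l\<^sup>2 * C"
      using f g int by (simp add: A_def B_def C_def)
    finally show ?thesis .
  qed
  have "B\<^sup>2 \<le> A * C"
  proof (cases "C = 0")
    case True
    have "B = 0"
    proof (rule ccontr)
      assume "B \<noteq> 0"
      \<comment> \<open>When C = 0 the polynomial is affine in l, and this choice of l makes it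
        equal to -1.\<close>
      hence "A + 2 * (- (A + 1) / (2 * B)) * B = -1" by (simp add: field_simps)
      moreover have "0 \<le> A + 2 * (- (A + 1) / (2 * B)) * B"
        using q[of "- (A + 1) / (2 * B)"] unfolding True by (simp only: mult_zero_right add_0_right)
      ultimately show False by linarith
    qed
    thus ?thesis using A0 by simp
  next
    case False
    hence C: "C > 0" using A0 by simp
    have "0 \<le> A + 2 * (- B / C) * B + (- B / C)\<^sup>2 * C" by (rule q)
    also have "\<dots> = A - B\<^sup>2 / C" using C by (simp add: power2_eq_square field_simps)
    finally show ?thesis using C by (simp add: field_simps)
  qed
  hence "\<bar>B\<bar> \<le> sqrt (A * C)" using real_sqrt_le_mono[of "B\<^sup>2" "A * C"] by simp
  thus "\<bar>\<integral>x. f x * g x \<partial>M\<bar> \<le> sqrt (\<integral>x. (f x)\<^sup>2 \<partial>M) * sqrt (\<integral>x. (g x)\<^sup>2 \<partial>M)"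
    by (simp add: A_def B_def C_def real_sqrt_mult)
qed

section \<open>Mean-square convergence\<close>

definition sq_integrable :: "'a measure \<Rightarrow> ('a \<Rightarrow> real) \<Rightarrow> bool" where
  "sq_integrable M f \<longleftrightarrow> f \<in> borel_measurable M \<and> integrable M (\<lambda>x. (f x)\<^sup>2)"

lemma sq_integrable_mult: "sq_integrable M f \<Longrightarrow> sq_integrable M g \<Longrightarrow> integrable M (\<lambda>x. f x * g x)"
  by (auto simp: sq_integrable_def intro: Cauchy_Schwarz_integral)

lemma sq_integrable_add:
  assumes "sq_integrable M f" "sq_integrable M g"
  shows "sq_integrable M (\<lambda>x. f x + g x)"
proof -
  have "(f x + g x)\<^sup>2 = (f x)\<^sup>2 + (g x)\<^sup>2 + 2 * (f x * g x)" for x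
    by (simp add: power2_eq_square algebra_simps)
  thus ?thesis using assms sq_integrable_mult[OF assms]
    by (auto simp: sq_integrable_def)
qed

lemma sq_integrable_cmult: "sq_integrable M f \<Longrightarrow> sq_integrable M (\<lambda>x. c * f x)"
  by (auto simp: sq_integrable_def power_mult_distrib)

lemma sq_integrable_diff:
  assumes "sq_integrable M f" "sq_integrable M g"
  shows "sq_integrable M (\<lambda>x. f x - g x)"
  using sq_integrable_add[OF assms(1) sq_integrable_cmult[OF assms(2), of "-1"]] by simp

lemma sq_integrable_sum:
  assumes "\<And>i. i \<in> I \<Longrightarrow> sq_integrable M (f i)"
  shows "sq_integrable M (\<lambda>x. \<Sum>i\<in>I. f i x)"
  using assms
proof (induction I rule: infinite_finite_induct)
  case (insert i I)
  thus ?case by (simp add: sq_integrable_add)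
qed (simp_all add: sq_integrable_def)

lemma sq_integrable_bounded_mult:
  assumes "sq_integrable M f" and [measurable]: "Z \<in> borel_measurable M"
    and Z: "\<And>x. x \<in> space M \<Longrightarrow> \<bar>Z x\<bar> \<le> C"
  shows "sq_integrable M (\<lambda>x. Z x * f x)"
  unfolding sq_integrable_def
proof
  have [measurable]: "f \<in> borel_measurable M" and i: "integrable M (\<lambda>x. (f x)\<^sup>2)"
    using assms by (auto simp: sq_integrable_def)
  show "(\<lambda>x. Z x * f x) \<in> borel_measurable M" by measurable
  show "integrable M (\<lambda>x. (Z x * f x)\<^sup>2)"
  proof (rule Bochner_Integration.integrable_bound[OF integrable_mult_right[OF i, of "C\<^sup>2"]])
    show "AE x in M. norm ((Z x * f x)\<^sup>2) \<le> norm (C\<^sup>2 * (f x)\<^sup>2)"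
    proof (rule AE_I2)
      fix x assume "x \<in> space M"
      hence "(Z x)\<^sup>2 \<le> C\<^sup>2" using Z[of x] by (simp add: abs_le_square_iff[symmetric])
      thus "norm ((Z x * f x)\<^sup>2) \<le> norm (C\<^sup>2 * (f x)\<^sup>2)"
        by (simp add: power_mult_distrib mult_right_mono)
    qed
  qed measurable
qed

text \<open>The Bochner integral of a non-integrable function is 0. Square integrability of the
  terms and of the limit is therefore part of the definition; otherwise the last condition could
  hold for the wrong reason.\<close>

definition L2_tendsto :: "'a measure \<Rightarrow> (nat \<Rightarrow> 'a \<Rightarrow> real) \<Rightarrow> ('a \<Rightarrow> real) \<Rightarrow> bool" where
  "L2_tendsto M f g \<longleftrightarrow> (\<forall>n. sq_integrable M (f n)) \<and> sq_integrable M g \<and>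
     (\<lambda>n. \<integral>x. (f n x - g x)\<^sup>2 \<partial>M) \<longlonglongrightarrow> 0"

text \<open>The difference of the products is expanded around the limits into three terms, each of
  which Cauchy-Schwarz makes small.\<close>

lemma L2_tendsto_inner:
  assumes f: "L2_tendsto M f f'" and g: "L2_tendsto M g g'"
  shows "(\<lambda>n. \<integral>x. f n x * g n x \<partial>M) \<longlonglongrightarrow> (\<integral>x. f' x * g' x \<partial>M)"
proof -
  have sq: "sq_integrable M (f n)" "sq_integrable M f'" "sq_integrable M (g n)" "sq_integrable M g'" for n
    using f g by (auto simp: L2_tendsto_def)
  define a where "a n = sqrt (\<integral>x. (f n x - f' x)\<^sup>2 \<partial>M)" for n
  define b where "b n = sqrt (\<integral>x. (g n x - g' x)\<^sup>2 \<partial>M)" for n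
  define A where "A = sqrt (\<integral>x. (f' x)\<^sup>2 \<partial>M)"
  define B where "B = sqrt (\<integral>x. (g' x)\<^sup>2 \<partial>M)"
  have a: "a \<longlonglongrightarrow> 0" and b: "b \<longlonglongrightarrow> 0"
    using f g unfolding L2_tendsto_def a_def b_def by (auto intro: tendsto_eq_intros)
  have CS: "\<bar>\<integral>x. u x * v x \<partial>M\<bar> \<le> sqrt (\<integral>x. (u x)\<^sup>2 \<partial>M) * sqrt (\<integral>x. (v x)\<^sup>2 \<partial>M)"
    if "sq_integrable M u" "sq_integrable M v" for u v
    using that by (intro Cauchy_Schwarz_integral) (auto simp: sq_integrable_def)
  have "\<bar>(\<integral>x. f n x * g n x \<partial>M) - (\<integral>x. f' x * g' x \<partial>M)\<bar> \<le> a n * b n + A * b n + a n * B" for n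
  proof -
    note d = sq_integrable_diff[OF sq(1,2), of n] sq_integrable_diff[OF sq(3,4), of n]
    have "(\<integral>x. f n x * g n x \<partial>M) - (\<integral>x. f' x * g' x \<partial>M) = (\<integral>x. f n x * g n x - f' x * g' x \<partial>M)"
      by (rule Bochner_Integration.integral_diff[symmetric]) (auto intro: sq_integrable_mult sq)
    also have "\<dots> = (\<integral>x. (f n x - f' x) * (g n x - g' x) + f' x * (g n x - g' x) + (f n x - f' x) * g' x \<partial>M)"
      by (intro Bochner_Integration.integral_cong) (auto simp: algebra_simps)
    also have "\<dots> = (\<integral>x. (f n x - f' x) * (g n x - g' x) \<partial>M) + (\<integral>x. f' x * (g n x - g' x) \<partial>M)
        + (\<integral>x. (f n x - f' x) * g' x \<partial>M)"
      using d sq by (simp add: sq_integrable_mult)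
    finally show ?thesis
      using CS[OF d] CS[OF sq(2) d(2)] CS[OF d(1) sq(4)] by (simp add: a_def b_def A_def B_def)
  qed
  note le = this
  have lim: "(\<lambda>n. a n * b n + A * b n + a n * B) \<longlonglongrightarrow> 0"
    by (auto intro!: tendsto_eq_intros a b)
  have "(\<lambda>n. (\<integral>x. f n x * g n x \<partial>M) - (\<integral>x. f' x * g' x \<partial>M)) \<longlonglongrightarrow> 0"
    by (rule Lim_null_comparison[OF always_eventually lim]) (simp add: le)
  thus ?thesis by (simp add: LIM_zero_iff)
qed

lemma L2_tendsto_const: "sq_integrable M f \<Longrightarrow> L2_tendsto M (\<lambda>_. f) f"
  by (simp add: L2_tendsto_def)

lemma sq_add_le: "(u + v)\<^sup>2 \<le> 2 * u\<^sup>2 + 2 * (v::real)\<^sup>2"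
  using sum_squares_bound[of u v] by (simp add: power2_eq_square algebra_simps)

lemma L2_tendsto_add:
  assumes f: "L2_tendsto M f f'" and g: "L2_tendsto M g g'"
  shows "L2_tendsto M (\<lambda>n x. f n x + g n x) (\<lambda>x. f' x + g' x)"
proof -
  have sq: "sq_integrable M (f n)" "sq_integrable M f'" "sq_integrable M (g n)" "sq_integrable M g'" for n
    using f g by (auto simp: L2_tendsto_def)
  have int: "integrable M (\<lambda>x. (f n x - f' x)\<^sup>2)" "integrable M (\<lambda>x. (g n x - g' x)\<^sup>2)" 
    "integrable M (\<lambda>x. (f n x + g n x - (f' x + g' x))\<^sup>2)" for n
    using sq_integrable_diff[OF sq(1,2), of n] sq_integrable_diff[OF sq(3,4), of n]
      sq_integrable_diff[OF sq_integrable_add[OF sq(1,3)] sq_integrable_add[OF sq(2,4)], of n n]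
    by (auto simp: sq_integrable_def)
  have le: "(\<integral>x. (f n x + g n x - (f' x + g' x))\<^sup>2 \<partial>M)
      \<le> 2 * (\<integral>x. (f n x - f' x)\<^sup>2 \<partial>M) + 2 * (\<integral>x. (g n x - g' x)\<^sup>2 \<partial>M)" for n
  proof -
    have "(\<integral>x. (f n x + g n x - (f' x + g' x))\<^sup>2 \<partial>M)
      \<le> (\<integral>x. 2 * (f n x - f' x)\<^sup>2 + 2 * (g n x - g' x)\<^sup>2 \<partial>M)"
      using int sq_add_le[of "f n _ - f' _" "g n _ - g' _"]
      by (intro integral_mono) (auto simp: algebra_simps)
    thus ?thesis using int by simp
  qed
  have lim: "(\<lambda>n. 2 * (\<integral>x. (f n x - f' x)\<^sup>2 \<partial>M) + 2 * (\<integral>x. (g n x - g' x)\<^sup>2 \<partial>M)) \<longlonglongrightarrow> 0"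
    using f g by (auto simp: L2_tendsto_def intro!: tendsto_eq_intros)
  have "(\<lambda>n. \<integral>x. (f n x + g n x - (f' x + g' x))\<^sup>2 \<partial>M) \<longlonglongrightarrow> 0"
    by (rule tendsto_sandwich[OF _ _ tendsto_const lim]) (use le in auto)
  thus ?thesis using sq by (simp add: L2_tendsto_def sq_integrable_add)
qed

lemma L2_tendsto_bounded_mult:
  assumes f: "L2_tendsto M f f'" and [measurable]: "Z \<in> borel_measurable M"
    and Z: "\<And>x. x \<in> space M \<Longrightarrow> \<bar>Z x\<bar> \<le> C"
  shows "L2_tendsto M (\<lambda>n x. Z x * f n x) (\<lambda>x. Z x * f' x)"
proof -
  have sq: "sq_integrable M (f n)" "sq_integrable M f'" for n
    using f by (auto simp: L2_tendsto_def)
  have le: "(\<integral>x. (Z x * f n x - Z x * f' x)\<^sup>2 \<partial>M) \<le> C\<^sup>2 * (\<integral>x. (f n x - f' x)\<^sup>2 \<partial>M)" for n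
  proof -
    have d: "sq_integrable M (\<lambda>x. f n x - f' x)" by (intro sq_integrable_diff sq)
    have "(\<integral>x. (Z x * (f n x - f' x))\<^sup>2 \<partial>M) \<le> (\<integral>x. C\<^sup>2 * (f n x - f' x)\<^sup>2 \<partial>M)"
    proof (rule integral_mono)
      show "integrable M (\<lambda>x. (Z x * (f n x - f' x))\<^sup>2)"
        using sq_integrable_bounded_mult[OF d assms(2) Z] by (simp add: sq_integrable_def)
      show "integrable M (\<lambda>x. C\<^sup>2 * (f n x - f' x)\<^sup>2)" using d by (simp add: sq_integrable_def)
      fix x assume "x \<in> space M"
      hence "(Z x)\<^sup>2 \<le> C\<^sup>2" using Z[of x] by (simp add: abs_le_square_iff[symmetric])
      thus "(Z x * (f n x - f' x))\<^sup>2 \<le> C\<^sup>2 * (f n x - f' x)\<^sup>2"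
        by (simp add: power_mult_distrib mult_right_mono)
    qed
    thus ?thesis by (simp add: right_diff_distrib)
  qed
  have lim: "(\<lambda>n. C\<^sup>2 * (\<integral>x. (f n x - f' x)\<^sup>2 \<partial>M)) \<longlonglongrightarrow> 0"
    using f by (auto simp: L2_tendsto_def intro!: tendsto_eq_intros)
  have "(\<lambda>n. \<integral>x. (Z x * f n x - Z x * f' x)\<^sup>2 \<partial>M) \<longlonglongrightarrow> 0"
    by (rule tendsto_sandwich[OF _ _ tendsto_const lim]) (use le in auto)
  thus ?thesis using sq sq_integrable_bounded_mult[OF _ assms(2) Z] by (simp add: L2_tendsto_def)
qed

text \<open>Passage from the extended integrals in the definition of the Ito integral to real ones.
  The square integrability of the limit \<open>g\<close> is a conclusion: at an index where the
  distance is below 1, \<open>g\<close> is a difference of square integrable functions. From that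
  index on all distances are finite.\<close>

lemma L2_tendsto_nn_integral:
  assumes "\<And>n. f n \<in> borel_measurable M" and [measurable]: "g \<in> borel_measurable M"
    and sq: "\<And>n. sq_integrable M (f n)"
    and lim: "(\<lambda>n. \<integral>\<^sup>+x. ennreal ((f n x - g x)\<^sup>2) \<partial>M) \<longlonglongrightarrow> 0"
  shows "\<exists>k. L2_tendsto M (\<lambda>n. f (n + k)) g"
proof -
  have [measurable]: "f n \<in> borel_measurable M" for n by fact
  have "\<forall>\<^sub>F n in sequentially. (\<integral>\<^sup>+x. ennreal ((f n x - g x)\<^sup>2) \<partial>M) < 1"
    by (rule order_tendstoD(2)[OF lim]) simp
  then obtain k where k: "\<And>n. n \<ge> k \<Longrightarrow> (\<integral>\<^sup>+x. ennreal ((f n x - g x)\<^sup>2) \<partial>M) < 1"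
    by (auto simp: eventually_sequentially)
  have int: "integrable M (\<lambda>x. (f n x - g x)\<^sup>2)" if "n \<ge> k" for n
    using k[OF that] by (intro integrableI_bounded) (auto intro: less_trans)
  have "sq_integrable M (\<lambda>x. f k x - (f k x - g x))"
    by (rule sq_integrable_diff[OF sq]) (use int[of k] in \<open>auto simp: sq_integrable_def\<close>)
  hence g: "sq_integrable M g" by simp
  have "(\<lambda>n. \<integral>\<^sup>+x. ennreal ((f (n + k) x - g x)\<^sup>2) \<partial>M) \<longlonglongrightarrow> 0"
    by (rule LIMSEQ_ignore_initial_segment[OF lim])
  moreover have "(\<integral>\<^sup>+x. ennreal ((f (n + k) x - g x)\<^sup>2) \<partial>M) = ennreal (\<integral>x. (f (n + k) x - g x)\<^sup>2 \<partial>M)" for n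
    by (rule nn_integral_eq_integral) (auto intro: int)
  ultimately have "(\<lambda>n. ennreal (\<integral>x. (f (n + k) x - g x)\<^sup>2 \<partial>M)) \<longlonglongrightarrow> ennreal 0" by simp
  hence "(\<lambda>n. \<integral>x. (f (n + k) x - g x)\<^sup>2 \<partial>M) \<longlonglongrightarrow> 0"
    by (subst (asm) tendsto_ennreal_iff) auto
  thus ?thesis using g sq by (auto simp: L2_tendsto_def)
qed

text \<open>Mean-square convergence yields an almost everywhere convergent subsequence, along which
  Fatou's lemma preserves the bound on fourth moments.\<close>

lemma L2_tendsto_fourth_moment:
  assumes f: "L2_tendsto M f g" and f4: "\<And>n. integrable M (\<lambda>x. f n x ^ 4)" "\<And>n. (\<integral>x. f n x ^ 4 \<partial>M) \<le> K"
  shows "integrable M (\<lambda>x. g x ^ 4)" "(\<integral>x. g x ^ 4 \<partial>M) \<le> K"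
proof -
  have sq: "sq_integrable M (f n)" "sq_integrable M g" for n using f by (auto simp: L2_tendsto_def)
  hence [measurable]: "f n \<in> borel_measurable M" "g \<in> borel_measurable M" for n
    by (auto simp: sq_integrable_def)
  have "0 \<le> (\<integral>x. f 0 x ^ 4 \<partial>M)" by simp
  hence K: "K \<ge> 0" using f4(2)[of 0] by linarith
  have "\<exists>r. strict_mono r \<and> (AE x in M. (\<lambda>n. (f (r n) x - g x)\<^sup>2) \<longlonglongrightarrow> 0)"
    using f sq_integrable_diff[OF sq]
    by (intro tendsto_L1_AE_subseq) (auto simp: L2_tendsto_def sq_integrable_def)
  then obtain r where r: "AE x in M. (\<lambda>n. (f (r n) x - g x)\<^sup>2) \<longlonglongrightarrow> 0" by blast
  have "(\<integral>\<^sup>+x. ennreal (g x ^ 4) \<partial>M) \<le> (\<integral>\<^sup>+x. liminf (\<lambda>n. ennreal (f (r n) x ^ 4)) \<partial>M)"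
  proof (rule nn_integral_mono_AE, use r in eventually_elim)
    case (elim x)
    have "(\<lambda>n. sqrt ((f (r n) x - g x)\<^sup>2)) \<longlonglongrightarrow> sqrt 0" by (intro tendsto_intros elim)
    hence "(\<lambda>n. f (r n) x - g x) \<longlonglongrightarrow> 0" by (simp add: tendsto_rabs_zero_iff)
    hence "(\<lambda>n. f (r n) x) \<longlonglongrightarrow> g x" by (simp add: LIM_zero_iff)
    hence "(\<lambda>n. ennreal (f (r n) x ^ 4)) \<longlonglongrightarrow> ennreal (g x ^ 4)" by (intro tendsto_ennrealI tendsto_intros)
    from lim_imp_Liminf[OF trivial_limit_sequentially this] show ?case by simp
  qed
  also have "\<dots> \<le> liminf (\<lambda>n. \<integral>\<^sup>+x. ennreal (f (r n) x ^ 4) \<partial>M)"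
    by (rule nn_integral_liminf) auto
  also have "\<dots> \<le> ennreal K"
  proof (rule Liminf_le)
    show "\<forall>\<^sub>F n in sequentially. (\<integral>\<^sup>+x. ennreal (f (r n) x ^ 4) \<partial>M) \<le> ennreal K"
      using f4 by (intro always_eventually allI) (simp add: nn_integral_eq_integral K ennreal_leI)
  qed simp
  finally have le: "(\<integral>\<^sup>+x. ennreal (g x ^ 4) \<partial>M) \<le> ennreal K" .
  show int: "integrable M (\<lambda>x. g x ^ 4)"
    using le by (intro integrableI_bounded) (auto simp: power_abs power_even_abs intro: le_less_trans)
  have "(\<integral>\<^sup>+x. ennreal (g x ^ 4) \<partial>M) = ennreal (\<integral>x. g x ^ 4 \<partial>M)"
    by (rule nn_integral_eq_integral[OF int]) auto
  thus "(\<integral>x. g x ^ 4 \<partial>M) \<le> K" using le K by simp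
qed

text \<open>Extends orthogonality from bounded test functions to a test function that is only
  integrable against X, by truncation and dominated convergence. Needed because an earlier
  martingale increment, used as test function for a later one, may be unbounded.\<close>

lemma integral_mult_zero_of_bounded:
  fixes X Z :: "'a \<Rightarrow> real"
  assumes [measurable]: "Z \<in> borel_measurable F" and X: "X \<in> borel_measurable M"
    and sub: "subalgebra M F"
    and zero: "\<And>Y C. Y \<in> borel_measurable F \<Longrightarrow> (\<And>x. \<bar>Y x\<bar> \<le> C) \<Longrightarrow> (\<integral>x. Y x * X x \<partial>M) = 0"
    and ZX: "integrable M (\<lambda>x. Z x * X x)"
  shows "(\<integral>x. Z x * X x \<partial>M) = 0"
proof -
  define Y where "Y n x = max (- real n) (min (real n) (Z x))" for n x
  have [measurable]: "Y n \<in> borel_measurable F" for n unfolding Y_def by measurable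
  have YM: "Y n \<in> borel_measurable M" for n by (rule measurable_from_subalg[OF sub]) measurable
  have "(\<lambda>n. \<integral>x. Y n x * X x \<partial>M) \<longlonglongrightarrow> (\<integral>x. Z x * X x \<partial>M)"
  proof (rule integral_dominated_convergence[where w = "\<lambda>x. \<bar>Z x * X x\<bar>"])
    show "AE x in M. (\<lambda>n. Y n x * X x) \<longlonglongrightarrow> Z x * X x"
    proof (rule AE_I2, rule tendsto_mult[OF _ tendsto_const], rule tendsto_eventually)
      fix x
      obtain m where m: "real m \<ge> \<bar>Z x\<bar>" using real_arch_simple by blast
      show "\<forall>\<^sub>F n in sequentially. Y n x = Z x"
        using eventually_ge_at_top[of m]
      proof eventually_elim
        case (elim n)
        hence "real n \<ge> \<bar>Z x\<bar>" using m by linarith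
        thus ?case by (auto simp: Y_def)
      qed
    qed
    show "AE x in M. norm (Y n x * X x) \<le> \<bar>Z x * X x\<bar>" for n
      by (intro AE_I2) (auto simp: abs_mult Y_def intro!: mult_right_mono)
  qed (use X YM ZX borel_measurable_integrable in auto)
  moreover have "(\<integral>x. Y n x * X x \<partial>M) = 0" for n
    by (rule zero[where C = "real n"]) (auto simp: Y_def)
  ultimately show ?thesis by (simp add: LIMSEQ_const_iff)
qed

lemma integral_sum_orthogonal:
  assumes "finite I" and sq: "\<And>i. i \<in> I \<Longrightarrow> sq_integrable M (f i)"
    and orth: "\<And>i j. i \<in> I \<Longrightarrow> j \<in> I \<Longrightarrow> i \<noteq> j \<Longrightarrow> (\<integral>x. f i x * f j x \<partial>M) = 0"
  shows "(\<integral>x. (\<Sum>i\<in>I. f i x)\<^sup>2 \<partial>M) = (\<Sum>i\<in>I. \<integral>x. (f i x)\<^sup>2 \<partial>M)"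
proof -
  have "(\<integral>x. (\<Sum>i\<in>I. f i x)\<^sup>2 \<partial>M) = (\<integral>x. (\<Sum>i\<in>I. \<Sum>j\<in>I. f i x * f j x) \<partial>M)"
    by (simp add: power2_eq_square sum_product)
  also have "\<dots> = (\<Sum>i\<in>I. \<Sum>j\<in>I. \<integral>x. f i x * f j x \<partial>M)"
    using sq by (subst Bochner_Integration.integral_sum; (intro sum.cong refl
        Bochner_Integration.integral_sum)?)
      (auto intro!: sq_integrable_mult Bochner_Integration.integrable_sum)
  also have "\<dots> = (\<Sum>i\<in>I. \<Sum>j\<in>I. if i = j then \<integral>x. (f i x)\<^sup>2 \<partial>M else 0)"
    using orth by (intro sum.cong refl) (auto simp: power2_eq_square)
  also have "\<dots> = (\<Sum>i\<in>I. \<integral>x. (f i x)\<^sup>2 \<partial>M)"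
    using \<open>finite I\<close> by simp
  finally show ?thesis .
qed

section \<open>Elementary stochastic integrals\<close>

lemma integrable_bounded_mult:
  fixes f Z :: "'a \<Rightarrow> real"
  assumes f: "integrable M f" and Z: "Z \<in> borel_measurable M" "\<And>x. x \<in> space M \<Longrightarrow> \<bar>Z x\<bar> \<le> C"
  shows "integrable M (\<lambda>x. Z x * f x)"
proof (rule Bochner_Integration.integrable_bound[OF integrable_mult_right[OF f, of C]])
  show "(\<lambda>x. Z x * f x) \<in> borel_measurable M" using f Z by measurable
  show "AE x in M. norm (Z x * f x) \<le> norm (C * f x)"
    using Z(2) by (intro AE_I2)
        (auto simp: abs_mult intro!: mult_right_mono order_trans[OF Z(2) abs_ge_self])
qed

lemma (in prob_space) integrable_lower_power:
  fixes f :: "'a \<Rightarrow> real"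
  assumes [measurable]: "f \<in> borel_measurable M" and f4: "integrable M (\<lambda>x. f x ^ 4)" and k: "k \<le> 4"
  shows "integrable M (\<lambda>x. f x ^ k)"
proof (rule Bochner_Integration.integrable_bound[OF Bochner_Integration.integrable_add[OF
    integrable_const[of 1] f4]])
  show "AE x in M. norm (f x ^ k) \<le> norm (1 + f x ^ 4)"
  proof (rule AE_I2)
    fix x
    have "\<bar>f x\<bar> ^ k \<le> 1 + \<bar>f x\<bar> ^ 4"
    proof (cases "\<bar>f x\<bar> \<le> 1")
      case True
      hence "\<bar>f x\<bar> ^ k \<le> 1" by (simp add: power_le_one)
      thus ?thesis by (simp add: add_increasing2)
    next
      case False
      hence "\<bar>f x\<bar> ^ k \<le> \<bar>f x\<bar> ^ 4" using k by (intro power_increasing) auto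
      thus ?thesis by simp
    qed
    thus "norm (f x ^ k) \<le> norm (1 + f x ^ 4)" by (simp add: power_abs power_even_abs)
  qed
qed measurable

text \<open>Moments of the centred normal law of variance h, meaningful for orders up to 4. For h =
  0 they are the powers of 0, so that degenerate increments fit in.\<close>

definition gaussian_moment :: "nat \<Rightarrow> real \<Rightarrow> real" where
  "gaussian_moment k h = (if k = 0 then 1 else if k = 2 then h else if k = 4 then 3 * h\<^sup>2 else 0)"

locale brownian_filtration = prob_space M for M :: "'w measure" +
  fixes F :: "real \<Rightarrow> 'w measure" and N :: nat and B :: "nat \<Rightarrow> real \<Rightarrow> 'w \<Rightarrow> real"
  assumes filt: "filtration (space M) F" and subalg: "\<And>t. t \<ge> 0 \<Longrightarrow> subalgebra M (F t)"
    and bm: "brownian_motion M F N B"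
begin

lemma space_F: "space (F t) = space M"
  using filt by (simp add: filtration_def)

lemma measurable_F_mono: "s \<le> t \<Longrightarrow> f \<in> borel_measurable (F s) \<Longrightarrow> f \<in> borel_measurable (F t)"
  by (rule measurable_from_subalg[of "F t" "F s"])
    (use filt in \<open>simp_all add: filtration_def subalgebra_def\<close>)

lemma measurable_F_M: "t \<ge> 0 \<Longrightarrow> f \<in> borel_measurable (F t) \<Longrightarrow> f \<in> borel_measurable M"
  by (rule measurable_from_subalg[OF subalg])

section \<open>Increments of the driving Brownian motions\<close>

definition D :: "nat \<Rightarrow> real \<Rightarrow> real \<Rightarrow> 'w \<Rightarrow> real" where
  "D i s t \<omega> = B i t \<omega> - B i s \<omega>"

lemma D_same [simp]: "D i s s \<omega> = 0" by (simp add: D_def)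

lemma D_split: "D i s t \<omega> = D i s u \<omega> + D i u t \<omega>" by (simp add: D_def)

lemma D_measurable:
  assumes "i < N" "0 \<le> s" "s \<le> t"
  shows "D i s t \<in> borel_measurable (F t)"
proof -
  have [measurable]: "B i t \<in> borel_measurable (F t)" using bm assms by (auto simp: brownian_motion_def)
  have "B i s \<in> borel_measurable (F s)" using bm assms by (auto simp: brownian_motion_def)
  hence [measurable]: "B i s \<in> borel_measurable (F t)" using assms measurable_F_mono by blast
  show ?thesis unfolding D_def[abs_def] by measurable
qed

lemma D_moment:
  assumes "i < N" "0 \<le> s" "s < t" "k \<le> 4"
  shows "integrable M (\<lambda>\<omega>. D i s t \<omega> ^ k)" "(\<integral>\<omega>. D i s t \<omega> ^ k \<partial>M) = gaussian_moment k (t - s)"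
proof -
  define \<sigma> where "\<sigma> = sqrt (t - s)"
  have \<sigma>: "\<sigma> > 0" "\<sigma>\<^sup>2 = t - s" using assms by (auto simp: \<sigma>_def)
  have dist: "distributed M lborel (D i s t) (\<lambda>x. ennreal (normal_density 0 \<sigma> x))"
    using bm assms by (auto simp: brownian_motion_def D_def[abs_def] \<sigma>_def)
  show "integrable M (\<lambda>\<omega>. D i s t \<omega> ^ k)"
    using integrable_normal_moment[OF \<sigma>(1), of 0 k]
    by (subst distributed_integrable[OF dist, symmetric]) auto
  have eq: "(\<integral>\<omega>. D i s t \<omega> ^ k \<partial>M) = (\<integral>x. normal_density 0 \<sigma> x * x ^ k \<partial>lborel)"
    by (rule distributed_integral[OF dist, symmetric]) auto
  have "k = 0 \<or> k = 1 \<or> k = 2 \<or> k = 3 \<or> k = 4" using assms by auto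
  thus "(\<integral>\<omega>. D i s t \<omega> ^ k \<partial>M) = gaussian_moment k (t - s)"
    unfolding eq gaussian_moment_def
    using integral_normal_moment_even[OF \<sigma>(1), of 0 0] integral_normal_moment_odd[OF \<sigma>(1), of 0 0]
      integral_normal_moment_even[OF \<sigma>(1), of 0 1] integral_normal_moment_odd[OF \<sigma>(1), of 0 1]
      integral_normal_moment_even[OF \<sigma>(1), of 0 2] \<sigma>
    by (elim disjE) (auto simp: fact_numeral power2_eq_square numeral_eq_Suc)
qed

text \<open>The whole vector of increments is independent of the past, hence so is any measurable
  function \<open>h\<close> of it. The vector form is needed for products of increments of two
  different motions.\<close>

lemma indep_increment:
  fixes Z Y :: "'w \<Rightarrow> real"
  assumes s: "0 \<le> s" "s < t" and Z: "Z \<in> borel_measurable (F s)" "integrable M Z"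
    and h: "h \<in> borel_measurable (\<Pi>\<^sub>M i\<in>{..<N}. borel)"
    and Y: "\<And>\<omega>. Y \<omega> = h (\<lambda>i\<in>{..<N}. D i s t \<omega>)" and Yint: "integrable M Y"
  shows "integrable M (\<lambda>\<omega>. Z \<omega> * Y \<omega>)" "(\<integral>\<omega>. Z \<omega> * Y \<omega> \<partial>M) = (\<integral>\<omega>. Z \<omega> \<partial>M) * (\<integral>\<omega>. Y \<omega> \<partial>M)"
proof -
  define v where "v \<omega> = (\<lambda>i\<in>{..<N}. D i s t \<omega>)" for \<omega>
  define V where "V = vimage_algebra (space M) v (\<Pi>\<^sub>M i\<in>{..<N}. borel :: real measure)"
  have ind: "indep_set (sets (F s)) (sets V)"
  proof -
    have "indep_set (sets (F s)) (sets (vimage_algebra (space M) (\<lambda>\<omega>. \<lambda>i\<in>{..<N}. B i t \<omega> - B i s \<omega>)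
       (\<Pi>\<^sub>M i\<in>{..<N}. borel)))"
      using bm s unfolding brownian_motion_def by blast
    thus ?thesis by (simp add: V_def v_def[abs_def] D_def)
  qed
  have vV: "v \<in> V \<rightarrow>\<^sub>M (\<Pi>\<^sub>M i\<in>{..<N}. borel)"
    unfolding V_def by (rule measurable_vimage_algebra1) (auto simp: v_def space_PiM)
  have YV: "Y \<in> borel_measurable V"
    using measurable_compose[OF vV h] by (simp add: Y[abs_def] v_def)
  have "indep_var borel Z borel Y"
    unfolding indep_var_eq
  proof (intro conjI)
    show "Z \<in> borel_measurable M" "Y \<in> borel_measurable M" using Z Yint by auto
    have 1: "sigma_sets (space M) {Z -` A \<inter> space M |A. A \<in> sets borel} \<subseteq> sets (F s)"
      unfolding space_F[of s, symmetric]
      by (rule sets.sigma_sets_subset) (auto intro: measurable_sets[OF Z(1)])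
    have sV: "space V = space M" by (simp add: V_def)
    have 2: "sigma_sets (space M) {Y -` A \<inter> space M |A. A \<in> sets borel} \<subseteq> sets V"
      unfolding sV[symmetric]
      by (rule sets.sigma_sets_subset) (auto intro: measurable_sets[OF YV])
    show "indep_set (sigma_sets (space M) {Z -` A \<inter> space M |A. A \<in> sets borel})
       (sigma_sets (space M) {Y -` A \<inter> space M |A. A \<in> sets borel})"
      unfolding indep_set_def
      by (rule indep_sets_mono_sets[OF ind[unfolded indep_set_def]]) (use 1 2 in \<open>auto split: bool.split\<close>)
  qed
  from indep_var_integrable[OF this Z(2) Yint] indep_var_lebesgue_integral[OF this Z(2) Yint]
  show "integrable M (\<lambda>\<omega>. Z \<omega> * Y \<omega>)" "(\<integral>\<omega>. Z \<omega> * Y \<omega> \<partial>M) = (\<integral>\<omega>. Z \<omega> \<partial>M) * (\<integral>\<omega>. Y \<omega> \<partial>M)" .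
qed

text \<open>Over an interval of length 0 the increment vanishes and independence is not at hand, but
  the moments of variance 0 give the same formula.\<close>

lemma D_mult:
  assumes i: "i < N" and s: "0 \<le> s" "s \<le> t" and Z: "Z \<in> borel_measurable (F s)" "integrable M Z"
    and k: "k \<le> 4"
  shows "integrable M (\<lambda>\<omega>. Z \<omega> * D i s t \<omega> ^ k)"
    and "(\<integral>\<omega>. Z \<omega> * D i s t \<omega> ^ k \<partial>M) = (\<integral>\<omega>. Z \<omega> \<partial>M) * gaussian_moment k (t - s)"
proof -
  have "integrable M (\<lambda>\<omega>. Z \<omega> * D i s t \<omega> ^ k) \<and>
    (\<integral>\<omega>. Z \<omega> * D i s t \<omega> ^ k \<partial>M) = (\<integral>\<omega>. Z \<omega> \<partial>M) * gaussian_moment k (t - s)"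
  proof (cases "s = t")
    case True
    thus ?thesis using Z by (auto simp: gaussian_moment_def power_0_left)
  next
    case False
    hence st: "s < t" using s by simp
    have [measurable]: "(\<lambda>x. x i) \<in> borel_measurable (\<Pi>\<^sub>M i\<in>{..<N}. borel :: real measure)"
      by (rule measurable_component_singleton) (use i in simp)
    have h: "(\<lambda>x. x i ^ k) \<in> borel_measurable (\<Pi>\<^sub>M i\<in>{..<N}. borel :: real measure)"
      by measurable
    show ?thesis
      using indep_increment[OF s(1) st Z h _ D_moment(1)[OF i s(1) st k]] i D_moment(2)[OF i s(1) st k]
      by simp
  qed
  thus "integrable M (\<lambda>\<omega>. Z \<omega> * D i s t \<omega> ^ k)"
    "(\<integral>\<omega>. Z \<omega> * D i s t \<omega> ^ k \<partial>M) = (\<integral>\<omega>. Z \<omega> \<partial>M) * gaussian_moment k (t - s)" by auto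
qed

lemma D_mult_1:
  assumes "i < N" "0 \<le> s" "s \<le> t" "Z \<in> borel_measurable (F s)" "integrable M Z"
  shows "integrable M (\<lambda>\<omega>. Z \<omega> * D i s t \<omega>)" "(\<integral>\<omega>. Z \<omega> * D i s t \<omega> \<partial>M) = 0"
proof -
  have k: "(1::nat) \<le> 4" by simp
  note D_mult[OF assms k, unfolded power_one_right]
  moreover have "gaussian_moment 1 (t - s) = 0" by (simp add: gaussian_moment_def)
  ultimately show "integrable M (\<lambda>\<omega>. Z \<omega> * D i s t \<omega>)" "(\<integral>\<omega>. Z \<omega> * D i s t \<omega> \<partial>M) = 0"
    by (simp_all only: mult_zero_right)
qed

lemma D_prod_mult:
  assumes ij: "i < N" "j < N" and s: "0 \<le> s" "s \<le> t" and Z: "Z \<in> borel_measurable (F s)" "integrable M Z"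
  shows "integrable M (\<lambda>\<omega>. Z \<omega> * (D i s t \<omega> * D j s t \<omega>))"
    and "(\<integral>\<omega>. Z \<omega> * (D i s t \<omega> * D j s t \<omega>) \<partial>M) = (if i = j then (\<integral>\<omega>. Z \<omega> \<partial>M) * (t - s) else 0)"
proof -
  have "integrable M (\<lambda>\<omega>. Z \<omega> * (D i s t \<omega> * D j s t \<omega>)) \<and>
    (\<integral>\<omega>. Z \<omega> * (D i s t \<omega> * D j s t \<omega>) \<partial>M) = (if i = j then (\<integral>\<omega>. Z \<omega> \<partial>M) * (t - s) else 0)"
  proof (cases "i = j \<or> s = t")
    case True
    thus ?thesis
      using D_mult[OF ij(1) s Z, of 2] by (auto simp: power2_eq_square gaussian_moment_def)
  next
    case False
    hence st: "s < t" and ne: "i \<noteq> j" using s by auto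
    have iv: "indep_vars (\<lambda>_. borel) (\<lambda>i \<omega>. D i s t \<omega>) {i, j}"
    proof (rule indep_vars_subset[where I = "{..<N}"])
      show "indep_vars (\<lambda>_. borel) (\<lambda>i \<omega>. D i s t \<omega>) {..<N}"
        using bm s st unfolding brownian_motion_def D_def by blast
    qed (use ij in auto)
    have int: "integrable M (D l s t)" "(\<integral>\<omega>. D l s t \<omega> \<partial>M) = 0" if "l \<in> {i, j}" for l
      using D_moment[of l s t 1] that ij s st by (auto simp: gaussian_moment_def)
    have "integrable M (\<lambda>\<omega>. D i s t \<omega> * D j s t \<omega>)"
      using indep_vars_integrable[OF _ iv int(1)] ne by simp
    moreover have "(\<integral>\<omega>. D i s t \<omega> * D j s t \<omega> \<partial>M) = 0"
      using indep_vars_lebesgue_integral[OF _ iv int(1)] int(2) ne by simp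
    moreover have "(\<lambda>x. x i * x j) \<in> borel_measurable (\<Pi>\<^sub>M i\<in>{..<N}. borel :: real measure)"
    proof -
      have [measurable]: "(\<lambda>x. x l) \<in> borel_measurable (\<Pi>\<^sub>M i\<in>{..<N}. borel :: real measure)" if "l < N"
          for l
        by (rule measurable_component_singleton) (use that in simp)
      show ?thesis using ij by measurable
    qed
    ultimately show ?thesis
      using indep_increment[OF s(1) st Z, of "\<lambda>x. x i * x j" "\<lambda>\<omega>. D i s t \<omega> * D j s t \<omega>"] ij ne by simp
  qed
  thus "integrable M (\<lambda>\<omega>. Z \<omega> * (D i s t \<omega> * D j s t \<omega>))"
    "(\<integral>\<omega>. Z \<omega> * (D i s t \<omega> * D j s t \<omega>) \<partial>M) = (if i = j then (\<integral>\<omega>. Z \<omega> \<partial>M) * (t - s) else 0)" by auto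
qed

lemma integrable_bounded:
  fixes Z :: "'w \<Rightarrow> real"
  assumes "t \<ge> 0" "Z \<in> borel_measurable (F t)" "\<And>\<omega>. \<omega> \<in> space M \<Longrightarrow> \<bar>Z \<omega>\<bar> \<le> C"
  shows "integrable M Z"
proof (rule integrable_const_bound)
  show "AE \<omega> in M. norm (Z \<omega>) \<le> C" by (rule AE_I2) (simp add: assms(3))
qed (rule measurable_F_M[OF assms(1,2)])

text \<open>The second increment starts no earlier than the first, and \<open>Z\<close> is known
  when it starts. Both intervals are cut at each other's end points. A product of pieces over
  disjoint intervals has mean 0, because the later piece is independent of everything before it and
  centred; only the common stretch contributes, with its length.\<close>

lemma D_cross_aux:
  assumes ij: "i < N" "j < N" and p: "0 \<le> p" "p \<le> q" and u: "p \<le> u" "u \<le> v"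
    and Z: "Z \<in> borel_measurable (F u)" "\<And>\<omega>. \<omega> \<in> space M \<Longrightarrow> \<bar>Z \<omega>\<bar> \<le> C"
  shows "integrable M (\<lambda>\<omega>. Z \<omega> * (D i p q \<omega> * D j u v \<omega>))"
    and "(\<integral>\<omega>. Z \<omega> * (D i p q \<omega> * D j u v \<omega>) \<partial>M) = (if i = j then (\<integral>\<omega>. Z \<omega> \<partial>M) * max 0 (min q v - u) else 0)"
proof -
  have u0: "0 \<le> u" using p u by simp
  have int1: "integrable M (D i x y)" if "0 \<le> x" "x \<le> y" for x y
  proof -
    have "integrable M (\<lambda>\<omega>. 1 * D i x y \<omega>)" by (rule D_mult_1(1)[OF ij(1) that]) auto
    thus ?thesis by (simp only: mult_1_left)
  qed
  note ZM = measurable_F_M[OF u0 Z(1)]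
  have Zi: "integrable M Z" by (rule integrable_bounded[OF u0 Z])
  \<comment> \<open>The first increment is cut at u: the part up to \<open>m1\<close> is known at
    time u and can be merged with \<open>Z\<close>.\<close>
  define m1 where "m1 = min q u"
  have m1: "p \<le> m1" "m1 \<le> u" "m1 \<le> q" using p u by (auto simp: m1_def)
  have Y1: "(\<lambda>\<omega>. Z \<omega> * D i p m1 \<omega>) \<in> borel_measurable (F u)"
    using Z(1) measurable_F_mono[OF m1(2) D_measurable[OF ij(1) p(1) m1(1)]] by measurable
  have Y1i: "integrable M (\<lambda>\<omega>. Z \<omega> * D i p m1 \<omega>)"
    by (rule integrable_bounded_mult[OF int1[OF p(1) m1(1)] ZM Z(2)])
  note A = D_mult_1[OF ij(2) u0 u(2) Y1 Y1i]
  have "integrable M (\<lambda>\<omega>. Z \<omega> * (D i m1 q \<omega> * D j u v \<omega>)) \<and>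
     (\<integral>\<omega>. Z \<omega> * (D i m1 q \<omega> * D j u v \<omega>) \<partial>M) = (if i = j then (\<integral>\<omega>. Z \<omega> \<partial>M) * max 0 (min q v - u) else 0)"
  proof (cases "q \<le> u")
    case True
    hence "m1 = q" by (simp add: m1_def)
    moreover have "max 0 (min q v - u) = 0" using True u by simp
    ultimately show ?thesis by simp
  next
    case False
    hence uq: "u \<le> q" and m1u: "m1 = u" by (auto simp: m1_def)
    define r where "r = min q v"
    have r: "u \<le> r" "r \<le> q" "r \<le> v" "0 \<le> r" using uq u u0 by (auto simp: r_def)
    note B1 = D_prod_mult[OF ij u0 r(1) Z(1) Zi]
    have Zr: "Z \<in> borel_measurable (F r)" by (rule measurable_F_mono[OF r(1) Z(1)])
    have C2: "integrable M (\<lambda>\<omega>. (Z \<omega> * D i u r \<omega>) * D j r v \<omega>)" "(\<integral>\<omega>. (Z \<omega> * D i u r \<omega>) * D j r v \<omega> \<partial>M) = 0"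
      using D_mult_1[OF ij(2) r(4,3), of "\<lambda>\<omega>. Z \<omega> * D i u r \<omega>"] Zr D_measurable[OF ij(1) u0 r(1)]
        D_mult_1(1)[OF ij(1) u0 r(1) Z(1) Zi] by auto
    have C3: "integrable M (\<lambda>\<omega>. (Z \<omega> * D j u r \<omega>) * D i r q \<omega>)" "(\<integral>\<omega>. (Z \<omega> * D j u r \<omega>) * D i r q \<omega> \<partial>M) = 0"
      using D_mult_1[OF ij(1) r(4,2), of "\<lambda>\<omega>. Z \<omega> * D j u r \<omega>"] Zr D_measurable[OF ij(2) u0 r(1)]
        D_mult_1(1)[OF ij(2) u0 r(1) Z(1) Zi] by auto
    \<comment> \<open>As \<open>r\<close> is the smaller of the two right ends, one of the two
      remaining pieces has length 0.\<close>
    have zero: "D i r q \<omega> * D j r v \<omega> = 0" for \<omega> by (auto simp: r_def min_def)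
    have "Z \<omega> * (D i m1 q \<omega> * D j u v \<omega>) = Z \<omega> * (D i u r \<omega> * D j u r \<omega>) + (Z \<omega> * D i u r \<omega>) * D j r v \<omega>
        + (Z \<omega> * D j u r \<omega>) * D i r q \<omega>" for \<omega>
      unfolding m1u D_split[of i u q \<omega> r] D_split[of j u v \<omega> r] using zero[of \<omega>]
      by (simp add: algebra_simps)
    thus ?thesis using B1 C2 C3 r by (simp add: r_def)
  qed
  moreover have "Z \<omega> * (D i p q \<omega> * D j u v \<omega>)
      = (Z \<omega> * D i p m1 \<omega>) * D j u v \<omega> + Z \<omega> * (D i m1 q \<omega> * D j u v \<omega>)" for \<omega>
    unfolding D_split[of i p q \<omega> m1] by (simp add: algebra_simps)
  ultimately show "integrable M (\<lambda>\<omega>. Z \<omega> * (D i p q \<omega> * D j u v \<omega>))"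
    "(\<integral>\<omega>. Z \<omega> * (D i p q \<omega> * D j u v \<omega>) \<partial>M) = (if i = j then (\<integral>\<omega>. Z \<omega> \<partial>M) * max 0 (min q v - u) else 0)"
    using A by auto
qed

text \<open>Both coefficients are measurable at the later of the two left ends, where their product
  can play the role of \<open>Z\<close>; the two orders of the left ends are symmetric.\<close>

lemma D_cross:
  assumes ij: "i < N" "j < N" and p: "0 \<le> p" "p \<le> q" and u: "0 \<le> u" "u \<le> v"
    and \<xi>: "\<xi> \<in> borel_measurable (F p)" "\<And>\<omega>. \<omega> \<in> space M \<Longrightarrow> \<bar>\<xi> \<omega>\<bar> \<le> C"
    and \<eta>: "\<eta> \<in> borel_measurable (F u)" "\<And>\<omega>. \<omega> \<in> space M \<Longrightarrow> \<bar>\<eta> \<omega>\<bar> \<le> C'"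
  shows "integrable M (\<lambda>\<omega>. (\<xi> \<omega> * D i p q \<omega>) * (\<eta> \<omega> * D j u v \<omega>))"
    and "(\<integral>\<omega>. (\<xi> \<omega> * D i p q \<omega>) * (\<eta> \<omega> * D j u v \<omega>) \<partial>M)
       = (if i = j then (\<integral>\<omega>. \<xi> \<omega> * \<eta> \<omega> \<partial>M) * max 0 (min q v - max p u) else 0)"
proof -
  have bd: "\<bar>\<xi> \<omega> * \<eta> \<omega>\<bar> \<le> C * C'" if "\<omega> \<in> space M" for \<omega>
    using \<xi>(2)[OF that] \<eta>(2)[OF that] abs_ge_zero[of "\<xi> \<omega>"]
    by (auto simp: abs_mult intro!: mult_mono intro: order_trans)
  have "integrable M (\<lambda>\<omega>. (\<xi> \<omega> * D i p q \<omega>) * (\<eta> \<omega> * D j u v \<omega>)) \<and>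
    (\<integral>\<omega>. (\<xi> \<omega> * D i p q \<omega>) * (\<eta> \<omega> * D j u v \<omega>) \<partial>M)
       = (if i = j then (\<integral>\<omega>. \<xi> \<omega> * \<eta> \<omega> \<partial>M) * max 0 (min q v - max p u) else 0)"
  proof (cases "p \<le> u")
    case True
    have "(\<lambda>\<omega>. \<xi> \<omega> * \<eta> \<omega>) \<in> borel_measurable (F u)"
      using \<eta>(1) measurable_F_mono[OF True \<xi>(1)] by measurable
    from D_cross_aux[OF ij p True u(2) this bd]
    show ?thesis using True by (simp add: mult_ac max_absorb2)
  next
    case False
    hence up: "u \<le> p" by simp
    have "(\<lambda>\<omega>. \<xi> \<omega> * \<eta> \<omega>) \<in> borel_measurable (F p)"
      using \<xi>(1) measurable_F_mono[OF up \<eta>(1)] by measurable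
    from D_cross_aux[OF ij(2,1) u up p(2) this bd]
    show ?thesis using up by (simp add: mult_ac max_absorb1 min.commute)
  qed
  thus "integrable M (\<lambda>\<omega>. (\<xi> \<omega> * D i p q \<omega>) * (\<eta> \<omega> * D j u v \<omega>))"
    "(\<integral>\<omega>. (\<xi> \<omega> * D i p q \<omega>) * (\<eta> \<omega> * D j u v \<omega>) \<partial>M)
       = (if i = j then (\<integral>\<omega>. \<xi> \<omega> * \<eta> \<omega> \<partial>M) * max 0 (min q v - max p u) else 0)" by auto
qed

text \<open>In contrast to \<open>elementary\<close>, the left end s of the time interval and the
  bound C are explicit: s is the time on which one conditions, and C enters the moment
  estimates.\<close>

definition simple :: "real \<Rightarrow> real \<Rightarrow> real \<Rightarrow> 'w elementary \<Rightarrow> bool" where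
  "simple s t C = (\<lambda>(n, \<tau>, \<xi>). 0 \<le> s \<and> s \<le> \<tau> 0 \<and> \<tau> n \<le> t \<and> (\<forall>j<n. \<tau> j \<le> \<tau> (Suc j)) \<and>
     (\<forall>j<n. \<xi> j \<in> borel_measurable (F (\<tau> j)) \<and> (\<forall>\<omega>\<in>space M. \<bar>\<xi> j \<omega>\<bar> \<le> C)))"

lemma grid_mono:
  fixes \<tau> :: "nat \<Rightarrow> real"
  assumes "\<forall>j<n. \<tau> j \<le> \<tau> (Suc j)" "j \<le> k" "k \<le> n"
  shows "\<tau> j \<le> \<tau> k"
  using assms(2,3)
proof (induction k rule: dec_induct)
  case (step m)
  thus ?case using assms(1) by (meson Suc_le_lessD less_imp_le order_trans)
qed simp

lemma simpleD:
  assumes "simple s t C (n, \<tau>, \<xi>)"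
  shows "0 \<le> s" "\<And>j. j \<le> n \<Longrightarrow> s \<le> \<tau> j" "\<And>j. j \<le> n \<Longrightarrow> \<tau> j \<le> t" "\<And>j. j < n \<Longrightarrow> \<tau> j \<le> \<tau> (Suc j)"
    "\<And>j. j < n \<Longrightarrow> \<xi> j \<in> borel_measurable (F (\<tau> j))" "\<And>j \<omega>. j < n \<Longrightarrow> \<omega> \<in> space M \<Longrightarrow> \<bar>\<xi> j \<omega>\<bar> \<le> C"
    "\<And>j. j \<le> n \<Longrightarrow> 0 \<le> \<tau> j"
proof -
  have m: "\<forall>j<n. \<tau> j \<le> \<tau> (Suc j)" and s: "0 \<le> s" "s \<le> \<tau> 0" "\<tau> n \<le> t"
    using assms by (auto simp: simple_def)
  show a: "s \<le> \<tau> j" if "j \<le> n" for j using grid_mono[OF m, of 0 j] that s by simp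
  show "\<tau> j \<le> t" if "j \<le> n" for j using grid_mono[OF m that] s by simp
  show "0 \<le> \<tau> j" if "j \<le> n" for j using a[OF that] s by simp
qed (use assms in \<open>auto simp: simple_def\<close>)

abbreviation I :: "nat \<Rightarrow> 'w elementary \<Rightarrow> 'w \<Rightarrow> real" where
  "I i \<equiv> elementary_integral (B i)"

lemma I_eq: "I i (n, \<tau>, \<xi>) \<omega> = (\<Sum>j<n. \<xi> j \<omega> * D i (\<tau> j) (\<tau> (Suc j)) \<omega>)"
  by (simp add: elementary_integral_def D_def)

text \<open>Induction over the cells, expanding (S + \<zeta> d)^4. Terms with odd powers of the
  Gaussian increment vanish, and with L the length so far and h the new cell the rest is bounded by
  3 C^4 (L^2 + 2 L h + h^2). This is 3 C^4 (L + h)^2, so the bound reproduces itself.\<close>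

lemma I_moments:
  assumes i: "i < N" and \<phi>: "simple s t C (n, \<tau>, \<xi>)"
  shows "I i (n, \<tau>, \<xi>) \<in> borel_measurable (F (\<tau> n))" "integrable M (\<lambda>\<omega>. I i (n, \<tau>, \<xi>) \<omega> ^ 4)"
    "(\<integral>\<omega>. I i (n, \<tau>, \<xi>) \<omega> ^ 2 \<partial>M) \<le> C\<^sup>2 * (\<tau> n - \<tau> 0)"
    "(\<integral>\<omega>. I i (n, \<tau>, \<xi>) \<omega> ^ 4 \<partial>M) \<le> 3 * C ^ 4 * (\<tau> n - \<tau> 0)\<^sup>2"
proof -
  note \<phi>D = simpleD[OF \<phi>]
  define S where "S m \<omega> = (\<Sum>j<m. \<xi> j \<omega> * D i (\<tau> j) (\<tau> (Suc j)) \<omega>)" for m \<omega>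
  have "S m \<in> borel_measurable (F (\<tau> m)) \<and> integrable M (\<lambda>\<omega>. S m \<omega> ^ 4) \<and>
     (\<integral>\<omega>. S m \<omega> ^ 2 \<partial>M) \<le> C\<^sup>2 * (\<tau> m - \<tau> 0) \<and> (\<integral>\<omega>. S m \<omega> ^ 4 \<partial>M) \<le> 3 * C ^ 4 *
         (\<tau> m - \<tau> 0)\<^sup>2" if "m \<le> n" for m
    using that
  proof (induction m)
    case 0
    thus ?case by (simp add: S_def)
  next
    case (Suc m)
    hence m: "m < n" by simp
    define p where "p = \<tau> m"
    define q where "q = \<tau> (Suc m)"
    have p: "0 \<le> p" "p \<le> q" using \<phi>D(4,7) m by (auto simp: p_def q_def)
    define \<zeta> where "\<zeta> = \<xi> m"
    have \<zeta>[measurable]: "\<zeta> \<in> borel_measurable (F p)" and \<zeta>C: "\<And>\<omega>. \<omega> \<in> space M \<Longrightarrow> \<bar>\<zeta> \<omega>\<bar> \<le> C"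
      using \<phi>D(5,6)[OF m] by (auto simp: p_def \<zeta>_def)
    define d where "d = D i p q"
    have S[measurable]: "S m \<in> borel_measurable (F p)" and S4: "integrable M (\<lambda>\<omega>. S m \<omega> ^ 4)"
      and ES2: "(\<integral>\<omega>. S m \<omega> ^ 2 \<partial>M) \<le> C\<^sup>2 * (p - \<tau> 0)"
      and ES4: "(\<integral>\<omega>. S m \<omega> ^ 4 \<partial>M) \<le> 3 * C ^ 4 * (p - \<tau> 0)\<^sup>2"
      using Suc by (auto simp: p_def)
    note SM = measurable_F_M[OF p(1) S]
    note \<zeta>M = measurable_F_M[OF p(1) \<zeta>]
    have Sk: "integrable M (\<lambda>\<omega>. S m \<omega> ^ k)" if "k \<le> 4" for k
      by (rule integrable_lower_power[OF SM S4 that])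
    have C0: "C \<ge> 0" using \<zeta>C abs_ge_zero order_trans not_empty by blast
    have \<zeta>k: "\<bar>\<zeta> \<omega> ^ l\<bar> \<le> C ^ l" if "\<omega> \<in> space M" for l \<omega>
      using \<zeta>C[OF that] by (simp add: power_abs power_mono)
    have Z: "(\<lambda>\<omega>. \<zeta> \<omega> ^ l * S m \<omega> ^ k) \<in> borel_measurable (F p)" "integrable M (\<lambda>\<omega>. \<zeta> \<omega> ^ l * S m \<omega> ^ k)"
      if "k \<le> 4" for k l
      using integrable_bounded_mult[OF Sk[OF that], of "\<lambda>\<omega>. \<zeta> \<omega> ^ l" "C ^ l"] \<zeta>M \<zeta>k by auto
    have Dm: "integrable M (\<lambda>\<omega>. (\<zeta> \<omega> ^ l * S m \<omega> ^ k) * d \<omega> ^ l)"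
      "(\<integral>\<omega>. (\<zeta> \<omega> ^ l * S m \<omega> ^ k) * d \<omega> ^ l \<partial>M) = (\<integral>\<omega>. \<zeta> \<omega> ^ l * S m \<omega> ^ k \<partial>M) * gaussian_moment l (q - p)"
      if "k \<le> 4" "l \<le> 4" for k l
      using D_mult[OF i p Z[OF that(1)] that(2)] by (simp_all add: d_def)
    have SS: "S (Suc m) \<omega> = S m \<omega> + \<zeta> \<omega> * d \<omega>" for \<omega> by (simp add: S_def \<zeta>_def d_def p_def q_def)
    \<comment> \<open>The powers 0 and 1 are spelled out so that every summand has the shape covered
      by \<open>Dm\<close>.\<close>
    have e4: "S (Suc m) \<omega> ^ 4 = (\<zeta> \<omega> ^ 0 * S m \<omega> ^ 4) * d \<omega> ^ 0 + 4 * ((\<zeta> \<omega> ^ 1 * S m \<omega> ^ 3) * d \<omega> ^ 1)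
       + 6 * ((\<zeta> \<omega> ^ 2 * S m \<omega> ^ 2) * d \<omega> ^ 2) + 4 * ((\<zeta> \<omega> ^ 3 * S m \<omega> ^ 1) * d \<omega> ^ 3)
       + (\<zeta> \<omega> ^ 4 * S m \<omega> ^ 0) * d \<omega> ^ 4" for \<omega>
      unfolding SS by (simp add: power4_eq_xxxx power3_eq_cube power2_eq_square algebra_simps)
    have e2: "S (Suc m) \<omega> ^ 2 = (\<zeta> \<omega> ^ 0 * S m \<omega> ^ 2) * d \<omega> ^ 0 + 2 * ((\<zeta> \<omega> ^ 1 * S m \<omega> ^ 1) * d \<omega> ^ 1)
       + (\<zeta> \<omega> ^ 2 * S m \<omega> ^ 0) * d \<omega> ^ 2" for \<omega>
      unfolding SS by (simp add: power2_eq_square algebra_simps)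
    have i4: "integrable M (\<lambda>\<omega>. S (Suc m) \<omega> ^ 4)"
      unfolding e4 by (intro Bochner_Integration.integrable_add integrable_mult_right Dm(1)) auto
    have E4: "(\<integral>\<omega>. S (Suc m) \<omega> ^ 4 \<partial>M) = (\<integral>\<omega>. S m \<omega> ^ 4 \<partial>M) + 6 * ((\<integral>\<omega>. \<zeta> \<omega> ^ 2 * S m \<omega> ^ 2 \<partial>M) * (q - p))
        + (\<integral>\<omega>. \<zeta> \<omega> ^ 4 \<partial>M) * (3 * (q - p)\<^sup>2)"
      unfolding e4
      using Dm[of 4 0] Dm[of 3 1] Dm[of 2 2] Dm[of 1 3] Dm[of 0 4] S4
      by (simp add: gaussian_moment_def)
    have E2: "(\<integral>\<omega>. S (Suc m) \<omega> ^ 2 \<partial>M) = (\<integral>\<omega>. S m \<omega> ^ 2 \<partial>M) + (\<integral>\<omega>. \<zeta> \<omega> ^ 2 \<partial>M) * (q - p)"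
      unfolding e2
      using Dm[of 2 0] Dm[of 1 1] Dm[of 0 2] Sk[of 2]
      by (simp add: gaussian_moment_def)
    have b\<zeta>: "(\<integral>\<omega>. \<zeta> \<omega> ^ l \<partial>M) \<le> C ^ l" for l
    proof -
      have "(\<integral>\<omega>. \<zeta> \<omega> ^ l \<partial>M) \<le> (\<integral>\<omega>. C ^ l \<partial>M)"
        using \<zeta>k[of _ l] Z(2)[of 0 l] by (intro integral_mono) (auto intro: order_trans[OF abs_ge_self])
      thus ?thesis using prob_space by simp
    qed
    have b2: "(\<integral>\<omega>. \<zeta> \<omega> ^ 2 * S m \<omega> ^ 2 \<partial>M) \<le> C\<^sup>2 * (C\<^sup>2 * (p - \<tau> 0))"
    proof -
      have "(\<integral>\<omega>. \<zeta> \<omega> ^ 2 * S m \<omega> ^ 2 \<partial>M) \<le> (\<integral>\<omega>. C\<^sup>2 * S m \<omega> ^ 2 \<partial>M)"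
        using \<zeta>k[of _ 2] Z(2)[of 2 2] Sk[of 2]
        by (intro integral_mono mult_right_mono) (auto intro: order_trans[OF abs_ge_self])
      also have "\<dots> = C\<^sup>2 * (\<integral>\<omega>. S m \<omega> ^ 2 \<partial>M)" by simp
      also have "\<dots> \<le> C\<^sup>2 * (C\<^sup>2 * (p - \<tau> 0))" by (rule mult_left_mono[OF ES2]) simp
      finally show ?thesis .
    qed
    have "(\<integral>\<omega>. S (Suc m) \<omega> ^ 2 \<partial>M) \<le> C\<^sup>2 * (p - \<tau> 0) + C\<^sup>2 * (q - p)"
      unfolding E2 using ES2 mult_right_mono[OF b\<zeta>[of 2], of "q - p"] p by simp
    hence r2: "(\<integral>\<omega>. S (Suc m) \<omega> ^ 2 \<partial>M) \<le> C\<^sup>2 * (q - \<tau> 0)" by (simp add: algebra_simps)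
    have "(\<integral>\<omega>. S (Suc m) \<omega> ^ 4 \<partial>M) \<le> 3 * C ^ 4 * (p - \<tau> 0)\<^sup>2 + 6 * ((C\<^sup>2 * (C\<^sup>2 * (p - \<tau> 0))) * (q - p))
        + C ^ 4 * (3 * (q - p)\<^sup>2)"
      unfolding E4 using ES4 mult_right_mono[OF b2, of "q - p"]
          mult_right_mono[OF b\<zeta>[of 4], of "3 * (q - p)\<^sup>2"] p by simp
    also have "\<dots> = 3 * C ^ 4 * (q - \<tau> 0)\<^sup>2"
      by (simp add: power4_eq_xxxx power2_eq_square algebra_simps)
    finally have r4: "(\<integral>\<omega>. S (Suc m) \<omega> ^ 4 \<partial>M) \<le> 3 * C ^ 4 * (q - \<tau> 0)\<^sup>2" .
    have "S (Suc m) \<in> borel_measurable (F q)"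
    proof -
      have [measurable]: "d \<in> borel_measurable (F q)" unfolding d_def by (rule D_measurable[OF i p])
      have [measurable]: "S m \<in> borel_measurable (F q)" "\<zeta> \<in> borel_measurable (F q)"
        by (rule measurable_F_mono[OF p(2) S], rule measurable_F_mono[OF p(2) \<zeta>])
      show ?thesis unfolding SS[abs_def] by measurable
    qed
    thus ?case using i4 r2 r4 by (simp add: q_def)
  qed
  moreover have "I i (n, \<tau>, \<xi>) = S n" by (auto simp: I_eq S_def)
  ultimately show "I i (n, \<tau>, \<xi>) \<in> borel_measurable (F (\<tau> n))" "integrable M (\<lambda>\<omega>. I i (n, \<tau>, \<xi>) \<omega> ^ 4)"
    "(\<integral>\<omega>. I i (n, \<tau>, \<xi>) \<omega> ^ 2 \<partial>M) \<le> C\<^sup>2 * (\<tau> n - \<tau> 0)"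
    "(\<integral>\<omega>. I i (n, \<tau>, \<xi>) \<omega> ^ 4 \<partial>M) \<le> 3 * C ^ 4 * (\<tau> n - \<tau> 0)\<^sup>2" by auto
qed

end

section \<open>Transforming and restricting elementary processes\<close>

lemma elementary_process_cmult:
  "elementary_process (n, \<tau>, \<lambda>j \<omega>. Z \<omega> * \<xi> j \<omega>) x \<omega> = Z \<omega> * elementary_process (n, \<tau>, \<xi>) x \<omega>"
  by (simp add: elementary_process_def sum_distrib_left mult.assoc)

lemma elementary_integral_cmult:
  "elementary_integral B (n, \<tau>, \<lambda>j \<omega>. Z \<omega> * \<xi> j \<omega>) \<omega> = Z \<omega> * elementary_integral B (n, \<tau>, \<xi>) \<omega>"
  by (simp add: elementary_integral_def sum_distrib_left mult.assoc)

text \<open>The half-open cells of a nondecreasing grid are disjoint, so at each time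
  \<open>h\<close> acts on a single coefficient or on 0. The induction also carries that the process
  vanishes beyond its last grid point, which separates the next cell from the previous ones.\<close>

lemma elementary_process_map:
  fixes h :: "real \<Rightarrow> real"
  assumes "\<forall>j<n. \<tau> j \<le> \<tau> (Suc j)" "h 0 = 0"
  shows "elementary_process (n, \<tau>, \<lambda>j \<omega>. h (\<xi> j \<omega>)) x \<omega> = h (elementary_process (n, \<tau>, \<xi>) x \<omega>)"
proof -
  have "elementary_process (n, \<tau>, \<lambda>j \<omega>. h (\<xi> j \<omega>)) x \<omega> = h (elementary_process (n, \<tau>, \<xi>) x \<omega>) \<and>
     (x > \<tau> n \<longrightarrow> elementary_process (n, \<tau>, \<lambda>j \<omega>. h (\<xi> j \<omega>)) x \<omega> = 0 \<and> elementary_process (n, \<tau>, \<xi>) x \<omega> = 0)"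
    using assms(1)
  proof (induction n)
    case 0
    thus ?case by (simp add: elementary_process_def assms)
  next
    case (Suc n)
    have "\<tau> n \<le> \<tau> (Suc n)" using Suc.prems by simp
    moreover have st: "elementary_process (Suc n, \<tau>, \<zeta>) x \<omega>
        = elementary_process (n, \<tau>, \<zeta>) x \<omega> + \<zeta> n \<omega> * indicator {\<tau> n<..\<tau> (Suc n)} x"
      for \<zeta> :: "nat \<Rightarrow> 'a \<Rightarrow> real" unfolding elementary_process_def prod.case by (rule sum.lessThan_Suc)
    ultimately show ?case using Suc by (cases "x > \<tau> n") (auto simp: indicator_def)
  qed
  thus ?thesis by simp
qed

lemma elementary_process_after:
  assumes "\<forall>j<n. \<tau> j \<le> \<tau> (Suc j)"
  shows "elementary_process (n, \<lambda>j. max s (\<tau> j), \<xi>) x \<omega>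
      = indicator {s<..} x * elementary_process (n, \<tau>, \<xi>) x \<omega>"
  unfolding elementary_process_def sum_distrib_left prod.case
proof (rule sum.cong)
  fix j assume "j \<in> {..<n}"
  hence "\<tau> j \<le> \<tau> (Suc j)" using assms by simp
  thus "\<xi> j \<omega> * indicat_real {max s (\<tau> j)<..max s (\<tau> (Suc j))} x
     = indicator {s<..} x * (\<xi> j \<omega> * indicator {\<tau> j<..\<tau> (Suc j)} x)"
    by (auto simp: indicator_def)
qed simp

text \<open>A cell that starts at s or later is squeezed to an empty one at s. Its coefficient is
  set to 0, because it need not be measurable at time s.\<close>

lemma elementary_process_before:
  assumes "\<forall>j<n. \<tau> j \<le> \<tau> (Suc j)"
  shows "elementary_process (n, \<lambda>j. min s (\<tau> j), \<lambda>j \<omega>. if \<tau> j < s then \<xi> j \<omega> else 0) x \<omega>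
     = indicator {..s} x * elementary_process (n, \<tau>, \<xi>) x \<omega>"
  unfolding elementary_process_def sum_distrib_left prod.case
proof (rule sum.cong)
  fix j assume "j \<in> {..<n}"
  hence "\<tau> j \<le> \<tau> (Suc j)" using assms by simp
  thus "(if \<tau> j < s then \<xi> j \<omega> else 0) * indicat_real {min s (\<tau> j)<..min s (\<tau> (Suc j))} x
     = indicator {..s} x * (\<xi> j \<omega> * indicator {\<tau> j<..\<tau> (Suc j)} x)"
    by (auto simp: indicator_def)
qed simp

lemma elementary_integral_split:
  assumes "\<forall>j<n. \<tau> j \<le> \<tau> (Suc j)"
  shows "elementary_integral B (n, \<tau>, \<xi>) \<omega>
     = elementary_integral B (n, \<lambda>j. min s (\<tau> j), \<lambda>j \<omega>. if \<tau> j < s then \<xi> j \<omega> else 0) \<omega>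
     + elementary_integral B (n, \<lambda>j. max s (\<tau> j), \<xi>) \<omega>"
  unfolding elementary_integral_def prod.case sum.distrib[symmetric]
proof (rule sum.cong)
  fix j assume "j \<in> {..<n}"
  hence "\<tau> j \<le> \<tau> (Suc j)" using assms by simp
  thus "\<xi> j \<omega> * (B (\<tau> (Suc j)) \<omega> - B (\<tau> j) \<omega>) =
         (if \<tau> j < s then \<xi> j \<omega> else 0) * (B (min s (\<tau> (Suc j))) \<omega> - B (min s (\<tau> j)) \<omega>) +
         \<xi> j \<omega> * (B (max s (\<tau> (Suc j))) \<omega> - B (max s (\<tau> j)) \<omega>)"
    by (auto simp: min_def max_def algebra_simps)
qed simp

lemma L2_tendsto_shift: "L2_tendsto M f g \<Longrightarrow> L2_tendsto M (\<lambda>n. f (n + k)) g"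
  by (auto simp: L2_tendsto_def intro: LIMSEQ_ignore_initial_segment[where f =
      "\<lambda>n. \<integral>x. (f n x - g x)\<^sup>2 \<partial>M"])

lemma L2_tendsto_diff:
  assumes "L2_tendsto M f f'" "L2_tendsto M g g'"
  shows "L2_tendsto M (\<lambda>n x. f n x - g n x) (\<lambda>x. f' x - g' x)"
proof -
  have "L2_tendsto M (\<lambda>n x. - 1 * g n x) (\<lambda>x. - 1 * g' x)"
    by (rule L2_tendsto_bounded_mult[OF assms(2), of "\<lambda>_. -1" 1]) auto
  from L2_tendsto_add[OF assms(1) this] show ?thesis by simp
qed

lemma L2_tendsto_dominated:
  assumes f: "L2_tendsto M f g" and h: "\<And>n. h n \<in> borel_measurable M" and k: "sq_integrable M k"
    and le: "\<And>n x. x \<in> space M \<Longrightarrow> \<bar>h n x - k x\<bar> \<le> \<bar>f n x - g x\<bar>"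
  shows "L2_tendsto M h k"
proof -
  have d: "sq_integrable M (\<lambda>x. f n x - g x)" for n
    using f by (intro sq_integrable_diff) (auto simp: L2_tendsto_def)
  have [measurable]: "k \<in> borel_measurable M" "h n \<in> borel_measurable M" for n using k h
    by (auto simp: sq_integrable_def)
  have le2: "(h n x - k x)\<^sup>2 \<le> (f n x - g x)\<^sup>2" if "x \<in> space M" for n x
    using le[OF that] by (simp add: abs_le_square_iff)
  have e: "sq_integrable M (\<lambda>x. h n x - k x)" for n
    unfolding sq_integrable_def
  proof
    show "integrable M (\<lambda>x. (h n x - k x)\<^sup>2)"
      by (rule Bochner_Integration.integrable_bound[of M "\<lambda>x. (f n x - g x)\<^sup>2"])
        (use d le2 in \<open>auto simp: sq_integrable_def\<close>)
  qed measurable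
  have "sq_integrable M (\<lambda>x. (h n x - k x) + k x)" for n by (rule sq_integrable_add[OF e k])
  hence hs: "sq_integrable M (h n)" for n by simp
  have "(\<integral>x. (h n x - k x)\<^sup>2 \<partial>M) \<le> (\<integral>x. (f n x - g x)\<^sup>2 \<partial>M)" for n
    using d e le2 by (intro integral_mono) (auto simp: sq_integrable_def)
  note le3 = this
  have lim: "(\<lambda>n. \<integral>x. (f n x - g x)\<^sup>2 \<partial>M) \<longlonglongrightarrow> 0" using f by (simp add: L2_tendsto_def)
  have "(\<lambda>n. \<integral>x. (h n x - k x)\<^sup>2 \<partial>M) \<longlonglongrightarrow> 0"
    by (rule tendsto_sandwich[OF _ _ tendsto_const lim]) (use le3 in auto)
  thus ?thesis using hs k by (simp add: L2_tendsto_def)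
qed

context brownian_filtration
begin

section \<open>The Ito isometry on the product of the sample space with time\<close>

sublocale P: pair_sigma_finite M lborel ..

abbreviation PP :: "('w \<times> real) measure" where "PP \<equiv> M \<Otimes>\<^sub>M lborel"

definition EP :: "'w elementary \<Rightarrow> 'w \<times> real \<Rightarrow> real" where
  "EP \<phi> = (\<lambda>(\<omega>, x). elementary_process \<phi> x \<omega>)"

lemma product_indicator_integral:
  fixes g :: "'w \<Rightarrow> real"
  assumes g: "integrable M g" and A: "A \<in> sets borel" "emeasure lborel A < \<infinity>"
  shows "integrable PP (\<lambda>(\<omega>, x). g \<omega> * indicator A x)"
    "(\<integral>p. (case p of (\<omega>, x) \<Rightarrow> g \<omega> * indicator A x) \<partial>PP) = (\<integral>\<omega>. g \<omega> \<partial>M) * measure lborel A"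
proof -
  have [measurable]: "g \<in> borel_measurable M" "A \<in> sets borel" using g A by auto
  have Ai: "integrable lborel (indicat_real A)" using A by (intro integrable_real_indicator) auto
  show int: "integrable PP (\<lambda>(\<omega>, x). g \<omega> * indicator A x)"
  proof (rule P.Fubini_integrable)
    show "integrable M (\<lambda>\<omega>. \<integral>x. norm (case (\<omega>, x) of (\<omega>, x) \<Rightarrow> g \<omega> * indicator A x) \<partial>lborel)"
      using g by (simp add: abs_mult)
    show "AE \<omega> in M. integrable lborel (\<lambda>x. case (\<omega>, x) of (\<omega>, x) \<Rightarrow> g \<omega> * indicator A x)"
      using Ai by simp
  qed measurable
  show "(\<integral>p. (case p of (\<omega>, x) \<Rightarrow> g \<omega> * indicator A x) \<partial>PP) = (\<integral>\<omega>. g \<omega> \<partial>M) * measure lborel A"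
    using P.integral_fst'[OF int] A by simp
qed

lemma Ioc_Int_Ioc:
  "{p<..q} \<inter> {u<..v} = {max p u<..min q (v::real)}" by auto

lemma measure_Ioc_Int: "measure lborel ({p<..q} \<inter> {u<..v}) = max 0 (min q v - max p (u::real))"
proof (cases "max p u \<le> min q v")
  case True
  thus ?thesis unfolding Ioc_Int_Ioc by (simp del: max.bounded_iff min.bounded_iff)
next
  case False
  hence "{max p u<..min q v} = {}" by auto
  thus ?thesis using False unfolding Ioc_Int_Ioc by (simp del: max.bounded_iff min.bounded_iff)
qed

text \<open>The isometry in polarized form, for two integrands and two motions: both sides are
  computed cell pair by cell pair, with \<open>D_cross\<close> supplying the length of the overlap.
  The form with two indices also contains the orthogonality of integrals against different
  motions.\<close>

lemma isometry:
  assumes ij: "i < N" "j < N" and \<phi>: "simple s t C (n, \<tau>, \<xi>)" and \<psi>: "simple s' t' C' (m, \<sigma>, \<eta>)"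
  shows "integrable M (\<lambda>\<omega>. I i (n, \<tau>, \<xi>) \<omega> * I j (m, \<sigma>, \<eta>) \<omega>)"
    and "integrable PP (\<lambda>p. EP (n, \<tau>, \<xi>) p * EP (m, \<sigma>, \<eta>) p)"
    and "(\<integral>\<omega>. I i (n, \<tau>, \<xi>) \<omega> * I j (m, \<sigma>, \<eta>) \<omega> \<partial>M) =
      (if i = j then \<integral>p. EP (n, \<tau>, \<xi>) p * EP (m, \<sigma>, \<eta>) p \<partial>PP else 0)"
proof -
  note \<phi>D = simpleD[OF \<phi>]
  note \<psi>D = simpleD[OF \<psi>]
  define X where "X k l \<omega> = (\<xi> k \<omega> * D i (\<tau> k) (\<tau> (Suc k)) \<omega>) * (\<eta> l \<omega> * D j (\<sigma> l) (\<sigma> (Suc l)) \<omega>)" for k l \<omega>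
  define e where "e k l = (\<integral>\<omega>. \<xi> k \<omega> * \<eta> l \<omega> \<partial>M) * measure lborel ({\<tau> k<..\<tau> (Suc k)} \<inter> {\<sigma> l<..\<sigma> (Suc l)})"
      for k l
  define Y where "Y k l p
      = (case p of (\<omega>, x) \<Rightarrow> (\<xi> k \<omega> * \<eta> l \<omega>) * indicat_real ({\<tau> k<..\<tau> (Suc k)} \<inter> {\<sigma> l<..\<sigma> (Suc l)})
          x)" for k l p
  have X: "integrable M (X k l)" "(\<integral>\<omega>. X k l \<omega> \<partial>M) = (if i = j then e k l else 0)" if "k < n" "l < m"
      for k l
  proof -
    note kl = less_imp_le[OF that(1)] less_imp_le[OF that(2)]
    note D_cross[OF ij \<phi>D(7)[OF kl(1)] \<phi>D(4)[OF that(1)] \<psi>D(7)[OF kl(2)] \<psi>D(4)[OF that(2)]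
        \<phi>D(5)[OF that(1)] \<phi>D(6)[OF that(1)] \<psi>D(5)[OF that(2)] \<psi>D(6)[OF that(2)]]
    thus "integrable M (X k l)" "(\<integral>\<omega>. X k l \<omega> \<partial>M) = (if i = j then e k l else 0)"
      unfolding X_def[abs_def] e_def measure_Ioc_Int by auto
  qed
  have Y: "integrable PP (Y k l)" "(\<integral>p. Y k l p \<partial>PP) = e k l" if "k < n" "l < m" for k l
  proof -
    have \<eta>i: "integrable M (\<eta> l)"
      by (rule integrable_bounded[OF \<psi>D(7) \<psi>D(5) \<psi>D(6)]) (use that in auto)
    have "integrable M (\<lambda>\<omega>. \<xi> k \<omega> * \<eta> l \<omega>)"
      by (rule integrable_bounded_mult[OF \<eta>i measurable_F_M[OF \<phi>D(7) \<phi>D(5)] \<phi>D(6)]) (use that in auto)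
    moreover have "emeasure lborel ({\<tau> k<..\<tau> (Suc k)} \<inter> {\<sigma> l<..\<sigma> (Suc l)}) < \<infinity>"
      unfolding Ioc_Int_Ioc
      by (cases "max (\<tau> k) (\<sigma> l) \<le> min (\<tau> (Suc k)) (\<sigma> (Suc l))")
          (simp_all del: max.bounded_iff min.bounded_iff)
    ultimately show "integrable PP (Y k l)" "(\<integral>p. Y k l p \<partial>PP) = e k l"
      unfolding Y_def[abs_def] e_def by (auto intro!: product_indicator_integral)
  qed
  have IX: "I i (n, \<tau>, \<xi>) \<omega> * I j (m, \<sigma>, \<eta>) \<omega> = (\<Sum>k<n. \<Sum>l<m. X k l \<omega>)" for \<omega>
    by (simp add: I_eq X_def sum_product)
  have EY: "EP (n, \<tau>, \<xi>) p * EP (m, \<sigma>, \<eta>) p = (\<Sum>k<n. \<Sum>l<m. Y k l p)" for p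
  proof (cases p)
    case (Pair \<omega> x)
    show ?thesis unfolding Pair EP_def elementary_process_def Y_def prod.case sum_product
      by (intro sum.cong refl) (simp only: indicator_inter_arith mult_ac)
  qed
  show "integrable M (\<lambda>\<omega>. I i (n, \<tau>, \<xi>) \<omega> * I j (m, \<sigma>, \<eta>) \<omega>)"
    unfolding IX by (intro Bochner_Integration.integrable_sum X) auto
  show "integrable PP (\<lambda>p. EP (n, \<tau>, \<xi>) p * EP (m, \<sigma>, \<eta>) p)"
    unfolding EY by (intro Bochner_Integration.integrable_sum Y) auto
  have "(\<integral>\<omega>. I i (n, \<tau>, \<xi>) \<omega> * I j (m, \<sigma>, \<eta>) \<omega> \<partial>M) = (\<Sum>k<n. \<Sum>l<m. \<integral>\<omega>. X k l \<omega> \<partial>M)"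
    unfolding IX by (subst Bochner_Integration.integral_sum; (intro sum.cong refl
        Bochner_Integration.integral_sum)?)
      (auto intro!: X Bochner_Integration.integrable_sum)
  also have "\<dots> = (if i = j then (\<Sum>k<n. \<Sum>l<m. e k l) else 0)"
    using X(2) by auto
  also have "(\<Sum>k<n. \<Sum>l<m. e k l) = (\<integral>p. EP (n, \<tau>, \<xi>) p * EP (m, \<sigma>, \<eta>) p \<partial>PP)"
  proof -
    have "(\<integral>p. (\<Sum>k<n. \<Sum>l<m. Y k l p) \<partial>PP) = (\<Sum>k<n. \<integral>p. (\<Sum>l<m. Y k l p) \<partial>PP)"
      by (rule Bochner_Integration.integral_sum) (auto intro!: Y Bochner_Integration.integrable_sum)
    also have "\<dots> = (\<Sum>k<n. \<Sum>l<m. e k l)"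
    proof (intro sum.cong refl)
      fix k assume "k \<in> {..<n}"
      thus "(\<integral>p. (\<Sum>l<m. Y k l p) \<partial>PP) = (\<Sum>l<m. e k l)"
        by (subst Bochner_Integration.integral_sum) (auto simp: Y)
    qed
    finally show ?thesis unfolding EY by simp
  qed
  finally show "(\<integral>\<omega>. I i (n, \<tau>, \<xi>) \<omega> * I j (m, \<sigma>, \<eta>) \<omega> \<partial>M) =
      (if i = j then \<integral>p. EP (n, \<tau>, \<xi>) p * EP (m, \<sigma>, \<eta>) p \<partial>PP else 0)" .
qed

lemma EP_measurable:
  assumes "simple s t C (n, \<tau>, \<xi>)"
  shows "EP (n, \<tau>, \<xi>) \<in> borel_measurable PP"
proof -
  note D = simpleD[OF assms]
  have eq: "EP (n, \<tau>, \<xi>) = (\<lambda>p. \<Sum>j<n. \<xi> j (fst p) * indicator {\<tau> j<..\<tau> (Suc j)} (snd p))"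
    by (auto simp: EP_def elementary_process_def)
  show ?thesis unfolding eq
  proof (intro borel_measurable_sum borel_measurable_times)
    fix j assume "j \<in> {..<n}"
    hence [measurable]: "\<xi> j \<in> borel_measurable M" by (intro measurable_F_M[OF D(7) D(5)]) auto
    show "(\<lambda>p. \<xi> j (fst p)) \<in> borel_measurable PP" by measurable
    show "(\<lambda>p. indicat_real {\<tau> j<..\<tau> (Suc j)} (snd p)) \<in> borel_measurable PP" by measurable
  qed
qed

lemma sq_integrable_I: "i < N \<Longrightarrow> simple s t C (n, \<tau>, \<xi>) \<Longrightarrow> sq_integrable M (I i (n, \<tau>, \<xi>))"
  using isometry(1)[of i i s t C n \<tau> \<xi>] measurable_F_M[OF _ I_moments(1)] simpleD(7)[of s t C n \<tau> \<xi> n]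
  by (simp add: sq_integrable_def power2_eq_square)

lemma sq_integrable_EP: 
  assumes i: "i < N" and \<phi>: "simple s t C (n, \<tau>, \<xi>)"
  shows "sq_integrable PP (EP (n, \<tau>, \<xi>))"
  using isometry(2)[OF i i \<phi> \<phi>] EP_measurable[OF \<phi>]
  by (simp add: sq_integrable_def power2_eq_square)

lemma isometry_diff:
  assumes i: "i < N" and \<phi>: "simple s t C (n, \<tau>, \<xi>)" and \<psi>: "simple s' t' C' (m, \<sigma>, \<eta>)"
  shows "(\<integral>\<omega>. (I i (n, \<tau>, \<xi>) \<omega> - I i (m, \<sigma>, \<eta>) \<omega>)\<^sup>2 \<partial>M) = (\<integral>p. (EP (n, \<tau>, \<xi>) p - EP (m, \<sigma>, \<eta>) p)\<^sup>2 \<partial>PP)"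
proof -
  have sq: "(u - v)\<^sup>2 = u * u - 2 * (u * v) + v * v" for u v :: real
    by (simp add: power2_eq_square algebra_simps)
  show ?thesis
    unfolding sq
    using isometry[OF i i \<phi> \<phi>] isometry[OF i i \<phi> \<psi>] isometry[OF i i \<psi> \<psi>] by simp
qed

lemma expectation_I:
  assumes i: "i < N" and \<phi>: "simple s t C (n, \<tau>, \<xi>)"
  shows "(\<integral>\<omega>. I i (n, \<tau>, \<xi>) \<omega> \<partial>M) = 0"
proof -
  note D = simpleD[OF \<phi>]
  have *: "integrable M (\<lambda>\<omega>. \<xi> j \<omega> * D i (\<tau> j) (\<tau> (Suc j)) \<omega>)" "(\<integral>\<omega>. \<xi> j \<omega> * D i (\<tau> j) (\<tau> (Suc j)) \<omega> \<partial>M)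
      = 0" if "j < n" for j
    using D_mult_1[OF i D(7) D(4) D(5) integrable_bounded[OF D(7) D(5) D(6)], of j] that by auto
  show ?thesis unfolding I_eq
    by (subst Bochner_Integration.integral_sum) (auto simp: *)
qed

text \<open>All grid points lie at s or later, so a bounded factor known at time s can be absorbed
  into the coefficients. Identities with such factors take the place of conditional
  expectations.\<close>

lemma simple_cmult:
  assumes \<phi>: "simple s t C (n, \<tau>, \<xi>)" and Z: "Z \<in> borel_measurable (F s)" "\<And>\<omega>. \<bar>Z \<omega>\<bar> \<le> K"
  shows "simple s t (K * C) (n, \<tau>, \<lambda>j \<omega>. Z \<omega> * \<xi> j \<omega>)"
proof -
  note D = simpleD[OF \<phi>]
  have "(\<lambda>\<omega>. Z \<omega> * \<xi> j \<omega>) \<in> borel_measurable (F (\<tau> j))" if "j < n" for j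
  proof -
    have [measurable]: "Z \<in> borel_measurable (F (\<tau> j))"
      by (rule measurable_F_mono[OF D(2) Z(1)]) (use that in simp)
    have [measurable]: "\<xi> j \<in> borel_measurable (F (\<tau> j))" by (rule D(5)[OF that])
    show ?thesis by measurable
  qed
  moreover have "\<bar>Z \<omega> * \<xi> j \<omega>\<bar> \<le> K * C" if "j < n" "\<omega> \<in> space M" for j \<omega>
    unfolding abs_mult
    by (rule mult_mono[OF Z(2) D(6)[OF that]]) (use Z(2)[of \<omega>] in auto)
  ultimately show ?thesis using \<phi> by (auto simp: simple_def)
qed

end

context brownian_filtration
begin

section \<open>Approximation by clipped simple processes\<close>

definition window :: "(real \<Rightarrow> 'w \<Rightarrow> real) \<Rightarrow> real set \<Rightarrow> 'w \<times> real \<Rightarrow> real" where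
  "window H A = (\<lambda>(\<omega>, x). indicator A x * H x \<omega>)"

text \<open>Clipping the approximating integrands bounds the fourth moments of their integrals, so that the
  squares of the integrals converge in mean as well.\<close>

definition clip :: "real \<Rightarrow> real" where "clip x = max (-1) (min 1 x)"

lemma clip_close: "\<bar>y\<bar> \<le> 1 \<Longrightarrow> \<bar>clip x - y\<bar> \<le> \<bar>x - y\<bar>" "\<bar>clip x\<bar> \<le> 1" "clip 0 = 0"
  "\<bar>y\<bar> \<le> 1 \<Longrightarrow> \<bar>clip x - x\<bar> \<le> \<bar>x - y\<bar>"
  by (auto simp: clip_def)

lemma simple_of_elementary:
  assumes "elementary M F t (n, \<tau>, \<xi>)"
  shows "\<exists>C. simple 0 t C (n, \<tau>, \<xi>)"
  using assms by (auto simp: elementary_def simple_def)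

lemma simple_clip:
  assumes "simple s t C (n, \<tau>, \<xi>)"
  shows "simple s t 1 (n, \<tau>, \<lambda>j \<omega>. clip (\<xi> j \<omega>))"
  using assms unfolding simple_def clip_def by auto

lemma EP_clip:
  assumes "simple s t C (n, \<tau>, \<xi>)"
  shows "EP (n, \<tau>, \<lambda>j \<omega>. clip (\<xi> j \<omega>)) p = clip (EP (n, \<tau>, \<xi>) p)"
proof (cases p)
  case (Pair \<omega> x)
  have "\<forall>j<n. \<tau> j \<le> \<tau> (Suc j)" using assms by (simp add: simple_def)
  thus ?thesis unfolding Pair EP_def prod.case by (rule elementary_process_map) (simp add: clip_def)
qed

lemma EP_outside:
  assumes "simple s t C (n, \<tau>, \<xi>)" "x \<notin> {s..t}"
  shows "EP (n, \<tau>, \<xi>) (\<omega>, x) = 0"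
proof -
  have "indicat_real {\<tau> j<..\<tau> (Suc j)} x = 0" if "j < n" for j
    using simpleD(2)[OF assms(1), of j] simpleD(3)[OF assms(1), of "Suc j"] assms(2) that
    by (auto simp: indicator_def)
  thus ?thesis unfolding EP_def elementary_process_def prod.case
    by (intro sum.neutral ballI) (simp only: lessThan_iff mult_zero_right)
qed

text \<open>X is the Ito integral of the integrand \<open>G\<close> over the time from s to t, with
  one sequence that witnesses both convergences and has coefficients bounded by 1. Having s explicit
  permits conditioning on the past of s.\<close>

definition approx :: "nat \<Rightarrow> real \<Rightarrow> real \<Rightarrow> ('w \<times> real \<Rightarrow> real) \<Rightarrow> ('w \<Rightarrow> real) \<Rightarrow> (nat \<Rightarrow> 'w elementary) \<Rightarrow> bool"
    where
  "approx i s t G X \<phi> \<longleftrightarrow> (\<forall>n. simple s t 1 (\<phi> n)) \<and> L2_tendsto PP (\<lambda>n. EP (\<phi> n)) G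
      \<and> L2_tendsto M (\<lambda>n. I i (\<phi> n)) X"

text \<open>Clipping does not increase the distance to an integrand bounded by 1, so the clipped
  processes have the same limit. The isometry then carries the vanishing difference over to the
  integrals.\<close>

lemma has_ito_integral_approx:
  assumes i: "i < N" and t: "t \<ge> 0" and ito: "has_ito_integral M F (B i) H t X"
    and H1: "\<And>x \<omega>. x \<in> {0..t} \<Longrightarrow> \<omega> \<in> space M \<Longrightarrow> \<bar>H x \<omega>\<bar> \<le> 1"
    and G: "window H {0..t} \<in> borel_measurable PP"
  shows "\<exists>\<phi>. approx i 0 t (window H {0..t}) X \<phi>"
proof -
  define G where "G = window H {0..t}"
  have G_eq: "G (\<omega>, x) = indicator {0..t} x * H x \<omega>" for \<omega> x by (simp add: G_def window_def)
  have [measurable]: "G \<in> borel_measurable PP" using assms(5) by (simp add: G_def)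
  have G1: "\<bar>G p\<bar> \<le> 1" if "p \<in> space PP" for p
    using that H1 by (cases p) (auto simp: G_eq space_pair_measure indicator_def)
  obtain \<phi> where \<phi>e: "\<And>n. elementary M F t (\<phi> n)"
    and l1: "(\<lambda>n. \<integral>\<^sup>+\<omega>. (\<integral>\<^sup>+x\<in>{0..t}. ennreal ((elementary_process (\<phi> n) x \<omega> - H x \<omega>)\<^sup>2) \<partial>lborel) \<partial>M) \<longlonglongrightarrow> 0"
    and l2: "(\<lambda>n. \<integral>\<^sup>+\<omega>. ennreal ((elementary_integral (B i) (\<phi> n) \<omega> - X \<omega>)\<^sup>2) \<partial>M) \<longlonglongrightarrow> 0"
    and X: "X \<in> borel_measurable M"
    using ito unfolding has_ito_integral_def by blast
  define m where "m n = fst (\<phi> n)" for n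
  define \<tau> where "\<tau> n = fst (snd (\<phi> n))" for n
  define \<xi> where "\<xi> n = snd (snd (\<phi> n))" for n
  have \<phi>_eq: "\<phi> n = (m n, \<tau> n, \<xi> n)" for n by (simp add: m_def \<tau>_def \<xi>_def)
  have "\<exists>C. simple 0 t C (\<phi> n)" for n
    using simple_of_elementary \<phi>e[of n] unfolding \<phi>_eq by blast
  then obtain C where \<phi>s: "\<And>n. simple 0 t (C n) (m n, \<tau> n, \<xi> n)" unfolding \<phi>_eq by metis
  have sqE: "sq_integrable PP (EP (\<phi> n))" and sqI: "sq_integrable M (I i (\<phi> n))" for n
    unfolding \<phi>_eq using sq_integrable_EP[OF i \<phi>s] sq_integrable_I[OF i \<phi>s] by auto
  have mE[measurable]: "EP (\<phi> n) \<in> borel_measurable PP" for n using sqE by (simp add: sq_integrable_def)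
  have "(\<integral>\<^sup>+\<omega>. (\<integral>\<^sup>+x\<in>{0..t}. ennreal ((elementary_process (\<phi> n) x \<omega> - H x \<omega>)\<^sup>2) \<partial>lborel) \<partial>M)
     = (\<integral>\<^sup>+p. ennreal ((EP (\<phi> n) p - G p)\<^sup>2) \<partial>PP)" for n
  proof -
    have "(\<integral>\<^sup>+p. ennreal ((EP (\<phi> n) p - G p)\<^sup>2) \<partial>PP)
        = (\<integral>\<^sup>+\<omega>. \<integral>\<^sup>+x. ennreal ((EP (\<phi> n) (\<omega>, x) - G (\<omega>, x))\<^sup>2) \<partial>lborel \<partial>M)"
      by (rule lborel.nn_integral_fst[symmetric]) measurable
    also have "\<dots> = (\<integral>\<^sup>+\<omega>. (\<integral>\<^sup>+x\<in>{0..t}. ennreal ((elementary_process (\<phi> n) x \<omega> - H x \<omega>)\<^sup>2) \<partial>lborel) \<partial>M)"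
    proof (intro nn_integral_cong)
      fix \<omega> x
      \<comment> \<open>Outside [0,t] both the elementary process and the window vanish, so the
        iterated integral of the definition is an integral over the product space.\<close>
      show "ennreal ((EP (\<phi> n) (\<omega>, x) - G (\<omega>, x))\<^sup>2)
         = ennreal ((elementary_process (\<phi> n) x \<omega> - H x \<omega>)\<^sup>2) * indicator {0..t} x"
      proof (cases "x \<in> {0..t}")
        case True
        thus ?thesis by (simp add: EP_def G_eq)
      next
        case False
        thus ?thesis using EP_outside[OF \<phi>s False] by (simp add: \<phi>_eq G_eq)
      qed
    qed
    finally show ?thesis by simp
  qed
  hence l1': "(\<lambda>n. \<integral>\<^sup>+p. ennreal ((EP (\<phi> n) p - G p)\<^sup>2) \<partial>PP) \<longlonglongrightarrow> 0" using l1 by simp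
  obtain k1 where k1: "L2_tendsto PP (\<lambda>n. EP (\<phi> (n + k1))) G"
    using L2_tendsto_nn_integral[of "\<lambda>n. EP (\<phi> n)" PP G, OF mE _ sqE l1'] by auto
  have mI: "I i (\<phi> n) \<in> borel_measurable M" for n using sqI by (simp add: sq_integrable_def)
  obtain k2 where k2: "L2_tendsto M (\<lambda>n. I i (\<phi> (n + k2))) X"
    using L2_tendsto_nn_integral[of "\<lambda>n. I i (\<phi> n)" M X, OF mI X sqI l2] by auto
  \<comment> \<open>The two convergences are available from different indices on; a common shift
    serves both.\<close>
  define K where "K = k1 + k2"
  have L1: "L2_tendsto PP (\<lambda>n. EP (\<phi> (n + K))) G"
    using L2_tendsto_shift[OF k1, of k2] by (simp add: K_def add_ac)
  have L2: "L2_tendsto M (\<lambda>n. I i (\<phi> (n + K))) X"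
    using L2_tendsto_shift[OF k2, of k1] by (simp add: K_def add_ac)
  define \<psi> where "\<psi> n = (m (n + K), \<tau> (n + K), \<lambda>j \<omega>. clip (\<xi> (n + K) j \<omega>))" for n
  have \<psi>s: "simple 0 t 1 (\<psi> n)" for n unfolding \<psi>_def by (rule simple_clip[OF \<phi>s])
  have E\<psi>: "EP (\<psi> n) p = clip (EP (\<phi> (n + K)) p)" for n p
    unfolding \<psi>_def \<phi>_eq by (rule EP_clip[OF \<phi>s])
  have [measurable]: "EP (\<psi> n) \<in> borel_measurable PP" for n
    using EP_measurable[OF \<psi>s[of n, unfolded \<psi>_def]] by (simp add: \<psi>_def)
  have L1\<psi>: "L2_tendsto PP (\<lambda>n. EP (\<psi> n)) G"
  proof (rule L2_tendsto_dominated[OF L1])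
    show "sq_integrable PP G" using k1 by (simp add: L2_tendsto_def)
    show "\<bar>EP (\<psi> n) p - G p\<bar> \<le> \<bar>EP (\<phi> (n + K)) p - G p\<bar>" if "p \<in> space PP" for n p
      unfolding E\<psi> by (rule clip_close(1)[OF G1[OF that]])
  qed measurable
  \<comment> \<open>Clipped and unclipped processes have the same limit, so their difference tends
    to 0 on the product space.\<close>
  have "L2_tendsto PP (\<lambda>n p. EP (\<psi> n) p - EP (\<phi> (n + K)) p) (\<lambda>p. G p - G p)"
    by (rule L2_tendsto_diff[OF L1\<psi> L1])
  hence "(\<lambda>n. \<integral>p. (EP (\<psi> n) p - EP (\<phi> (n + K)) p)\<^sup>2 \<partial>PP) \<longlonglongrightarrow> 0" by (simp add: L2_tendsto_def)
  moreover have "(\<integral>p. (EP (\<psi> n) p - EP (\<phi> (n + K)) p)\<^sup>2 \<partial>PP) = (\<integral>\<omega>. (I i (\<psi> n) \<omega> - I i (\<phi> (n + K)) \<omega>)\<^sup>2 \<partial>M)"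
      for n
    using isometry_diff[OF i \<psi>s[of n, unfolded \<psi>_def] \<phi>s[of "n + K"]] by (simp add: \<psi>_def \<phi>_eq)
  moreover have sqI\<psi>: "sq_integrable M (I i (\<psi> n))" for n
    using sq_integrable_I[OF i \<psi>s[of n, unfolded \<psi>_def]] by (simp add: \<psi>_def)
  ultimately have "L2_tendsto M (\<lambda>n \<omega>. I i (\<psi> n) \<omega> - I i (\<phi> (n + K)) \<omega>) (\<lambda>_. 0)"
    using sqI by (simp add: L2_tendsto_def sq_integrable_diff) (simp add: sq_integrable_def)
  from L2_tendsto_add[OF this L2] have "L2_tendsto M (\<lambda>n. I i (\<psi> n)) X" by simp
  thus ?thesis using L1\<psi> \<psi>s unfolding approx_def G_def by blast
qed

text \<open>The integrals up to s and up to t come with unrelated approximating sequences. The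
  sequence for t is split at s; its lower half approximates the same integrand as the sequence for
  s, so by the isometry its integrals tend to Y, and the upper half has to tend to X - Y.\<close>

lemma approx_increment:
  assumes i: "i < N" and st: "0 \<le> s" "s \<le> t"
    and \<phi>: "approx i 0 t (window H {0..t}) X \<phi>" and \<psi>: "approx i 0 s (window H {0..s}) Y \<psi>"
  shows "\<exists>\<zeta>. approx i s t (window H {s<..t}) (\<lambda>\<omega>. X \<omega> - Y \<omega>) \<zeta>"
proof -
  define m where "m n = fst (\<phi> n)" for n
  define \<tau> where "\<tau> n = fst (snd (\<phi> n))" for n
  define \<xi> where "\<xi> n = snd (snd (\<phi> n))" for n
  have \<phi>_eq: "\<phi> n = (m n, \<tau> n, \<xi> n)" for n by (simp add: m_def \<tau>_def \<xi>_def)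
  have \<phi>s: "simple 0 t 1 (m n, \<tau> n, \<xi> n)" for n using \<phi> by (auto simp: approx_def \<phi>_eq[symmetric])
  note D = simpleD[OF \<phi>s]
  have mono: "\<forall>j<m n. \<tau> n j \<le> \<tau> n (Suc j)" for n using D(4) by blast
  define lo where "lo n = (m n, \<lambda>j. min s (\<tau> n j), \<lambda>j \<omega>. if \<tau> n j < s then \<xi> n j \<omega> else 0)" for n
  define hi where "hi n = (m n, \<lambda>j. max s (\<tau> n j), \<xi> n)" for n
  have los: "simple 0 s 1 (lo n)" for n
    unfolding lo_def simple_def prod.case
  proof (intro conjI allI impI ballI)
    fix j assume j: "j < m n"
    show "(\<lambda>\<omega>. if \<tau> n j < s then \<xi> n j \<omega> else 0) \<in> borel_measurable (F (min s (\<tau> n j)))"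
      using D(5)[OF j] by (cases "\<tau> n j < s") (auto simp: min_absorb2)
    show "\<bar>if \<tau> n j < s then \<xi> n j \<omega> else 0\<bar> \<le> 1" if "\<omega> \<in> space M" for \<omega> using D(6)[OF j that] by simp
    show "min s (\<tau> n j) \<le> min s (\<tau> n (Suc j))" using D(4)[OF j] by simp
  qed (use st D(2)[of 0 n] in auto)
  have his: "simple s t 1 (hi n)" for n
    unfolding hi_def simple_def prod.case
  proof (intro conjI allI impI ballI)
    fix j assume j: "j < m n"
    show "\<xi> n j \<in> borel_measurable (F (max s (\<tau> n j)))"
      by (rule measurable_F_mono[OF _ D(5)[OF j]]) simp
    show "\<bar>\<xi> n j \<omega>\<bar> \<le> 1" if "\<omega> \<in> space M" for \<omega> by (rule D(6)[OF j that])
    show "max s (\<tau> n j) \<le> max s (\<tau> n (Suc j))" using D(4)[OF j] by simp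
  qed (use st D(3)[of "m n" n] in auto)
  have Elo: "EP (lo n) p = indicator {..s} (snd p) * EP (\<phi> n) p" for n p
    unfolding EP_def lo_def \<phi>_eq by (cases p) (simp add: elementary_process_before[OF mono])
  have Ehi: "EP (hi n) p = indicator {s<..} (snd p) * EP (\<phi> n) p" for n p
    unfolding EP_def hi_def \<phi>_eq by (cases p) (simp add: elementary_process_after[OF mono])
  have Isplit: "I i (\<phi> n) \<omega> = I i (lo n) \<omega> + I i (hi n) \<omega>" for n \<omega>
    unfolding lo_def hi_def \<phi>_eq by (rule elementary_integral_split[OF mono])
  have L\<phi>: "L2_tendsto PP (\<lambda>n. EP (\<phi> n)) (window H {0..t})" and I\<phi>: "L2_tendsto M (\<lambda>n. I i (\<phi> n)) X"
    using \<phi> by (auto simp: approx_def)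
  have L\<psi>: "L2_tendsto PP (\<lambda>n. EP (\<psi> n)) (window H {0..s})" and I\<psi>: "L2_tendsto M (\<lambda>n. I i (\<psi> n)) Y"
    and \<psi>s: "\<And>n. simple 0 s 1 (\<psi> n)"
    using \<psi> by (auto simp: approx_def)
  have "L2_tendsto PP (\<lambda>n p. indicator {s<..} (snd p) * EP (\<phi> n) p) (\<lambda>p. indicator {s<..} (snd p) * window H
      {0..t} p)"
    by (rule L2_tendsto_bounded_mult[OF L\<phi>, where C = 1]) (auto simp: indicator_def)
  moreover have "(\<lambda>p. indicator {s<..} (snd p) * window H {0..t} p) = window H {s<..t}"
    using st by (auto simp: window_def indicator_def fun_eq_iff)
  ultimately have Lhi: "L2_tendsto PP (\<lambda>n. EP (hi n)) (window H {s<..t})"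
    by (simp add: Ehi[abs_def])
  have "L2_tendsto PP (\<lambda>n p. indicator {..s} (snd p) * EP (\<phi> n) p) (\<lambda>p. indicator {..s} (snd p) * window H
      {0..t} p)"
    by (rule L2_tendsto_bounded_mult[OF L\<phi>, where C = 1]) (auto simp: indicator_def)
  moreover have "(\<lambda>p. indicator {..s} (snd p) * window H {0..t} p) = window H {0..s}"
    using st by (auto simp: window_def indicator_def fun_eq_iff)
  ultimately have Llo: "L2_tendsto PP (\<lambda>n. EP (lo n)) (window H {0..s})"
    by (simp add: Elo[abs_def])
  have "L2_tendsto PP (\<lambda>n p. EP (lo n) p - EP (\<psi> n) p) (\<lambda>p. window H {0..s} p - window H {0..s} p)"
    by (rule L2_tendsto_diff[OF Llo L\<psi>])
  hence l0: "(\<lambda>n. \<integral>p. (EP (lo n) p - EP (\<psi> n) p)\<^sup>2 \<partial>PP) \<longlonglongrightarrow> 0" by (simp add: L2_tendsto_def)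
  have sqI: "sq_integrable M (I i (lo n))" "sq_integrable M (I i (\<psi> n))" for n
    using sq_integrable_I[OF i los[of n, unfolded lo_def]] I\<psi> by (auto simp: lo_def L2_tendsto_def)
  have "(\<integral>p. (EP (lo n) p - EP (\<psi> n) p)\<^sup>2 \<partial>PP) = (\<integral>\<omega>. (I i (lo n) \<omega> - I i (\<psi> n) \<omega>)\<^sup>2 \<partial>M)" for n
  proof -
    obtain a b c where e: "\<psi> n = (a, b, c)" by (cases "\<psi> n")
    show ?thesis
      using isometry_diff[OF i los[of n, unfolded lo_def] \<psi>s[of n, unfolded e]] by (simp add: lo_def e)
  qed
  hence "L2_tendsto M (\<lambda>n \<omega>. I i (lo n) \<omega> - I i (\<psi> n) \<omega>) (\<lambda>_. 0)"
    using l0 sqI by (simp add: L2_tendsto_def sq_integrable_diff) (simp add: sq_integrable_def)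
  from L2_tendsto_diff[OF L2_tendsto_diff[OF I\<phi> this] I\<psi>]
  have "L2_tendsto M (\<lambda>n \<omega>. I i (hi n) \<omega>) (\<lambda>\<omega>. X \<omega> - Y \<omega>)"
    by (simp add: Isplit)
  thus ?thesis using Lhi his unfolding approx_def by blast
qed

text \<open>Mean-square limits of the identities for simple processes. The factor \<open>Z\<close>
  expresses conditioning on time s: mean zero, conditional variance, and orthogonality of different
  components. The constant 3 is the fourth moment of a standard normal variable, the coefficients
  being bounded by 1.\<close>

lemma approx_expectation:
  assumes i: "i < N" and \<phi>: "approx i s t G X \<phi>"
    and Z: "Z \<in> borel_measurable (F s)" "\<And>\<omega>. \<bar>Z \<omega>\<bar> \<le> K" and s: "0 \<le> s"
  shows "(\<integral>\<omega>. Z \<omega> * X \<omega> \<partial>M) = 0"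
    and "(\<integral>\<omega>. Z \<omega> * (X \<omega>)\<^sup>2 \<partial>M) = (\<integral>p. Z (fst p) * (G p)\<^sup>2 \<partial>PP)"
    and "j < N \<Longrightarrow> approx j s t G' Y \<psi> \<Longrightarrow> i \<noteq> j \<Longrightarrow> (\<integral>\<omega>. Z \<omega> * (X \<omega> * Y \<omega>) \<partial>M) = 0"
    and "sq_integrable M X" "integrable M (\<lambda>\<omega>. X \<omega> ^ 4)" "(\<integral>\<omega>. X \<omega> ^ 4 \<partial>M) \<le> 3 * (t - s)\<^sup>2"
proof -
  have ZM[measurable]: "Z \<in> borel_measurable M" by (rule measurable_F_M[OF s Z(1)])
  have L: "L2_tendsto PP (\<lambda>n. EP (\<phi> n)) G" and IL: "L2_tendsto M (\<lambda>n. I i (\<phi> n)) X"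
    and \<phi>s: "\<And>n. simple s t 1 (\<phi> n)"
    using \<phi> by (auto simp: approx_def)
  \<comment> \<open>The factor is moved into the integrand, so that the plain isometry yields the
    conditional one.\<close>
  define Z\<phi> where "Z\<phi> n = (fst (\<phi> n), fst (snd (\<phi> n)), \<lambda>j \<omega>. Z \<omega> * snd (snd (\<phi> n)) j \<omega>)" for n
  have Zs: "simple s t (K * 1) (Z\<phi> n)" for n
    unfolding Z\<phi>_def by (rule simple_cmult[OF _ Z]) (simp add: \<phi>s)
  have ZI: "I i (Z\<phi> n) \<omega> = Z \<omega> * I i (\<phi> n) \<omega>" for n \<omega>
    unfolding Z\<phi>_def elementary_integral_cmult by simp
  have ZE: "EP (Z\<phi> n) p = Z (fst p) * EP (\<phi> n) p" for n p
    unfolding Z\<phi>_def EP_def by (cases p) (simp add: elementary_process_cmult)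
  have ZIL: "L2_tendsto M (\<lambda>n \<omega>. Z \<omega> * I i (\<phi> n) \<omega>) (\<lambda>\<omega>. Z \<omega> * X \<omega>)"
    by (rule L2_tendsto_bounded_mult[OF IL ZM Z(2)])
  have ZEL: "L2_tendsto PP (\<lambda>n p. Z (fst p) * EP (\<phi> n) p) (\<lambda>p. Z (fst p) * G p)"
    by (rule L2_tendsto_bounded_mult[OF L _ Z(2)]) measurable
  show sqX: "sq_integrable M X" using IL by (simp add: L2_tendsto_def)
  have one: "L2_tendsto M (\<lambda>_ _. 1) (\<lambda>_. 1)" by (rule L2_tendsto_const) (simp add: sq_integrable_def)
  have "(\<lambda>n. \<integral>\<omega>. Z \<omega> * I i (\<phi> n) \<omega> * 1 \<partial>M) \<longlonglongrightarrow> (\<integral>\<omega>. Z \<omega> * X \<omega> * 1 \<partial>M)"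
    by (rule L2_tendsto_inner[OF ZIL one])
  moreover have "(\<integral>\<omega>. Z \<omega> * I i (\<phi> n) \<omega> * 1 \<partial>M) = 0" for n
    using expectation_I[OF i Zs[of n, unfolded Z\<phi>_def], folded Z\<phi>_def] by (simp add: ZI)
  ultimately show "(\<integral>\<omega>. Z \<omega> * X \<omega> \<partial>M) = 0" by (simp add: LIMSEQ_const_iff)
  have "(\<lambda>n. \<integral>\<omega>. (Z \<omega> * I i (\<phi> n) \<omega>) * I i (\<phi> n) \<omega> \<partial>M) \<longlonglongrightarrow> (\<integral>\<omega>. (Z \<omega> * X \<omega>) * X \<omega> \<partial>M)"
    by (rule L2_tendsto_inner[OF ZIL IL])
  moreover have "(\<integral>\<omega>. (Z \<omega> * I i (\<phi> n) \<omega>) * I i (\<phi> n) \<omega> \<partial>M)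
      = (\<integral>p. (Z (fst p) * EP (\<phi> n) p) * EP (\<phi> n) p \<partial>PP)" for n
  proof -
    obtain a b c where e: "\<phi> n = (a, b, c)" by (cases "\<phi> n")
    show ?thesis
      using isometry(3)[OF i i Zs[of n, unfolded Z\<phi>_def] \<phi>s[of n, unfolded e], folded Z\<phi>_def e]
      by (simp add: ZI ZE)
  qed
  moreover have "(\<lambda>n. \<integral>p. (Z (fst p) * EP (\<phi> n) p) * EP (\<phi> n) p \<partial>PP) \<longlonglongrightarrow> (\<integral>p. (Z (fst p) * G p) * G p \<partial>PP)"
    by (rule L2_tendsto_inner[OF ZEL L])
  ultimately have "(\<integral>\<omega>. (Z \<omega> * X \<omega>) * X \<omega> \<partial>M) = (\<integral>p. (Z (fst p) * G p) * G p \<partial>PP)"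
    by (simp add: LIMSEQ_unique)
  thus "(\<integral>\<omega>. Z \<omega> * (X \<omega>)\<^sup>2 \<partial>M) = (\<integral>p. Z (fst p) * (G p)\<^sup>2 \<partial>PP)"
    by (simp add: power2_eq_square mult.assoc)
  show "(\<integral>\<omega>. Z \<omega> * (X \<omega> * Y \<omega>) \<partial>M) = 0" if j: "j < N" and \<psi>: "approx j s t G' Y \<psi>" and ij: "i \<noteq> j"
  proof -
    have IL': "L2_tendsto M (\<lambda>n. I j (\<psi> n)) Y" and \<psi>s: "\<And>n. simple s t 1 (\<psi> n)"
      using \<psi> by (auto simp: approx_def)
    have "(\<lambda>n. \<integral>\<omega>. (Z \<omega> * I i (\<phi> n) \<omega>) * I j (\<psi> n) \<omega> \<partial>M) \<longlonglongrightarrow> (\<integral>\<omega>. (Z \<omega> * X \<omega>) * Y \<omega> \<partial>M)"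
      by (rule L2_tendsto_inner[OF ZIL IL'])
    moreover have "(\<integral>\<omega>. (Z \<omega> * I i (\<phi> n) \<omega>) * I j (\<psi> n) \<omega> \<partial>M) = 0" for n
    proof -
      obtain a b c where e: "\<psi> n = (a, b, c)" by (cases "\<psi> n")
      show ?thesis
        using isometry(3)[OF i j Zs[of n, unfolded Z\<phi>_def] \<psi>s[of n, unfolded e], folded Z\<phi>_def e] ij
        by (simp add: ZI)
    qed
    ultimately show ?thesis by (simp add: LIMSEQ_const_iff mult.assoc)
  qed
  have m4: "integrable M (\<lambda>\<omega>. I i (\<phi> n) \<omega> ^ 4)" "(\<integral>\<omega>. I i (\<phi> n) \<omega> ^ 4 \<partial>M) \<le> 3 * (t - s)\<^sup>2" for n
  proof -
    obtain a b c where e: "\<phi> n = (a, b, c)" by (cases "\<phi> n")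
    note sm = \<phi>s[of n, unfolded e]
    show "integrable M (\<lambda>\<omega>. I i (\<phi> n) \<omega> ^ 4)" unfolding e by (rule I_moments(2)[OF i sm])
    have "(\<integral>\<omega>. I i (\<phi> n) \<omega> ^ 4 \<partial>M) \<le> 3 * 1 ^ 4 * (b a - b 0)\<^sup>2" unfolding e by (rule I_moments(4)[OF i sm])
    also have "\<dots> \<le> 3 * (t - s)\<^sup>2"
      using simpleD(2)[OF sm, of 0] simpleD(3)[OF sm, of a] grid_mono[of a b 0 a] simpleD(4)[OF sm]
      by (auto intro!: power_mono)
    finally show "(\<integral>\<omega>. I i (\<phi> n) \<omega> ^ 4 \<partial>M) \<le> 3 * (t - s)\<^sup>2" .
  qed
  show "integrable M (\<lambda>\<omega>. X \<omega> ^ 4)" "(\<integral>\<omega>. X \<omega> ^ 4 \<partial>M) \<le> 3 * (t - s)\<^sup>2"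
    using L2_tendsto_fourth_moment[OF IL m4] by auto
qed

end

section \<open>A pathwise discrete Ito formula for powers\<close>

text \<open>With h = y - x the remainders obey E' = y E + k (k - 1) / 2 x^(k - 2) h^3 from k to k +
  1. The crude bound k^3 works because k^3 + k^2 <= (k + 1)^3.\<close>

lemma taylor_power_remainder:
  fixes x y :: real
  assumes "x \<in> {0..1}" "y \<in> {0..1}"
  shows "\<bar>y ^ k - x ^ k - real k * x ^ (k - 1) * (y - x)
      - real k * (real k - 1) / 2 * x ^ (k - 2) * (y - x)\<^sup>2\<bar>
    \<le> real k ^ 3 * \<bar>y - x\<bar> ^ 3"
proof (induction k)
  case 0
  thus ?case by simp
next
  case (Suc k)
  define h where "h = y - x"
  define E where "E = y ^ k - x ^ k - real k * x ^ (k - 1) * h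
      - real k * (real k - 1) / 2 * x ^ (k - 2) * h\<^sup>2"
  have y: "y = x + h" by (simp add: h_def)
  have IH: "\<bar>E\<bar> \<le> real k ^ 3 * \<bar>h\<bar> ^ 3" using Suc by (simp add: E_def h_def)
  have yk: "y ^ k = x ^ k + real k * x ^ (k - 1) * h + real k * (real k - 1) / 2 * x ^ (k - 2) * h\<^sup>2 + E"
    by (simp add: E_def)
  \<comment> \<open>The truncated exponents are wrong for k = 0 and k = 1, but there the
    coefficients in front vanish.\<close>
  have p1: "real k * (x * x ^ (k - 1)) = real k * x ^ k" by (cases k) auto
  have p2: "real k * (real k - 1) * (x * x ^ (k - 2)) = real k * (real k - 1) * x ^ (k - 1)"
  proof -
    consider "k = 0" | "k = 1" | l where "k = Suc (Suc l)" by (metis One_nat_def not0_implies_Suc)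
    thus ?thesis by cases auto
  qed
  have "y ^ Suc k - x ^ Suc k - real (Suc k) * x ^ (Suc k - 1) * h
      - real (Suc k) * (real (Suc k) - 1) / 2 * x ^ (Suc k - 2) * h\<^sup>2
     = y * E + real k * (real k - 1) / 2 * x ^ (k - 2) * h ^ 3"
  proof -
    define w where "w = real k * (real k - 1) / 2 * x ^ (k - 2)"
    have wx: "w * x = real k * (real k - 1) / 2 * x ^ (k - 1)"
      using p2 by (simp add: w_def mult_ac)
    have "y ^ Suc k = y * E + (x ^ Suc k + (real k * (x * x ^ (k - 1))) * h + (w * x) * h\<^sup>2)
       + (h * x ^ k + real k * x ^ (k - 1) * h\<^sup>2 + w * h ^ 3)"
      unfolding power_Suc yk w_def[symmetric] unfolding y
      by (simp add: algebra_simps power2_eq_square power3_eq_cube)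
    hence "y ^ Suc k = y * E
        + (x ^ Suc k + (real k * x ^ k) * h + (real k * (real k - 1) / 2 * x ^ (k - 1)) * h\<^sup>2)
       + (h * x ^ k + real k * x ^ (k - 1) * h\<^sup>2 + w * h ^ 3)"
      unfolding p1 wx .
    moreover have "Suc k - 2 = k - 1" by simp
    ultimately show ?thesis unfolding w_def[symmetric] by (simp add: field_simps)
  qed
  moreover have "\<bar>y * E + real k * (real k - 1) / 2 * x ^ (k - 2) * h ^ 3\<bar> \<le> real (Suc k) ^ 3 * \<bar>h\<bar> ^ 3"
  proof -
    have "\<bar>y * E\<bar> \<le> 1 * (real k ^ 3 * \<bar>h\<bar> ^ 3)" unfolding abs_mult using assms IH by (intro mult_mono) auto
    moreover have "\<bar>real k * (real k - 1) / 2 * x ^ (k - 2) * h ^ 3\<bar> \<le> real k ^ 2 * \<bar>h\<bar> ^ 3"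
    proof -
      have a: "\<bar>real k * (real k - 1) / 2\<bar> \<le> real k ^ 2"
        by (cases k) (auto simp: power2_eq_square abs_mult divide_simps intro!: mult_mono)
      have b: "\<bar>x ^ (k - 2)\<bar> \<le> 1" using assms by (simp add: power_abs power_le_one)
      have "\<bar>real k * (real k - 1) / 2\<bar> * \<bar>x ^ (k - 2)\<bar> \<le> real k ^ 2 * 1"
        by (rule mult_mono[OF a b]) auto
      hence "\<bar>real k * (real k - 1) / 2\<bar> * \<bar>x ^ (k - 2)\<bar> * \<bar>h\<bar> ^ 3 \<le> real k ^ 2 * 1 * \<bar>h\<bar> ^ 3"
        by (rule mult_right_mono) simp
      thus ?thesis by (simp add: abs_mult power_abs)
    qed
    moreover have "real k ^ 3 * \<bar>h\<bar> ^ 3 + real k ^ 2 * \<bar>h\<bar> ^ 3 \<le> real (Suc k) ^ 3 * \<bar>h\<bar> ^ 3"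
      unfolding distrib_right[symmetric]
      by (rule mult_right_mono, simp add: power2_eq_square power3_eq_cube algebra_simps, simp)
    ultimately show ?thesis by linarith
  qed
  ultimately show ?case by (simp only: h_def)
qed

section \<open>Riemann sums along uniform grids\<close>

definition grid :: "real \<Rightarrow> real \<Rightarrow> nat \<Rightarrow> nat \<Rightarrow> real" where
  "grid s t n l = s + (t - s) * real l / real n"

lemma grid_0 [simp]: "grid s t n 0 = s" by (simp add: grid_def)
lemma grid_n: "n > 0 \<Longrightarrow> grid s t n n = t" by (simp add: grid_def)
lemma grid_le: "s \<le> t \<Longrightarrow> l \<le> m \<Longrightarrow> grid s t n l \<le> grid s t n m"
  unfolding grid_def by (intro add_left_mono divide_right_mono mult_left_mono) auto
lemma grid_in: "s \<le> t \<Longrightarrow> l \<le> n \<Longrightarrow> 0 < n \<Longrightarrow> grid s t n l \<in> {s..t}"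
  using grid_le[of s t 0 l n] grid_le[of s t l n n] grid_n[of n s t] by simp
lemma grid_step: "n > 0 \<Longrightarrow> grid s t n (Suc l) - grid s t n l = (t - s) / real n"
  by (simp add: grid_def field_simps)

lemma grid_cells_subset: "s \<le> t \<Longrightarrow> l < n \<Longrightarrow> {grid s t n l..grid s t n (Suc l)} \<subseteq> {s..t}"
  using grid_in[of s t l n] grid_in[of s t "Suc l" n] by auto

lemma eventually_grid_oscillation:
  fixes w :: "real \<Rightarrow> real"
  assumes w: "continuous_on {s..t} w" and st: "s \<le> t" and e: "e > 0"
  shows "\<forall>\<^sub>F n in sequentially. n > 0
      \<and> (\<forall>l<n. \<forall>u\<in>{grid s t n l..grid s t n (Suc l)}. \<bar>w u - w (grid s t n l)\<bar> \<le> e)"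
proof -
  obtain d where d: "d > 0" "\<And>u v. u \<in> {s..t} \<Longrightarrow> v \<in> {s..t} \<Longrightarrow> dist u v < d \<Longrightarrow> dist (w u) (w v) < e"
    using compact_uniformly_continuous[OF w compact_Icc] e unfolding uniformly_continuous_on_def by metis
  obtain m where m: "real m > (t - s) / d" using reals_Archimedean2 by blast
  show ?thesis
    using eventually_gt_at_top[of m]
  proof eventually_elim
    case (elim n)
    hence n: "n > 0" "real n > (t - s) / d" using m by auto
    hence nd: "(t - s) / real n < d" using d by (simp add: field_simps)
    have "\<bar>w u - w (grid s t n l)\<bar> \<le> e" if "l < n" "u \<in> {grid s t n l..grid s t n (Suc l)}" for l u
    proof -
      have "u \<in> {s..t}" "grid s t n l \<in> {s..t}"
        using grid_cells_subset[OF st that(1)] that grid_in[OF st _ n(1), of l] by auto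
      moreover have "dist u (grid s t n l) < d"
        using that grid_step[OF n(1), of s t l] nd by (simp add: dist_real_def)
      ultimately have "dist (w u) (w (grid s t n l)) < e" by (rule d(2))
      thus ?thesis by (simp add: dist_real_def)
    qed
    with n show ?case by blast
  qed
qed

lemma integral_grid_sum:
  fixes f :: "real \<Rightarrow> real"
  assumes f: "f integrable_on {s..t}" and st: "s \<le> t" and n: "n > 0"
  shows "(\<Sum>l<n. integral {grid s t n l..grid s t n (Suc l)} f) = integral {s..t} f"
proof -
  have "(\<Sum>l<m. integral {grid s t n l..grid s t n (Suc l)} f) = integral {s..grid s t n m} f" if "m \<le> n"
      for m
    using that
  proof (induction m)
    case (Suc m)
    have "integral {s..grid s t n m} f + integral {grid s t n m..grid s t n (Suc m)} f
        = integral {s..grid s t n (Suc m)} f"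
    proof (rule Henstock_Kurzweil_Integration.integral_combine)
      show "s \<le> grid s t n m" "grid s t n m \<le> grid s t n (Suc m)"
        using grid_in[OF st _ n, of m] Suc.prems grid_le[OF st, of m "Suc m" n] by auto
      show "f integrable_on {s..grid s t n (Suc m)}"
        by (rule integrable_on_subinterval[OF f]) (use grid_in[OF st Suc.prems n] in auto)
    qed
    thus ?case using Suc by simp
  qed simp
  from this[of n] show ?thesis using grid_n[OF n] by simp
qed

text \<open>The integrator has a density \<open>d\<close> that is absolutely integrable but may be
  unbounded, as the drift of the particles is. The error is at most the oscillation of
  \<open>w\<close> on a cell times the integral of |d|.\<close>

lemma riemann_stieltjes_grid:
  fixes w d :: "real \<Rightarrow> real"
  assumes w: "continuous_on {s..t} w" and d: "d absolutely_integrable_on {s..t}" and st: "s \<le> t"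
  shows "(\<lambda>n. \<Sum>l<n. w (grid s t n l) * integral {grid s t n l..grid s t n (Suc l)} d)
      \<longlonglongrightarrow> integral {s..t} (\<lambda>u. w u * d u)"
proof (rule LIMSEQ_I)
  fix e :: real assume e: "e > 0"
  have di: "d integrable_on {s..t}" and dn: "(\<lambda>u. \<bar>d u\<bar>) integrable_on {s..t}"
    using d by (auto simp: absolutely_integrable_on_def)
  have wd: "(\<lambda>u. w u * d u) absolutely_integrable_on {s..t}"
  proof (rule absolutely_integrable_bounded_measurable_product_real)
    show "w \<in> borel_measurable (lebesgue_on {s..t})"
      by (rule continuous_imp_measurable_on_sets_lebesgue[OF w]) simp
    show "bounded (w ` {s..t})" by (rule compact_imp_bounded[OF compact_continuous_image[OF w compact_Icc]])
  qed (use d in auto)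
  hence wdi: "(\<lambda>u. w u * d u) integrable_on {s..t}" by (simp add: absolutely_integrable_on_def)
  define K where "K = integral {s..t} (\<lambda>u. \<bar>d u\<bar>)"
  have K: "K \<ge> 0" unfolding K_def by (rule integral_nonneg[OF dn]) simp
  define \<eta> where "\<eta> = e / (2 * (K + 1))"
  have \<eta>: "\<eta> > 0" using e K by (simp add: \<eta>_def)
  have \<eta>K: "\<eta> * K < e" using e K by (simp add: \<eta>_def field_simps) (simp add: add_nonneg_pos)
  obtain no where no: "\<And>n. n \<ge> no \<Longrightarrow> n > 0
      \<and> (\<forall>l<n. \<forall>u\<in>{grid s t n l..grid s t n (Suc l)}. \<bar>w u - w (grid s t n l)\<bar> \<le> \<eta>)"
    using eventually_grid_oscillation[OF w st \<eta>] by (auto simp: eventually_sequentially)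
  have "norm ((\<Sum>l<n. w (grid s t n l) * integral {grid s t n l..grid s t n (Suc l)} d)
      - integral {s..t} (\<lambda>u. w u * d u)) < e"
    if "n \<ge> no" for n
  proof -
    have n: "n > 0" and osc: "\<And>l u. l < n \<Longrightarrow> u \<in> {grid s t n l..grid s t n (Suc l)}
        \<Longrightarrow> \<bar>w u - w (grid s t n l)\<bar> \<le> \<eta>"
      using no[OF that] by auto
    have "\<bar>w (grid s t n l) * integral {grid s t n l..grid s t n (Suc l)} d
        - integral {grid s t n l..grid s t n (Suc l)} (\<lambda>u. w u * d u)\<bar>
       \<le> \<eta> * integral {grid s t n l..grid s t n (Suc l)} (\<lambda>u. \<bar>d u\<bar>)" if l: "l < n" for l
    proof -
      let ?c = "{grid s t n l..grid s t n (Suc l)}"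
      note sub = integrable_on_subinterval[OF _ grid_cells_subset[OF st l]]
      have "w (grid s t n l) * integral ?c d - integral ?c (\<lambda>u. w u * d u)
          = integral ?c (\<lambda>u. w (grid s t n l) * d u - w u * d u)"
        using sub[OF di] sub[OF wdi]
        by (simp add: Henstock_Kurzweil_Integration.integral_diff integrable_on_mult_right)
      also have "\<bar>\<dots>\<bar> \<le> integral ?c (\<lambda>u. \<eta> * \<bar>d u\<bar>)"
        unfolding real_norm_def[symmetric]
      proof (rule integral_norm_bound_integral)
        show "(\<lambda>u. w (grid s t n l) * d u - w u * d u) integrable_on ?c"
          using sub[OF di] sub[OF wdi]
          by (intro Henstock_Kurzweil_Integration.integrable_diff integrable_on_mult_right)
        show "(\<lambda>u. \<eta> * norm (d u)) integrable_on ?c"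
          using sub[OF dn] by (auto intro: integrable_on_mult_right)
        fix u assume "u \<in> ?c"
        hence "\<bar>w (grid s t n l) - w u\<bar> * \<bar>d u\<bar> \<le> \<eta> * \<bar>d u\<bar>"
          using osc[OF l] by (intro mult_right_mono) (auto simp: abs_minus_commute)
        thus "norm (w (grid s t n l) * d u - w u * d u) \<le> \<eta> * norm (d u)"
          by (simp add: abs_mult flip: left_diff_distrib)
      qed
      finally show ?thesis by simp
    qed
    hence "(\<Sum>l<n. \<bar>w (grid s t n l) * integral {grid s t n l..grid s t n (Suc l)} d
        - integral {grid s t n l..grid s t n (Suc l)} (\<lambda>u. w u * d u)\<bar>)
       \<le> (\<Sum>l<n. \<eta> * integral {grid s t n l..grid s t n (Suc l)} (\<lambda>u. \<bar>d u\<bar>))" by (intro sum_mono) auto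
    also have "\<dots> = \<eta> * K" unfolding K_def integral_grid_sum[OF dn st n, symmetric]
      by (simp add: sum_distrib_left)
    finally have "\<bar>\<Sum>l<n. w (grid s t n l) * integral {grid s t n l..grid s t n (Suc l)} d
        - integral {grid s t n l..grid s t n (Suc l)} (\<lambda>u. w u * d u)\<bar> \<le> \<eta> * K"
      by (rule order_trans[OF sum_abs])
    thus ?thesis using \<eta>K unfolding integral_grid_sum[OF wdi st n, symmetric] by (simp add: sum_subtractf)
  qed
  thus "\<exists>no. \<forall>n\<ge>no. norm ((\<Sum>l<n. w (grid s t n l) * integral {grid s t n l..grid s t n (Suc l)} d)
      - integral {s..t} (\<lambda>u. w u * d u)) < e"
    by blast
qed

text \<open>Increments of a continuous function against those of a function of bounded variation sum
  to 0 in the limit. In the quadratic variation this removes the cross term and the square of the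
  drift.\<close>

lemma small_times_variation:
  fixes z d :: "real \<Rightarrow> real" and c :: "nat \<Rightarrow> nat \<Rightarrow> real"
  assumes z: "continuous_on {s..t} z" and d: "d absolutely_integrable_on {s..t}" and st: "s \<le> t"
    and c: "\<And>n l. l < n \<Longrightarrow> \<bar>c n l\<bar> \<le> 1"
  shows "(\<lambda>n. \<Sum>l<n. c n l * (z (grid s t n (Suc l)) - z (grid s t n l)) * integral
      {grid s t n l..grid s t n (Suc l)} d) \<longlonglongrightarrow> 0"
proof (rule LIMSEQ_I)
  fix e :: real assume e: "e > 0"
  have di: "d integrable_on {s..t}" and dn: "(\<lambda>u. \<bar>d u\<bar>) integrable_on {s..t}"
    using d by (auto simp: absolutely_integrable_on_def)
  define K where "K = integral {s..t} (\<lambda>u. \<bar>d u\<bar>)"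
  have K: "K \<ge> 0" unfolding K_def by (rule integral_nonneg[OF dn]) simp
  define \<eta> where "\<eta> = e / (2 * (K + 1))"
  have \<eta>: "\<eta> > 0" using e K by (simp add: \<eta>_def)
  have \<eta>K: "\<eta> * K < e" using e K by (simp add: \<eta>_def field_simps) (simp add: add_nonneg_pos)
  obtain no where no: "\<And>n. n \<ge> no \<Longrightarrow> n > 0
      \<and> (\<forall>l<n. \<forall>u\<in>{grid s t n l..grid s t n (Suc l)}. \<bar>z u - z (grid s t n l)\<bar> \<le> \<eta>)"
    using eventually_grid_oscillation[OF z st \<eta>] by (auto simp: eventually_sequentially)
  have "norm ((\<Sum>l<n. c n l * (z (grid s t n (Suc l)) - z (grid s t n l)) * integral
      {grid s t n l..grid s t n (Suc l)} d) - 0) < e"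
    if "n \<ge> no" for n
  proof -
    have n: "n > 0" using no[OF that] by auto
    have "\<bar>c n l * (z (grid s t n (Suc l)) - z (grid s t n l)) * integral {grid s t n l..grid s t n (Suc l)}
        d\<bar>
       \<le> \<eta> * integral {grid s t n l..grid s t n (Suc l)} (\<lambda>u. \<bar>d u\<bar>)" if l: "l < n" for l
    proof -
      let ?c = "{grid s t n l..grid s t n (Suc l)}"
      note sub = integrable_on_subinterval[OF _ grid_cells_subset[OF st l]]
      have "\<bar>integral ?c d\<bar> \<le> integral ?c (\<lambda>u. \<bar>d u\<bar>)"
        using integral_norm_bound_integral[OF sub[OF di] sub[OF dn]] by simp
      moreover have "\<bar>z (grid s t n (Suc l)) - z (grid s t n l)\<bar> \<le> \<eta>"
        using no[OF \<open>n \<ge> no\<close>] l grid_le[OF st, of l "Suc l" n] by auto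
      hence "\<bar>c n l\<bar> * \<bar>z (grid s t n (Suc l)) - z (grid s t n l)\<bar> \<le> 1 * \<eta>"
        by (intro mult_mono c[OF l]) auto
      ultimately have "(\<bar>c n l\<bar> * \<bar>z (grid s t n (Suc l)) - z (grid s t n l)\<bar>) * \<bar>integral ?c d\<bar>
          \<le> (1 * \<eta>) * integral ?c (\<lambda>u. \<bar>d u\<bar>)"
        using \<eta> by (rule_tac mult_mono) simp_all
      thus ?thesis by (simp add: abs_mult)
    qed
    hence "(\<Sum>l<n. \<bar>c n l * (z (grid s t n (Suc l)) - z (grid s t n l)) * integral
        {grid s t n l..grid s t n (Suc l)} d\<bar>)
       \<le> (\<Sum>l<n. \<eta> * integral {grid s t n l..grid s t n (Suc l)} (\<lambda>u. \<bar>d u\<bar>))" by (intro sum_mono) auto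
    also have "\<dots> = \<eta> * K" unfolding K_def integral_grid_sum[OF dn st n, symmetric]
      by (simp add: sum_distrib_left)
    finally show ?thesis using \<eta>K order_trans[OF sum_abs] by fastforce
  qed
  thus "\<exists>no. \<forall>n\<ge>no. norm ((\<Sum>l<n. c n l * (z (grid s t n (Suc l)) - z (grid s t n l)) * integral
      {grid s t n l..grid s t n (Suc l)} d) - 0) < e"
    by blast
qed

text \<open>Here the semimartingale is x = (martingale) + (integral of d), v is the density of its quadratic
  variation, and X n l is the increment of the martingale part over the l-th cell.\<close>

lemma discrete_ito_power:
  fixes x d v :: "real \<Rightarrow> real" and r :: "nat \<Rightarrow> nat"
  assumes x: "continuous_on {s..t} x" and x01: "\<And>u. u \<in> {s..t} \<Longrightarrow> x u \<in> {0..1}"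
    and d: "d absolutely_integrable_on {s..t}" and v: "continuous_on {s..t} v" and st: "s \<le> t"
    and r: "strict_mono r"
    and X: "\<And>n l. X n l = x (grid s t n (Suc l)) - x (grid s t n l)
        - integral {grid s t n l..grid s t n (Suc l)} d"
    and Q: "\<And>p. p \<in> {0, k - 2}
        \<Longrightarrow> (\<lambda>n. \<Sum>l<r n. x (grid s t (r n) l) ^ p * ((X (r n) l)\<^sup>2 - integral {grid s t (r n) l..grid s t (r
            n) (Suc l)} v)) \<longlonglongrightarrow> 0"
  shows "(\<lambda>n. \<Sum>l<r n. real k * x (grid s t (r n) l) ^ (k - 1) * X (r n) l) \<longlonglongrightarrow>
     x t ^ k - x s ^ k - integral {s..t} (\<lambda>u. real k * x u ^ (k - 1) * d u) - integral {s..t}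
         (\<lambda>u. real k * (real k - 1) / 2 * x u ^ (k - 2) * v u)"
proof -
  let ?g = "grid s t"
  define \<Delta> where "\<Delta> n l = x (?g n (Suc l)) - x (?g n l)" for n l
  define \<delta> where "\<delta> n l = integral {?g n l..?g n (Suc l)} d" for n l
  have di: "d integrable_on {s..t}" using d by (simp add: absolutely_integrable_on_def)
  have va: "v absolutely_integrable_on {s..t}"
    using absolutely_integrable_continuous[of s t v] v by (simp add: cbox_interval)
  have pw: "\<bar>x (?g n l) ^ p\<bar> \<le> 1" if "l < n" for n l p
    using x01[OF grid_in[OF st, of l n]] that by (simp add: power_abs power_le_one)
  \<comment> \<open>The limits of pathwise analysis hold along all grids. Only \<open>Q\<close>,
    which comes from mean-square convergence, is tied to the subsequence \<open>r\<close>.\<close>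
  have conv: "(\<lambda>n. f (r n)) \<longlonglongrightarrow> L" if "f \<longlonglongrightarrow> L" for f and L :: real
    using LIMSEQ_subseq_LIMSEQ[OF that r] by (simp add: o_def)
  define z where "z u = integral {s..u} d" for u
  have zc: "continuous_on {s..t} z" unfolding z_def by (rule indefinite_integral_continuous_1[OF di])
  have z\<delta>: "z (?g n (Suc l)) - z (?g n l) = \<delta> n l" if "l < n" for n l
  proof -
    have "integral {s..?g n l} d + integral {?g n l..?g n (Suc l)} d = integral {s..?g n (Suc l)} d"
    proof (rule Henstock_Kurzweil_Integration.integral_combine)
      show "s \<le> grid s t n l" "grid s t n l \<le> grid s t n (Suc l)"
        using grid_in[OF st, of l n] that grid_le[OF st, of l "Suc l" n] by auto
      show "d integrable_on {s..grid s t n (Suc l)}"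
        by (rule integrable_on_subinterval[OF di]) (use grid_in[OF st, of "Suc l" n] that in auto)
    qed
    thus ?thesis by (simp add: z_def \<delta>_def)
  qed
  \<comment> \<open>Since X = \<Delta> - \<delta>, one has \<Delta>^2 = X^2 + 2 \<Delta> \<delta> -
    \<delta>^2, and the last two sums vanish in the limit. The exponent 0 gives the quadratic
    variation that controls the remainder, the exponent k - 2 gives the second-order term.\<close>
  have qv: "(\<lambda>n. \<Sum>l<r n. x (?g (r n) l) ^ p * (\<Delta> (r n) l)\<^sup>2) \<longlonglongrightarrow> integral {s..t} (\<lambda>u. x u ^ p * v u)"
    if p: "p \<in> {0, k - 2}" for p
  proof -
    have 1: "(\<lambda>n. \<Sum>l<n. x (?g n l) ^ p * (x (?g n (Suc l)) - x (?g n l)) * \<delta> n l) \<longlonglongrightarrow> 0"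
      unfolding \<delta>_def using small_times_variation[OF x d st, of "\<lambda>n l. x (?g n l) ^ p"] pw by simp
    have "(\<lambda>n. \<Sum>l<n. x (?g n l) ^ p * (z (?g n (Suc l)) - z (?g n l)) * \<delta> n l) \<longlonglongrightarrow> 0"
      unfolding \<delta>_def using small_times_variation[OF zc d st, of "\<lambda>n l. x (?g n l) ^ p"] pw by simp
    moreover have "(\<Sum>l<n. x (?g n l) ^ p * (z (?g n (Suc l)) - z (?g n l)) * \<delta> n l)
        = (\<Sum>l<n. x (?g n l) ^ p * \<delta> n l * \<delta> n l)" for n
      by (intro sum.cong refl) (simp add: z\<delta>)
    ultimately have 2: "(\<lambda>n. \<Sum>l<n. x (?g n l) ^ p * \<delta> n l * \<delta> n l) \<longlonglongrightarrow> 0" by simp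
    have 3: "(\<lambda>n. \<Sum>l<n. x (?g n l) ^ p * integral {?g n l..?g n (Suc l)} v)
        \<longlonglongrightarrow> integral {s..t} (\<lambda>u. x u ^ p * v u)"
      by (rule riemann_stieltjes_grid[OF _ va st]) (intro continuous_intros x)
    have "(\<lambda>n. (\<Sum>l<r n. x (?g (r n) l) ^ p * ((X (r n) l)\<^sup>2 - integral {?g (r n) l..?g (r n) (Suc l)} v))
       + (\<Sum>l<r n. x (?g (r n) l) ^ p * integral {?g (r n) l..?g (r n) (Suc l)} v)
       + 2 * (\<Sum>l<r n. x (?g (r n) l) ^ p * (x (?g (r n) (Suc l)) - x (?g (r n) l)) * \<delta> (r n) l)
       - (\<Sum>l<r n. x (?g (r n) l) ^ p * \<delta> (r n) l * \<delta> (r n) l)) \<longlonglongrightarrow> 0 + integral {s..t} (\<lambda>u. x u ^ p * v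
           u) + 2 * 0 - 0"
      by (intro tendsto_intros Q[OF p] conv[OF 1] conv[OF 2] conv[OF 3])
    moreover have "(\<Sum>l<n. x (?g n l) ^ p * ((X n l)\<^sup>2 - integral {?g n l..?g n (Suc l)} v))
       + (\<Sum>l<n. x (?g n l) ^ p * integral {?g n l..?g n (Suc l)} v)
       + 2 * (\<Sum>l<n. x (?g n l) ^ p * (x (?g n (Suc l)) - x (?g n l)) * \<delta> n l)
       - (\<Sum>l<n. x (?g n l) ^ p * \<delta> n l * \<delta> n l) = (\<Sum>l<n. x (?g n l) ^ p * (\<Delta> n l)\<^sup>2)" for n
      unfolding sum_distrib_left sum.distrib[symmetric] sum_subtractf[symmetric]
      by (intro sum.cong refl) (simp add: X \<Delta>_def \<delta>_def power2_eq_square algebra_simps)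
    ultimately show ?thesis by simp
  qed
  \<comment> \<open>The third-order remainder is bounded by k^3 times the largest increment times
    the sum of squared increments; the former tends to 0 and the latter stays bounded.\<close>
  define R where "R n l = x (?g n (Suc l)) ^ k - x (?g n l) ^ k - real k * x (?g n l) ^ (k - 1) * \<Delta> n l
     - real k * (real k - 1) / 2 * x (?g n l) ^ (k - 2) * (\<Delta> n l)\<^sup>2" for n l
  have Rb: "\<bar>R n l\<bar> \<le> real k ^ 3 * \<bar>\<Delta> n l\<bar> ^ 3" if "l < n" for n l
    unfolding R_def \<Delta>_def
    by (rule taylor_power_remainder)
        (use that x01[OF grid_in[OF st, of l n]] x01[OF grid_in[OF st, of "Suc l" n]] in auto)
  have R0: "(\<lambda>n. \<Sum>l<r n. R (r n) l) \<longlonglongrightarrow> 0"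
  proof (rule LIMSEQ_I)
    fix e :: real assume e: "e > 0"
    define V where "V = integral {s..t} (\<lambda>u. x u ^ 0 * v u)"
    have qv0: "(\<lambda>n. \<Sum>l<r n. (\<Delta> (r n) l)\<^sup>2) \<longlonglongrightarrow> V" using qv[of 0] by (simp add: V_def)
    have V0: "V \<ge> 0" by (rule LIMSEQ_le_const[OF qv0]) (intro exI allI impI sum_nonneg zero_le_power2)
    have ev1: "\<forall>\<^sub>F n in sequentially. (\<Sum>l<r n. (\<Delta> (r n) l)\<^sup>2) < V + 1"
      using order_tendstoD(2)[OF qv0, of "V + 1"] by simp
    define K where "K = real k ^ 3 * (V + 1)"
    have K: "K \<ge> 0" using V0 by (simp add: K_def)
    define \<eta> where "\<eta> = e / (2 * (K + 1))"
    have \<eta>: "\<eta> > 0" using e K by (simp add: \<eta>_def)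
    have \<eta>K: "\<eta> * K < e" using e K by (simp add: \<eta>_def field_simps) (simp add: add_nonneg_pos)
    have "\<forall>\<^sub>F n in sequentially. r n > 0
        \<and> (\<forall>l<r n. \<forall>u\<in>{?g (r n) l..?g (r n) (Suc l)}. \<bar>x u - x (?g (r n) l)\<bar> \<le> \<eta>)"
      using eventually_subseq[OF r eventually_grid_oscillation[OF x st \<eta>]] .
    with ev1 have "\<forall>\<^sub>F n in sequentially. norm ((\<Sum>l<r n. R (r n) l) - 0) < e"
    proof eventually_elim
      case (elim n)
      have "\<bar>R (r n) l\<bar> \<le> real k ^ 3 * \<eta> * (\<Delta> (r n) l)\<^sup>2" if l: "l < r n" for l
      proof -
        have "\<bar>\<Delta> (r n) l\<bar> \<le> \<eta>"
          using elim(2) l grid_le[OF st, of l "Suc l" "r n"] unfolding \<Delta>_def by auto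
        hence "\<bar>\<Delta> (r n) l\<bar> * (\<Delta> (r n) l)\<^sup>2 \<le> \<eta> * (\<Delta> (r n) l)\<^sup>2" by (intro mult_right_mono) auto
        hence "\<bar>\<Delta> (r n) l\<bar> ^ 3 \<le> \<eta> * (\<Delta> (r n) l)\<^sup>2" by (simp add: power3_eq_cube power2_eq_square)
        hence "real k ^ 3 * \<bar>\<Delta> (r n) l\<bar> ^ 3 \<le> real k ^ 3 * (\<eta> * (\<Delta> (r n) l)\<^sup>2)"
          by (intro mult_left_mono) auto
        with Rb[OF l] show ?thesis by (simp add: mult.assoc)
      qed
      hence "(\<Sum>l<r n. \<bar>R (r n) l\<bar>) \<le> (\<Sum>l<r n. real k ^ 3 * \<eta> * (\<Delta> (r n) l)\<^sup>2)" by (intro sum_mono) auto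
      also have "\<dots> = real k ^ 3 * \<eta> * (\<Sum>l<r n. (\<Delta> (r n) l)\<^sup>2)" by (simp add: sum_distrib_left)
      also have "\<dots> \<le> real k ^ 3 * \<eta> * (V + 1)" using elim(1) \<eta> by (intro mult_left_mono) auto
      also have "\<dots> = \<eta> * K" by (simp add: K_def)
      finally show ?case using \<eta>K order_trans[OF sum_abs] by fastforce
    qed
    thus "\<exists>no. \<forall>n\<ge>no. norm ((\<Sum>l<r n. R (r n) l) - 0) < e" by (simp add: eventually_sequentially)
  qed
  have T1: "(\<lambda>n. \<Sum>l<n. (real k * x (?g n l) ^ (k - 1)) * \<delta> n l)
      \<longlonglongrightarrow> integral {s..t} (\<lambda>u. (real k * x u ^ (k - 1)) * d u)"
    unfolding \<delta>_def by (rule riemann_stieltjes_grid[OF _ d st]) (intro continuous_intros x)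
  have T2: "(\<lambda>n. real k * (real k - 1) / 2 * (\<Sum>l<r n. x (?g (r n) l) ^ (k - 2) * (\<Delta> (r n) l)\<^sup>2)) \<longlonglongrightarrow>
     integral {s..t} (\<lambda>u. real k * (real k - 1) / 2 * x u ^ (k - 2) * v u)"
  proof -
    have "(\<lambda>n. real k * (real k - 1) / 2 * (\<Sum>l<r n. x (?g (r n) l) ^ (k - 2) * (\<Delta> (r n) l)\<^sup>2)) \<longlonglongrightarrow>
       real k * (real k - 1) / 2 * integral {s..t} (\<lambda>u. x u ^ (k - 2) * v u)"
      by (intro tendsto_intros qv) simp
    also have "real k * (real k - 1) / 2 * integral {s..t} (\<lambda>u. x u ^ (k - 2) * v u)
        = integral {s..t} (\<lambda>u. real k * (real k - 1) / 2 * (x u ^ (k - 2) * v u))"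
      by (rule integral_mult_right[symmetric])
    finally show ?thesis by (simp only: mult.assoc)
  qed
  have lim: "(\<lambda>n. (x t ^ k - x s ^ k) - (\<Sum>l<r n. (real k * x (?g (r n) l) ^ (k - 1)) * \<delta> (r n) l)
      - real k * (real k - 1) / 2 * (\<Sum>l<r n. x (?g (r n) l) ^ (k - 2) * (\<Delta> (r n) l)\<^sup>2) -
          (\<Sum>l<r n. R (r n) l))
     \<longlonglongrightarrow> (x t ^ k - x s ^ k) - integral {s..t} (\<lambda>u. (real k * x u ^ (k - 1)) * d u)
      - integral {s..t} (\<lambda>u. real k * (real k - 1) / 2 * x u ^ (k - 2) * v u) - 0"
    by (intro tendsto_intros conv[OF T1] T2 R0)
  \<comment> \<open>The increments of x^k telescope; solving the Taylor expansion for the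
    first-order martingale term leaves the stated limit.\<close>
  have eq: "(\<Sum>l<n. real k * x (?g n l) ^ (k - 1) * X n l)
      = (x t ^ k - x s ^ k) - (\<Sum>l<n. (real k * x (?g n l) ^ (k - 1)) * \<delta> n l)
      - real k * (real k - 1) / 2 * (\<Sum>l<n. x (?g n l) ^ (k - 2) * (\<Delta> n l)\<^sup>2) -
          (\<Sum>l<n. R n l)" if n: "n > 0" for n
  proof -
    have "x t ^ k - x s ^ k = (\<Sum>l<n. x (?g n (Suc l)) ^ k - x (?g n l) ^ k)"
      using sum_lessThan_telescope[of "\<lambda>l. x (?g n l) ^ k" n] grid_n[OF n] by simp
    thus ?thesis
      by (simp only: sum_distrib_left sum_subtractf[symmetric])
          (intro sum.cong refl, simp add: R_def X \<Delta>_def \<delta>_def algebra_simps)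
  qed
  have "\<forall>\<^sub>F n in sequentially. r n > 0"
    using eventually_subseq[OF r eventually_gt_at_top[of 0]] .
  hence "\<forall>\<^sub>F n in sequentially. (x t ^ k - x s ^ k)
      - (\<Sum>l<r n. (real k * x (?g (r n) l) ^ (k - 1)) * \<delta> (r n) l)
      - real k * (real k - 1) / 2 * (\<Sum>l<r n. x (?g (r n) l) ^ (k - 2) * (\<Delta> (r n) l)\<^sup>2) - (\<Sum>l<r n. R (r n) l)
      = (\<Sum>l<r n. real k * x (?g (r n) l) ^ (k - 1) * X (r n) l)"
    by eventually_elim (simp only: eq)
  from Lim_transform_eventually[OF lim this] show ?thesis by simp
qed

section \<open>The drift of the power sums\<close>

definition power_sum :: "nat \<Rightarrow> (nat \<Rightarrow> real) \<Rightarrow> nat \<Rightarrow> real" where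
  "power_sum N x k = (\<Sum>i<N. x i ^ k) / real N"

text \<open>The four lines are the linear part of the drift; the symmetrized repulsion summed over
  all pairs, the diagonal included; the correction that takes the diagonal out again; and the
  second-order term of the Ito formula.\<close>

definition power_sum_drift :: "real \<Rightarrow> real \<Rightarrow> real \<Rightarrow> nat \<Rightarrow> nat \<Rightarrow> (nat \<Rightarrow> real) \<Rightarrow> real" where
  "power_sum_drift a b \<beta> N k S = real k * ((a + 1) * S (k - 1) - (a + b + 2) * S k)
     + \<beta> * real N / 2 * real k * ((\<Sum>p<k. S p * S (k - 1 - p)) - (\<Sum>p\<le>k. S p * S (k - p)))
     + \<beta> / 2 * real k * ((real k + 1) * S k - real k * S (k - 1))
     + real k * (real k - 1) * (S (k - 1) - S k)"

lemma sum_symmetrize: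
  fixes f :: "nat \<Rightarrow> nat \<Rightarrow> real"
  shows "(\<Sum>i<N. \<Sum>j\<in>{..<N} - {i}. f i j) = (\<Sum>i<N. \<Sum>j\<in>{..<N} - {i}. (f i j + f j i) / 2)"
proof -
  have e: "(\<Sum>i<N. \<Sum>j\<in>{..<N} - {i}. g i j) = (\<Sum>i<N. \<Sum>j<N. if i = j then 0 else g i j)"
      for g :: "nat \<Rightarrow> nat \<Rightarrow> real"
  proof (rule sum.cong)
    fix i assume i: "i \<in> {..<N}"
    have "(\<Sum>j<N. if i = j then 0 else g i j) = (\<Sum>j\<in>{..<N} - {i}. if i = j then 0 else g i j)"
      by (rule sum.mono_neutral_right) auto
    also have "\<dots> = (\<Sum>j\<in>{..<N} - {i}. g i j)" by (intro sum.cong) auto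
    finally show "(\<Sum>j\<in>{..<N} - {i}. g i j) = (\<Sum>j<N. if i = j then 0 else g i j)" by simp
  qed simp
  have sw: "(\<Sum>i<N. \<Sum>j\<in>{..<N} - {i}. f j i) = (\<Sum>i<N. \<Sum>j\<in>{..<N} - {i}. f i j)"
    unfolding e by (subst sum.swap) (auto intro!: sum.cong)
  have "(\<Sum>i<N. \<Sum>j\<in>{..<N} - {i}. (f i j + f j i) / 2)
     = ((\<Sum>i<N. \<Sum>j\<in>{..<N} - {i}. f i j) + (\<Sum>i<N. \<Sum>j\<in>{..<N} - {i}. f j i)) / 2"
    by (simp add: sum.distrib flip: sum_divide_distrib)
  thus ?thesis using sw by simp
qed

text \<open>The sum over all pairs factors into power sums. On the diagonal each of the k summands
  is x^(k - 1), which gives the subtracted term.\<close>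

lemma sum_offdiag_powers:
  fixes x :: "nat \<Rightarrow> real"
  assumes "N > 0" "k \<ge> 1"
  shows "(\<Sum>i<N. \<Sum>j\<in>{..<N} - {i}. \<Sum>p<k. x i ^ p * x j ^ (k - 1 - p))
     = (real N)\<^sup>2 * (\<Sum>p<k. power_sum N x p * power_sum N x (k - 1 - p)) - real N * real k * power_sum N x
         (k - 1)"
proof -
  have "(\<Sum>i<N. \<Sum>j\<in>{..<N} - {i}. \<Sum>p<k. x i ^ p * x j ^ (k - 1 - p))
     = (\<Sum>i<N. (\<Sum>j<N. \<Sum>p<k. x i ^ p * x j ^ (k - 1 - p)) - (\<Sum>p<k. x i ^ p * x i ^ (k - 1 - p)))"
    by (intro sum.cong refl) (simp add: sum_diff1)
  also have "\<dots> = (\<Sum>i<N. \<Sum>j<N. \<Sum>p<k. x i ^ p * x j ^ (k - 1 - p))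
      - (\<Sum>i<N. \<Sum>p<k. x i ^ p * x i ^ (k - 1 - p))"
    by (rule sum_subtractf)
  also have "(\<Sum>i<N. \<Sum>p<k. x i ^ p * x i ^ (k - 1 - p)) = (\<Sum>i<N. real k * x i ^ (k - 1))"
  proof (intro sum.cong refl)
    fix i
    have "(\<Sum>p<k. x i ^ p * x i ^ (k - 1 - p)) = (\<Sum>p<k. x i ^ (k - 1))"
      by (intro sum.cong refl) (auto simp flip: power_add)
    thus "(\<Sum>p<k. x i ^ p * x i ^ (k - 1 - p)) = real k * x i ^ (k - 1)" by simp
  qed
  also have "\<dots> = real N * real k * power_sum N x (k - 1)"
    using assms by (simp add: power_sum_def flip: sum_distrib_left)
  also have "(\<Sum>i<N. \<Sum>j<N. \<Sum>p<k. x i ^ p * x j ^ (k - 1 - p))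
      = (\<Sum>i<N. \<Sum>p<k. \<Sum>j<N. x i ^ p * x j ^ (k - 1 - p))"
    by (rule sum.cong, rule refl, rule sum.swap)
  also have "\<dots> = (\<Sum>p<k. \<Sum>i<N. \<Sum>j<N. x i ^ p * x j ^ (k - 1 - p))" by (rule sum.swap)
  also have "\<dots> = (\<Sum>p<k. (real N)\<^sup>2 * (power_sum N x p * power_sum N x (k - 1 - p)))"
    using assms by (intro sum.cong refl) (simp add: power_sum_def sum_product power2_eq_square)
  finally show ?thesis by (simp add: sum_distrib_left)
qed

lemma power_divided_difference:
  fixes x y :: real
  assumes "x \<noteq> y" "k \<ge> 1"
  shows "(x ^ k - y ^ k) / (x - y) = (\<Sum>p<k. x ^ p * y ^ (k - 1 - p))"
proof -
  obtain n where k: "k = Suc n" using assms(2) by (cases k) auto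
  have "x ^ Suc n - y ^ Suc n = (x - y) * (\<Sum>p<Suc n. x ^ p * y ^ (n - p))"
    by (rule diff_power_eq_sum)
  thus ?thesis using assms(1) by (simp add: k)
qed

text \<open>The singular terms cancel in pairs: symmetrization in i and j turns the quotients into
  divided differences, which are polynomials. Distinct positions are required, since a quotient at a
  collision has the default value 0 and not that of the divided difference.\<close>

lemma jacobi_drift_power_sum:
  fixes x :: "nat \<Rightarrow> real"
  assumes N: "N > 0" and k: "k \<ge> 1" and inj: "inj_on x {..<N}"
  shows "(\<Sum>i<N. real k * x i ^ (k - 1) * jacobi_drift a b \<beta> N x i
      + real k * (real k - 1) / 2 * x i ^ (k - 2) * (2 * x i * (1 - x i))) / real N
     = power_sum_drift a b \<beta> N k (power_sum N x)"
proof -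
  have ne: "x i \<noteq> x j" if "i < N" "j \<in> {..<N} - {i}" for i j
    using inj that by (auto simp: inj_on_def)
  obtain n where kn: "k = Suc n" using k by (cases k) auto
  define D where "D i j = x i ^ k * (1 - x i) / (x i - x j)" for i j
  \<comment> \<open>Exchanging i and j changes the sign of the denominator, so the half-sum is half
    the divided difference of x^k - x^(k + 1).\<close>
  have Dsym: "(D i j + D j i) / 2
      = ((\<Sum>p<k. x i ^ p * x j ^ (k - 1 - p)) - (\<Sum>p<Suc k. x i ^ p * x j ^ (Suc k - 1 - p))) / 2"
    if "i < N" "j \<in> {..<N} - {i}" for i j
  proof -
    have n0: "x i - x j \<noteq> 0" "x j - x i \<noteq> 0" using ne[OF that] by auto
    have "D j i = - (x j ^ k * (1 - x j) / (x i - x j))"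
      unfolding D_def using n0 by (simp add: field_simps)
    hence "D i j + D j i = (x i ^ k - x j ^ k) / (x i - x j) - (x i ^ Suc k - x j ^ Suc k) / (x i - x j)"
      unfolding D_def by (simp add: algebra_simps flip: diff_divide_distrib add_divide_distrib)
    thus ?thesis
      using power_divided_difference[OF ne[OF that] k] power_divided_difference[OF ne[OF that], of "Suc k"]
      by simp
  qed
  have "(\<Sum>i<N. \<Sum>j\<in>{..<N} - {i}. D i j) = (\<Sum>i<N. \<Sum>j\<in>{..<N} - {i}. (D i j + D j i) / 2)"
    by (rule sum_symmetrize)
  also have "\<dots> = (\<Sum>i<N. \<Sum>j\<in>{..<N}
      - {i}. ((\<Sum>p<k. x i ^ p * x j ^ (k - 1 - p)) - (\<Sum>p<Suc k. x i ^ p * x j ^ (Suc k - 1 - p))) / 2)"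
    by (intro sum.cong refl) (use Dsym in auto)
  also have "\<dots> = ((\<Sum>i<N. \<Sum>j\<in>{..<N} - {i}. \<Sum>p<k. x i ^ p * x j ^ (k - 1 - p))
      - (\<Sum>i<N. \<Sum>j\<in>{..<N} - {i}. \<Sum>p<Suc k. x i ^ p * x j ^ (Suc k - 1 - p))) / 2"
    by (simp only: sum_subtractf sum_divide_distrib[symmetric])
  also have "\<dots> = ((real N)\<^sup>2 * ((\<Sum>p<k. power_sum N x p * power_sum N x (k - 1 - p))
      - (\<Sum>p<Suc k. power_sum N x p * power_sum N x (k - p)))
      - real N * (real k * power_sum N x (k - 1) - (real k + 1) * power_sum N x k)) / 2"
  proof -
    have "Suc k \<ge> 1" by simp
    from sum_offdiag_powers[OF N this, of x]
    have e: "(\<Sum>i<N. \<Sum>j\<in>{..<N} - {i}. \<Sum>p<Suc k. x i ^ p * x j ^ (Suc k - 1 - p))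
       = (real N)\<^sup>2 * (\<Sum>p<Suc k. power_sum N x p * power_sum N x (k - p)) - real N * real
           (Suc k) * power_sum N x k"
      by (simp only: diff_Suc_1)
    show ?thesis unfolding e sum_offdiag_powers[OF N k] by (simp add: algebra_simps del: sum.lessThan_Suc)
  qed
  finally have DD: "(\<Sum>i<N. \<Sum>j\<in>{..<N} - {i}. D i j) =
     ((real N)\<^sup>2 * ((\<Sum>p<k. power_sum N x p * power_sum N x (k - 1 - p)) - (\<Sum>p\<le>k. power_sum N x p * power_sum
         N x (k - p)))
      - real N * (real k * power_sum N x (k - 1) - (real k + 1) * power_sum N x k)) / 2"
    by (simp only: lessThan_Suc_atMost)
  have per_i: "real k * x i ^ (k - 1) * jacobi_drift a b \<beta> N x i
      + real k * (real k - 1) / 2 * x i ^ (k - 2) * (2 * x i * (1 - x i))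
     = real k * ((a + 1) * x i ^ (k - 1) - (a + b + 2) * x i ^ k) + real k * \<beta> * (\<Sum>j\<in>{..<N} - {i}. D i j)
       + real k * (real k - 1) * (x i ^ (k - 1) - x i ^ k)" for i
  proof -
    have xk: "x i ^ (k - 1) * x i = x i ^ k" by (simp add: kn)
    have xk2: "real k * (real k - 1) * (x i ^ (k - 2) * x i) = real k * (real k - 1) * x i ^ (k - 1)"
      by (cases n) (auto simp: kn)
    define s where "s = \<beta> / 2 * (\<Sum>j\<in>{..<N} - {i}. 2 * x i * (1 - x i) / (x i - x j))"
    have sD: "x i ^ (k - 1) * s = \<beta> * (\<Sum>j\<in>{..<N} - {i}. D i j)"
      unfolding D_def s_def sum_distrib_left xk[symmetric] by (intro sum.cong refl) simp
    have 1: "real k * x i ^ (k - 1) * jacobi_drift a b \<beta> N x i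
        = real k * ((a + 1) * x i ^ (k - 1) - (a + b + 2) * (x i ^ (k - 1) * x i))
        + real k * (\<beta> * (\<Sum>j\<in>{..<N} - {i}. D i j))"
      unfolding jacobi_drift_def s_def[symmetric] sD[symmetric] by (simp add: algebra_simps)
    have "c / 2 * y * (2 * z * (1 - z)) = (c * (y * z)) * (1 - z)" for c y z :: real
      by (simp add: field_simps)
    hence "real k * (real k - 1) / 2 * x i ^ (k - 2) * (2 * x i * (1 - x i))
        = (real k * (real k - 1) * (x i ^ (k - 2) * x i)) * (1 - x i)" .
    also have "\<dots> = real k * (real k - 1) * (x i ^ (k - 1) - x i ^ (k - 1) * x i)"
      unfolding xk2 by (simp add: algebra_simps)
    finally show ?thesis using 1 unfolding xk by (simp add: mult.assoc)
  qed
  have S: "(\<Sum>i<N. x i ^ p) = real N * power_sum N x p" for p using N by (simp add: power_sum_def)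
  have "(\<Sum>i<N. real k * x i ^ (k - 1) * jacobi_drift a b \<beta> N x i
      + real k * (real k - 1) / 2 * x i ^ (k - 2) * (2 * x i * (1 - x i)))
     = real k * ((a + 1) * (real N * power_sum N x (k - 1)) - (a + b + 2) * (real N * power_sum N x k))
       + real k * \<beta> * (\<Sum>i<N. \<Sum>j\<in>{..<N} - {i}. D i j) + real k * (real k - 1) *
           (real N * power_sum N x (k - 1) - real N * power_sum N x k)"
    unfolding per_i S[symmetric] by (simp only: sum.distrib sum_subtractf sum_distrib_left[symmetric])
  also have "\<dots> = real N * power_sum_drift a b \<beta> N k (power_sum N x)"
    unfolding DD power_sum_drift_def by (simp add: field_simps power2_eq_square)
  finally show ?thesis using N by simp
qed

section \<open>Martingale increments\<close>

text \<open>The integrand has to be jointly measurable only on the times in \<open>A\<close>;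
  \<open>K\<close> extends it from there, in applications by clamping the time.\<close>

lemma time_integral_measurable_set:
  fixes K :: "'w \<Rightarrow> real \<Rightarrow> real"
  assumes [measurable]: "(\<lambda>(\<omega>, s). K \<omega> s) \<in> borel_measurable (G \<Otimes>\<^sub>M borel)" "A \<in> sets borel"
    and eq: "\<And>\<omega> s. s \<in> A \<Longrightarrow> k \<omega> s = K \<omega> s"
  shows "(\<lambda>\<omega>. LBINT s:A. k \<omega> s) \<in> borel_measurable G"
proof -
  have "(\<lambda>\<omega>. \<integral>s. indicator A s * K \<omega> s \<partial>lborel) \<in> borel_measurable G"
    by measurable
  moreover have "(LBINT s:A. k \<omega> s) = (\<integral>s. indicator A s * K \<omega> s \<partial>lborel)" for \<omega>
    unfolding set_lebesgue_integral_def
    by (intro Bochner_Integration.integral_cong) (auto simp: indicator_def eq)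
  ultimately show ?thesis by simp
qed

context brownian_filtration
begin

text \<open>Martingale increments from time s to time t; the test functions Z replace conditional expectations.\<close>

definition md :: "real \<Rightarrow> real \<Rightarrow> ('w \<Rightarrow> real) \<Rightarrow> bool" where
  "md s t U \<longleftrightarrow> sq_integrable M U \<and> U \<in> borel_measurable (F t) \<and>
     (\<forall>Z K. Z \<in> borel_measurable (F s) \<longrightarrow> (\<forall>\<omega>\<in>space M. \<bar>Z \<omega>\<bar> \<le> K) \<longrightarrow> (\<integral>\<omega>. Z \<omega> * U \<omega> \<partial>M) = 0)"

text \<open>Mediates between bounds on the sample space and bounds on the whole type: outside the
  space the function is reset to 0.\<close>

lemma extend_bounded:
  fixes Z :: "'w \<Rightarrow> real"
  assumes Z: "Z \<in> borel_measurable (F s)" and b: "\<And>\<omega>. \<omega> \<in> space M \<Longrightarrow> \<bar>Z \<omega>\<bar> \<le> K"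
  shows "\<exists>Z'. Z' \<in> borel_measurable (F s) \<and> (\<forall>\<omega>. \<bar>Z' \<omega>\<bar> \<le> K) \<and> (\<forall>\<omega>\<in>space M. Z' \<omega> = Z \<omega>)"
proof (intro exI conjI)
  define Z' where "Z' \<omega> = (if \<omega> \<in> space M then Z \<omega> else 0)" for \<omega>
  show "Z' \<in> borel_measurable (F s)"
    using Z by (subst measurable_cong[where g = Z]) (auto simp: Z'_def space_F)
  obtain \<omega>0 where "\<omega>0 \<in> space M" using not_empty by blast
  hence "0 \<le> K" using b[of \<omega>0] by linarith
  thus "\<forall>\<omega>. \<bar>Z' \<omega>\<bar> \<le> K" using b by (auto simp: Z'_def)
  show "\<forall>\<omega>\<in>space M. Z' \<omega> = Z \<omega>" by (simp add: Z'_def)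
qed

lemma mdI:
  assumes "sq_integrable M U" "U \<in> borel_measurable (F t)"
    and z: "\<And>Z K. Z \<in> borel_measurable (F s) \<Longrightarrow> (\<And>\<omega>. \<bar>Z \<omega>\<bar> \<le> K) \<Longrightarrow> (\<integral>\<omega>. Z \<omega> * U \<omega> \<partial>M) = 0"
  shows "md s t U"
  unfolding md_def
proof (intro conjI allI impI assms(1,2))
  fix Z :: "'w \<Rightarrow> real" and K assume Z: "Z \<in> borel_measurable (F s)" and b: "\<forall>\<omega>\<in>space M. \<bar>Z \<omega>\<bar> \<le> K"
  have "\<exists>Z'. Z' \<in> borel_measurable (F s) \<and> (\<forall>\<omega>. \<bar>Z' \<omega>\<bar> \<le> K) \<and> (\<forall>\<omega>\<in>space M. Z' \<omega> = Z \<omega>)"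
    by (rule extend_bounded[OF Z]) (rule bspec[OF b])
  then obtain Z' where Z'_all: "Z' \<in> borel_measurable (F s) \<and> (\<forall>\<omega>. \<bar>Z' \<omega>\<bar> \<le> K) \<and> (\<forall>\<omega>\<in>space M. Z' \<omega> = Z \<omega>)"
    by (rule exE)
  have Z': "Z' \<in> borel_measurable (F s)" "\<And>\<omega>. \<bar>Z' \<omega>\<bar> \<le> K" "\<And>\<omega>. \<omega> \<in> space M \<Longrightarrow> Z' \<omega> = Z \<omega>"
    using Z'_all by simp_all
  have "(\<integral>\<omega>. Z \<omega> * U \<omega> \<partial>M) = (\<integral>\<omega>. Z' \<omega> * U \<omega> \<partial>M)"
    by (intro Bochner_Integration.integral_cong refl) (simp add: Z'(3))
  thus "(\<integral>\<omega>. Z \<omega> * U \<omega> \<partial>M) = 0" using z[OF Z'(1,2)] by simp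
qed

lemma mdD:
  assumes "md s t U"
  shows "sq_integrable M U" "U \<in> borel_measurable (F t)"
    "\<And>Z K. Z \<in> borel_measurable (F s) \<Longrightarrow> (\<And>\<omega>. \<omega> \<in> space M \<Longrightarrow> \<bar>Z \<omega>\<bar> \<le> K) \<Longrightarrow> (\<integral>\<omega>. Z \<omega> * U \<omega> \<partial>M) = 0"
proof -
  show "sq_integrable M U" "U \<in> borel_measurable (F t)" using assms unfolding md_def by simp_all
  fix Z :: "'w \<Rightarrow> real" and K
  assume Z: "Z \<in> borel_measurable (F s)" and b: "\<And>\<omega>. \<omega> \<in> space M \<Longrightarrow> \<bar>Z \<omega>\<bar> \<le> K"
  have "\<forall>Z K. Z \<in> borel_measurable (F s) \<longrightarrow> (\<forall>\<omega>\<in>space M. \<bar>Z \<omega>\<bar> \<le> K) \<longrightarrow> (\<integral>\<omega>. Z \<omega> * U \<omega> \<partial>M) = 0"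
    using assms unfolding md_def by simp
  thus "(\<integral>\<omega>. Z \<omega> * U \<omega> \<partial>M) = 0" using Z b by (elim allE impE) auto
qed

lemma md_bounded_mult:
  assumes U: "md s t U" and st: "0 \<le> s" "s \<le> t" and c: "c \<in> borel_measurable (F s)"
    and C: "\<And>\<omega>. \<omega> \<in> space M \<Longrightarrow> \<bar>c \<omega>\<bar> \<le> C"
  shows "md s t (\<lambda>\<omega>. c \<omega> * U \<omega>)"
proof (rule mdI)
  show "sq_integrable M (\<lambda>\<omega>. c \<omega> * U \<omega>)"
    by (rule sq_integrable_bounded_mult[OF mdD(1)[OF U] measurable_F_M[OF st(1) c] C])
  show "(\<lambda>\<omega>. c \<omega> * U \<omega>) \<in> borel_measurable (F t)"
    using measurable_F_mono[OF st(2) c] mdD(2)[OF U] by measurable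
  fix Z :: "'w \<Rightarrow> real" and K assume Z: "Z \<in> borel_measurable (F s)" and b: "\<And>\<omega>. \<bar>Z \<omega>\<bar> \<le> K"
  have "(\<integral>\<omega>. (Z \<omega> * c \<omega>) * U \<omega> \<partial>M) = 0"
  proof (rule mdD(3)[OF U])
    show "(\<lambda>\<omega>. Z \<omega> * c \<omega>) \<in> borel_measurable (F s)" using Z c by measurable
    show "\<bar>Z \<omega> * c \<omega>\<bar> \<le> K * C" if "\<omega> \<in> space M" for \<omega>
      unfolding abs_mult by (rule mult_mono[OF b C[OF that]]) (use b[of \<omega>] in auto)
  qed
  thus "(\<integral>\<omega>. Z \<omega> * (c \<omega> * U \<omega>) \<partial>M) = 0" by (simp add: mult.assoc)
qed

lemma md_sum:
  assumes U: "\<And>i. i \<in> A \<Longrightarrow> md s t (U i)" and s: "0 \<le> s"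
  shows "md s t (\<lambda>\<omega>. \<Sum>i\<in>A. U i \<omega>)"
proof (rule mdI)
  show "sq_integrable M (\<lambda>\<omega>. \<Sum>i\<in>A. U i \<omega>)" by (rule sq_integrable_sum) (rule mdD(1)[OF U])
  show "(\<lambda>\<omega>. \<Sum>i\<in>A. U i \<omega>) \<in> borel_measurable (F t)" by (rule borel_measurable_sum) (rule mdD(2)[OF U])
  fix Z :: "'w \<Rightarrow> real" and K assume Z: "Z \<in> borel_measurable (F s)" and b: "\<And>\<omega>. \<bar>Z \<omega>\<bar> \<le> K"
  have Zsq: "sq_integrable M Z"
    using measurable_F_M[OF s Z] integrable_bounded[OF s, of "\<lambda>\<omega>. (Z \<omega>)\<^sup>2" "K\<^sup>2"] Z b
    by (simp add: sq_integrable_def abs_le_square_iff[symmetric] order_trans[OF b abs_ge_self])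
  have "(\<integral>\<omega>. Z \<omega> * (\<Sum>i\<in>A. U i \<omega>) \<partial>M) = (\<Sum>i\<in>A. \<integral>\<omega>. Z \<omega> * U i \<omega> \<partial>M)"
    unfolding sum_distrib_left
    by (rule Bochner_Integration.integral_sum) (rule sq_integrable_mult[OF Zsq mdD(1)[OF U]])
  also have "\<dots> = 0"
    by (rule sum.neutral) (use mdD(3)[OF U Z] b in blast)
  finally show "(\<integral>\<omega>. Z \<omega> * (\<Sum>i\<in>A. U i \<omega>) \<partial>M) = 0" .
qed

text \<open>The earlier increment serves as test function for the later one; it may be unbounded,
  hence the truncation lemma.\<close>

lemma md_orthogonal:
  assumes U: "md s t U" and V: "md t' u V" and t: "0 \<le> t" "t \<le> t'"
  shows "(\<integral>\<omega>. U \<omega> * V \<omega> \<partial>M) = 0"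
proof (rule integral_mult_zero_of_bounded[where F = "F t'"])
  show "U \<in> borel_measurable (F t')" by (rule measurable_F_mono[OF t(2) mdD(2)[OF U]])
  show "V \<in> borel_measurable M" using mdD(1)[OF V] by (simp add: sq_integrable_def)
  show "subalgebra M (F t')" using subalg t by simp
  show "integrable M (\<lambda>\<omega>. U \<omega> * V \<omega>)" by (rule sq_integrable_mult[OF mdD(1)[OF U] mdD(1)[OF V]])
  show "(\<integral>\<omega>. Y \<omega> * V \<omega> \<partial>M) = 0" if "Y \<in> borel_measurable (F t')" "\<And>\<omega>. \<bar>Y \<omega>\<bar> \<le> C" for Y C
    by (rule mdD(3)[OF V that])
qed

text \<open>Increments over successive cells are pairwise orthogonal, so the second moment of the
  sum is the sum of the second moments.\<close>

lemma md_chain: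
  fixes g :: "nat \<Rightarrow> real"
  assumes g: "\<And>l. l < n \<Longrightarrow> g l \<le> g (Suc l)" "0 \<le> g 0" and U: "\<And>l. l < n \<Longrightarrow> md (g l) (g (Suc l)) (U l)"
  shows "md (g 0) (g n) (\<lambda>\<omega>. \<Sum>l<n. U l \<omega>)"
    and "(\<integral>\<omega>. (\<Sum>l<n. U l \<omega>)\<^sup>2 \<partial>M) = (\<Sum>l<n. \<integral>\<omega>. (U l \<omega>)\<^sup>2 \<partial>M)"
proof -
  have mono: "g j \<le> g k" if "j \<le> k" "k \<le> n" for j k
    by (rule grid_mono[OF _ that]) (use g in auto)
  have pos: "0 \<le> g j" if "j \<le> n" for j using mono[of 0 j] that g by simp
  show "md (g 0) (g n) (\<lambda>\<omega>. \<Sum>l<n. U l \<omega>)"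
  proof (rule md_sum)
    fix l assume "l \<in> {..<n}"
    hence l: "l < n" by simp
    show "md (g 0) (g n) (U l)"
    proof (rule mdI)
      show "sq_integrable M (U l)" by (rule mdD(1)[OF U[OF l]])
      show "U l \<in> borel_measurable (F (g n))"
        by (rule measurable_F_mono[OF mono mdD(2)[OF U[OF l]]]) (use l in auto)
      show "(\<integral>\<omega>. Z \<omega> * U l \<omega> \<partial>M) = 0" if "Z \<in> borel_measurable (F (g 0))" "\<And>\<omega>. \<bar>Z \<omega>\<bar> \<le> K" for Z K
        by (rule mdD(3)[OF U[OF l] measurable_F_mono[OF mono that(1)] that(2)]) (use l in auto)
    qed
  qed (rule g)
  show "(\<integral>\<omega>. (\<Sum>l<n. U l \<omega>)\<^sup>2 \<partial>M) = (\<Sum>l<n. \<integral>\<omega>. (U l \<omega>)\<^sup>2 \<partial>M)"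
  proof (rule integral_sum_orthogonal)
    show "sq_integrable M (U l)" if "l \<in> {..<n}" for l using mdD(1)[OF U] that by simp
    have lt: "(\<integral>\<omega>. U j \<omega> * U k \<omega> \<partial>M) = 0" if "j < k" "k < n" for j k
      by (rule md_orthogonal[OF U U]) (use that mono[of "Suc j" k] pos[of "Suc j"] in auto)
    fix j k assume "j \<in> {..<n}" "k \<in> {..<n}" "j \<noteq> k"
    thus "(\<integral>\<omega>. U j \<omega> * U k \<omega> \<partial>M) = 0"
      using lt[of j k] lt[of k j] by (cases j k rule: linorder_cases) (auto simp: mult.commute)
  qed simp
qed

text \<open>Almost everywhere convergence does not preserve expectations by itself; the common
  second moment bound \<open>K\<close> supplies uniform integrability. Truncation at a level R above
  \<open>C\<close> leaves the limit unchanged, makes dominated convergence available, and changes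
  the expectations by at most B K / R. Finally R grows. The second moment of the limit is bounded by
  Fatou's lemma.\<close>

lemma md_AE_limit:
  fixes U :: "nat \<Rightarrow> 'w \<Rightarrow> real"
  assumes U: "\<And>n. md s t (U n)" and K: "\<And>n. (\<integral>\<omega>. (U n \<omega>)\<^sup>2 \<partial>M) \<le> K" and s: "0 \<le> s"
    and lim: "AE \<omega> in M. (\<lambda>n. U n \<omega>) \<longlonglongrightarrow> V \<omega>"
    and V: "V \<in> borel_measurable (F t)" "V \<in> borel_measurable M" "\<And>\<omega>. \<omega> \<in> space M \<Longrightarrow> \<bar>V \<omega>\<bar> \<le> C"
  shows "md s t V" "(\<integral>\<omega>. (V \<omega>)\<^sup>2 \<partial>M) \<le> K"
proof -
  note [measurable] = V(2)
  have UM[measurable]: "U n \<in> borel_measurable M" for n using mdD(1)[OF U] by (simp add: sq_integrable_def)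
  have U2: "integrable M (\<lambda>\<omega>. (U n \<omega>)\<^sup>2)" for n using mdD(1)[OF U] by (simp add: sq_integrable_def)
  have Vsq: "sq_integrable M V"
    unfolding sq_integrable_def
  proof
    show "integrable M (\<lambda>\<omega>. (V \<omega>)\<^sup>2)"
    proof (rule integrable_const_bound[of _ "C\<^sup>2"])
      show "AE \<omega> in M. norm ((V \<omega>)\<^sup>2) \<le> C\<^sup>2"
        by (rule AE_I2) (use V(3) in \<open>simp add: abs_le_square_iff[symmetric] order_trans[OF V(3)
            abs_ge_self]\<close>)
    qed measurable
  qed measurable
  have K0: "0 \<le> K" using K[of 0] order_trans[of 0 "\<integral>\<omega>. (U 0 \<omega>)\<^sup>2 \<partial>M" K] by simp
  show "md s t V"
  proof (rule mdI[OF Vsq V(1)])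
    fix Z :: "'w \<Rightarrow> real" and B assume Z: "Z \<in> borel_measurable (F s)" and b: "\<And>\<omega>. \<bar>Z \<omega>\<bar> \<le> B"
    have [measurable]: "Z \<in> borel_measurable M" by (rule measurable_F_M[OF s Z])
    have B0: "0 \<le> B" using b[of undefined] by linarith
    have le: "\<bar>\<integral>\<omega>. Z \<omega> * V \<omega> \<partial>M\<bar> \<le> B * K / R" if R: "R > \<bar>C\<bar>" "R > 0" for R
    proof -
      define h where "h x = max (- R) (min R x)" for x :: real
      have hb: "\<bar>h x\<bar> \<le> R" for x using R by (auto simp: h_def)
      have hcont: "continuous_on UNIV h" unfolding h_def by (intro continuous_intros)
      have [measurable]: "h \<in> borel_measurable borel" by (rule borel_measurable_continuous_onI[OF hcont])
      have hV: "h (V \<omega>) = V \<omega>" if "\<omega> \<in> space M" for \<omega> using V(3)[OF that] R by (auto simp: h_def)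
      \<comment> \<open>Only values above R are changed, and for these |x| <= x^2 / R; so the cost
        of truncation is a second moment over R.\<close>
      have hd: "\<bar>x - h x\<bar> \<le> x\<^sup>2 / R" for x
      proof (cases "\<bar>x\<bar> \<le> R")
        case True
        thus ?thesis using R by (auto simp: h_def)
      next
        case False
        have "\<bar>x - h x\<bar> \<le> \<bar>x\<bar>" using R by (auto simp: h_def)
        also have "\<dots> \<le> x\<^sup>2 / R"
        proof -
          have "\<bar>x\<bar> * R \<le> \<bar>x\<bar> * \<bar>x\<bar>" using False by (intro mult_left_mono) auto
          thus ?thesis using R by (simp add: field_simps power2_eq_square)
        qed
        finally show ?thesis .
      qed
      have lim_h: "(\<lambda>n. \<integral>\<omega>. Z \<omega> * h (U n \<omega>) \<partial>M) \<longlonglongrightarrow> (\<integral>\<omega>. Z \<omega> * V \<omega> \<partial>M)"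
      proof (rule integral_dominated_convergence[where w = "\<lambda>_. B * R"])
        show "AE \<omega> in M. (\<lambda>n. Z \<omega> * h (U n \<omega>)) \<longlonglongrightarrow> Z \<omega> * V \<omega>"
          using lim AE_space
        proof eventually_elim
          case (elim \<omega>)
          have "(\<lambda>n. h (U n \<omega>)) \<longlonglongrightarrow> h (V \<omega>)"
            by (rule continuous_on_tendsto_compose[OF hcont elim(1)]) auto
          thus ?case using hV[OF elim(2)] by (intro tendsto_intros) simp
        qed
        show "AE \<omega> in M. norm (Z \<omega> * h (U n \<omega>)) \<le> B * R" for n
          using b hb B0 by (intro AE_I2) (simp add: abs_mult mult_mono)
      qed measurable
      have bd: "\<bar>\<integral>\<omega>. Z \<omega> * h (U n \<omega>) \<partial>M\<bar> \<le> B * K / R" for n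
      proof -
        have Zsq: "sq_integrable M Z"
          using measurable_F_M[OF s Z] integrable_bounded[OF s, of "\<lambda>\<omega>. (Z \<omega>)\<^sup>2" "B\<^sup>2"] Z b
          by (simp add: sq_integrable_def abs_le_square_iff[symmetric] order_trans[OF b abs_ge_self])
        have i1: "integrable M (\<lambda>\<omega>. Z \<omega> * U n \<omega>)" by (rule sq_integrable_mult[OF Zsq mdD(1)[OF U]])
        have i2: "integrable M (\<lambda>\<omega>. Z \<omega> * h (U n \<omega>))"
        proof (rule integrable_const_bound[of _ "B * R"])
          show "AE \<omega> in M. norm (Z \<omega> * h (U n \<omega>)) \<le> B * R"
            using b hb B0 by (intro AE_I2) (simp add: abs_mult mult_mono)
        qed measurable
        have "(\<integral>\<omega>. Z \<omega> * h (U n \<omega>) \<partial>M) = (\<integral>\<omega>. Z \<omega> * h (U n \<omega>) - Z \<omega> * U n \<omega> \<partial>M)"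
          using mdD(3)[OF U Z b] i1 i2 by simp
        also have "\<bar>\<dots>\<bar> \<le> (\<integral>\<omega>. \<bar>Z \<omega> * h (U n \<omega>) - Z \<omega> * U n \<omega>\<bar> \<partial>M)" by (rule integral_abs_bound)
        also have "\<dots> \<le> (\<integral>\<omega>. B * ((U n \<omega>)\<^sup>2 / R) \<partial>M)"
        proof (rule integral_mono)
          show "integrable M (\<lambda>\<omega>. B * ((U n \<omega>)\<^sup>2 / R))" using U2[of n] by simp
          show "integrable M (\<lambda>\<omega>. \<bar>Z \<omega> * h (U n \<omega>) - Z \<omega> * U n \<omega>\<bar>)" using i1 i2 by auto
          fix \<omega>
          have "\<bar>Z \<omega>\<bar> * \<bar>h (U n \<omega>) - U n \<omega>\<bar> \<le> B * ((U n \<omega>)\<^sup>2 / R)"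
            using b hd[of "U n \<omega>"] B0 by (intro mult_mono) (auto simp: abs_minus_commute)
          thus "\<bar>Z \<omega> * h (U n \<omega>) - Z \<omega> * U n \<omega>\<bar> \<le> B * ((U n \<omega>)\<^sup>2 / R)"
            by (simp add: abs_mult flip: right_diff_distrib)
        qed
        also have "\<dots> = B * (\<integral>\<omega>. (U n \<omega>)\<^sup>2 \<partial>M) / R" by simp
        also have "\<dots> \<le> B * K / R" using K[of n] B0 R by (intro divide_right_mono mult_left_mono) auto
        finally show ?thesis .
      qed
      show ?thesis by (rule LIMSEQ_le_const2[OF tendsto_rabs[OF lim_h]]) (use bd in auto)
    qed
    have lim0: "(\<lambda>n. B * K / real (Suc n)) \<longlonglongrightarrow> 0"
      using tendsto_mult[OF tendsto_const[of "B * K"] LIMSEQ_Suc[OF lim_1_over_n]] by simp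
    obtain m where m: "real m > \<bar>C\<bar>" using reals_Archimedean2 by blast
    have "\<bar>\<integral>\<omega>. Z \<omega> * V \<omega> \<partial>M\<bar> \<le> 0"
    proof (rule LIMSEQ_le_const[OF lim0], intro exI allI impI)
      fix n assume "n \<ge> m"
      hence "real (Suc n) > \<bar>C\<bar>" using m by simp
      thus "\<bar>\<integral>\<omega>. Z \<omega> * V \<omega> \<partial>M\<bar> \<le> B * K / real (Suc n)" by (intro le) auto
    qed
    thus "(\<integral>\<omega>. Z \<omega> * V \<omega> \<partial>M) = 0" by simp
  qed
  have "(\<integral>\<^sup>+\<omega>. ennreal ((V \<omega>)\<^sup>2) \<partial>M) \<le> (\<integral>\<^sup>+\<omega>. liminf (\<lambda>n. ennreal ((U n \<omega>)\<^sup>2)) \<partial>M)"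
  proof (rule nn_integral_mono_AE, use lim in eventually_elim)
    case (elim \<omega>)
    have "(\<lambda>n. ennreal ((U n \<omega>)\<^sup>2)) \<longlonglongrightarrow> ennreal ((V \<omega>)\<^sup>2)" by (intro tendsto_ennrealI tendsto_intros elim)
    from lim_imp_Liminf[OF trivial_limit_sequentially this] show ?case by simp
  qed
  also have "\<dots> \<le> liminf (\<lambda>n. \<integral>\<^sup>+\<omega>. ennreal ((U n \<omega>)\<^sup>2) \<partial>M)"
    by (rule nn_integral_liminf) measurable
  also have "\<dots> \<le> ennreal K"
  proof (rule Liminf_le)
    show "\<forall>\<^sub>F n in sequentially. (\<integral>\<^sup>+\<omega>. ennreal ((U n \<omega>)\<^sup>2) \<partial>M) \<le> ennreal K"
      using K U2 by (intro always_eventually allI) (simp add: nn_integral_eq_integral K0 ennreal_leI)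
  qed simp
  also have "(\<integral>\<^sup>+\<omega>. ennreal ((V \<omega>)\<^sup>2) \<partial>M) = ennreal (\<integral>\<omega>. (V \<omega>)\<^sup>2 \<partial>M)"
    using Vsq by (intro nn_integral_eq_integral) (auto simp: sq_integrable_def)
  finally show "(\<integral>\<omega>. (V \<omega>)\<^sup>2 \<partial>M) \<le> K" using K0 by simp
qed

end

section \<open>The martingale parts of the power sums\<close>

locale jacobi_process =
  fixes a b \<beta> :: real and N :: nat and x0 :: "nat \<Rightarrow> real" and M :: "'w measure" and F :: "real \<Rightarrow> 'w measure"
    and B \<Lambda> :: "nat \<Rightarrow> real \<Rightarrow> 'w \<Rightarrow> real"
  assumes jp: "beta_jacobi_process a b \<beta> N x0 M F B \<Lambda>" and N_pos: "N \<ge> 1"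

sublocale jacobi_process \<subseteq> brownian_filtration M F N B
  using jp by (simp add: beta_jacobi_process_def brownian_filtration_def brownian_filtration_axioms_def)

section \<open>The martingale part of a single particle\<close>

context jacobi_process
begin

lemma \<Lambda>_measurable: "i < N \<Longrightarrow> t \<ge> 0 \<Longrightarrow> \<Lambda> i t \<in> borel_measurable (F t)"
  using jp by (simp add: beta_jacobi_process_def)

lemma \<Lambda>_continuous: "\<omega> \<in> space M \<Longrightarrow> i < N \<Longrightarrow> continuous_on {0..} (\<lambda>t. \<Lambda> i t \<omega>)"
  using jp by (simp add: beta_jacobi_process_def)

lemma \<Lambda>_01: "\<omega> \<in> space M \<Longrightarrow> i < N \<Longrightarrow> t \<ge> 0 \<Longrightarrow> \<Lambda> i t \<omega> \<in> {0..1}"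
  using jp unfolding beta_jacobi_process_def by blast

definition drift :: "nat \<Rightarrow> real \<Rightarrow> 'w \<Rightarrow> real" where
  "drift i u \<omega> = jacobi_drift a b \<beta> N (\<lambda>j. \<Lambda> j u \<omega>) i"

definition H :: "nat \<Rightarrow> real \<Rightarrow> 'w \<Rightarrow> real" where
  "H i u \<omega> = sqrt (2 * \<Lambda> i u \<omega> * (1 - \<Lambda> i u \<omega>))"

definition vd :: "nat \<Rightarrow> real \<Rightarrow> 'w \<Rightarrow> real" where
  "vd i u \<omega> = 2 * \<Lambda> i u \<omega> * (1 - \<Lambda> i u \<omega>)"

text \<open>By the stochastic equation this is a version of the Ito integral of \<open>H i\<close>.
  The pathwise formula gives more than a version does: adaptedness, and exact additivity of the
  increments \<open>X\<close>.\<close>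

definition W :: "nat \<Rightarrow> real \<Rightarrow> 'w \<Rightarrow> real" where
  "W i t \<omega> = \<Lambda> i t \<omega> - x0 i - (LBINT u:{0..t}. drift i u \<omega>)"

definition X :: "nat \<Rightarrow> real \<Rightarrow> real \<Rightarrow> 'w \<Rightarrow> real" where
  "X i s t \<omega> = W i t \<omega> - W i s \<omega>"

definition V :: "nat \<Rightarrow> real \<Rightarrow> real \<Rightarrow> 'w \<Rightarrow> real" where
  "V i s t \<omega> = (LBINT u:{s..t}. vd i u \<omega>)"

lemma vd_bounds:
  assumes "\<omega> \<in> space M" "i < N" "t \<ge> 0"
  shows "0 \<le> vd i t \<omega>" "vd i t \<omega> \<le> 1" "(H i t \<omega>)\<^sup>2 = vd i t \<omega>" "\<bar>H i t \<omega>\<bar> \<le> 1"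
proof -
  have x: "\<Lambda> i t \<omega> \<in> {0..1}" by (rule \<Lambda>_01[OF assms])
  show v0: "0 \<le> vd i t \<omega>" using x by (simp add: vd_def)
  have "0 \<le> (1 - 2 * \<Lambda> i t \<omega>)\<^sup>2" by simp
  thus v1: "vd i t \<omega> \<le> 1" unfolding vd_def by (simp add: power2_eq_square algebra_simps)
  show "(H i t \<omega>)\<^sup>2 = vd i t \<omega>" using v0 by (simp add: H_def vd_def)
  show "\<bar>H i t \<omega>\<bar> \<le> 1" using v0 v1 by (simp add: H_def vd_def)
qed

text \<open>Progressive measurability: the clamp keeps times in [0,t], so the sigma-algebra at time
  t suffices.\<close>

lemma \<Lambda>_joint:
  assumes "i < N" "t \<ge> 0"
  shows "(\<lambda>p. \<Lambda> i (max 0 (min t (snd p))) (fst p)) \<in> borel_measurable (F t \<Otimes>\<^sub>M borel)"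
proof -
  have "(\<lambda>(\<omega>, s). \<Lambda> i (max 0 (min t s)) \<omega>) \<in> borel_measurable (F t \<Otimes>\<^sub>M borel)"
  proof (rule continuous_process_jointly_measurable)
    fix s assume "s \<in> {0..t}"
    thus "\<Lambda> i s \<in> borel_measurable (F t)"
      by (intro measurable_F_mono[OF _ \<Lambda>_measurable[OF assms(1)]]) auto
  next
    fix \<omega> assume "\<omega> \<in> space (F t)"
    thus "continuous_on {0..t} (\<lambda>t. \<Lambda> i t \<omega>)"
      by (intro continuous_on_subset[OF \<Lambda>_continuous[OF _ assms(1)]]) (auto simp: space_F)
  qed (rule assms)
  thus ?thesis by (simp add: case_prod_beta')
qed

lemma clamp_eq: "s \<in> {0..t} \<Longrightarrow> max 0 (min t s) = (s::real)" by auto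

text \<open>Adaptedness without completeness of the filtration. It includes the exceptional paths on
  which the drift is not integrable; there the integral has the default value 0.\<close>

lemma drift_integral_measurable:
  assumes i: "i < N" and t: "t \<ge> 0"
  shows "(\<lambda>\<omega>. LBINT u:{0..t}. drift i u \<omega>) \<in> borel_measurable (F t)"
proof (rule time_integral_measurable_set[where K = "\<lambda>\<omega> u. drift i (max 0 (min t u)) \<omega>"])
  show "(\<lambda>(\<omega>, u). drift i (max 0 (min t u)) \<omega>) \<in> borel_measurable (F t \<Otimes>\<^sub>M borel)"
    unfolding drift_def jacobi_drift_def case_prod_beta'
    by (intro borel_measurable_add borel_measurable_diff borel_measurable_times borel_measurable_const
        borel_measurable_sum borel_measurable_divide \<Lambda>_joint[OF _ t]) (use i in auto)
qed (simp_all only: clamp_eq, simp)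

lemma V_measurable:
  assumes i: "i < N" and st: "0 \<le> s" "s \<le> t"
  shows "V i s t \<in> borel_measurable (F t)"
  unfolding V_def[abs_def]
proof (rule time_integral_measurable_set[where K = "\<lambda>\<omega> u. vd i (max 0 (min t u)) \<omega>"])
  have "0 \<le> t" using st by simp
  thus "(\<lambda>(\<omega>, u). vd i (max 0 (min t u)) \<omega>) \<in> borel_measurable (F t \<Otimes>\<^sub>M borel)"
    unfolding vd_def case_prod_beta'
    by (intro borel_measurable_diff borel_measurable_times borel_measurable_const \<Lambda>_joint[OF i])
qed (use st in \<open>simp_all add: clamp_eq\<close>)

lemma W_measurable: "i < N \<Longrightarrow> t \<ge> 0 \<Longrightarrow> W i t \<in> borel_measurable (F t)"
  unfolding W_def[abs_def]
  by (intro borel_measurable_diff borel_measurable_const \<Lambda>_measurable drift_integral_measurable)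

lemma X_measurable:
  assumes "i < N" "0 \<le> s" "s \<le> t"
  shows "X i s t \<in> borel_measurable (F t)"
  unfolding X_def[abs_def]
  by (intro borel_measurable_diff W_measurable measurable_F_mono[OF assms(3) W_measurable])
      (use assms in auto)

lemma window_measurable:
  assumes i: "i < N" and t: "t \<ge> 0"
  shows "window (H i) {0..t} \<in> borel_measurable PP"
proof -
  have L: "(\<lambda>p. \<Lambda> i (max 0 (min t (snd p))) (fst p)) \<in> borel_measurable (M \<Otimes>\<^sub>M borel)"
  proof -
    have "(\<lambda>(\<omega>, s). \<Lambda> i (max 0 (min t s)) \<omega>) \<in> borel_measurable (M \<Otimes>\<^sub>M borel)"
    proof (rule continuous_process_jointly_measurable)
      fix s assume "s \<in> {0..t}"
      thus "\<Lambda> i s \<in> borel_measurable M" by (intro measurable_F_M[OF _ \<Lambda>_measurable[OF i]]) auto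
    next
      fix \<omega> assume "\<omega> \<in> space M"
      thus "continuous_on {0..t} (\<lambda>t. \<Lambda> i t \<omega>)"
        by (intro continuous_on_subset[OF \<Lambda>_continuous[OF _ i]]) auto
    qed (rule t)
    thus ?thesis by (simp add: case_prod_beta')
  qed
  note [measurable] = L
  have "(\<lambda>p. indicator {0..t} (snd p) * sqrt (2 * \<Lambda> i (max 0 (min t (snd p))) (fst p) * (1
      - \<Lambda> i (max 0 (min t (snd p))) (fst p))))
     \<in> borel_measurable (M \<Otimes>\<^sub>M borel)"
    by measurable
  also have "(\<lambda>p. indicator {0..t} (snd p) * sqrt (2 * \<Lambda> i (max 0 (min t (snd p))) (fst p) * (1
      - \<Lambda> i (max 0 (min t (snd p))) (fst p))))
     = window (H i) {0..t}"
  proof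
    fix p :: "'w \<times> real"
    show "indicator {0..t} (snd p) * sqrt (2 * \<Lambda> i (max 0 (min t (snd p))) (fst p) * (1
        - \<Lambda> i (max 0 (min t (snd p))) (fst p)))
       = window (H i) {0..t} p"
      by (cases p) (auto simp: window_def H_def indicator_def clamp_eq)
  qed
  finally show ?thesis by (simp cong: measurable_cong_sets)
qed

lemma W_approx:
  assumes i: "i < N" and t: "t \<ge> 0"
  shows "\<exists>\<phi>. approx i 0 t (window (H i) {0..t}) (W i t) \<phi>"
proof (rule has_ito_integral_approx[OF i t])
  show "has_ito_integral M F (B i) (H i) t (W i t)"
    using jp i t unfolding beta_jacobi_process_def H_def[abs_def] W_def[abs_def] drift_def by blast
  show "window (H i) {0..t} \<in> borel_measurable PP" by (rule window_measurable[OF i t])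
  show "\<bar>H i x \<omega>\<bar> \<le> 1" if "x \<in> {0..t}" "\<omega> \<in> space M" for x \<omega>
    by (rule vd_bounds(4)) (use that i in auto)
qed

lemma X_approx:
  assumes i: "i < N" and st: "0 \<le> s" "s \<le> t"
  shows "\<exists>\<phi>. approx i s t (window (H i) {s<..t}) (X i s t) \<phi>"
proof -
  have t: "0 \<le> t" using st by simp
  obtain \<phi> where \<phi>: "approx i 0 t (window (H i) {0..t}) (W i t) \<phi>" using W_approx[OF i t] by (rule exE)
  obtain \<psi> where \<psi>: "approx i 0 s (window (H i) {0..s}) (W i s) \<psi>" using W_approx[OF i st(1)] by (rule exE)
  show ?thesis using approx_increment[OF i st \<phi> \<psi>] unfolding X_def[abs_def] .
qed

lemma vd_continuous:
  assumes "\<omega> \<in> space M" "i < N" "0 \<le> s"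
  shows "continuous_on {s..t} (\<lambda>u. vd i u \<omega>)"
  unfolding vd_def
  by (intro continuous_intros continuous_on_subset[OF \<Lambda>_continuous[OF assms(1,2)]]) (use assms in auto)

lemma continuous_LBINT_eq_integral:
  fixes f :: "real \<Rightarrow> real"
  assumes "continuous_on {s..t} f"
  shows "set_integrable lborel {s..t} f" "(LBINT u:{s..t}. f u) = integral {s..t} f"
proof -
  show *: "set_integrable lborel {s..t} f" by (rule borel_integrable_atLeastAtMost'[OF assms])
  show "(LBINT u:{s..t}. f u) = integral {s..t} f" by (rule set_borel_integral_eq_integral(2)[OF *])
qed

lemma V_eq: "\<omega> \<in> space M \<Longrightarrow> i < N \<Longrightarrow> 0 \<le> s \<Longrightarrow> V i s t \<omega> = integral {s..t} (\<lambda>u. vd i u \<omega>)"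
  unfolding V_def by (rule continuous_LBINT_eq_integral(2)[OF vd_continuous])

lemma V_bounds:
  assumes \<omega>: "\<omega> \<in> space M" and i: "i < N" and st: "0 \<le> s" "s \<le> t"
  shows "0 \<le> V i s t \<omega>" "V i s t \<omega> \<le> t - s"
proof -
  have int: "(\<lambda>u. vd i u \<omega>) integrable_on {s..t}"
    by (rule integrable_continuous_interval[OF vd_continuous[OF \<omega> i st(1)]])
  have b: "0 \<le> vd i u \<omega>" "vd i u \<omega> \<le> 1" if "u \<in> {s..t}" for u
    using vd_bounds(1,2)[OF \<omega> i, of u] that st by auto
  show "0 \<le> V i s t \<omega>" unfolding V_eq[OF \<omega> i st(1)] by (rule integral_nonneg[OF int b(1)])
  have "integral {s..t} (\<lambda>u. vd i u \<omega>) \<le> integral {s..t} (\<lambda>u. 1)"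
    by (rule integral_le[OF int _ b(2)]) auto
  thus "V i s t \<omega> \<le> t - s" unfolding V_eq[OF \<omega> i st(1)] using st by simp
qed

text \<open>The conditional isometry, after Fubini's theorem and because \<open>H i\<close> squared
  is \<open>vd i\<close>: \<open>V\<close> compensates the square of \<open>X\<close>.\<close>

lemma expectation_mult_X_sq:
  assumes i: "i < N" and st: "0 \<le> s" "s \<le> t" and Z: "Z \<in> borel_measurable (F s)" "\<And>\<omega>. \<bar>Z \<omega>\<bar> \<le> K"
  shows "(\<integral>\<omega>. Z \<omega> * (X i s t \<omega>)\<^sup>2 \<partial>M) = (\<integral>\<omega>. Z \<omega> * V i s t \<omega> \<partial>M)"
proof -
  let ?G = "window (H i) {s<..t}"
  obtain \<phi> where \<phi>: "approx i s t ?G (X i s t) \<phi>" using X_approx[OF i st] by (rule exE)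
  have sqG: "sq_integrable PP ?G" using \<phi> by (simp add: approx_def L2_tendsto_def)
  have [measurable]: "Z \<in> borel_measurable M" by (rule measurable_F_M[OF st(1) Z(1)])
  have int: "integrable PP (\<lambda>p. Z (fst p) * (?G p)\<^sup>2)"
    by (rule integrable_bounded_mult[where C = K]) (use sqG Z in \<open>simp_all add: sq_integrable_def\<close>)
  have "(\<integral>\<omega>. Z \<omega> * (X i s t \<omega>)\<^sup>2 \<partial>M) = (\<integral>p. Z (fst p) * (?G p)\<^sup>2 \<partial>PP)"
    by (rule approx_expectation(2)[OF i \<phi> Z st(1)])
  also have "\<dots> = (\<integral>\<omega>. \<integral>x. Z (fst (\<omega>, x)) * (?G (\<omega>, x))\<^sup>2 \<partial>lborel \<partial>M)"
    by (rule P.integral_fst'[OF int, symmetric])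
  also have "\<dots> = (\<integral>\<omega>. Z \<omega> * V i s t \<omega> \<partial>M)"
  proof (rule Bochner_Integration.integral_cong[OF refl])
    fix \<omega> assume \<omega>: "\<omega> \<in> space M"
    have "(\<integral>x. (?G (\<omega>, x))\<^sup>2 \<partial>lborel) = V i s t \<omega>"
      unfolding V_def set_lebesgue_integral_def
    proof (rule integral_cong_AE)
      have vdm: "(\<lambda>x. indicator {s..t} x *\<^sub>R vd i x \<omega>) \<in> borel_measurable lborel"
        using continuous_LBINT_eq_integral(1)[OF vd_continuous[OF \<omega> i st(1)], of t]
        unfolding set_integrable_def by simp
      thus "(\<lambda>x. indicator {s..t} x *\<^sub>R vd i x \<omega>) \<in> borel_measurable lborel" .
      have "(?G (\<omega>, x))\<^sup>2 = indicator {s<..t} x * (indicator {s..t} x *\<^sub>R vd i x \<omega>)" for x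
        using vd_bounds(3)[OF \<omega> i, of x] st by (auto simp: window_def indicator_def)
      moreover have "(\<lambda>x. indicator {s<..t} x * (indicator {s..t} x *\<^sub>R vd i x \<omega>))
          \<in> borel_measurable lborel"
        using vdm by measurable
      ultimately show "(\<lambda>x. (?G (\<omega>, x))\<^sup>2) \<in> borel_measurable lborel" by simp
      \<comment> \<open>The window excludes the left end s and the integral in \<open>V\<close>
        includes it, a difference of one point.\<close>
      show "AE x in lborel. (?G (\<omega>, x))\<^sup>2 = indicator {s..t} x *\<^sub>R vd i x \<omega>"
        using AE_lborel_singleton[of s]
      proof eventually_elim
        case (elim x)
        thus ?case using vd_bounds(3)[OF \<omega> i, of x] st by (auto simp: window_def indicator_def)
      qed
    qed
    thus "(\<integral>x. Z (fst (\<omega>, x)) * (?G (\<omega>, x))\<^sup>2 \<partial>lborel) = Z \<omega> * V i s t \<omega>" by simp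
  qed
  finally show ?thesis .
qed

lemma X_moments:
  assumes i: "i < N" and st: "0 \<le> s" "s \<le> t"
  shows "sq_integrable M (X i s t)" "integrable M (\<lambda>\<omega>. X i s t \<omega> ^ 4)"
      "(\<integral>\<omega>. X i s t \<omega> ^ 4 \<partial>M) \<le> 3 * (t - s)\<^sup>2"
proof -
  obtain \<phi> where \<phi>: "approx i s t (window (H i) {s<..t}) (X i s t) \<phi>" using X_approx[OF i st] by (rule exE)
  \<comment> \<open>Any test function would do; only the statements that do not involve it are read
    off.\<close>
  have Z: "(\<lambda>_. 0) \<in> borel_measurable (F s)" "\<And>\<omega>::'w. \<bar>0\<bar> \<le> (0::real)" by simp_all
  from approx_expectation(4-6)[OF i \<phi> Z st(1)]
  show "sq_integrable M (X i s t)" "integrable M (\<lambda>\<omega>. X i s t \<omega> ^ 4)"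
      "(\<integral>\<omega>. X i s t \<omega> ^ 4 \<partial>M) \<le> 3 * (t - s)\<^sup>2" .
qed

lemma md_X:
  assumes i: "i < N" and st: "0 \<le> s" "s \<le> t"
  shows "md s t (X i s t)"
proof -
  obtain \<phi> where \<phi>: "approx i s t (window (H i) {s<..t}) (X i s t) \<phi>" using X_approx[OF i st] by (rule exE)
  show ?thesis
    by (rule mdI[OF X_moments(1)[OF assms] X_measurable[OF assms]])
        (rule approx_expectation(1)[OF i \<phi> _ _ st(1)])
qed

lemma V_integrable:
  assumes i: "i < N" and st: "0 \<le> s" "s \<le> t"
  shows "integrable M (\<lambda>\<omega>. (V i s t \<omega>) ^ k)" "V i s t \<in> borel_measurable M"
proof -
  show [measurable]: "V i s t \<in> borel_measurable M"
    by (rule measurable_F_M[OF _ V_measurable[OF assms]]) (use st in simp)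
  show "integrable M (\<lambda>\<omega>. (V i s t \<omega>) ^ k)"
  proof (rule integrable_const_bound)
    show "AE \<omega> in M. norm ((V i s t \<omega>) ^ k) \<le> (t - s) ^ k"
      using V_bounds[OF _ i st] by (intro AE_I2) (simp add: power_abs power_mono)
  qed measurable
qed

definition q :: "nat \<Rightarrow> real \<Rightarrow> real \<Rightarrow> 'w \<Rightarrow> real" where
  "q i s t \<omega> = (X i s t \<omega>)\<^sup>2 - V i s t \<omega>"

text \<open>The constant 8 is 2 * 3 + 2 * 1: twice the fourth moment bound of \<open>X\<close>, plus
  twice the square of the bound t - s on \<open>V\<close>.\<close>

lemma md_q:
  assumes i: "i < N" and st: "0 \<le> s" "s \<le> t"
  shows "md s t (q i s t)" "(\<integral>\<omega>. (q i s t \<omega>)\<^sup>2 \<partial>M) \<le> 8 * (t - s)\<^sup>2"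
proof -
  note Xm = X_moments[OF assms]
  have XM[measurable]: "X i s t \<in> borel_measurable M" using Xm(1) by (simp add: sq_integrable_def)
  note VM[measurable] = V_integrable(2)[OF assms]
  have X2: "sq_integrable M (\<lambda>\<omega>. (X i s t \<omega>)\<^sup>2)"
    using Xm(2) by (simp add: sq_integrable_def power_mult[symmetric])
  have Vsq: "sq_integrable M (V i s t)" using V_integrable(1)[OF assms, of 2]
    by (simp add: sq_integrable_def)
  have sq: "sq_integrable M (q i s t)" unfolding q_def[abs_def] by (rule sq_integrable_diff[OF X2 Vsq])
  show "md s t (q i s t)"
  proof (rule mdI[OF sq])
    show "q i s t \<in> borel_measurable (F t)"
      unfolding q_def[abs_def]
      by (intro borel_measurable_diff borel_measurable_power X_measurable[OF assms] V_measurable[OF assms])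
    fix Z :: "'w \<Rightarrow> real" and K assume Z: "Z \<in> borel_measurable (F s)" and b: "\<And>\<omega>. \<bar>Z \<omega>\<bar> \<le> K"
    have ZM: "Z \<in> borel_measurable M" by (rule measurable_F_M[OF st(1) Z])
    have i1: "integrable M (\<lambda>\<omega>. Z \<omega> * (X i s t \<omega>)\<^sup>2)"
      by (rule integrable_bounded_mult[OF _ ZM b]) (use Xm(1) in \<open>simp add: sq_integrable_def\<close>)
    have i2: "integrable M (\<lambda>\<omega>. Z \<omega> * V i s t \<omega>)"
      by (rule integrable_bounded_mult[OF _ ZM b]) (use V_integrable(1)[OF assms, of 1] in simp)
    show "(\<integral>\<omega>. Z \<omega> * q i s t \<omega> \<partial>M) = 0"
      unfolding q_def right_diff_distrib using i1 i2 expectation_mult_X_sq[OF assms Z b] by simp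
  qed
  have le: "(q i s t \<omega>)\<^sup>2 \<le> 2 * X i s t \<omega> ^ 4 + 2 * (V i s t \<omega>)\<^sup>2" for \<omega>
    using sq_add_le[of "(X i s t \<omega>)\<^sup>2" "- V i s t \<omega>"] by (simp add: q_def power_mult[symmetric])
  have "(\<integral>\<omega>. (q i s t \<omega>)\<^sup>2 \<partial>M) \<le> (\<integral>\<omega>. 2 * X i s t \<omega> ^ 4 + 2 * (V i s t \<omega>)\<^sup>2 \<partial>M)"
    using sq Xm(2) V_integrable(1)[OF assms, of 2] le
    by (intro integral_mono) (auto simp: sq_integrable_def)
  also have "\<dots> = 2 * (\<integral>\<omega>. X i s t \<omega> ^ 4 \<partial>M) + 2 * (\<integral>\<omega>. (V i s t \<omega>)\<^sup>2 \<partial>M)"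
    using Xm(2) V_integrable(1)[OF assms, of 2] by simp
  also have "(\<integral>\<omega>. (V i s t \<omega>)\<^sup>2 \<partial>M) \<le> (\<integral>\<omega>. (t - s)\<^sup>2 \<partial>M)"
    using V_integrable(1)[OF assms, of 2] V_bounds[OF _ i st] by (intro integral_mono power_mono) auto
  also have "(\<integral>\<omega>. (t - s)\<^sup>2 \<partial>M) = (t - s)\<^sup>2" using prob_space by simp
  finally show "(\<integral>\<omega>. (q i s t \<omega>)\<^sup>2 \<partial>M) \<le> 8 * (t - s)\<^sup>2" using Xm(3) by linarith
qed

lemma expectation_X_sq_le:
  assumes i: "i < N" and st: "0 \<le> s" "s \<le> t"
  shows "(\<integral>\<omega>. (X i s t \<omega>)\<^sup>2 \<partial>M) \<le> t - s"
proof -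
  have "(\<integral>\<omega>. 1 * (X i s t \<omega>)\<^sup>2 \<partial>M) = (\<integral>\<omega>. 1 * V i s t \<omega> \<partial>M)"
    by (rule expectation_mult_X_sq[OF assms, of _ 1]) auto
  also have "\<dots> \<le> (\<integral>\<omega>. t - s \<partial>M)"
    using V_integrable(1)[OF assms, of 1] V_bounds[OF _ i st] by (intro integral_mono) auto
  finally show ?thesis using prob_space by simp
qed

text \<open>Different particles are driven by independent motions, so their increments over one
  interval are conditionally uncorrelated, although the particles themselves interact.\<close>

lemma expectation_X_X:
  assumes ij: "i < N" "j < N" "i \<noteq> j" and st: "0 \<le> s" "s \<le> t"
    and Z: "Z \<in> borel_measurable (F s)" "\<And>\<omega>. \<omega> \<in> space M \<Longrightarrow> \<bar>Z \<omega>\<bar> \<le> K"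
  shows "(\<integral>\<omega>. Z \<omega> * (X i s t \<omega> * X j s t \<omega>) \<partial>M) = 0"
proof -
  obtain \<phi> where \<phi>: "approx i s t (window (H i) {s<..t}) (X i s t) \<phi>" using X_approx[OF ij(1) st]
    by (rule exE)
  obtain \<psi> where \<psi>: "approx j s t (window (H j) {s<..t}) (X j s t) \<psi>" using X_approx[OF ij(2) st]
    by (rule exE)
  have "\<exists>Z'. Z' \<in> borel_measurable (F s) \<and> (\<forall>\<omega>. \<bar>Z' \<omega>\<bar> \<le> K) \<and> (\<forall>\<omega>\<in>space M. Z' \<omega> = Z \<omega>)"
    by (rule extend_bounded[OF Z])
  then obtain Z' where Z'_all: "Z' \<in> borel_measurable (F s) \<and> (\<forall>\<omega>. \<bar>Z' \<omega>\<bar> \<le> K) \<and> (\<forall>\<omega>\<in>space M. Z' \<omega> = Z \<omega>)"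
    by (rule exE)
  have Z': "Z' \<in> borel_measurable (F s)" "\<And>\<omega>. \<bar>Z' \<omega>\<bar> \<le> K" "\<And>\<omega>. \<omega> \<in> space M \<Longrightarrow> Z' \<omega> = Z \<omega>"
    using Z'_all by simp_all
  have "(\<integral>\<omega>. Z \<omega> * (X i s t \<omega> * X j s t \<omega>) \<partial>M) = (\<integral>\<omega>. Z' \<omega> * (X i s t \<omega> * X j s t \<omega>) \<partial>M)"
    by (intro Bochner_Integration.integral_cong refl) (simp add: Z'(3))
  also have "\<dots> = 0" by (rule approx_expectation(3)[OF ij(1) \<phi> Z'(1,2) st(1) ij(2) \<psi> ij(3)])
  finally show ?thesis .
qed

end

lemma continuous_mult_integrable:
  fixes w d :: "real \<Rightarrow> real"
  assumes w: "continuous_on {s..t} w" and d: "d absolutely_integrable_on {s..t}"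
  shows "(\<lambda>u. w u * d u) integrable_on {s..t}"
proof -
  have "(\<lambda>u. w u * d u) absolutely_integrable_on {s..t}"
  proof (rule absolutely_integrable_bounded_measurable_product_real)
    show "w \<in> borel_measurable (lebesgue_on {s..t})"
      by (rule continuous_imp_measurable_on_sets_lebesgue[OF w]) simp
    show "bounded (w ` {s..t})" by (rule compact_imp_bounded[OF compact_continuous_image[OF w compact_Icc]])
  qed (use d in auto)
  thus ?thesis by (simp add: absolutely_integrable_on_def)
qed

lemma set_integrable_lborel_imp_absolutely_integrable:
  fixes d :: "real \<Rightarrow> real"
  assumes "set_integrable lborel A d"
  shows "d absolutely_integrable_on A"
proof -
  have i: "integrable lborel (\<lambda>x. indicator A x *\<^sub>R d x)" using assms by (simp add: set_integrable_def)
  hence m: "(\<lambda>x. indicator A x *\<^sub>R d x) \<in> borel_measurable lborel" by (rule borel_measurable_integrable)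
  show ?thesis unfolding set_integrable_def using i integrable_completion[OF m] by blast
qed

lemma power_sum_01:
  assumes "N \<ge> 1" "\<And>i. i < N \<Longrightarrow> x i \<in> {0..1}"
  shows "power_sum N x k \<in> {0..1}"
proof -
  have "0 \<le> (\<Sum>i<N. x i ^ k)" using assms by (intro sum_nonneg) auto
  moreover have "(\<Sum>i<N. x i ^ k) \<le> (\<Sum>i<N. 1)" using assms by (intro sum_mono power_le_one) auto
  ultimately show ?thesis using assms by (simp add: power_sum_def field_simps)
qed

lemma power_sum_drift_bounded:
  "\<exists>K. \<forall>S. (\<forall>p. S p \<in> {0..1}) \<longrightarrow> \<bar>power_sum_drift a b \<beta> N k S\<bar> \<le> K"
proof -
  define K1 where "K1 = real k * (\<bar>a + 1\<bar> + \<bar>a + b + 2\<bar>)"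
  define K2 where "K2 = \<bar>\<beta> * real N / 2 * real k\<bar> * (real k + real (Suc k))"
  define K3 where "K3 = \<bar>\<beta> / 2 * real k\<bar> * ((real k + 1) + real k)"
  define K4 where "K4 = \<bar>real k * (real k - 1)\<bar> * 1"
  have sum4: "\<bar>x + y + z + w\<bar> \<le> x' + y' + z' + w'"
    if "\<bar>x\<bar> \<le> x'" "\<bar>y\<bar> \<le> y'" "\<bar>z\<bar> \<le> z'" "\<bar>w\<bar> \<le> w'" for x y z w x' y' z' w' :: real
    using that by linarith
  show ?thesis
  proof (rule exI, intro allI impI)
    fix S :: "nat \<Rightarrow> real"
    assume S: "\<forall>p. S p \<in> {0..1}"
    have S01: "0 \<le> S p" "S p \<le> 1" for p using S by auto
    have ss: "0 \<le> S p * S q" "S p * S q \<le> 1" for p q using S01 by (auto intro: mult_le_one)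
    have cS: "\<bar>c * S p\<bar> \<le> \<bar>c\<bar>" for c p using S01[of p] by (simp add: abs_mult mult_left_le)
    have "\<bar>(a + 1) * S (k - 1) - (a + b + 2) * S k\<bar> \<le> \<bar>a + 1\<bar> + \<bar>a + b + 2\<bar>"
      using cS[of "a + 1" "k - 1"] cS[of "a + b + 2" k] by linarith
    hence 1: "\<bar>real k * ((a + 1) * S (k - 1) - (a + b + 2) * S k)\<bar> \<le> K1"
      unfolding K1_def abs_mult by (intro mult_mono) auto
    have s1: "0 \<le> (\<Sum>p<k. S p * S (k - 1 - p))" "(\<Sum>p<k. S p * S (k - 1 - p)) \<le> real k"
      using sum_bounded_above[of "{..<k}" "\<lambda>p. S p * S (k - 1 - p)" 1] ss by (auto intro: sum_nonneg)
    have s2: "0 \<le> (\<Sum>p\<le>k. S p * S (k - p))" "(\<Sum>p\<le>k. S p * S (k - p)) \<le> real (Suc k)"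
      using sum_bounded_above[of "{..k}" "\<lambda>p. S p * S (k - p)" 1] ss by (auto intro: sum_nonneg)
    have "\<bar>(\<Sum>p<k. S p * S (k - 1 - p)) - (\<Sum>p\<le>k. S p * S (k - p))\<bar> \<le> real k + real (Suc k)"
      using s1 s2 by linarith
    hence 2: "\<bar>\<beta> * real N / 2 * real k * ((\<Sum>p<k. S p * S (k - 1 - p)) - (\<Sum>p\<le>k. S p * S (k - p)))\<bar> \<le> K2"
      unfolding K2_def by (subst abs_mult) (rule mult_left_mono, auto)
    have "\<bar>(real k + 1) * S k - real k * S (k - 1)\<bar> \<le> (real k + 1) + real k"
      using cS[of "real k + 1" k] cS[of "real k" "k - 1"] by linarith
    hence 3: "\<bar>\<beta> / 2 * real k * ((real k + 1) * S k - real k * S (k - 1))\<bar> \<le> K3"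
      unfolding K3_def by (subst abs_mult) (rule mult_left_mono, auto)
    have "\<bar>S (k - 1) - S k\<bar> \<le> 1" using S01[of k] S01[of "k - 1"] by linarith
    hence 4: "\<bar>real k * (real k - 1) * (S (k - 1) - S k)\<bar> \<le> K4"
      unfolding K4_def by (subst abs_mult) (rule mult_left_mono, auto)
    show "\<bar>power_sum_drift a b \<beta> N k S\<bar> \<le> K1 + K2 + K3 + K4"
      unfolding power_sum_drift_def by (rule sum4[OF 1 2 3 4])
  qed
qed

section \<open>Martingale parts of the power sums of the process\<close>

context jacobi_process
begin

definition S :: "nat \<Rightarrow> real \<Rightarrow> 'w \<Rightarrow> real" where
  "S k u \<omega> = power_sum N (\<lambda>i. \<Lambda> i u \<omega>) k"

definition G :: "nat \<Rightarrow> real \<Rightarrow> 'w \<Rightarrow> real" where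
  "G k u \<omega> = power_sum_drift a b \<beta> N k (\<lambda>p. S p u \<omega>)"

text \<open>The drift \<open>G\<close> is a polynomial in the power sums, so this formula is bounded
  and continuous along every path, whereas \<open>W\<close> contains the singular drift. That it is
  a martingale is proved afterwards.\<close>

definition Y :: "nat \<Rightarrow> real \<Rightarrow> 'w \<Rightarrow> real" where
  "Y k t \<omega> = S k t \<omega> - S k 0 \<omega> - (LBINT u:{0..t}. G k u \<omega>)"

lemma S_01: "\<omega> \<in> space M \<Longrightarrow> t \<ge> 0 \<Longrightarrow> S k t \<omega> \<in> {0..1}"
  unfolding S_def by (rule power_sum_01[OF N_pos]) (rule \<Lambda>_01)

lemma S_continuous: "\<omega> \<in> space M \<Longrightarrow> continuous_on {0..} (\<lambda>t. S k t \<omega>)"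
  unfolding S_def power_sum_def
  by (intro continuous_intros \<Lambda>_continuous) (use N_pos in auto)

lemma S_measurable: "t \<ge> 0 \<Longrightarrow> S k t \<in> borel_measurable (F t)"
  unfolding S_def[abs_def] power_sum_def
  by (intro borel_measurable_divide borel_measurable_sum borel_measurable_power \<Lambda>_measurable
      borel_measurable_const) auto

lemma G_continuous: "\<omega> \<in> space M \<Longrightarrow> continuous_on {0..} (\<lambda>t. G k t \<omega>)"
  unfolding G_def power_sum_drift_def
  by (intro continuous_on_add continuous_on_mult continuous_on_diff continuous_on_const continuous_on_sum
      S_continuous)

lemma G_bounded: "\<exists>K. \<forall>\<omega>\<in>space M. \<forall>t\<ge>0. \<bar>G k t \<omega>\<bar> \<le> K"
proof -
  obtain K where K: "\<forall>S. (\<forall>p. S p \<in> {0..1}) \<longrightarrow> \<bar>power_sum_drift a b \<beta> N k S\<bar> \<le> K"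
    using power_sum_drift_bounded[of a b \<beta> N k] by (rule exE)
  show ?thesis
    unfolding G_def by (intro exI[of _ K] ballI allI impI K[rule_format] S_01)
qed

lemma G_interval:
  assumes "\<omega> \<in> space M" "0 \<le> s"
  shows "continuous_on {s..t} (\<lambda>u. G k u \<omega>)" "(\<lambda>u. G k u \<omega>) integrable_on {s..t}"
proof -
  show "continuous_on {s..t} (\<lambda>u. G k u \<omega>)"
    by (rule continuous_on_subset[OF G_continuous[OF assms(1)]]) (use assms in auto)
  thus "(\<lambda>u. G k u \<omega>) integrable_on {s..t}" by (rule integrable_continuous_interval)
qed

lemma Y_eq: "\<omega> \<in> space M \<Longrightarrow> Y k t \<omega> = S k t \<omega> - S k 0 \<omega> - integral {0..t} (\<lambda>u. G k u \<omega>)"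
  unfolding Y_def by (subst continuous_LBINT_eq_integral(2)[OF G_interval(1)]) auto

lemma Y_increment_eq:
  assumes \<omega>: "\<omega> \<in> space M" and st: "0 \<le> s" "s \<le> t"
  shows "Y k t \<omega> - Y k s \<omega> = S k t \<omega> - S k s \<omega> - integral {s..t} (\<lambda>u. G k u \<omega>)"
proof -
  have "integral {0..s} (\<lambda>u. G k u \<omega>) + integral {s..t} (\<lambda>u. G k u \<omega>) = integral {0..t} (\<lambda>u. G k u \<omega>)"
    by (rule Henstock_Kurzweil_Integration.integral_combine[OF st G_interval(2)[OF \<omega>]]) simp
  thus ?thesis by (simp add: Y_eq[OF \<omega>])
qed

lemma Y_continuous:
  assumes \<omega>: "\<omega> \<in> space M"
  shows "continuous_on {0..T} (\<lambda>t. Y k t \<omega>)"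
proof -
  have "continuous_on {0..T} (\<lambda>t. S k t \<omega> - S k 0 \<omega> - integral {0..t} (\<lambda>u. G k u \<omega>))"
    by (intro continuous_intros continuous_on_subset[OF S_continuous[OF \<omega>]]
        indefinite_integral_continuous_1 G_interval(2)[OF \<omega>]) auto
  thus ?thesis by (simp add: Y_eq[OF \<omega>])
qed

lemma Y_measurable:
  assumes t: "t \<ge> 0"
  shows "Y k t \<in> borel_measurable (F t)"
proof -
  have "(\<lambda>\<omega>. LBINT u:{0..t}. G k u \<omega>) \<in> borel_measurable (F t)"
  proof (rule time_integral_measurable_set[where K = "\<lambda>\<omega> u. G k (max 0 (min t u)) \<omega>"])
    have "(\<lambda>p. S q (max 0 (min t (snd p))) (fst p)) \<in> borel_measurable (F t \<Otimes>\<^sub>M borel)" for q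
      unfolding S_def power_sum_def
      by (intro borel_measurable_divide borel_measurable_sum borel_measurable_power borel_measurable_const
          \<Lambda>_joint[OF _ t]) auto
    thus "(\<lambda>(\<omega>, u). G k (max 0 (min t u)) \<omega>) \<in> borel_measurable (F t \<Otimes>\<^sub>M borel)"
      unfolding G_def power_sum_drift_def case_prod_beta'
      by (intro borel_measurable_add borel_measurable_diff borel_measurable_times borel_measurable_const
          borel_measurable_sum)
  qed (simp_all only: clamp_eq, simp)
  moreover have "S k 0 \<in> borel_measurable (F t)" by (rule measurable_F_mono[OF t S_measurable]) simp
  ultimately show ?thesis
    unfolding Y_def[abs_def] by (intro borel_measurable_diff S_measurable[OF t])
qed

lemma Y_bounded: "\<exists>K. \<forall>\<omega>\<in>space M. \<forall>t\<in>{0..T}. \<bar>Y k t \<omega>\<bar> \<le> K"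
proof -
  obtain K where K: "\<forall>\<omega>\<in>space M. \<forall>t\<ge>0. \<bar>G k t \<omega>\<bar> \<le> K" using G_bounded by (rule exE)
  have "\<bar>Y k t \<omega>\<bar> \<le> 2 + T * \<bar>K\<bar>" if \<omega>: "\<omega> \<in> space M" and t: "t \<in> {0..T}" for \<omega> t
  proof -
    have "norm (integral {0..t} (\<lambda>u. G k u \<omega>)) \<le> integral {0..t} (\<lambda>u. \<bar>K\<bar>)"
    proof (rule integral_norm_bound_integral)
      fix u assume "u \<in> {0..t}"
      hence "\<bar>G k u \<omega>\<bar> \<le> K" using K \<omega> by simp
      thus "norm (G k u \<omega>) \<le> \<bar>K\<bar>" by simp
    qed (use G_interval(2)[OF \<omega>] in auto)
    also have "\<dots> = t * \<bar>K\<bar>" using t by simp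
    also have "\<dots> \<le> T * \<bar>K\<bar>" using t by (intro mult_right_mono) auto
    finally have "\<bar>integral {0..t} (\<lambda>u. G k u \<omega>)\<bar> \<le> T * \<bar>K\<bar>" by simp
    thus ?thesis using S_01[OF \<omega>, of t k] S_01[OF \<omega>, of 0 k] t unfolding Y_eq[OF \<omega>] by auto
  qed
  thus ?thesis by (intro exI[of _ "2 + T * \<bar>K\<bar>"] ballI)
qed

text \<open>The increment of Y with the integrand frozen at the initial time s.\<close>

definition U :: "nat \<Rightarrow> real \<Rightarrow> real \<Rightarrow> 'w \<Rightarrow> real" where
  "U k s t \<omega> = (\<Sum>i<N. (real k * \<Lambda> i s \<omega> ^ (k - 1) / real N) * X i s t \<omega>)"

text \<open>Increments of distinct particles are orthogonal, so second moments add: N terms with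
  squared weight at most (k / N)^2 and variance at most t - s. This is where the factor 1 / N
  arises.\<close>

lemma md_U:
  assumes st: "0 \<le> s" "s \<le> t"
  shows "md s t (U k s t)" "(\<integral>\<omega>. (U k s t \<omega>)\<^sup>2 \<partial>M) \<le> (real k)\<^sup>2 * (t - s) / real N"
proof -
  define c where "c i \<omega> = real k * \<Lambda> i s \<omega> ^ (k - 1) / real N" for i \<omega>
  have cb: "\<bar>c i \<omega>\<bar> \<le> real k / real N" if "i < N" "\<omega> \<in> space M" for i \<omega>
  proof -
    have "\<Lambda> i s \<omega> ^ (k - 1) \<in> {0..1}" using \<Lambda>_01[OF that(2,1) st(1)] by (auto intro: power_le_one)
    hence "\<bar>real k * \<Lambda> i s \<omega> ^ (k - 1)\<bar> \<le> real k" by (simp add: abs_mult mult_left_le)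
    thus ?thesis unfolding c_def using N_pos by (simp add: divide_right_mono)
  qed
  have cm: "c i \<in> borel_measurable (F s)" if "i < N" for i
    unfolding c_def[abs_def] using that st
    by (intro borel_measurable_divide borel_measurable_times borel_measurable_power borel_measurable_const
        \<Lambda>_measurable)
  have md: "md s t (\<lambda>\<omega>. c i \<omega> * X i s t \<omega>)" if "i < N" for i
    by (rule md_bounded_mult[OF md_X[OF that st] st cm[OF that] cb[OF that]])
  have Ueq: "U k s t = (\<lambda>\<omega>. \<Sum>i<N. c i \<omega> * X i s t \<omega>)" by (auto simp: U_def c_def)
  show "md s t (U k s t)" unfolding Ueq by (rule md_sum[OF md st(1)]) simp
  have "(\<integral>\<omega>. (U k s t \<omega>)\<^sup>2 \<partial>M) = (\<Sum>i<N. \<integral>\<omega>. (c i \<omega> * X i s t \<omega>)\<^sup>2 \<partial>M)"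
    unfolding Ueq
  proof (rule integral_sum_orthogonal)
    show "sq_integrable M (\<lambda>\<omega>. c i \<omega> * X i s t \<omega>)" if "i \<in> {..<N}" for i using mdD(1)[OF md] that by simp
    fix i j assume ij: "i \<in> {..<N}" "j \<in> {..<N}" "i \<noteq> j"
    hence ij': "i < N" "j < N" by auto
    have "(\<integral>\<omega>. (c i \<omega> * c j \<omega>) * (X i s t \<omega> * X j s t \<omega>) \<partial>M) = 0"
    proof (rule expectation_X_X[OF ij' ij(3) st])
      show "(\<lambda>\<omega>. c i \<omega> * c j \<omega>) \<in> borel_measurable (F s)" using cm ij' by (intro borel_measurable_times)
      show "\<bar>c i \<omega> * c j \<omega>\<bar> \<le> (real k / real N) * (real k / real N)" if "\<omega> \<in> space M" for \<omega>
        unfolding abs_mult using cb ij' that by (intro mult_mono) auto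
    qed
    thus "(\<integral>\<omega>. (c i \<omega> * X i s t \<omega>) * (c j \<omega> * X j s t \<omega>) \<partial>M) = 0" by (simp add: mult_ac)
  qed simp
  also have "\<dots> \<le> (\<Sum>i<N. (real k / real N)\<^sup>2 * (t - s))"
  proof (rule sum_mono)
    fix i assume "i \<in> {..<N}"
    hence i: "i < N" by simp
    have X2: "integrable M (\<lambda>\<omega>. (X i s t \<omega>)\<^sup>2)" using X_moments(1)[OF i st] by (simp add: sq_integrable_def)
    have "(\<integral>\<omega>. (c i \<omega> * X i s t \<omega>)\<^sup>2 \<partial>M) \<le> (\<integral>\<omega>. (real k / real N)\<^sup>2 * (X i s t \<omega>)\<^sup>2 \<partial>M)"
    proof (rule integral_mono)
      show "integrable M (\<lambda>\<omega>. (c i \<omega> * X i s t \<omega>)\<^sup>2)" using mdD(1)[OF md[OF i]]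
        by (simp add: sq_integrable_def)
      show "integrable M (\<lambda>\<omega>. (real k / real N)\<^sup>2 * (X i s t \<omega>)\<^sup>2)" using X2 by simp
      fix \<omega> assume "\<omega> \<in> space M"
      hence "\<bar>c i \<omega>\<bar> \<le> \<bar>real k / real N\<bar>" using cb[OF i] by simp
      hence "(c i \<omega>)\<^sup>2 \<le> (real k / real N)\<^sup>2" by (simp only: abs_le_square_iff)
      thus "(c i \<omega> * X i s t \<omega>)\<^sup>2 \<le> (real k / real N)\<^sup>2 * (X i s t \<omega>)\<^sup>2"
        unfolding power_mult_distrib by (rule mult_right_mono) simp
    qed
    also have "\<dots> = (real k / real N)\<^sup>2 * (\<integral>\<omega>. (X i s t \<omega>)\<^sup>2 \<partial>M)" by simp
    also have "\<dots> \<le> (real k / real N)\<^sup>2 * (t - s)"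
      by (rule mult_left_mono[OF expectation_X_sq_le[OF i st]]) simp
    finally show "(\<integral>\<omega>. (c i \<omega> * X i s t \<omega>)\<^sup>2 \<partial>M) \<le> (real k / real N)\<^sup>2 * (t - s)" .
  qed
  also have "\<dots> = (real k)\<^sup>2 * (t - s) / real N"
    using N_pos by (simp add: power2_eq_square field_simps)
  finally show "(\<integral>\<omega>. (U k s t \<omega>)\<^sup>2 \<partial>M) \<le> (real k)\<^sup>2 * (t - s) / real N" .
qed

lemma grid_chain:
  assumes st: "0 \<le> s" "s \<le> t" and n: "n > 0"
  shows "\<And>l. l < n \<Longrightarrow> grid s t n l \<le> grid s t n (Suc l)" "0 \<le> grid s t n 0" "\<And>l. l \<le> n \<Longrightarrow> 0 \<le> grid s t n l"
proof -
  show "grid s t n l \<le> grid s t n (Suc l)" for l by (rule grid_le[OF st(2)]) simp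
  show "0 \<le> grid s t n 0" using st by simp
  show "0 \<le> grid s t n l" if "l \<le> n" for l using grid_in[OF st(2) that n] st by simp
qed

lemma md_U_sum:
  assumes st: "0 \<le> s" "s \<le> t" and n: "n > 0"
  shows "md s t (\<lambda>\<omega>. \<Sum>l<n. U k (grid s t n l) (grid s t n (Suc l)) \<omega>)"
    "(\<integral>\<omega>. (\<Sum>l<n. U k (grid s t n l) (grid s t n (Suc l)) \<omega>)\<^sup>2 \<partial>M) \<le> (real k)\<^sup>2 * (t - s) / real N"
proof -
  note gc = grid_chain[OF st n]
  have md: "md (grid s t n l) (grid s t n (Suc l)) (U k (grid s t n l) (grid s t n (Suc l)))" if "l < n"
      for l
    by (rule md_U(1)) (use gc that in auto)
  show "md s t (\<lambda>\<omega>. \<Sum>l<n. U k (grid s t n l) (grid s t n (Suc l)) \<omega>)"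
  proof -
    have "md (grid s t n 0) (grid s t n n) (\<lambda>\<omega>. \<Sum>l<n. U k (grid s t n l) (grid s t n (Suc l)) \<omega>)"
      by (rule md_chain(1)[where n = n and g = "grid s t n", OF gc(1,2) md])
    thus ?thesis by (simp add: grid_n[OF n])
  qed
  have "(\<integral>\<omega>. (\<Sum>l<n. U k (grid s t n l) (grid s t n (Suc l)) \<omega>)\<^sup>2 \<partial>M)
     = (\<Sum>l<n. \<integral>\<omega>. (U k (grid s t n l) (grid s t n (Suc l)) \<omega>)\<^sup>2 \<partial>M)"
    by (rule md_chain(2)[OF gc(1,2) md])
  also have "\<dots> \<le> (\<Sum>l<n. (real k)\<^sup>2 * (grid s t n (Suc l) - grid s t n l) / real N)"
    by (intro sum_mono md_U(2)) (use gc in auto)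
  also have "\<dots> = (real k)\<^sup>2 * (\<Sum>l<n. grid s t n (Suc l) - grid s t n l) / real N"
    by (simp only: sum_distrib_left sum_divide_distrib)
  also have "(\<Sum>l<n. grid s t n (Suc l) - grid s t n l) = t - s"
    using sum_lessThan_telescope[of "grid s t n" n] grid_n[OF n, of s t] by simp
  finally show "(\<integral>\<omega>. (\<Sum>l<n. U k (grid s t n l) (grid s t n (Suc l)) \<omega>)\<^sup>2 \<partial>M)
      \<le> (real k)\<^sup>2 * (t - s) / real N" .
qed

text \<open>Convergence of the quadratic variation, with powers as weights. The compensated squares
  are orthogonal over the n cells and have second moments of order 1 / n^2, so the sum has a second
  moment of order 1 / n.\<close>

lemma q_sum:
  fixes p :: nat
  assumes i: "i < N" and st: "0 \<le> s" "s \<le> t" and n: "n > 0"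
  defines "Q \<equiv> \<lambda>\<omega>. \<Sum>l<n. \<Lambda> i (grid s t n l) \<omega> ^ p * q i (grid s t n l) (grid s t n (Suc l)) \<omega>"
  shows "integrable M (\<lambda>\<omega>. (Q \<omega>)\<^sup>2)" "(\<integral>\<omega>. (Q \<omega>)\<^sup>2 \<partial>M) \<le> 8 * (t - s)\<^sup>2 / real n"
proof -
  note gc = grid_chain[OF st n]
  have c: "(\<lambda>\<omega>. \<Lambda> i (grid s t n l) \<omega> ^ p) \<in> borel_measurable (F (grid s t n l))"
    "\<And>\<omega>. \<omega> \<in> space M \<Longrightarrow> \<bar>\<Lambda> i (grid s t n l) \<omega> ^ p\<bar> \<le> 1" if "l < n" for l
  proof -
    have g0: "0 \<le> grid s t n l" using gc(3) that by simp
    show "(\<lambda>\<omega>. \<Lambda> i (grid s t n l) \<omega> ^ p) \<in> borel_measurable (F (grid s t n l))"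
      by (intro borel_measurable_power \<Lambda>_measurable[OF i g0])
    show "\<bar>\<Lambda> i (grid s t n l) \<omega> ^ p\<bar> \<le> 1" if "\<omega> \<in> space M" for \<omega>
      using \<Lambda>_01[OF that i g0] by (simp add: power_abs power_le_one)
  qed
  have md: "md (grid s t n l) (grid s t n (Suc l)) (\<lambda>\<omega>. \<Lambda> i (grid s t n l) \<omega> ^ p *
      q i (grid s t n l) (grid s t n (Suc l)) \<omega>)" if "l < n" for l
    by (rule md_bounded_mult[OF md_q(1)[OF i] _ _ c[OF that]]) (use gc that in auto)
  show "integrable M (\<lambda>\<omega>. (Q \<omega>)\<^sup>2)"
    using mdD(1)[OF md_chain(1)[OF gc(1,2) md]] by (simp add: sq_integrable_def Q_def)
  have "(\<integral>\<omega>. (Q \<omega>)\<^sup>2 \<partial>M)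
      = (\<Sum>l<n. \<integral>\<omega>. (\<Lambda> i (grid s t n l) \<omega> ^ p * q i (grid s t n l) (grid s t n (Suc l)) \<omega>)\<^sup>2 \<partial>M)"
    unfolding Q_def by (rule md_chain(2)[OF gc(1,2) md])
  also have "\<dots> \<le> (\<Sum>l<n. 8 * ((t - s) / real n)\<^sup>2)"
  proof (rule sum_mono)
    fix l assume "l \<in> {..<n}"
    hence l: "l < n" by simp
    have g: "0 \<le> grid s t n l" "grid s t n l \<le> grid s t n (Suc l)" using gc l by auto
    have q2: "integrable M (\<lambda>\<omega>. (q i (grid s t n l) (grid s t n (Suc l)) \<omega>)\<^sup>2)"
      using mdD(1)[OF md_q(1)[OF i g]] by (simp add: sq_integrable_def)
    have "(\<integral>\<omega>. (\<Lambda> i (grid s t n l) \<omega> ^ p * q i (grid s t n l) (grid s t n (Suc l)) \<omega>)\<^sup>2 \<partial>M)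
       \<le> (\<integral>\<omega>. (q i (grid s t n l) (grid s t n (Suc l)) \<omega>)\<^sup>2 \<partial>M)"
    proof (rule integral_mono[OF _ q2])
      show "integrable M (\<lambda>\<omega>. (\<Lambda> i (grid s t n l) \<omega> ^ p * q i (grid s t n l) (grid s t n (Suc l)) \<omega>)\<^sup>2)"
        using mdD(1)[OF md[OF l]] by (simp add: sq_integrable_def)
      fix \<omega> assume "\<omega> \<in> space M"
      hence "\<bar>\<Lambda> i (grid s t n l) \<omega> ^ p\<bar> \<le> \<bar>1\<bar>" using c(2)[OF l] by simp
      hence "(\<Lambda> i (grid s t n l) \<omega> ^ p)\<^sup>2 \<le> 1\<^sup>2" by (simp only: abs_le_square_iff)
      hence "(\<Lambda> i (grid s t n l) \<omega> ^ p)\<^sup>2 * (q i (grid s t n l) (grid s t n (Suc l)) \<omega>)\<^sup>2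
          \<le> 1\<^sup>2 * (q i (grid s t n l) (grid s t n (Suc l)) \<omega>)\<^sup>2"
        by (rule mult_right_mono) simp
      thus "(\<Lambda> i (grid s t n l) \<omega> ^ p * q i (grid s t n l) (grid s t n (Suc l)) \<omega>)\<^sup>2
          \<le> (q i (grid s t n l) (grid s t n (Suc l)) \<omega>)\<^sup>2"
        by (simp only: power_mult_distrib power_one mult_1_left)
    qed
    also have "\<dots> \<le> 8 * (grid s t n (Suc l) - grid s t n l)\<^sup>2" by (rule md_q(2)[OF i g])
    finally show "(\<integral>\<omega>. (\<Lambda> i (grid s t n l) \<omega> ^ p * q i (grid s t n l) (grid s t n (Suc l)) \<omega>)\<^sup>2 \<partial>M)
        \<le> 8 * ((t - s) / real n)\<^sup>2"
      by (simp only: grid_step[OF n])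
  qed
  also have "\<dots> = 8 * (t - s)\<^sup>2 / real n" using n by (simp add: power2_eq_square field_simps)
  finally show "(\<integral>\<omega>. (Q \<omega>)\<^sup>2 \<partial>M) \<le> 8 * (t - s)\<^sup>2 / real n" .
qed

lemma X_pathwise:
  assumes \<omega>: "\<omega> \<in> space M" and i: "i < N" and st: "0 \<le> s" "s \<le> t" "t \<le> T"
    and d: "set_integrable lborel {0..T} (\<lambda>u. drift i u \<omega>)"
  shows "X i s t \<omega> = \<Lambda> i t \<omega> - \<Lambda> i s \<omega> - integral {s..t} (\<lambda>u. drift i u \<omega>)"
proof -
  have e: "set_integrable lborel {0..v} (\<lambda>u. drift i u \<omega>)" if "v \<le> T" for v
    by (rule set_integrable_subset[OF d]) (use that in auto)
  have eq: "(LBINT u:{0..v}. drift i u \<omega>) = integral {0..v} (\<lambda>u. drift i u \<omega>)" if "v \<le> T" for v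
    by (rule set_borel_integral_eq_integral(2)[OF e[OF that]])
  have "integral {0..s} (\<lambda>u. drift i u \<omega>) + integral {s..t} (\<lambda>u. drift i u \<omega>)
      = integral {0..t} (\<lambda>u. drift i u \<omega>)"
    by (rule Henstock_Kurzweil_Integration.integral_combine[OF st(1,2) set_borel_integral_eq_integral(1)[OF
        e[OF st(3)]]])
  thus ?thesis unfolding X_def W_def using eq[of s] eq[of t] st by simp
qed

text \<open>The discrete Ito formula for each particle at one sample point, averaged over the
  particles. Almost sure properties are hypotheses here, so the argument is free of
  probability.\<close>

lemma Y_increment_limit:
  assumes \<omega>: "\<omega> \<in> space M" and st: "0 \<le> s" "s \<le> t" and k: "k \<ge> 1" and r: "strict_mono r"
    and d: "\<And>i. i < N \<Longrightarrow> set_integrable lborel {0..t} (\<lambda>u. drift i u \<omega>)"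
    and coll: "{u. 0 \<le> u \<and> (\<exists>i<N. \<exists>j<N. i \<noteq> j \<and> \<Lambda> i u \<omega> = \<Lambda> j u \<omega>)} \<in> null_sets lborel"
    and Q: "\<And>i p. i < N \<Longrightarrow> p \<in> {0, k - 2} \<Longrightarrow>
       (\<lambda>n. \<Sum>l<r n. \<Lambda> i (grid s t (r n) l) \<omega> ^ p * q i (grid s t (r n) l) (grid s t (r n) (Suc l)) \<omega>) \<longlonglongrightarrow> 0"
  shows "(\<lambda>n. \<Sum>l<r n. U k (grid s t (r n) l) (grid s t (r n) (Suc l)) \<omega>) \<longlonglongrightarrow> Y k t \<omega> - Y k s \<omega>"
proof -
  let ?g = "grid s t"
  define A where "A i = integral {s..t} (\<lambda>u. real k * \<Lambda> i u \<omega> ^ (k - 1) * drift i u \<omega>)" for i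
  define C where "C i = integral {s..t} (\<lambda>u. real k * (real k - 1) / 2 * \<Lambda> i u \<omega> ^ (k - 2) * vd i u \<omega>)"
      for i
  have cL: "continuous_on {s..t} (\<lambda>u. \<Lambda> i u \<omega>)" if "i < N" for i
    by (rule continuous_on_subset[OF \<Lambda>_continuous[OF \<omega> that]]) (use st in auto)
  have da: "(\<lambda>u. drift i u \<omega>) absolutely_integrable_on {s..t}" if "i < N" for i
    by (rule set_integrable_lborel_imp_absolutely_integrable[OF set_integrable_subset[OF d[OF that]]])
        (use st in auto)
  have Xe: "X i (?g n l) (?g n (Suc l)) \<omega>
      = \<Lambda> i (?g n (Suc l)) \<omega> - \<Lambda> i (?g n l) \<omega> - integral {?g n l..?g n (Suc l)} (\<lambda>u. drift i u \<omega>)"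
    if "i < N" "l < n" for i n l
  proof (rule X_pathwise[OF \<omega> that(1) _ _ _ d[OF that(1)]])
    show "0 \<le> ?g n l" "?g n l \<le> ?g n (Suc l)" "?g n (Suc l) \<le> t"
      using grid_in[OF st(2), of l n] grid_in[OF st(2), of "Suc l" n] grid_le[OF st(2), of l "Suc l" n] that
          st by auto
  qed
  have one: "(\<lambda>n. \<Sum>l<r n. real k * \<Lambda> i (?g (r n) l) \<omega> ^ (k - 1) * X i (?g (r n) l) (?g (r n) (Suc l)) \<omega>)
     \<longlonglongrightarrow> \<Lambda> i t \<omega> ^ k - \<Lambda> i s \<omega> ^ k - A i - C i" if i: "i < N" for i
  proof -
    define Xf where "Xf n l
        = \<Lambda> i (?g n (Suc l)) \<omega> - \<Lambda> i (?g n l) \<omega> - integral {?g n l..?g n (Suc l)} (\<lambda>u. drift i u \<omega>)" for n l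
    have "(\<lambda>n. \<Sum>l<r n. real k * \<Lambda> i (?g (r n) l) \<omega> ^ (k - 1) * Xf (r n) l)
       \<longlonglongrightarrow> \<Lambda> i t \<omega> ^ k - \<Lambda> i s \<omega> ^ k - A i - C i"
      unfolding A_def C_def
    proof (rule discrete_ito_power[where x = "\<lambda>u. \<Lambda> i u \<omega>" and v = "\<lambda>u. vd i u \<omega>", OF cL[OF i] _ da[OF i]
        vd_continuous[OF \<omega> i st(1)] st(2) r])
      show "\<Lambda> i u \<omega> \<in> {0..1}" if "u \<in> {s..t}" for u using \<Lambda>_01[OF \<omega> i, of u] that st by simp
      show "Xf n l = \<Lambda> i (?g n (Suc l)) \<omega> - \<Lambda> i (?g n l) \<omega>
          - integral {?g n l..?g n (Suc l)} (\<lambda>u. drift i u \<omega>)" for n l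
        by (rule Xf_def)
      fix p assume p: "p \<in> {0, k - 2}"
      have "(\<Sum>l<n. \<Lambda> i (?g n l) \<omega> ^ p * q i (?g n l) (?g n (Suc l)) \<omega>)
         = (\<Sum>l<n. \<Lambda> i (?g n l) \<omega> ^ p * ((Xf n l)\<^sup>2 - integral {?g n l..?g n (Suc l)} (\<lambda>u. vd i u \<omega>)))" for n
      proof (rule sum.cong[OF refl])
        fix l assume "l \<in> {..<n}"
        hence l: "l < n" by simp
        have "0 \<le> ?g n l" using grid_in[OF st(2), of l n] l st by simp
        thus "\<Lambda> i (?g n l) \<omega> ^ p * q i (?g n l) (?g n (Suc l)) \<omega>
          = \<Lambda> i (?g n l) \<omega> ^ p * ((Xf n l)\<^sup>2 - integral {?g n l..?g n (Suc l)} (\<lambda>u. vd i u \<omega>))"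
          unfolding q_def Xf_def by (simp only: Xe[OF i l] V_eq[OF \<omega> i])
      qed
      thus "(\<lambda>n. \<Sum>l<r n. \<Lambda> i (?g (r n) l) \<omega> ^ p * ((Xf (r n) l)\<^sup>2
          - integral {?g (r n) l..?g (r n) (Suc l)} (\<lambda>u. vd i u \<omega>))) \<longlonglongrightarrow> 0"
        using Q[OF i p] by simp
    qed
    moreover have "(\<Sum>l<n. real k * \<Lambda> i (?g n l) \<omega> ^ (k - 1) * Xf n l)
       = (\<Sum>l<n. real k * \<Lambda> i (?g n l) \<omega> ^ (k - 1) * X i (?g n l) (?g n (Suc l)) \<omega>)" for n
      by (intro sum.cong refl) (simp add: Xf_def Xe[OF i])
    ultimately show ?thesis by simp
  qed
  have "(\<lambda>n. (\<Sum>i<N. \<Sum>l<r n. real k * \<Lambda> i (?g (r n) l) \<omega> ^ (k - 1) * X i (?g (r n) l) (?g (r n) (Suc l)) \<omega>) /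
      real N)
     \<longlonglongrightarrow> (\<Sum>i<N. \<Lambda> i t \<omega> ^ k - \<Lambda> i s \<omega> ^ k - A i - C i) / real N"
    using N_pos by (intro tendsto_divide tendsto_sum one tendsto_const) auto
  moreover have "(\<Sum>i<N. \<Sum>l<n. real k * \<Lambda> i (?g n l) \<omega> ^ (k - 1) * X i (?g n l) (?g n (Suc l)) \<omega>) / real N
     = (\<Sum>l<n. U k (?g n l) (?g n (Suc l)) \<omega>)" for n
    unfolding U_def by (subst sum.swap) (simp add: sum_divide_distrib)
  moreover have "(\<Sum>i<N. \<Lambda> i t \<omega> ^ k - \<Lambda> i s \<omega> ^ k - A i - C i) / real N = Y k t \<omega> - Y k s \<omega>"
  proof -
    have iA: "(\<lambda>u. real k * \<Lambda> i u \<omega> ^ (k - 1) * drift i u \<omega>) integrable_on {s..t}" if "i < N" for i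
      by (rule continuous_mult_integrable[OF _ da[OF that]]) (intro continuous_intros cL[OF that])
    have iC: "(\<lambda>u. real k * (real k - 1) / 2 * \<Lambda> i u \<omega> ^ (k - 2) * vd i u \<omega>) integrable_on {s..t}"
        if "i < N" for i
      by (rule integrable_continuous_interval)
          (intro continuous_intros cL[OF that] vd_continuous[OF \<omega> that st(1)])
    \<comment> \<open>Drift and second-order term combine to \<open>G\<close> only at times without
      collisions; the others form a null set and do not affect the integral.\<close>
    have neg: "negligible {u. 0 \<le> u \<and> (\<exists>i<N. \<exists>j<N. i \<noteq> j \<and> \<Lambda> i u \<omega> = \<Lambda> j u \<omega>)}"
      using coll by (simp add: negligible_iff_null_sets null_sets_completionI)
    have "(\<Sum>i<N. A i + C i) / real N = integral {s..t} (\<lambda>u. (\<Sum>i<N. real k * \<Lambda> i u \<omega> ^ (k - 1) * drift i u \<omega>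
        + real k * (real k - 1) / 2 * \<Lambda> i u \<omega> ^ (k - 2) * vd i u \<omega>) / real N)"
    proof -
      have "(\<Sum>i<N. A i + C i) = (\<Sum>i<N. integral {s..t} (\<lambda>u. real k * \<Lambda> i u \<omega> ^ (k - 1) * drift i u \<omega>
        + real k * (real k - 1) / 2 * \<Lambda> i u \<omega> ^ (k - 2) * vd i u \<omega>))"
        unfolding A_def C_def
        by (intro sum.cong refl Henstock_Kurzweil_Integration.integral_add[symmetric] iA iC) auto
      also have "\<dots> = integral {s..t} (\<lambda>u. \<Sum>i<N. real k * \<Lambda> i u \<omega> ^ (k - 1) * drift i u \<omega>
        + real k * (real k - 1) / 2 * \<Lambda> i u \<omega> ^ (k - 2) * vd i u \<omega>)"
        by (rule Henstock_Kurzweil_Integration.integral_sum[symmetric], simp,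
            rule Henstock_Kurzweil_Integration.integrable_add, (rule iA, simp), (rule iC, simp))
      finally show ?thesis by simp
    qed
    also have "\<dots> = integral {s..t} (\<lambda>u. G k u \<omega>)"
    proof (rule integral_spike[OF neg])
      fix u assume u: "u \<in> {s..t} - {u. 0 \<le> u \<and> (\<exists>i<N. \<exists>j<N. i \<noteq> j \<and> \<Lambda> i u \<omega> = \<Lambda> j u \<omega>)}"
      hence "inj_on (\<lambda>i. \<Lambda> i u \<omega>) {..<N}" using st by (auto simp: inj_on_def)
      from jacobi_drift_power_sum[OF _ k this, of a b \<beta>] N_pos
      show "G k u \<omega> = (\<Sum>i<N. real k * \<Lambda> i u \<omega> ^ (k - 1) * drift i u \<omega>
        + real k * (real k - 1) / 2 * \<Lambda> i u \<omega> ^ (k - 2) * vd i u \<omega>) / real N"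
        unfolding G_def S_def drift_def vd_def by simp
    qed
    finally have "(\<Sum>i<N. A i + C i) / real N = integral {s..t} (\<lambda>u. G k u \<omega>)" .
    moreover have "(\<Sum>i<N. \<Lambda> i t \<omega> ^ k - \<Lambda> i s \<omega> ^ k - A i - C i) / real N
       = S k t \<omega> - S k s \<omega> - (\<Sum>i<N. A i + C i) / real N"
      unfolding S_def power_sum_def
      by (simp add: sum_subtractf sum.distrib diff_divide_distrib add_divide_distrib)
    ultimately show ?thesis unfolding Y_increment_eq[OF \<omega> st] by simp
  qed
  ultimately show ?thesis by simp
qed

text \<open>The sums with frozen integrands are martingale increments with second moments bounded
  uniformly in the grid. Along a subsequence they converge almost surely to the increment of
  \<open>Y\<close>, which inherits both properties.\<close>

lemma md_Y:
  assumes st: "0 \<le> s" "s \<le> t" and k: "k \<ge> 1"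
  shows "md s t (\<lambda>\<omega>. Y k t \<omega> - Y k s \<omega>)" "(\<integral>\<omega>. (Y k t \<omega> - Y k s \<omega>)\<^sup>2 \<partial>M) \<le> (real k)\<^sup>2 * (t - s) / real N"
proof -
  let ?g = "grid s t"
  have t: "0 \<le> t" using st by simp
  define Q where "Q n i p \<omega>
      = (\<Sum>l<Suc n. \<Lambda> i (?g (Suc n) l) \<omega> ^ p * q i (?g (Suc n) l) (?g (Suc n) (Suc l)) \<omega>)" for n i p \<omega>
  have Qi: "integrable M (\<lambda>\<omega>. (Q n i p \<omega>)\<^sup>2)"
  and QE: "(\<integral>\<omega>. (Q n i p \<omega>)\<^sup>2 \<partial>M) \<le> 8 * (t - s)\<^sup>2 / real (Suc n)" if "i < N" for n i p
    unfolding Q_def using q_sum[OF that st, of "Suc n" p] by simp_all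
  \<comment> \<open>All compensated sums are collected in one integrable function, so that a single
    subsequence works for every particle and both exponents.\<close>
  define u where "u n \<omega> = (\<Sum>i<N. (Q n i 0 \<omega>)\<^sup>2 + (Q n i (k - 2) \<omega>)\<^sup>2)" for n \<omega>
  have u0: "0 \<le> u n \<omega>" for n \<omega> unfolding u_def by (intro sum_nonneg) simp
  have ui: "integrable M (u n)" for n
    unfolding u_def[abs_def]
    by (intro Bochner_Integration.integrable_sum Bochner_Integration.integrable_add Qi) auto
  have uE: "(\<integral>\<omega>. u n \<omega> \<partial>M) \<le> real N * (16 * (t - s)\<^sup>2) / real (Suc n)" for n
  proof -
    have "(\<integral>\<omega>. u n \<omega> \<partial>M) = (\<Sum>i<N. (\<integral>\<omega>. (Q n i 0 \<omega>)\<^sup>2 + (Q n i (k - 2) \<omega>)\<^sup>2 \<partial>M))"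
      unfolding u_def by (rule Bochner_Integration.integral_sum)
          (auto intro!: Bochner_Integration.integrable_add Qi)
    also have "\<dots> = (\<Sum>i<N. (\<integral>\<omega>. (Q n i 0 \<omega>)\<^sup>2 \<partial>M) + (\<integral>\<omega>. (Q n i (k - 2) \<omega>)\<^sup>2 \<partial>M))"
      by (intro sum.cong refl Bochner_Integration.integral_add Qi) auto
    also have "\<dots> \<le> (\<Sum>i<N. 8 * (t - s)\<^sup>2 / real (Suc n) + 8 * (t - s)\<^sup>2 / real (Suc n))"
      by (intro sum_mono add_mono QE) auto
    also have "\<dots> = real N * (16 * (t - s)\<^sup>2) / real (Suc n)" by simp
    finally show ?thesis .
  qed
  have lim0: "(\<lambda>n. real N * (16 * (t - s)\<^sup>2) / real (Suc n)) \<longlonglongrightarrow> 0"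
    using tendsto_mult[OF tendsto_const[of "real N * (16 * (t - s)\<^sup>2)"] LIMSEQ_Suc[OF lim_1_over_n]] by simp
  have "(\<lambda>n. \<integral>\<omega>. norm (u n \<omega>) \<partial>M) \<longlonglongrightarrow> 0"
    by (rule tendsto_sandwich[OF _ _ tendsto_const lim0]) (use u0 uE in auto)
  from tendsto_L1_AE_subseq[OF ui this]
  obtain r where r: "strict_mono r" "AE \<omega> in M. (\<lambda>n. u (r n) \<omega>) \<longlonglongrightarrow> 0" by blast
  \<comment> \<open>The sums \<open>Q n\<close> live on grids with Suc n cells, which keeps the
    number of cells positive.\<close>
  define R where "R n = Suc (r n)" for n
  have R: "strict_mono R" using r(1) by (auto simp: R_def strict_mono_def)
  have Rpos: "R n > 0" for n by (simp add: R_def)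
  have AEd: "AE \<omega> in M. \<forall>i\<in>{..<N}. set_integrable lborel {0..t} (\<lambda>u. drift i u \<omega>)"
    using jp t unfolding beta_jacobi_process_def drift_def by (subst AE_finite_all) auto
  have AEc: "AE \<omega> in M. {u. 0 \<le> u \<and> (\<exists>i<N. \<exists>j<N. i \<noteq> j \<and> \<Lambda> i u \<omega> = \<Lambda> j u \<omega>)} \<in> null_sets lborel"
    using jp unfolding beta_jacobi_process_def by blast
  have lim: "AE \<omega> in M. (\<lambda>n. \<Sum>l<R n. U k (?g (R n) l) (?g (R n) (Suc l)) \<omega>) \<longlonglongrightarrow> Y k t \<omega> - Y k s \<omega>"
    using r(2) AEd AEc AE_space
  proof eventually_elim
    case (elim \<omega>)
    have "(\<lambda>n. Q (r n) i p \<omega>) \<longlonglongrightarrow> 0" if i: "i < N" and p: "p \<in> {0, k - 2}" for i p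
    proof -
      have "(Q n i p \<omega>)\<^sup>2 \<le> u n \<omega>" for n
      proof -
        have "(Q n i p \<omega>)\<^sup>2 \<le> (Q n i 0 \<omega>)\<^sup>2 + (Q n i (k - 2) \<omega>)\<^sup>2" using p by auto
        also have "\<dots> \<le> u n \<omega>"
          unfolding u_def by (rule member_le_sum[of i "{..<N}" "\<lambda>i. (Q n i 0 \<omega>)\<^sup>2 + (Q n i (k - 2) \<omega>)\<^sup>2"])
              (use i in auto)
        finally show ?thesis .
      qed
      hence "(\<lambda>n. (Q (r n) i p \<omega>)\<^sup>2) \<longlonglongrightarrow> 0"
        by (intro tendsto_sandwich[OF _ _ tendsto_const elim(1)]) auto
      hence "(\<lambda>n. sqrt ((Q (r n) i p \<omega>)\<^sup>2)) \<longlonglongrightarrow> sqrt 0" by (intro tendsto_intros)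
      thus ?thesis by (simp add: tendsto_rabs_zero_iff)
    qed
    thus ?case
      using elim(2-4) by (intro Y_increment_limit[OF _ st k R]) (auto simp: Q_def R_def)
  qed
  have YM: "(\<lambda>\<omega>. Y k t \<omega> - Y k s \<omega>) \<in> borel_measurable (F t)"
    by (intro borel_measurable_diff Y_measurable[OF t] measurable_F_mono[OF st(2) Y_measurable[OF st(1)]])
  obtain K where K: "\<forall>\<omega>\<in>space M. \<forall>u\<in>{0..t}. \<bar>Y k u \<omega>\<bar> \<le> K" using Y_bounded by blast
  have Yb: "\<bar>Y k t \<omega> - Y k s \<omega>\<bar> \<le> 2 * K" if \<omega>: "\<omega> \<in> space M" for \<omega>
  proof -
    have "\<bar>Y k t \<omega>\<bar> \<le> K" "\<bar>Y k s \<omega>\<bar> \<le> K" using K \<omega> st by auto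
    thus ?thesis by linarith
  qed
  \<comment> \<open>Adaptedness and boundedness of the limit come from the formula for
    \<open>Y\<close>, not from the convergence.\<close>
  note fin = md_AE_limit[OF md_U_sum(1)[OF st Rpos] md_U_sum(2)[OF st Rpos] st(1) lim YM measurable_F_M[OF t
      YM] Yb]
  show "md s t (\<lambda>\<omega>. Y k t \<omega> - Y k s \<omega>)" by (rule fin(1))
  show "(\<integral>\<omega>. (Y k t \<omega> - Y k s \<omega>)\<^sup>2 \<partial>M) \<le> (real k)\<^sup>2 * (t - s) / real N" by (rule fin(2))
qed

end

section \<open>The maximal inequality\<close>

context brownian_filtration
begin

text \<open>Doob's inequality at finitely many times. The first passage events are disjoint and each
  is known at its grid time, so the later increment is orthogonal there: the mean of Z(T)^2 on such
  an event is at least the mean of Z^2 at the passage, hence at least \<epsilon>^2 times the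
  probability.\<close>

lemma doob_grid:
  fixes Z :: "real \<Rightarrow> 'w \<Rightarrow> real" and g :: "nat \<Rightarrow> real"
  assumes g: "\<And>l. l \<le> n \<Longrightarrow> 0 \<le> g l \<and> g l \<le> T" "\<And>j l. j \<le> l \<Longrightarrow> l \<le> n \<Longrightarrow> g j \<le> g l"
    and meas: "\<And>t. 0 \<le> t \<Longrightarrow> t \<le> T \<Longrightarrow> Z t \<in> borel_measurable (F t)"
    and bdd: "\<And>t \<omega>. 0 \<le> t \<Longrightarrow> t \<le> T \<Longrightarrow> \<omega> \<in> space M \<Longrightarrow> \<bar>Z t \<omega>\<bar> \<le> K"
    and mdZ: "\<And>t. 0 \<le> t \<Longrightarrow> t \<le> T \<Longrightarrow> md t T (\<lambda>\<omega>. Z T \<omega> - Z t \<omega>)"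
    and \<epsilon>: "\<epsilon> > 0"
  shows "{\<omega> \<in> space M. \<exists>l\<le>n. \<bar>Z (g l) \<omega>\<bar> > \<epsilon>} \<in> sets M"
    and "prob {\<omega> \<in> space M. \<exists>l\<le>n. \<bar>Z (g l) \<omega>\<bar> > \<epsilon>} \<le> (\<integral>\<omega>. (Z T \<omega>)\<^sup>2 \<partial>M) / \<epsilon>\<^sup>2"
proof -
  have T: "0 \<le> T" using g(1)[of 0] by simp
  have Zg: "Z (g l) \<in> borel_measurable (F (g l))" if "l \<le> n" for l using meas g(1)[OF that] by simp
  have ZgM: "Z (g l) \<in> borel_measurable M" if "l \<le> n" for l
    using measurable_F_M[OF _ Zg[OF that]] g(1)[OF that] by simp
  have ZTM[measurable]: "Z T \<in> borel_measurable M" using measurable_F_M[OF T meas[OF T order_refl]] .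
  \<comment> \<open>first passage of the level at the grid point l\<close>
  define A where "A l = {\<omega> \<in> space M. \<bar>Z (g l) \<omega>\<bar> > \<epsilon> \<and> (\<forall>j<l. \<bar>Z (g j) \<omega>\<bar> \<le> \<epsilon>)}" for l
  have AF: "A l \<in> sets (F (g l))" if l: "l \<le> n" for l
  proof -
    have Zj: "Z (g j) \<in> borel_measurable (F (g l))" if "j \<le> l" for j
      by (rule measurable_F_mono[OF g(2)[OF that l] Zg]) (use that l in simp)
    have 1: "{\<omega> \<in> space (F (g l)). \<bar>Z (g j) \<omega>\<bar> > \<epsilon>} \<in> sets (F (g l))" if "j \<le> l" for j
      by (rule borel_measurable_less[OF borel_measurable_const borel_measurable_abs[OF Zj[OF that]]])
    have 2: "A l = {\<omega> \<in> space (F (g l)). \<bar>Z (g l) \<omega>\<bar> > \<epsilon>} - (\<Union>j<l. {\<omega> \<in> space (F (g l)). \<bar>Z (g j) \<omega>\<bar> > \<epsilon>})"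
      unfolding A_def space_F by (auto simp: not_less)
    show ?thesis unfolding 2 by (intro sets.Diff sets.finite_UN 1) auto
  qed
  have AM[measurable]: "A l \<in> sets M" if "l \<le> n" for l
    using AF[OF that] subalg[of "g l"] g(1)[OF that] by (auto simp: subalgebra_def)
  have Eeq: "{\<omega> \<in> space M. \<exists>l\<le>n. \<bar>Z (g l) \<omega>\<bar> > \<epsilon>} = (\<Union>l\<le>n. A l)"
  proof
    show "{\<omega> \<in> space M. \<exists>l\<le>n. \<bar>Z (g l) \<omega>\<bar> > \<epsilon>} \<subseteq> (\<Union>l\<le>n. A l)"
    proof
      fix \<omega> assume "\<omega> \<in> {\<omega> \<in> space M. \<exists>l\<le>n. \<bar>Z (g l) \<omega>\<bar> > \<epsilon>}"
      then obtain l0 where \<omega>: "\<omega> \<in> space M" and l0: "l0 \<le> n" "\<bar>Z (g l0) \<omega>\<bar> > \<epsilon>" by auto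
      define l where "l = (LEAST l. \<bar>Z (g l) \<omega>\<bar> > \<epsilon>)"
      have "\<bar>Z (g l) \<omega>\<bar> > \<epsilon>" unfolding l_def by (rule LeastI[of _ l0]) (rule l0(2))
      moreover have "l \<le> l0" unfolding l_def by (rule Least_le) (rule l0(2))
      moreover have "\<bar>Z (g j) \<omega>\<bar> \<le> \<epsilon>" if "j < l" for j
        using not_less_Least[OF that[unfolded l_def]] by simp
      ultimately show "\<omega> \<in> (\<Union>l\<le>n. A l)" using \<omega> l0(1) by (auto simp: A_def intro!: exI[of _ l])
    qed
  qed (auto simp: A_def)
  show "{\<omega> \<in> space M. \<exists>l\<le>n. \<bar>Z (g l) \<omega>\<bar> > \<epsilon>} \<in> sets M" unfolding Eeq by (intro sets.finite_UN AM) auto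
  have disj: "disjoint_family_on A {..n}"
    unfolding disjoint_family_on_def
  proof (intro ballI impI)
    fix i j :: nat assume "i \<noteq> j"
    thus "A i \<inter> A j = {}" using nat_neq_iff[of i j] by (force simp: A_def)
  qed
  have ZT2: "integrable M (\<lambda>\<omega>. (Z T \<omega>)\<^sup>2)"
  proof (rule integrable_const_bound[where B = "K\<^sup>2"])
    show "AE \<omega> in M. norm ((Z T \<omega>)\<^sup>2) \<le> K\<^sup>2"
    proof (rule AE_I2)
      fix \<omega> assume "\<omega> \<in> space M"
      from power_mono[OF bdd[OF T order_refl this] abs_ge_zero, of 2]
      show "norm ((Z T \<omega>)\<^sup>2) \<le> K\<^sup>2" by simp
    qed
  qed measurable
  have step: "\<epsilon>\<^sup>2 * prob (A l) \<le> (\<integral>\<omega>. indicator (A l) \<omega> * (Z T \<omega>)\<^sup>2 \<partial>M)" if l: "l \<le> n" for l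
  proof -
    note gl = g(1)[OF l, THEN conjunct1] g(1)[OF l, THEN conjunct2]
    note [measurable] = AM[OF l] ZgM[OF l]
    define I :: "'w \<Rightarrow> real" where "I = indicator (A l)"
    have Im[measurable]: "I \<in> borel_measurable M" unfolding I_def by simp
    have md0: "(\<integral>\<omega>. (I \<omega> * Z (g l) \<omega>) * (Z T \<omega> - Z (g l) \<omega>) \<partial>M) = 0"
    proof (rule mdD(3)[OF mdZ[OF gl]])
      have "I \<in> borel_measurable (F (g l))" unfolding I_def using AF[OF l] by simp
      thus "(\<lambda>\<omega>. I \<omega> * Z (g l) \<omega>) \<in> borel_measurable (F (g l))" using Zg[OF l]
        by (rule borel_measurable_times)
      fix \<omega> assume \<omega>: "\<omega> \<in> space M"
      show "\<bar>I \<omega> * Z (g l) \<omega>\<bar> \<le> K"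
        using bdd[OF gl \<omega>] order_trans[OF abs_ge_zero bdd[OF gl \<omega>]] by (simp add: I_def indicator_def)
    qed
    have b: "\<bar>Z (g l) \<omega>\<bar> \<le> K" "\<bar>Z T \<omega>\<bar> \<le> K" "\<bar>Z T \<omega> - Z (g l) \<omega>\<bar> \<le> 2 * K" if "\<omega> \<in> space M" for \<omega>
      using bdd[OF gl that] bdd[OF T order_refl that] by linarith+
    have i1: "integrable M (\<lambda>\<omega>. (I \<omega> * Z (g l) \<omega>) * (Z T \<omega> - Z (g l) \<omega>))"
    proof (rule integrable_const_bound[where B = "(1 * K) * (2 * K)"])
      show "AE \<omega> in M. norm ((I \<omega> * Z (g l) \<omega>) * (Z T \<omega> - Z (g l) \<omega>)) \<le> (1 * K) * (2 * K)"
      proof (rule AE_I2)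
        fix \<omega> assume \<omega>: "\<omega> \<in> space M"
        have "0 \<le> K" using b(1)[OF \<omega>] by linarith
        thus "norm ((I \<omega> * Z (g l) \<omega>) * (Z T \<omega> - Z (g l) \<omega>)) \<le> (1 * K) * (2 * K)"
          unfolding real_norm_def abs_mult using b[OF \<omega>]
          by (intro mult_mono) (auto simp: I_def indicator_def)
      qed
    qed measurable
    have i2: "integrable M (\<lambda>\<omega>. I \<omega> * (Z T \<omega>)\<^sup>2)"
      using integrable_real_mult_indicator[OF AM[OF l] ZT2] unfolding I_def by (simp only: mult.commute)
    have i3: "integrable M I" unfolding I_def using AM[OF l]
      by (simp add: integrable_indicator_iff emeasure_eq_measure)
    have "\<epsilon>\<^sup>2 * prob (A l) = (\<integral>\<omega>. \<epsilon>\<^sup>2 * I \<omega> \<partial>M)" unfolding I_def using AM[OF l] by simp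
    also have "\<dots> \<le> (\<integral>\<omega>. I \<omega> * (Z T \<omega>)\<^sup>2 - 2 * ((I \<omega> * Z (g l) \<omega>) * (Z T \<omega> - Z (g l) \<omega>)) \<partial>M)"
    proof (rule integral_mono)
      fix \<omega> assume \<omega>: "\<omega> \<in> space M"
      show "\<epsilon>\<^sup>2 * I \<omega> \<le> I \<omega> * (Z T \<omega>)\<^sup>2 - 2 * ((I \<omega> * Z (g l) \<omega>) * (Z T \<omega> - Z (g l) \<omega>))"
      proof (cases "\<omega> \<in> A l")
        case True
        hence "\<bar>\<epsilon>\<bar> \<le> \<bar>Z (g l) \<omega>\<bar>" using \<epsilon> by (simp add: A_def)
        hence "\<epsilon>\<^sup>2 \<le> (Z (g l) \<omega>)\<^sup>2" by (simp only: abs_le_square_iff)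
        \<comment> \<open>Completion of the square; the subtracted product has mean 0 on the passage
          event by the martingale property.\<close>
        moreover have "(Z T \<omega>)\<^sup>2 - 2 * (Z (g l) \<omega> * (Z T \<omega> - Z (g l) \<omega>))
            = (Z T \<omega> - Z (g l) \<omega>)\<^sup>2 + (Z (g l) \<omega>)\<^sup>2"
          by (simp add: power2_eq_square algebra_simps)
        ultimately have "\<epsilon>\<^sup>2 \<le> (Z T \<omega>)\<^sup>2 - 2 * (Z (g l) \<omega> * (Z T \<omega> - Z (g l) \<omega>))"
          using zero_le_power2[of "Z T \<omega> - Z (g l) \<omega>"] by linarith
        thus ?thesis using True by (simp add: I_def)
      qed (simp add: I_def)
    qed (use i1 i2 i3 in auto)
    also have "\<dots> = (\<integral>\<omega>. I \<omega> * (Z T \<omega>)\<^sup>2 \<partial>M)" using i1 i2 md0 by simp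
    finally show ?thesis unfolding I_def .
  qed
  have "\<epsilon>\<^sup>2 * prob (\<Union>l\<le>n. A l) = (\<Sum>l\<le>n. \<epsilon>\<^sup>2 * prob (A l))"
    by (subst finite_measure_finite_Union[OF _ _ disj]) (use AM in \<open>auto simp: sum_distrib_left\<close>)
  also have "\<dots> \<le> (\<Sum>l\<le>n. \<integral>\<omega>. indicator (A l) \<omega> * (Z T \<omega>)\<^sup>2 \<partial>M)"
    by (intro sum_mono step) auto
  also have "\<dots> = (\<integral>\<omega>. (\<Sum>l\<le>n. indicator (A l) \<omega> * (Z T \<omega>)\<^sup>2) \<partial>M)"
  proof (rule Bochner_Integration.integral_sum[symmetric])
    fix l assume "l \<in> {..n}"
    hence "A l \<in> sets M" using AM by simp
    from integrable_real_mult_indicator[OF this ZT2]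
    show "integrable M (\<lambda>\<omega>. indicator (A l) \<omega> * (Z T \<omega>)\<^sup>2)" by (simp add: mult.commute)
  qed
  also have "\<dots> = (\<integral>\<omega>. (Z T \<omega>)\<^sup>2 * indicator (\<Union>l\<le>n. A l) \<omega> \<partial>M)"
    by (simp add: sum_distrib_right[symmetric] indicator_UN_disjoint[OF _ disj] mult.commute)
  also have "\<dots> \<le> (\<integral>\<omega>. (Z T \<omega>)\<^sup>2 \<partial>M)"
  proof (rule integral_mono[OF integrable_real_mult_indicator[OF _ ZT2] ZT2])
    show "(\<Union>l\<le>n. A l) \<in> sets M" by (intro sets.finite_UN AM) auto
  qed (simp add: indicator_def)
  finally show "prob {\<omega> \<in> space M. \<exists>l\<le>n. \<bar>Z (g l) \<omega>\<bar> > \<epsilon>} \<le> (\<integral>\<omega>. (Z T \<omega>)\<^sup>2 \<partial>M) / \<epsilon>\<^sup>2"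
    unfolding Eeq using \<epsilon> by (simp add: field_simps)
qed

text \<open>By continuity, a path that exceeds \<epsilon> somewhere does so at a point of every
  sufficiently fine grid. The event is thus the lower limit of the grid events, and their bound does
  not depend on the grid.\<close>

lemma doob_maximal:
  fixes Z :: "real \<Rightarrow> 'w \<Rightarrow> real"
  assumes T: "0 < T"
    and cont: "\<And>\<omega>. \<omega> \<in> space M \<Longrightarrow> continuous_on {0..T} (\<lambda>t. Z t \<omega>)"
    and meas: "\<And>t. 0 \<le> t \<Longrightarrow> t \<le> T \<Longrightarrow> Z t \<in> borel_measurable (F t)"
    and bdd: "\<And>t \<omega>. 0 \<le> t \<Longrightarrow> t \<le> T \<Longrightarrow> \<omega> \<in> space M \<Longrightarrow> \<bar>Z t \<omega>\<bar> \<le> K"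
    and mdZ: "\<And>t. 0 \<le> t \<Longrightarrow> t \<le> T \<Longrightarrow> md t T (\<lambda>\<omega>. Z T \<omega> - Z t \<omega>)"
    and \<epsilon>: "\<epsilon> > 0"
  shows "{\<omega> \<in> space M. \<exists>t\<in>{0..T}. \<bar>Z t \<omega>\<bar> > \<epsilon>} \<in> sets M"
    and "prob {\<omega> \<in> space M. \<exists>t\<in>{0..T}. \<bar>Z t \<omega>\<bar> > \<epsilon>} \<le> (\<integral>\<omega>. (Z T \<omega>)\<^sup>2 \<partial>M) / \<epsilon>\<^sup>2"
proof -
  define g where "g m l = real l * T / real (Suc m)" for m l :: nat
  define E where "E m = {\<omega> \<in> space M. \<exists>l\<le>Suc m. \<bar>Z (g m l) \<omega>\<bar> > \<epsilon>}" for m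
  have g: "0 \<le> g m l \<and> g m l \<le> T" if "l \<le> Suc m" for m l
  proof -
    have "real l * T \<le> real (Suc m) * T" using that T by (intro mult_right_mono) auto
    thus ?thesis using T by (simp add: g_def divide_le_eq mult.commute)
  qed
  have gm: "g m j \<le> g m l" if "j \<le> l" for m j l
    unfolding g_def using that T by (intro divide_right_mono mult_right_mono) auto
  have E: "E m \<in> sets M" "prob (E m) \<le> (\<integral>\<omega>. (Z T \<omega>)\<^sup>2 \<partial>M) / \<epsilon>\<^sup>2" for m
    unfolding E_def by (rule doob_grid[of "Suc m" "g m" T Z K, OF g gm meas bdd mdZ \<epsilon>], assumption+)+
  \<comment> \<open>The grids are not nested, so the grid events need not increase; their tail
    intersections do.\<close>
  define E' where "E' n = (\<Inter>m\<in>{n..}. E m)" for n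
  have E'M: "E' n \<in> sets M" for n unfolding E'_def by (intro sets.countable_INT') (auto simp: E(1))
  have eq: "{\<omega> \<in> space M. \<exists>t\<in>{0..T}. \<bar>Z t \<omega>\<bar> > \<epsilon>} = (\<Union>n. E' n)"
  proof
    show "{\<omega> \<in> space M. \<exists>t\<in>{0..T}. \<bar>Z t \<omega>\<bar> > \<epsilon>} \<subseteq> (\<Union>n. E' n)"
    proof
      fix \<omega> assume "\<omega> \<in> {\<omega> \<in> space M. \<exists>t\<in>{0..T}. \<bar>Z t \<omega>\<bar> > \<epsilon>}"
      then obtain t where \<omega>: "\<omega> \<in> space M" and t: "t \<in> {0..T}" "\<bar>Z t \<omega>\<bar> > \<epsilon>" by auto
      have "0 < \<bar>Z t \<omega>\<bar> - \<epsilon>" using t(2) by simp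
      with cont[OF \<omega>] t(1) have "\<exists>d>0. \<forall>u\<in>{0..T}. dist u t < d \<longrightarrow> dist (Z u \<omega>) (Z t \<omega>) < \<bar>Z t \<omega>\<bar> - \<epsilon>"
        unfolding continuous_on_iff by (auto simp only:)
      then obtain d where d: "d > 0" "\<And>u. u \<in> {0..T} \<Longrightarrow> dist u t < d \<Longrightarrow> dist (Z u \<omega>) (Z t \<omega>) < \<bar>Z t \<omega>\<bar> - \<epsilon>"
        by auto
      obtain n where n: "T / d < real n" using reals_Archimedean2 by blast
      have "\<omega> \<in> E m" if "m \<ge> n" for m
      proof -
        obtain j where j: "j < Suc m" "t \<in> {real j * T / real (Suc m)..real (Suc j) * T / real (Suc m)}"
          using grid_cell_exists[OF t(1), of "Suc m"] T by auto
        have "real (Suc j) * T / real (Suc m) - real j * T / real (Suc m) = T / real (Suc m)"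
          unfolding diff_divide_distrib[symmetric] of_nat_Suc[of j] by (simp add: algebra_simps)
        moreover have "T / real (Suc m) < d"
        proof -
          have "T / d < real (Suc m)" using n that by simp
          thus ?thesis using d(1) by (simp add: field_simps)
        qed
        ultimately have "dist (g m j) t < d" using j(2) by (auto simp: g_def dist_real_def)
        with d(2)[of "g m j"] g[of j m] j(1) have "dist (Z (g m j) \<omega>) (Z t \<omega>) < \<bar>Z t \<omega>\<bar> - \<epsilon>" by simp
        hence "\<bar>Z (g m j) \<omega>\<bar> > \<epsilon>" unfolding dist_real_def by linarith
        thus ?thesis unfolding E_def using \<omega> j(1) by (auto intro!: exI[of _ j])
      qed
      thus "\<omega> \<in> (\<Union>n. E' n)" by (auto simp: E'_def)
    qed
    show "(\<Union>n. E' n) \<subseteq> {\<omega> \<in> space M. \<exists>t\<in>{0..T}. \<bar>Z t \<omega>\<bar> > \<epsilon>}"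
    proof
      fix \<omega> assume "\<omega> \<in> (\<Union>n. E' n)"
      then obtain n where "\<omega> \<in> E n" by (auto simp: E'_def)
      then obtain l where "\<omega> \<in> space M" "l \<le> Suc n" "\<bar>Z (g n l) \<omega>\<bar> > \<epsilon>" by (auto simp: E_def)
      thus "\<omega> \<in> {\<omega> \<in> space M. \<exists>t\<in>{0..T}. \<bar>Z t \<omega>\<bar> > \<epsilon>}" using g[of l n] by (auto intro!: bexI[of _ "g n l"])
    qed
  qed
  show "{\<omega> \<in> space M. \<exists>t\<in>{0..T}. \<bar>Z t \<omega>\<bar> > \<epsilon>} \<in> sets M" unfolding eq using E'M by auto
  have inc: "incseq E'" by (auto simp: incseq_def E'_def)
  have lim: "(\<lambda>n. prob (E' n)) \<longlonglongrightarrow> prob (\<Union>n. E' n)"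
    by (rule finite_Lim_measure_incseq[OF _ inc]) (use E'M in auto)
  have "prob (E' n) \<le> (\<integral>\<omega>. (Z T \<omega>)\<^sup>2 \<partial>M) / \<epsilon>\<^sup>2" for n
    by (rule order_trans[OF finite_measure_mono[OF _ E(1)[of n]] E(2)[of n]]) (auto simp: E'_def)
  thus "prob {\<omega> \<in> space M. \<exists>t\<in>{0..T}. \<bar>Z t \<omega>\<bar> > \<epsilon>} \<le> (\<integral>\<omega>. (Z T \<omega>)\<^sup>2 \<partial>M) / \<epsilon>\<^sup>2"
    unfolding eq by (intro LIMSEQ_le_const2[OF lim]) auto
qed

end

lemma (in jacobi_process) Y_maximal:
  assumes T: "0 < T" and k: "k \<ge> 1" and \<epsilon>: "\<epsilon> > 0"
  shows "{\<omega> \<in> space M. \<exists>t\<in>{0..T}. \<bar>Y k t \<omega>\<bar> > \<epsilon>} \<in> sets M"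
    and "prob {\<omega> \<in> space M. \<exists>t\<in>{0..T}. \<bar>Y k t \<omega>\<bar> > \<epsilon>} \<le> (real k)\<^sup>2 * T / real N / \<epsilon>\<^sup>2"
proof -
  obtain K where K: "\<forall>\<omega>\<in>space M. \<forall>t\<in>{0..T}. \<bar>Y k t \<omega>\<bar> \<le> K" using Y_bounded by (rule exE)
  have b: "\<bar>Y k t \<omega>\<bar> \<le> K" if "0 \<le> t" "t \<le> T" "\<omega> \<in> space M" for t \<omega> using K that by simp
  note D = doob_maximal[of T "Y k" K, OF T Y_continuous Y_measurable b md_Y(1)[OF _ _ k] \<epsilon>]
  show "{\<omega> \<in> space M. \<exists>t\<in>{0..T}. \<bar>Y k t \<omega>\<bar> > \<epsilon>} \<in> sets M" by (rule D(1))
  have Y0: "Y k 0 \<omega> = 0" if "\<omega> \<in> space M" for \<omega> using that by (simp add: Y_eq)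
  have "(\<integral>\<omega>. (Y k T \<omega>)\<^sup>2 \<partial>M) = (\<integral>\<omega>. (Y k T \<omega> - Y k 0 \<omega>)\<^sup>2 \<partial>M)"
    by (intro Bochner_Integration.integral_cong refl) (simp add: Y0)
  also have "\<dots> \<le> (real k)\<^sup>2 * T / real N" using md_Y(2)[of 0 T k] T k by simp
  finally have "(\<integral>\<omega>. (Y k T \<omega>)\<^sup>2 \<partial>M) / \<epsilon>\<^sup>2 \<le> (real k)\<^sup>2 * T / real N / \<epsilon>\<^sup>2" by (rule divide_right_mono) simp
  with D(2) show "prob {\<omega> \<in> space M. \<exists>t\<in>{0..T}. \<bar>Y k t \<omega>\<bar> > \<epsilon>} \<le> (real k)\<^sup>2 * T / real N / \<epsilon>\<^sup>2" by linarith
qed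

section \<open>Stability of the moment hierarchy\<close>

text \<open>The end terms p = 0 and p = k of the second convolution are both S k; they are the
  origin of 2 c in \<open>moment_rate\<close>. What finite N adds to the limiting drift is a
  perturbation with the coefficients \<beta> N / 2 - c and \<beta> / 2.\<close>

lemma power_sum_drift_moment_forcing:
  assumes k: "k \<ge> 1" and S0: "S 0 = 1"
  shows "power_sum_drift a b \<beta> N k S = - moment_rate a b c k * S k + moment_forcing a c k S
    + (\<beta> * real N / 2 - c) * (real k * ((\<Sum>p<k. S p * S (k - 1 - p)) - (\<Sum>p\<le>k. S p * S (k - p))))
    + \<beta> / 2 * (real k * ((real k + 1) * S k - real k * S (k - 1)))"
proof -
  have "{..k} = insert 0 (insert k {1..<k})" using k by auto
  hence "(\<Sum>p\<le>k. S p * S (k - p)) = 2 * S k + (\<Sum>p\<in>{1..<k}. S p * S (k - p))"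
    using k by (simp add: S0)
  thus ?thesis
    unfolding power_sum_drift_def moment_rate_def moment_forcing_def by (simp add: algebra_simps)
qed

lemma power_sum_drift_approx:
  assumes k: "k \<ge> 1" and S0: "S 0 = 1" and S: "\<And>p. S p \<in> {0..1}"
  shows "\<bar>power_sum_drift a b \<beta> N k S - (- moment_rate a b c k * S k + moment_forcing a c k S)\<bar>
    \<le> (\<bar>\<beta> * real N / 2 - c\<bar> + \<bar>\<beta> / 2\<bar>) * (real k * (2 * real k + 1))"
proof -
  have S01: "0 \<le> S p" "S p \<le> 1" for p using S[of p] by auto
  have ss: "0 \<le> S p * S q" "S p * S q \<le> 1" for p q using S01 by (auto intro: mult_le_one)
  have "0 \<le> (\<Sum>p<k. S p * S (k - 1 - p))" "(\<Sum>p<k. S p * S (k - 1 - p)) \<le> real k"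
    using sum_bounded_above[of "{..<k}" "\<lambda>p. S p * S (k - 1 - p)" 1] ss by (auto intro: sum_nonneg)
  moreover have "0 \<le> (\<Sum>p\<le>k. S p * S (k - p))" "(\<Sum>p\<le>k. S p * S (k - p)) \<le> real k + 1"
    using sum_bounded_above[of "{..k}" "\<lambda>p. S p * S (k - p)" 1] ss by (auto intro: sum_nonneg)
  ultimately have "\<bar>(\<Sum>p<k. S p * S (k - 1 - p)) - (\<Sum>p\<le>k. S p * S (k - p))\<bar> \<le> 2 * real k + 1" by linarith
  hence 1: "\<bar>(\<beta> * real N / 2 - c) * (real k * ((\<Sum>p<k. S p * S (k - 1 - p)) - (\<Sum>p\<le>k. S p * S (k - p))))\<bar>
     \<le> \<bar>\<beta> * real N / 2 - c\<bar> * (real k * (2 * real k + 1))"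
    unfolding abs_mult abs_of_nat by (intro mult_left_mono) auto
  have "\<bar>(real k + 1) * y - real k * z\<bar> \<le> 2 * real k + 1" if "0 \<le> y" "y \<le> 1" "0 \<le> z" "z \<le> 1" for y z
  proof -
    have "(real k + 1) * y \<le> real k + 1" "real k * z \<le> real k" "0 \<le> (real k + 1) * y" "0 \<le> real k * z"
      using that by (simp_all add: mult_left_le)
    thus ?thesis by linarith
  qed
  hence "\<bar>(real k + 1) * S k - real k * S (k - 1)\<bar> \<le> 2 * real k + 1" using S01 by blast
  hence 2: "\<bar>\<beta> / 2 * (real k * ((real k + 1) * S k - real k * S (k - 1)))\<bar>
      \<le> \<bar>\<beta> / 2\<bar> * (real k * (2 * real k + 1))"
    unfolding abs_mult[of "\<beta> / 2"] abs_mult[of "real k"] abs_of_nat by (intro mult_left_mono) auto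
  show ?thesis
    unfolding power_sum_drift_moment_forcing[where S = S, OF k S0, of a b \<beta> N c]
        distrib_right[of "\<bar>\<beta> * real N / 2 - c\<bar>"] using 1 2 by linarith
qed

lemma has_real_derivative_integral:
  fixes f g :: "real \<Rightarrow> real"
  assumes f: "\<And>t. t \<ge> 0 \<Longrightarrow> (f has_real_derivative g t) (at t within {0..})" and t: "t \<ge> 0"
  shows "f t - f 0 = integral {0..t} g"
proof -
  have "(g has_integral (f t - f 0)) {0..t}"
  proof (rule fundamental_theorem_of_calculus[OF t])
    fix s assume "s \<in> {0..t}"
    hence "(f has_real_derivative g s) (at s within {0..t})"
      by (intro DERIV_subset[OF f]) auto
    thus "(f has_vector_derivative g s) (at s within {0..t})"
      by (simp add: has_real_derivative_iff_has_vector_derivative)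
  qed
  thus ?thesis by (simp add: integral_unique)
qed

lemma uniform_limit_moment_forcing:
  fixes x :: "nat \<Rightarrow> nat \<Rightarrow> real \<Rightarrow> real"
  assumes k: "k \<ge> 1" and x: "\<And>i. i < k \<Longrightarrow> uniform_limit A (\<lambda>n. x n i) (m i) sequentially"
    and bdd: "\<And>i. i < k \<Longrightarrow> bounded (m i ` A)"
  shows "uniform_limit A (\<lambda>n t. moment_forcing a c k (\<lambda>i. x n i t)) (\<lambda>t.
      moment_forcing a c k (\<lambda>i. m i t)) sequentially"
proof -
  have pr: "uniform_limit A (\<lambda>n t. x n i t * x n j t) (\<lambda>t. m i t * m j t) sequentially" if "i < k" "j < k"
      for i j
    using that by (intro uniform_lim_mult x bdd)
  have cm: "uniform_limit A (\<lambda>n t. r * f n t) (\<lambda>t. r * g t) sequentially"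
    if "uniform_limit A f g sequentially" for r :: real and f :: "nat \<Rightarrow> real \<Rightarrow> real" and g
    using bounded_linear.uniform_limit[OF bounded_linear_mult_right[of r] that] .
  have sm: "uniform_limit A (\<lambda>n t. \<Sum>i\<in>I. f i n t) (\<lambda>t. \<Sum>i\<in>I. g i t) sequentially"
    if "finite I" "\<And>i. i \<in> I \<Longrightarrow> uniform_limit A (f i) (g i) sequentially"
    for I :: "nat set" and f :: "nat \<Rightarrow> nat \<Rightarrow> real \<Rightarrow> real" and g
    using that by (induction I rule: finite_induct) (auto intro: uniform_limit_add uniform_limit_const)
  show ?thesis
    unfolding moment_forcing_def
    by (intro uniform_limit_add uniform_limit_minus sm cm x pr) (use k in auto)
qed

text \<open>The functions \<open>x n\<close> solve the hierarchy only in integrated form and up to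
  an error \<delta> n. The forcing of level k converges uniformly by induction, and Gronwall's
  inequality takes care of the linear term.\<close>

lemma moment_stability_seq:
  fixes x :: "nat \<Rightarrow> nat \<Rightarrow> real \<Rightarrow> real"
  assumes m: "moment_ivp a b c S0 m" and T: "T > 0" and r: "\<And>j. j \<ge> 1 \<Longrightarrow> moment_rate a b c j > 0"
    and x0: "\<And>n t. t \<ge> 0 \<Longrightarrow> x n 0 t = 1"
    and cont: "\<And>n j. continuous_on {0..} (x n j)"
    and init: "\<And>n j. 1 \<le> j \<Longrightarrow> j \<le> K \<Longrightarrow> \<bar>x n j 0 - m j 0\<bar> \<le> \<delta> n"
    and err: "\<And>n j t. 1 \<le> j \<Longrightarrow> j \<le> K \<Longrightarrow> t \<in> {0..T} \<Longrightarrow>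
      \<bar>x n j t - x n j 0 - integral {0..t}
          (\<lambda>s. - moment_rate a b c j * x n j s + moment_forcing a c j (\<lambda>i. x n i s))\<bar> \<le> \<delta> n"
    and \<delta>: "\<delta> \<longlonglongrightarrow> 0"
  shows "k \<le> K \<Longrightarrow> uniform_limit {0..T} (\<lambda>n. x n k) (m k) sequentially"
proof (induction k rule: less_induct)
  case (less k)
  note m' = m[unfolded moment_ivp_iff]
  have mc: "continuous_on {0..} (m i)" for i by (rule moment_ivp_continuous_on[OF m])
  show ?case
  proof (cases "k = 0")
    case True
    have "x n 0 t = m 0 t" if "t \<in> {0..T}" for n t using x0[of t n] m' that by auto
    thus ?thesis unfolding True uniform_limit_iff by simp
  next
    case False
    hence k: "k \<ge> 1" by simp
    let ?r = "moment_rate a b c k"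
    let ?f = "\<lambda>y t. moment_forcing a c k (\<lambda>i. y i t)"
    have uf: "uniform_limit {0..T} (\<lambda>n. ?f (x n)) (?f m) sequentially"
    proof (rule uniform_limit_moment_forcing[OF k])
      show "uniform_limit {0..T} (\<lambda>n. x n i) (m i) sequentially" if "i < k" for i
        using less that by simp
      show "bounded (m i ` {0..T})" for i
        by (rule compact_imp_bounded[OF compact_continuous_image[OF continuous_on_subset[OF mc]
            compact_Icc]]) auto
    qed
    have fc: "continuous_on {0..} (?f (x n))" "continuous_on {0..} (?f m)" for n
      by (rule continuous_on_moment_forcing[OF k], rule cont)
          (rule continuous_on_moment_forcing[OF k], rule mc)
    show ?thesis
      unfolding uniform_limit_iff
    proof (intro allI impI)
      fix \<epsilon> :: real assume \<epsilon>: "\<epsilon> > 0"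
      \<comment> \<open>The 2 stands for the error of the initial value and that of the equation, T
        for the integrated error of the forcing, and the exponential comes from Gronwall's
        inequality.\<close>
      define P where "P = (2 + T) * exp (?r * T)"
      have P: "P > 0" using T by (simp add: P_def)
      define e where "e = \<epsilon> / (2 * P)"
      have e: "e > 0" using \<epsilon> P by (simp add: e_def)
      have "\<forall>\<^sub>F n in sequentially. \<forall>t\<in>{0..T}. dist (?f (x n) t) (?f m t) < e"
        using uf e unfolding uniform_limit_iff by simp
      moreover have "\<forall>\<^sub>F n in sequentially. \<delta> n < e" using order_tendstoD(2)[OF \<delta> e] .
      ultimately show "\<forall>\<^sub>F n in sequentially. \<forall>t\<in>{0..T}. dist (x n k t) (m k t) < \<epsilon>"
      proof eventually_elim
        case (elim n)
        define u where "u t = \<bar>x n k t - m k t\<bar>" for t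
        have uc: "continuous_on {0..} u" unfolding u_def by (intro continuous_intros cont mc)
        have ucT: "continuous_on {0..T} u" by (rule continuous_on_subset[OF uc]) auto
        have "u t \<le> (2 + T) * e + ?r * integral {0..t} u" if t: "t \<in> {0..T}" for t
        proof -
          have t0: "t \<ge> 0" using t by simp
          have int: "f integrable_on {0..t}" if "continuous_on {0..} f" for f :: "real \<Rightarrow> real"
            by (rule integrable_continuous_interval[OF continuous_on_subset[OF that]]) auto
          have i1: "(\<lambda>s. - ?r * x n k s + ?f (x n) s) integrable_on {0..t}"
            by (intro int continuous_intros cont fc)
          have i2: "(\<lambda>s. - ?r * m k s + ?f m s) integrable_on {0..t}"
            by (intro int continuous_intros mc fc)
          have iu: "(\<lambda>s. e + ?r * u s) integrable_on {0..t}" by (intro int continuous_intros uc)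
          have "m k t - m k 0 = integral {0..t} (\<lambda>s. - ?r * m k s + ?f m s)"
            by (rule has_real_derivative_integral[OF _ t0]) (use m' k in auto)
          moreover have "\<bar>x n k t - x n k 0 - integral {0..t} (\<lambda>s. - ?r * x n k s + ?f (x n) s)\<bar> \<le> \<delta> n"
            by (rule err[OF k less.prems t])
          moreover have "\<bar>x n k 0 - m k 0\<bar> \<le> \<delta> n" by (rule init[OF k less.prems])
          moreover have "\<bar>integral {0..t} (\<lambda>s. - ?r * x n k s + ?f (x n) s)
              - integral {0..t} (\<lambda>s. - ?r * m k s + ?f m s)\<bar>
             \<le> integral {0..t} (\<lambda>s. e + ?r * u s)"
            unfolding Henstock_Kurzweil_Integration.integral_diff[OF i1 i2, symmetric]
                real_norm_def[symmetric]
          proof (rule integral_norm_bound_integral[OF Henstock_Kurzweil_Integration.integrable_diff[OF i1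
              i2] iu])
            fix s assume "s \<in> {0..t}"
            hence "dist (?f (x n) s) (?f m s) < e" using elim(1) t by auto
            moreover have "- ?r * x n k s + ?f (x n) s - (- ?r * m k s + ?f m s)
               = (?f (x n) s - ?f m s) - ?r * (x n k s - m k s)" by (simp add: algebra_simps)
            moreover have "\<bar>?r * (x n k s - m k s)\<bar> = ?r * u s" using r[OF k] by (simp add: abs_mult u_def)
            ultimately show "norm (- ?r * x n k s + ?f (x n) s - (- ?r * m k s + ?f m s)) \<le> e + ?r * u s"
              unfolding dist_real_def real_norm_def by linarith
          qed
          moreover have "integral {0..t} (\<lambda>s. e + ?r * u s) = t * e + ?r * integral {0..t} u"
            using t0 int[OF uc] by (subst Henstock_Kurzweil_Integration.integral_add)
                (auto intro: integrable_on_mult_right)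
          moreover have "t * e \<le> T * e" using t e by (intro mult_right_mono) auto
          ultimately show ?thesis using elim(2) unfolding u_def[of t] distrib_right by linarith
        qed
        note gr = gronwall[OF ucT less_imp_le[OF r[OF k]] this]
        show ?case
        proof
          fix t assume t: "t \<in> {0..T}"
          have "u t \<le> (2 + T) * e * exp (?r * t)" by (rule gr[OF _ t]) auto
          also have "\<dots> \<le> (2 + T) * e * exp (?r * T)"
            using t T e r[OF k] by (intro mult_left_mono) auto
          also have "\<dots> = P * e" by (simp add: P_def)
          also have "\<dots> = \<epsilon> / 2" using P by (simp add: e_def)
          also have "\<dots> < \<epsilon>" using \<epsilon> by simp
          finally show "dist (x n k t) (m k t) < \<epsilon>" by (simp add: u_def dist_real_def)
        qed
      qed
    qed
  qed
qed

text \<open>The sequential version as a threshold: counterexamples for 1 / (n + 1) would form a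
  sequence that contradicts it. The threshold depends neither on N nor on the path, so it applies to
  every sample path outside an exceptional event.\<close>

lemma moment_stability:
  assumes m: "moment_ivp a b c S0 m" and T: "T > 0" and r: "\<And>j. j \<ge> 1 \<Longrightarrow> moment_rate a b c j > 0"
    and \<epsilon>: "\<epsilon> > 0"
  shows "\<exists>\<delta>>0. \<forall>x :: nat \<Rightarrow> real \<Rightarrow> real. (\<forall>t\<ge>0. x 0 t = 1) \<longrightarrow> (\<forall>j. continuous_on {0..} (x j)) \<longrightarrow>
     (\<forall>j\<in>{1..k}. \<bar>x j 0 - m j 0\<bar> \<le> \<delta> \<and> (\<forall>t\<in>{0..T}.
      \<bar>x j t - x j 0 - integral {0..t}
          (\<lambda>s. - moment_rate a b c j * x j s + moment_forcing a c j (\<lambda>i. x i s))\<bar> \<le> \<delta>)) \<longrightarrow>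
     (\<forall>t\<in>{0..T}. \<bar>x k t - m k t\<bar> \<le> \<epsilon>)" (is "\<exists>\<delta>>0. \<forall>x. ?A x \<longrightarrow> ?B x \<longrightarrow> ?C \<delta> x \<longrightarrow> ?D x")
proof (rule ccontr)
  assume *: "\<not> ?thesis"
  have "\<exists>x. ?A x \<and> ?B x \<and> ?C (1 / real (Suc n)) x \<and> \<not> ?D x" for n
  proof -
    have "1 / real (Suc n) > 0" by simp
    with * show ?thesis by blast
  qed
  hence "\<exists>x. \<forall>n. ?A (x n) \<and> ?B (x n) \<and> ?C (1 / real (Suc n)) (x n) \<and> \<not> ?D (x n)"
    by (intro choice allI)
  then obtain x where x': "\<forall>n. ?A (x n) \<and> ?B (x n) \<and> ?C (1 / real (Suc n)) (x n) \<and> \<not> ?D (x n)"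
    by (rule exE)
  have x: "?A (x n)" "?B (x n)" "?C (1 / real (Suc n)) (x n)" "\<not> ?D (x n)" for n
    using x'[rule_format, of n] by blast+
  have "uniform_limit {0..T} (\<lambda>n. x n k) (m k) sequentially"
  proof (rule moment_stability_seq[OF m T r, where K = k and \<delta> = "\<lambda>n. 1 / real (Suc n)"])
    show "(\<lambda>n. 1 / real (Suc n)) \<longlonglongrightarrow> 0" by (rule LIMSEQ_Suc[OF lim_1_over_n])
  qed (use x(1-3) in auto)
  hence "\<forall>\<^sub>F n in sequentially. \<forall>t\<in>{0..T}. dist (x n k t) (m k t) < \<epsilon>"
    using \<epsilon> unfolding uniform_limit_iff by simp
  then obtain n where "\<forall>t\<in>{0..T}. dist (x n k t) (m k t) < \<epsilon>"
    using eventually_happens'[OF sequentially_bot] by blast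
  hence "?D (x n)" by (auto simp: dist_real_def less_imp_le)
  thus False using x(4) by simp
qed

section \<open>Convergence of the power sums\<close>

lemma integral_abs_diff_le:
  fixes f g :: "real \<Rightarrow> real"
  assumes "f integrable_on {0..t}" "g integrable_on {0..t}" "t \<ge> 0"
    and "\<And>s. s \<in> {0..t} \<Longrightarrow> \<bar>f s - g s\<bar> \<le> C"
  shows "\<bar>integral {0..t} f - integral {0..t} g\<bar> \<le> t * C"
proof -
  have "norm (integral {0..t} (\<lambda>s. f s - g s)) \<le> integral {0..t} (\<lambda>s. C)"
    by (rule integral_norm_bound_integral)
        (use assms in \<open>auto intro: Henstock_Kurzweil_Integration.integrable_diff\<close>)
  thus ?thesis using assms by (simp add: Henstock_Kurzweil_Integration.integral_diff)
qed

text \<open>The exceptional event consists of the null set with wrong initial values and of the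
  paths on which some \<open>Y j\<close> exceeds \<delta> / 2. Outside it the other half of \<delta>
  absorbs the perturbation of the drift, and the deterministic stability applies path by
  path.\<close>

lemma (in jacobi_process) power_sum_close:
  assumes T: "T > 0" and \<delta>: "\<delta> > 0"
    and stab: "\<And>x :: nat \<Rightarrow> real \<Rightarrow> real. (\<forall>t\<ge>0. x 0 t = 1) \<Longrightarrow> (\<forall>j. continuous_on {0..} (x j)) \<Longrightarrow>
     (\<forall>j\<in>{1..k}. \<bar>x j 0 - m j 0\<bar> \<le> \<delta> \<and> (\<forall>t\<in>{0..T}.
      \<bar>x j t - x j 0 - integral {0..t}
          (\<lambda>s. - moment_rate a b c j * x j s + moment_forcing a c j (\<lambda>i. x i s))\<bar> \<le> \<delta>)) \<Longrightarrow>
     (\<forall>t\<in>{0..T}. \<bar>x k t - m k t\<bar> \<le> \<epsilon>)"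
    and init: "\<And>j. j \<in> {1..k} \<Longrightarrow> \<bar>power_sum N x0 j - m j 0\<bar> \<le> \<delta>"
    and pert: "\<And>j. j \<in> {1..k} \<Longrightarrow> T * ((\<bar>\<beta> * real N / 2 - c\<bar> + \<bar>\<beta> / 2\<bar>) * (real j * (2 * real j + 1)))
        \<le> \<delta> / 2"
  shows "\<exists>E\<in>sets M. prob E \<le> (\<Sum>j\<in>{1..k}. (real j)\<^sup>2 * T / real N / (\<delta> / 2)\<^sup>2) \<and>
    (\<forall>\<omega>\<in>space M - E. \<forall>t\<in>{0..T}. \<bar>S k t \<omega> - m k t\<bar> \<le> \<epsilon>)"
proof -
  have "AE \<omega> in M. \<forall>i<N. \<Lambda> i 0 \<omega> = x0 i" using jp unfolding beta_jacobi_process_def by blast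
  then obtain N0 where N0: "N0 \<in> null_sets M" "{\<omega> \<in> space M. \<not> (\<forall>i<N. \<Lambda> i 0 \<omega> = x0 i)} \<subseteq> N0"
    using eventually_ae_filter[of _ M] by auto
  define D where "D j = {\<omega> \<in> space M. \<exists>t\<in>{0..T}. \<bar>Y j t \<omega>\<bar> > \<delta> / 2}" for j
  have \<delta>2: "\<delta> / 2 > 0" using \<delta> by simp
  have DM: "D j \<in> sets M" "prob (D j) \<le> (real j)\<^sup>2 * T / real N / (\<delta> / 2)\<^sup>2" if "j \<in> {1..k}" for j
    unfolding D_def by (rule Y_maximal[OF T _ \<delta>2], use that in simp)+
  have "prob (N0 \<union> (\<Union>j\<in>{1..k}. D j)) \<le> prob N0 + prob (\<Union>j\<in>{1..k}. D j)"
    by (rule measure_Un_le) (use N0 DM in auto)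
  also have "prob N0 = 0" using N0(1) by (simp add: measure_eq_0_null_sets)
  also have "prob (\<Union>j\<in>{1..k}. D j) \<le> (\<Sum>j\<in>{1..k}. prob (D j))"
    by (rule measure_UNION_le) (use DM in auto)
  also have "\<dots> \<le> (\<Sum>j\<in>{1..k}. (real j)\<^sup>2 * T / real N / (\<delta> / 2)\<^sup>2)" by (intro sum_mono DM)
  finally have P: "prob (N0 \<union> (\<Union>j\<in>{1..k}. D j)) \<le> (\<Sum>j\<in>{1..k}. (real j)\<^sup>2 * T / real N / (\<delta> / 2)\<^sup>2)" by simp
  have "\<bar>S k t \<omega> - m k t\<bar> \<le> \<epsilon>" if \<omega>: "\<omega> \<in> space M" "\<omega> \<notin> N0 \<union> (\<Union>j\<in>{1..k}. D j)" and t: "t \<in> {0..T}" for \<omega> t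
  proof -
    have S0: "S 0 t \<omega> = 1" for t using N_pos by (simp add: S_def power_sum_def)
    have "\<forall>t\<in>{0..T}. \<bar>S k t \<omega> - m k t\<bar> \<le> \<epsilon>"
    proof (rule stab[of "\<lambda>j t. S j t \<omega>"], goal_cases)
      case 1 show ?case using S0 by simp
    next
      case 2 show ?case using S_continuous[OF \<omega>(1)] by simp
    next
      case 3
      show ?case
      proof (intro ballI conjI)
        fix j assume j: "j \<in> {1..k}"
        have "\<forall>i<N. \<Lambda> i 0 \<omega> = x0 i" using N0(2) \<omega> by blast
        hence "S j 0 \<omega> = power_sum N x0 j" by (simp add: S_def power_sum_def)
        thus "\<bar>S j 0 \<omega> - m j 0\<bar> \<le> \<delta>" using init[OF j] by simp
        fix t assume t: "t \<in> {0..T}"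
        let ?g = "\<lambda>s. - moment_rate a b c j * S j s \<omega> + moment_forcing a c j (\<lambda>i. S i s \<omega>)"
        let ?C = "(\<bar>\<beta> * real N / 2 - c\<bar> + \<bar>\<beta> / 2\<bar>) * (real j * (2 * real j + 1))"
        have "\<bar>integral {0..t} (\<lambda>u. G j u \<omega>) - integral {0..t} ?g\<bar> \<le> t * ?C"
        proof (rule integral_abs_diff_le[OF G_interval(2)[OF \<omega>(1)]])
          have "continuous_on {0..} ?g"
            by (intro continuous_intros continuous_on_moment_forcing S_continuous[OF \<omega>(1)]) (use j in auto)
          thus "?g integrable_on {0..t}"
            by (intro integrable_continuous_interval) (rule continuous_on_subset, auto)
          show "\<bar>G j s \<omega> - ?g s\<bar> \<le> ?C" if "s \<in> {0..t}" for s
            unfolding G_def by (rule power_sum_drift_approx) (use j S0 S_01[OF \<omega>(1), of s] that in auto)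
        qed (use t in auto)
        also have "t * ?C \<le> T * ?C" by (rule mult_right_mono) (use t in auto)
        also have "\<dots> \<le> \<delta> / 2" by (rule pert[OF j])
        finally have "\<bar>integral {0..t} (\<lambda>u. G j u \<omega>) - integral {0..t} ?g\<bar> \<le> \<delta> / 2" .
        moreover have "\<bar>Y j t \<omega>\<bar> \<le> \<delta> / 2" using \<omega> j t unfolding D_def by (auto simp: not_less)
        ultimately show "\<bar>S j t \<omega> - S j 0 \<omega> - integral {0..t} ?g\<bar> \<le> \<delta>"
          unfolding Y_eq[OF \<omega>(1)] by linarith
      qed
    qed
    thus ?thesis using t by blast
  qed
  thus ?thesis using P N0(1) DM(1) by (intro bexI[of _ "N0 \<union> (\<Union>j\<in>{1..k}. D j)"]) auto
qed

text \<open>The conclusion names an exceptional event \<open>E\<close> in place of the probability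
  of a deviation, so that the events for several k can simply be united.\<close>

lemma power_sum_converges:
  fixes T :: real
  assumes ab: "a > -1" "b > -1" "c \<ge> 0" and T: "T > 0"
    and \<beta>: "(\<lambda>N. \<beta> N * real N) \<longlonglongrightarrow> 2 * c"
    and proc: "\<And>N. N \<ge> 1 \<Longrightarrow> beta_jacobi_process a b (\<beta> N) N (x0 N) (M N) (F N) (B N) (\<Lambda> N)"
    and m: "moment_ivp a b c S0 m" and init: "\<And>j. j \<ge> 1 \<Longrightarrow> (\<lambda>N. power_sum N (x0 N) j) \<longlonglongrightarrow> m j 0"
    and \<epsilon>: "\<epsilon> > 0" and \<eta>: "\<eta> > 0"
  shows "\<forall>\<^sub>F N in sequentially. \<exists>E\<in>sets (M N). measure (M N) E \<le> \<eta> \<and>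
    (\<forall>\<omega>\<in>space (M N) - E. \<forall>t\<in>{0..T}. \<bar>power_sum N (\<lambda>i. \<Lambda> N i t \<omega>) k - m k t\<bar> \<le> \<epsilon>)"
proof -
  from moment_stability[OF m T moment_rate_pos[OF ab] \<epsilon>, of k]
  obtain \<delta> where \<delta>: "\<delta> > 0"
  and stab: "\<And>x :: nat \<Rightarrow> real \<Rightarrow> real. (\<forall>t\<ge>0. x 0 t = 1) \<Longrightarrow> (\<forall>j. continuous_on {0..} (x j)) \<Longrightarrow>
     (\<forall>j\<in>{1..k}. \<bar>x j 0 - m j 0\<bar> \<le> \<delta> \<and> (\<forall>t\<in>{0..T}.
      \<bar>x j t - x j 0 - integral {0..t}
          (\<lambda>s. - moment_rate a b c j * x j s + moment_forcing a c j (\<lambda>i. x i s))\<bar> \<le> \<delta>)) \<Longrightarrow>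
     (\<forall>t\<in>{0..T}. \<bar>x k t - m k t\<bar> \<le> \<epsilon>)" by blast
  have "\<forall>\<^sub>F N in sequentially. \<bar>power_sum N (x0 N) j - m j 0\<bar> < \<delta>" if "j \<in> {1..k}" for j
    using tendstoD[OF init \<delta>, of j] that by (simp add: dist_real_def)
  hence 1: "\<forall>\<^sub>F N in sequentially. \<forall>j\<in>{1..k}. \<bar>power_sum N (x0 N) j - m j 0\<bar> < \<delta>"
    by (intro eventually_ball_finite) auto
  \<comment> \<open>Since \<beta> N times N converges, \<beta> N itself tends to 0; this removes the
    diagonal correction in the limit.\<close>
  have "(\<lambda>N. \<beta> N * real N * (1 / real N)) \<longlonglongrightarrow> 2 * c * 0" by (intro tendsto_mult \<beta> lim_1_over_n)
  moreover have "\<forall>\<^sub>F N in sequentially. \<beta> N * real N * (1 / real N) = \<beta> N"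
    using eventually_gt_at_top[of 0] by eventually_elim simp
  ultimately have \<beta>0: "\<beta> \<longlonglongrightarrow> 0" by (simp add: tendsto_cong)
  have "(\<lambda>N. T * ((\<bar>\<beta> N * real N / 2 - c\<bar> + \<bar>\<beta> N / 2\<bar>) * (real j * (2 * real j + 1))))
     \<longlonglongrightarrow> T * ((\<bar>2 * c / 2 - c\<bar> + \<bar>0 / 2\<bar>) * (real j * (2 * real j + 1)))" for j :: nat
    by (intro tendsto_intros \<beta> \<beta>0) auto
  hence "(\<lambda>N. T * ((\<bar>\<beta> N * real N / 2 - c\<bar> + \<bar>\<beta> N / 2\<bar>) * (real j * (2 * real j + 1)))) \<longlonglongrightarrow> 0" for j :: nat
    by simp
  hence "\<forall>\<^sub>F N in sequentially. T * ((\<bar>\<beta> N * real N / 2 - c\<bar> + \<bar>\<beta> N / 2\<bar>) * (real j * (2 * real j + 1))) < \<delta>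
      / 2" for j :: nat
    using order_tendstoD(2)[of _ 0 sequentially "\<delta> / 2"] \<delta> by simp
  hence 2: "\<forall>\<^sub>F N in sequentially. \<forall>j\<in>{1..k}. T *
      ((\<bar>\<beta> N * real N / 2 - c\<bar> + \<bar>\<beta> N / 2\<bar>) * (real j * (2 * real j + 1))) < \<delta> / 2"
    by (intro eventually_ball_finite) auto
  have "(\<lambda>N. \<Sum>j\<in>{1..k}. (real j)\<^sup>2 * T * (1 / real N) / (\<delta> / 2)\<^sup>2)
      \<longlonglongrightarrow> (\<Sum>j\<in>{1..k}. (real j)\<^sup>2 * T * 0 / (\<delta> / 2)\<^sup>2)"
    by (intro tendsto_sum tendsto_divide tendsto_mult tendsto_const lim_1_over_n) (use \<delta> in auto)
  hence "(\<lambda>N. \<Sum>j\<in>{1..k}. (real j)\<^sup>2 * T / real N / (\<delta> / 2)\<^sup>2) \<longlonglongrightarrow> 0" by simp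
  hence 3: "\<forall>\<^sub>F N in sequentially. (\<Sum>j\<in>{1..k}. (real j)\<^sup>2 * T / real N / (\<delta> / 2)\<^sup>2) < \<eta>"
    using order_tendstoD(2) \<eta> by blast
  show ?thesis
    using 1 2 3 eventually_ge_at_top[of 1]
  proof eventually_elim
    case (elim N)
    interpret jp: jacobi_process a b "\<beta> N" N "x0 N" "M N" "F N" "B N" "\<Lambda> N"
      by unfold_locales (use proc elim(4) in auto)
    have "\<exists>E\<in>sets (M N). measure (M N) E \<le> (\<Sum>j\<in>{1..k}. (real j)\<^sup>2 * T / real N / (\<delta> / 2)\<^sup>2) \<and>
      (\<forall>\<omega>\<in>space (M N) - E. \<forall>t\<in>{0..T}. \<bar>jp.S k t \<omega> - m k t\<bar> \<le> \<epsilon>)"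
    proof (rule jp.power_sum_close[where m = m and c = c and k = k and \<epsilon> = \<epsilon>, OF T \<delta>], goal_cases)
      case (1 x) thus ?case by (rule stab)
    qed (use elim(1,2) in \<open>auto intro: less_imp_le\<close>)
    then obtain E where E: "E \<in> sets (M N)"
        "measure (M N) E \<le> (\<Sum>j\<in>{1..k}. (real j)\<^sup>2 * T / real N / (\<delta> / 2)\<^sup>2)"
      "\<forall>\<omega>\<in>space (M N) - E. \<forall>t\<in>{0..T}. \<bar>jp.S k t \<omega> - m k t\<bar> \<le> \<epsilon>"
      by (elim bexE conjE)
    have "measure (M N) E \<le> \<eta>" using E(2) elim(3) by linarith
    thus ?case using E(1) E(3)[unfolded jp.S_def] by (intro bexI[of _ E] conjI)
  qed
qed

lemma power_sums_converge:
  fixes T :: real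
  assumes ab: "a > -1" "b > -1" "c \<ge> 0" and T: "T > 0"
    and \<beta>: "(\<lambda>N. \<beta> N * real N) \<longlonglongrightarrow> 2 * c"
    and proc: "\<And>N. N \<ge> 1 \<Longrightarrow> beta_jacobi_process a b (\<beta> N) N (x0 N) (M N) (F N) (B N) (\<Lambda> N)"
    and m: "moment_ivp a b c S0 m" and init: "\<And>j. j \<ge> 1 \<Longrightarrow> (\<lambda>N. power_sum N (x0 N) j) \<longlonglongrightarrow> m j 0"
    and \<epsilon>: "\<epsilon> > 0" and \<eta>: "\<eta> > 0"
  shows "\<forall>\<^sub>F N in sequentially. \<exists>E\<in>sets (M N). measure (M N) E \<le> \<eta> \<and>
    (\<forall>\<omega>\<in>space (M N) - E. \<forall>k\<le>K. \<forall>t\<in>{0..T}. \<bar>power_sum N (\<lambda>i. \<Lambda> N i t \<omega>) k - m k t\<bar> \<le> \<epsilon>)"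
proof -
  have \<eta>': "\<eta> / real (Suc K) > 0" using \<eta> by simp
  have "\<forall>\<^sub>F N in sequentially. \<forall>k\<in>{..K}. \<exists>E\<in>sets (M N). measure (M N) E \<le> \<eta> / real (Suc K) \<and>
    (\<forall>\<omega>\<in>space (M N) - E. \<forall>t\<in>{0..T}. \<bar>power_sum N (\<lambda>i. \<Lambda> N i t \<omega>) k - m k t\<bar> \<le> \<epsilon>)"
    by (intro eventually_ball_finite ballI power_sum_converges[OF ab T \<beta> proc m init \<epsilon> \<eta>']) auto
  thus ?thesis
    using eventually_ge_at_top[of 1]
  proof eventually_elim
    case (elim N)
    interpret jp: jacobi_process a b "\<beta> N" N "x0 N" "M N" "F N" "B N" "\<Lambda> N"
      by unfold_locales (use proc elim(2) in auto)
    obtain E where E': "\<forall>k\<in>{..K}. E k \<in> sets (M N) \<and> measure (M N) (E k) \<le> \<eta> / real (Suc K) \<and>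
      (\<forall>\<omega>\<in>space (M N) - E k. \<forall>t\<in>{0..T}. \<bar>power_sum N (\<lambda>i. \<Lambda> N i t \<omega>) k - m k t\<bar> \<le> \<epsilon>)"
      using bchoice[OF elim(1)[unfolded Bex_def]] by (rule exE)
    have E: "E k \<in> sets (M N)" "measure (M N) (E k) \<le> \<eta> / real (Suc K)"
      "\<And>\<omega> t. \<omega> \<in> space (M N) - E k \<Longrightarrow> t \<in> {0..T} \<Longrightarrow> \<bar>power_sum N (\<lambda>i. \<Lambda> N i t \<omega>) k - m k t\<bar> \<le> \<epsilon>"
      if "k \<le> K" for k using bspec[OF E', of k] that by simp_all
    have "measure (M N) (\<Union>k\<in>{..K}. E k) \<le> (\<Sum>k\<in>{..K}. measure (M N) (E k))"
      by (rule measure_UNION_le) (use E(1) in auto)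
    also have "\<dots> \<le> (\<Sum>k\<in>{..K}. \<eta> / real (Suc K))" by (intro sum_mono E(2)) auto
    also have "\<dots> = \<eta>" by simp
    finally have "measure (M N) (\<Union>k\<in>{..K}. E k) \<le> \<eta>" .
    moreover have "\<forall>\<omega>\<in>space (M N) - (\<Union>k\<in>{..K}. E k). \<forall>k\<le>K. \<forall>t\<in>{0..T}. \<bar>power_sum N (\<lambda>i. \<Lambda> N i t \<omega>) k
        - m k t\<bar> \<le> \<epsilon>"
    proof (intro ballI allI impI)
      fix \<omega> k t assume *: "\<omega> \<in> space (M N) - (\<Union>k\<in>{..K}. E k)" "k \<le> K" "t \<in> {0..T}"
      hence "\<omega> \<in> space (M N) - E k" by auto
      thus "\<bar>power_sum N (\<lambda>i. \<Lambda> N i t \<omega>) k - m k t\<bar> \<le> \<epsilon>" by (rule E(3)[OF *(2) _ *(3)])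
    qed
    moreover have "(\<Union>k\<in>{..K}. E k) \<in> sets (M N)" by (intro sets.finite_UN E(1)) auto
    ultimately show ?case by (intro bexI[of _ "\<Union>k\<in>{..K}. E k"] conjI)
  qed
qed

section \<open>The Riccati equation and the Jacobi matrix\<close>

unbundle no vec_syntax
unbundle fps_syntax

text \<open>One step of the continued fraction: f = 1 / (1 - \<alpha> X g) is substituted into the
  Riccati equation, and g satisfies an equation of the same shape. P becomes 1 + P + 2 R, Q becomes
  - 1 - Q, R becomes 0 and S becomes - (P + R) \<alpha>.\<close>

lemma riccati_step:
  fixes f :: "real fps" and P Q R S \<alpha> :: real
  assumes f0: "f $ 0 = 1" and \<alpha>: "\<alpha> \<noteq> 0" and nz: "1 + P + 2 * R \<noteq> 0"
    and eq: "fps_X * (1 - fps_X) * fps_deriv f + (fps_const P + fps_const Q * fps_X) * f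
      + (fps_const R + fps_const S * fps_X) * f\<^sup>2 = fps_const (P + R)"
    and \<alpha>_eq: "\<alpha> * (1 + P + 2 * R) = - (Q + S)"
  shows "\<exists>g. g $ 0 = 1 \<and> f = 1 + fps_const \<alpha> * fps_X * f * g \<and>
    fps_X * (1 - fps_X) * fps_deriv g + (fps_const (1 + P + 2 * R) + fps_const (- 1 - Q) * fps_X) * g
      + (fps_const 0 + fps_const (- (P + R) * \<alpha>) * fps_X) * g\<^sup>2 = fps_const (1 + P + 2 * R + 0)"
proof -
  \<comment> \<open>The coefficient of X in the equation forces f $ 1 = \<alpha>, which is what g $
    0 = 1 requires.\<close>
  have "(fps_X * (1 - fps_X) * fps_deriv f + (fps_const P + fps_const Q * fps_X) * f
      + (fps_const R + fps_const S * fps_X) * f\<^sup>2) $ 1 = fps_const (P + R) $ 1"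
    using eq by simp
  hence "f $ 1 * (1 + P + 2 * R) = - (Q + S)"
    using f0 by (simp add: power2_eq_square algebra_simps fps_mult_nth_1 fps_mult_nth_0)
  hence f1: "f $ 1 = \<alpha>"
    using \<alpha>_eq nz by (metis mult_right_cancel)
  define h where "h = fps_shift 1 (f - 1)"
  have fh: "f = 1 + fps_X * h"
    using f0 by (simp add: h_def fps_eq_iff)
  \<comment> \<open>This is f = 1 + \<alpha> X f g solved for g, with h = (f - 1) / X.\<close>
  define g where "g = fps_const (1 / \<alpha>) * h * inverse f"
  have ff: "f * inverse f = 1"
    using f0 by (simp add: inverse_mult_eq_1')
  have h: "fps_const \<alpha> * f * g = h"
  proof -
    have "fps_const \<alpha> * f * g = (fps_const \<alpha> * fps_const (1 / \<alpha>)) * h * (f * inverse f)"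
      by (simp only: g_def mult_ac)
    thus ?thesis using \<alpha> ff by simp
  qed
  have g0: "g $ 0 = 1"
    using f0 f1 \<alpha> by (simp add: g_def h_def)
  have rel: "f = 1 + fps_const \<alpha> * fps_X * f * g"
    using fh h by (metis mult.assoc mult.commute)
  have drel: "fps_deriv f = fps_const \<alpha> * f * g + fps_const \<alpha> * fps_X * fps_deriv f * g
      + fps_const \<alpha> * fps_X * f * fps_deriv g"
    by (subst rel) (simp add: algebra_simps)
  define A where "A = fps_const \<alpha>"
  define p where "p = fps_const P"
  define q where "q = fps_const Q"
  define r where "r = fps_const R"
  define s where "s = fps_const S"
  define X where "X = (fps_X :: real fps)"
  have Aeq: "A * (1 + p + 2 * r) = - (q + s)"
    using arg_cong[OF \<alpha>_eq, of fps_const]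
    by (simp add: A_def p_def q_def r_def s_def flip: fps_const_mult fps_const_add fps_const_neg
        fps_numeral_fps_const)
  have eq': "X * (1 - X) * fps_deriv f + (p + q * X) * f + (r + s * X) * f\<^sup>2 = p + r"
    using eq by (simp add: p_def q_def r_def s_def X_def)
  have rel': "f = 1 + A * X * f * g" using rel by (simp add: A_def X_def)
  have drel': "fps_deriv f = A * f * g + A * X * fps_deriv f * g + A * X * f * fps_deriv g"
    using drel by (simp add: A_def X_def)
  \<comment> \<open>The equation for g is proved with the factor A X f^2, where it follows
    polynomially from the equation for f, the relation and its derivative. The factor is nonzero and
    cancels.\<close>
  have "A * X * f\<^sup>2 * (X * (1 - X) * fps_deriv g + ((1 + p + 2 * r) + (- 1 - q) * X) * g
      + (- (p + r) * A * X) * g\<^sup>2 - (1 + p + 2 * r)) = 0"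
    using Aeq eq' rel' drel' by algebra
  moreover have "A * X * f\<^sup>2 \<noteq> 0"
    using \<alpha> f0 by (auto simp: A_def X_def)
  ultimately have "X * (1 - X) * fps_deriv g + ((1 + p + 2 * r) + (- 1 - q) * X) * g
      + (- (p + r) * A * X) * g\<^sup>2 = 1 + p + 2 * r"
    by (metis eq_iff_diff_eq_0 mult_eq_0_iff)
  hence "fps_X * (1 - fps_X) * fps_deriv g + (fps_const (1 + P + 2 * R) + fps_const (- 1 - Q) * fps_X) * g
      + (fps_const 0 + fps_const (- (P + R) * \<alpha>) * fps_X) * g\<^sup>2 = fps_const (1 + P + 2 * R + 0)"
    by (simp add: A_def p_def q_def r_def X_def flip: fps_const_mult fps_const_add fps_const_neg
        fps_numeral_fps_const fps_const_sub)
  with g0 rel show ?thesis by blast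
qed

text \<open>The coefficients of the S-fraction of the limit moments.\<close>

definition S_coeff :: "real \<Rightarrow> real \<Rightarrow> real \<Rightarrow> nat \<Rightarrow> real" where
  "S_coeff a b c n = (if even n then jacobi_lambda a b c (n div 2) else jacobi_mu a b c (Suc (n div 2)))"

lemma jacobi_lambda_pos:
  assumes "a > -1" "b > -1" "c \<ge> 0"
  shows "jacobi_lambda a b c n > 0"
  using assms by (cases n) (auto simp: jacobi_lambda_def intro!: divide_pos_pos mult_pos_pos)

lemma jacobi_mu_pos:
  assumes "a > -1" "b > -1" "c \<ge> 0" "n \<ge> 1"
  shows "jacobi_mu a b c n > 0"
proof -
  have "real n \<ge> 1" using assms by simp
  thus ?thesis
    using assms unfolding jacobi_mu_def by (intro divide_pos_pos mult_pos_pos) linarith+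
qed

lemma S_coeff_pos:
  assumes "a > -1" "b > -1" "c \<ge> 0"
  shows "S_coeff a b c n > 0"
  using assms by (auto simp: S_coeff_def intro: jacobi_lambda_pos jacobi_mu_pos)

text \<open>The right-hand side is the constant term of the left-hand side when f $ 0 = 1.\<close>

definition riccati :: "real \<Rightarrow> real \<Rightarrow> real \<Rightarrow> real \<Rightarrow> real fps \<Rightarrow> bool" where
  "riccati P Q R S f \<longleftrightarrow> f $ 0 = 1 \<and>
     fps_X * (1 - fps_X) * fps_deriv f + (fps_const P + fps_const Q * fps_X) * f
      + (fps_const R + fps_const S * fps_X) * f\<^sup>2 = fps_const (P + R)"

text \<open>The k-th coefficient of the equation is the recursion of the limit moments with its
  denominator cleared. The derivative contributes the terms linear in k, and the end terms of the
  square contribute 2 c.\<close>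

lemma riccati_limit_moment:
  assumes "a > -1" "b > -1" "c \<ge> 0"
  shows "riccati (a + b + 1) (- (a + 1)) c (- c) (Abs_fps (limit_moment a b c))"
proof -
  define u where "u = limit_moment a b c"
  have u0: "u 0 = 1" by (simp add: u_def limit_moment.simps)
  have rec: "(2 * c + a + b + real k + 1) * u k = (a + real k) * u (k - 1)
      + c * (\<Sum>i\<in>{..<k}. u i * u (k - 1 - i)) - c * (\<Sum>j\<in>{1..<k}. u j * u (k - j))"
    if "k \<ge> 1" for k
  proof -
    have "2 * c + a + b + real k + 1 \<noteq> 0" using assms that by simp
    thus ?thesis
      using that unfolding u_def by (subst limit_moment.simps) (simp add: field_simps)
  qed
  have sq: "(Abs_fps u)\<^sup>2 $ k = (\<Sum>i\<le>k. u i * u (k - i))" for k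
    by (simp add: power2_eq_square fps_mult_nth atLeast0AtMost)
  have sq2: "(\<Sum>i\<le>k. u i * u (k - i)) = 2 * u k + (\<Sum>j\<in>{1..<k}. u j * u (k - j))" if "k \<ge> 1" for k
  proof -
    have "{..k} = insert 0 (insert k {1..<k})" using that by auto
    thus ?thesis using that u0 by simp
  qed
  have "(fps_X * (1 - fps_X) * fps_deriv (Abs_fps u)
      + (fps_const (a + b + 1) + fps_const (- (a + 1)) * fps_X) * Abs_fps u
      + (fps_const c + fps_const (- c) * fps_X) * (Abs_fps u)\<^sup>2) $ k = fps_const (a + b + 1 + c) $ k"
    (is "?L $ k = _") for k
  proof (cases k)
    case 0
    thus ?thesis using u0 by (simp add: power2_eq_square)
  next
    case (Suc j)
    have 1: "?L = fps_X * fps_deriv (Abs_fps u) - fps_X * (fps_X * fps_deriv (Abs_fps u))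
        + fps_const (a + b + 1) * Abs_fps u - fps_const (a + 1) * (fps_X * Abs_fps u)
        + fps_const c * (Abs_fps u)\<^sup>2 - fps_const c * (fps_X * (Abs_fps u)\<^sup>2)"
    proof -
      have "X * (1 - X) * D + (p + - q * X) * V + (r + - r * X) * E
          = X * D - X * (X * D) + p * V - q * (X * V) + r * E - r * (X * E)"
        for X D p q r V E :: "real fps" by (simp add: algebra_simps)
      thus ?thesis unfolding fps_const_neg[symmetric] .
    qed
    have "?L $ k = real k * u k - real j * u j + (a + b + 1) * u k - (a + 1) * u j
        + c * (\<Sum>i\<le>k. u i * u (k - i)) - c * (\<Sum>i\<le>j. u i * u (j - i))"
      unfolding 1 by (simp add: sq Suc algebra_simps fps_X_mult_nth del: fps_const_add)
    also have "\<dots> = (2 * c + a + b + real k + 1) * u k - (a + real k) * u (k - 1)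
       - c * (\<Sum>i\<in>{..<k}. u i * u (k - 1 - i)) + c * (\<Sum>j\<in>{1..<k}. u j * u (k - j))"
      using sq2[of k] by (simp add: Suc lessThan_Suc_atMost algebra_simps)
    also have "\<dots> = 0" using rec[of k] Suc by simp
    finally show ?thesis using Suc by simp
  qed
  thus ?thesis using u0 unfolding riccati_def u_def[symmetric] by (auto simp: fps_eq_iff)
qed

text \<open>Closed form of the equation after n steps of the continued fraction. The first step
  makes R vanish, so n = 0 stands apart; afterwards P grows by 1 per step and Q alternates between a
  and - 1 - a.\<close>

definition riccati_stage :: "real \<Rightarrow> real \<Rightarrow> real \<Rightarrow> nat \<Rightarrow> real fps \<Rightarrow> bool" where
  "riccati_stage a b c n f \<longleftrightarrow>
     (if n = 0 then riccati (a + b + 1) (- (a + 1)) c (- c) f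
      else riccati (a + b + 2 * c + 1 + n) (if odd n then a else - 1 - a) 0
       (if odd n then - (real (n div 2) + c + a + 1) * (real (n div 2) + c + a + b + 1) / (n + 2 * c + a + b
           + 1)
        else - (real (n div 2) + c) * (real (n div 2) + c + b) / (n + 2 * c + a + b + 1)) f)"

text \<open>The closed form is checked against the update rules. What makes it work is that - (Q +
  S) factors at every stage: divided by 1 + P + 2 R it is alternately a \<open>jacobi_lambda\<close>
  and a \<open>jacobi_mu\<close>.\<close>

lemma riccati_stage_step:
  assumes ab: "a > -1" "b > -1" "c \<ge> 0" and f: "riccati_stage a b c n f"
  shows "\<exists>g. riccati_stage a b c (Suc n) g \<and> f = 1 + fps_const (S_coeff a b c n) * fps_X * f * g"
proof -
  have pos: "S_coeff a b c n \<noteq> 0" using S_coeff_pos[OF ab, of n] by simp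
  have key: ?thesis
    if st: "riccati P Q R S f" and nz: "1 + P + 2 * R \<noteq> 0"
      and al: "S_coeff a b c n * (1 + P + 2 * R) = - (Q + S)"
      and nx: "\<And>g. riccati (1 + P + 2 * R) (-1 - Q) 0 (- (P + R) * S_coeff a b c n) g
         \<Longrightarrow> riccati_stage a b c (Suc n) g" for P Q R S
    using riccati_step[of f "S_coeff a b c n" P R Q S] st nz al nx pos
    unfolding riccati_def by (smt (verit, best))
  consider "n = 0" | "odd n" | "even n" "n > 0" by fastforce
  thus ?thesis
  proof cases
    case 1
    have d: "a + b + 2 + 2 * c \<noteq> 0" using ab by linarith
    show ?thesis
    proof (rule key)
      show "riccati (a + b + 1) (- (a + 1)) c (- c) f" using f 1 by (simp add: riccati_stage_def)
      show "1 + (a + b + 1) + 2 * c \<noteq> 0" using d by linarith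
      show "S_coeff a b c n * (1 + (a + b + 1) + 2 * c) = - (- (a + 1) + - c)"
        using d 1 by (simp add: S_coeff_def jacobi_lambda_def divide_simps) (simp add: algebra_simps)
    next
      fix g assume g: "riccati (1 + (a + b + 1) + 2 * c) (- 1 -
          - (a + 1)) 0 (- (a + b + 1 + c) * S_coeff a b c n) g"
      have "- (a + b + 1 + c) * S_coeff a b c n = - (c + a + 1) * (c + a + b + 1) / (1 + 2 * c + a + b + 1)"
        using d 1 by (simp add: S_coeff_def jacobi_lambda_def divide_simps) (simp add: algebra_simps)
      thus "riccati_stage a b c (Suc n) g"
        using g 1 by (simp add: riccati_stage_def algebra_simps)
    qed
  next
    case 2
    define m where "m = n div 2"
    have n: "n = 2 * m + 1" using 2 by (simp add: m_def)
    have d: "2 * real m + 2 * c + a + b + 2 > 0" "2 * real m + 2 * c + a + b + 3 > 0" using ab by linarith+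
    show ?thesis
    proof (rule key)
      show "riccati (a + b + 2 * c + 1 + n) a 0
         (- (m + c + a + 1) * (m + c + a + b + 1) / (n + 2 * c + a + b + 1)) f"
        using f n by (simp add: riccati_stage_def)
      show "1 + (a + b + 2 * c + 1 + n) + 2 * 0 \<noteq> 0" using d n by simp
      \<comment> \<open>The numerator of - (Q + S) is (m + c + 1) (m + c + b + 1), as in
        \<open>jacobi_mu\<close> at m + 1.\<close>
      show "S_coeff a b c n * (1 + (a + b + 2 * c + 1 + n) + 2 * 0)
         = - (a + - (m + c + a + 1) * (m + c + a + b + 1) / (n + 2 * c + a + b + 1))"
        using d n by (simp add: S_coeff_def jacobi_mu_def divide_simps) (simp add: algebra_simps)
    next
      fix g assume g: "riccati (1 + (a + b + 2 * c + 1 + real n) + 2 * 0) (- 1 - a) 0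
         (- (a + b + 2 * c + 1 + real n + 0) * S_coeff a b c n) g"
      have "- (a + b + 2 * c + 1 + real n + 0) * S_coeff a b c n
          = - (real (Suc n div 2) + c) * (real (Suc n div 2) + c + b) / (Suc n + 2 * c + a + b + 1)"
        using d n by (simp add: S_coeff_def jacobi_mu_def divide_simps) (simp add: algebra_simps)
      thus "riccati_stage a b c (Suc n) g"
        using g 2 by (simp add: riccati_stage_def algebra_simps)
    qed
  next
    case 3
    define m where "m = n div 2"
    have n: "n = 2 * m" and m: "m > 0" using 3 by (auto simp: m_def)
    hence "real m \<ge> 1" by simp
    hence d: "2 * real m + 2 * c + a + b + 2 > 0" "2 * real m + 2 * c + a + b + 1 > 0" using ab by linarith+
    show ?thesis
    proof (rule key)
      show "riccati (a + b + 2 * c + 1 + n) (- 1 - a) 0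
         (- (m + c) * (m + c + b) / (n + 2 * c + a + b + 1)) f"
        using f n m by (simp add: riccati_stage_def)
      show "1 + (a + b + 2 * c + 1 + n) + 2 * 0 \<noteq> 0" using d n by simp
      \<comment> \<open>The numerator of - (Q + S) is (m + c + a + 1) (m + c + a + b + 1), as in
        \<open>jacobi_lambda\<close> at m.\<close>
      show "S_coeff a b c n * (1 + (a + b + 2 * c + 1 + n) + 2 * 0)
         = - (- 1 - a + - (m + c) * (m + c + b) / (n + 2 * c + a + b + 1))"
        using d n m by (simp add: S_coeff_def jacobi_lambda_def divide_simps) (simp add: algebra_simps)
    next
      fix g assume g: "riccati (1 + (a + b + 2 * c + 1 + real n) + 2 * 0) (- 1 - (- 1 - a)) 0
         (- (a + b + 2 * c + 1 + real n + 0) * S_coeff a b c n) g"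
      have "- (a + b + 2 * c + 1 + real n + 0) * S_coeff a b c n
          = - (real (Suc n div 2) + c + a + 1) * (real (Suc n div 2) + c + a + b + 1) /
              (Suc n + 2 * c + a + b + 1)"
        using d n m by (simp add: S_coeff_def jacobi_lambda_def divide_simps) (simp add: algebra_simps)
      thus "riccati_stage a b c (Suc n) g"
        using g 3 by (simp add: riccati_stage_def algebra_simps)
    qed
  qed
qed

text \<open>\<open>w n\<close> is the generating function of the (n,0) entries of the powers of J.
  The hypothesis is the resolvent equation w = e_0 + X J w, which determines the coefficients one
  after the other.\<close>

lemma band_matrix_power_eq_fps_nth:
  fixes w :: "nat \<Rightarrow> real fps"
  assumes "\<And>n. w n = (if n = 0 then 1 else 0) + fps_X * (\<Sum>l\<le>Suc n. fps_const (J n l) * w l)"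
  shows "band_matrix_power J k n 0 = w n $ k"
proof (induction k arbitrary: n)
  case 0
  show ?case by (subst assms) simp
next
  case (Suc k)
  show ?case by (subst assms) (simp add: Suc fps_sum_nth)
qed

lemma tridiagonal_row_sum:
  fixes w :: "nat \<Rightarrow> real fps"
  shows "(\<Sum>l\<le>Suc (Suc n). fps_const (jacobi_matrix a b c (Suc n) l) * w l) =
    fps_const (jacobi_matrix a b c (Suc n) n) * w n
    + fps_const (jacobi_matrix a b c (Suc n) (Suc n)) * w (Suc n)
    + fps_const (jacobi_matrix a b c (Suc n) (Suc (Suc n))) * w (Suc (Suc n))"
proof -
  have "(\<Sum>l\<le>Suc (Suc n). fps_const (jacobi_matrix a b c (Suc n) l) * w l) =
     (\<Sum>l\<in>{n, Suc n, Suc (Suc n)}. fps_const (jacobi_matrix a b c (Suc n) l) * w l)"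
    by (rule sum.mono_neutral_right) (auto simp: jacobi_matrix_def)
  thus ?thesis by simp
qed

text \<open>The resolvent column is written down as a product of tails of the S-fraction. Two steps
  of the fraction make one row of the matrix, and the square roots divide the coefficients evenly
  between the two off-diagonals. The entry 0 of the column is the generating function of the limit
  moments.\<close>

lemma band_matrix_power_jacobi:
  assumes ab: "a > -1" "b > -1" "c \<ge> 0"
  shows "band_matrix_power (jacobi_matrix a b c) k 0 0 = limit_moment a b c k"
proof -
  define \<alpha> where "\<alpha> = S_coeff a b c"
  \<comment> \<open>The tails of the fraction are obtained by dependent choice, as each step only
    asserts that the next tail exists.\<close>
  have "\<exists>f. \<forall>n. (riccati_stage a b c n (f n) \<and> (n = 0 \<longrightarrow> f n = Abs_fps (limit_moment a b c))) \<and>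
      f n = 1 + fps_const (\<alpha> n) * fps_X * f n * f (Suc n)"
    unfolding \<alpha>_def
  proof (rule dependent_nat_choice)
    show "\<exists>x. riccati_stage a b c 0 x \<and> (0 = 0 \<longrightarrow> x = Abs_fps (limit_moment a b c))"
      using riccati_limit_moment[OF ab] by (auto simp: riccati_stage_def)
  next
    fix x n
    assume "riccati_stage a b c n x \<and> (n = 0 \<longrightarrow> x = Abs_fps (limit_moment a b c))"
    thus "\<exists>y. (riccati_stage a b c (Suc n) y \<and> (Suc n = 0 \<longrightarrow> y = Abs_fps (limit_moment a b c))) \<and>
        x = 1 + fps_const (S_coeff a b c n) * fps_X * x * y"
      using riccati_stage_step[OF ab, of n x] by auto
  qed
  then obtain f where f0: "f 0 = Abs_fps (limit_moment a b c)"
    and fs: "\<And>n. f n = 1 + fps_const (\<alpha> n) * fps_X * f n * f (Suc n)" by blast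
  define s where "s n = sqrt (\<alpha> n)" for n
  have ss: "fps_const (s n) * fps_const (s n) = fps_const (\<alpha> n)" for n
    using S_coeff_pos[OF ab, of n] by (simp add: s_def \<alpha>_def)
  define G where "G n = (\<Prod>j<n. fps_const (s (2 * j)) * fps_const (s (2 * j + 1)) * fps_X * f (2 * j) *
      f (2 * j + 1))" for n
  \<comment> \<open>the solution of (1 - X J) w = e_0, found by contracting the S-fraction\<close>
  define w where "w n = G n * f (2 * n)" for n
  have off: "jacobi_matrix a b c n (Suc n) = s (2 * n) * s (2 * n + 1)"
    "jacobi_matrix a b c (Suc n) n = s (2 * n) * s (2 * n + 1)" for n
    by (auto simp: jacobi_matrix_def s_def \<alpha>_def S_coeff_def real_sqrt_mult)
  have diag: "jacobi_matrix a b c (Suc n) (Suc n) = \<alpha> (2 * n + 1) + \<alpha> (2 * n + 2)"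
    "jacobi_matrix a b c 0 0 = \<alpha> 0" for n
    by (auto simp: jacobi_matrix_def \<alpha>_def S_coeff_def)
  have "w n = (if n = 0 then 1 else 0) + fps_X * (\<Sum>l\<le>Suc n. fps_const (jacobi_matrix a b c n l) * w l)"
      for n
  proof (cases n)
    case 0
    have "f 0 = 1 + fps_const (\<alpha> 0) * fps_X * f 0 + fps_X * (fps_const (s 0) * fps_const (s 1) *
       (fps_const (s 0) * fps_const (s 1) * fps_X * f 0 * f 1 * f 2))"
    proof -
      have "F0 = 1 + A0 * X * F0 + X * (u * v * (u * v * X * F0 * F1 * F2))"
        if "F0 = 1 + A0 * X * F0 * F1" "F1 = 1 + A1 * X * F1 * F2" "u * u = A0" "v * v = A1"
        for F0 F1 F2 X A0 A1 u v :: "real fps"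
        using that by algebra
      from this[OF fs[of 0] _ ss[of 0] ss[of 1]] fs[of 1] show ?thesis
        by (simp only: One_nat_def numeral_2_eq_2)
    qed
    thus ?thesis
      using 0 off(1)[of 0] diag(2)
      by (simp add: numeral_2_eq_2 w_def G_def algebra_simps flip: fps_const_mult)
  next
    case (Suc m)
    define p where "p = 2 * m"
    have G1: "G (Suc m) = G m * (fps_const (s p) * fps_const (s (p + 1)) * fps_X * f p * f (p + 1))"
      by (simp add: G_def p_def)
    have G2: "G (Suc (Suc m))
        = G (Suc m) * (fps_const (s (p + 2)) * fps_const (s (p + 3)) * fps_X * f (p + 2) * f (p + 3))"
      by (simp add: G_def p_def numeral_eq_Suc)
    have fp: "f p = 1 + fps_const (\<alpha> p) * fps_X * f p * f (p + 1)"
      "f (p + 1) = 1 + fps_const (\<alpha> (p + 1)) * fps_X * f (p + 1) * f (p + 2)"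
      "f (p + 2) = 1 + fps_const (\<alpha> (p + 2)) * fps_X * f (p + 2) * f (p + 3)"
      "f (p + 3) = 1 + fps_const (\<alpha> (p + 3)) * fps_X * f (p + 3) * f (p + 4)"
      using fs[of p] fs[of "p + 1"] fs[of "p + 2"] fs[of "p + 3"] by (simp_all add: numeral_eq_Suc)
    \<comment> \<open>The row equation in indeterminates. It comes down to f1 f2 = 1 + (A1 + A2) X
      f1 f2 + A2 A3 X^2 f1 f2 f3 f4.\<close>
    have main: "W = X * (u * v * (g * f0) + (A1 + A2) * W + x * y * W2)"
      if "W = g * (u * v * X * f0 * f1) * f2" "W2 = g * (u * v * X * f0 * f1) * (x * y * X * f2 * f3) * f4"
       "f1 = 1 + A1 * X * f1 * f2" "f2 = 1 + A2 * X * f2 * f3" "f3 = 1 + A3 * X * f3 * f4"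
       "x * x = A2" "y * y = A3"
      for W W2 X g u v f0 f1 f2 f3 f4 x y A1 A2 A3 :: "real fps"
      using that by algebra
    have "w (Suc m) = fps_X * (fps_const (s p) * fps_const (s (p + 1)) * (G m * f p)
       + (fps_const (\<alpha> (p + 1)) + fps_const (\<alpha> (p + 2))) * w (Suc m)
       + fps_const (s (p + 2)) * fps_const (s (p + 3)) * w (Suc (Suc m)))"
    proof (rule main[OF _ _ fp(2,3,4) ss ss])
      show "w (Suc m) = G m * (fps_const (s p) * fps_const (s (p + 1)) * fps_X * f p * f (p + 1)) * f (p
          + 2)"
        by (simp add: w_def G1) (simp add: p_def)
      show "w (Suc (Suc m)) = G m * (fps_const (s p) * fps_const (s (p + 1)) * fps_X * f p * f (p + 1)) *
         (fps_const (s (p + 2)) * fps_const (s (p + 3)) * fps_X * f (p + 2) * f (p + 3)) * f (p + 4)"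
        by (simp add: w_def G1 G2) (simp add: p_def numeral_eq_Suc)
    qed
    moreover have "fps_const (jacobi_matrix a b c (Suc m) m) = fps_const (s p) * fps_const (s (p + 1))"
      "fps_const (jacobi_matrix a b c (Suc m) (Suc m)) = fps_const (\<alpha> (p + 1)) + fps_const (\<alpha> (p + 2))"
      "fps_const (jacobi_matrix a b c (Suc m) (Suc (Suc m)))
          = fps_const (s (p + 2)) * fps_const (s (p + 3))"
      by (simp_all add: off diag p_def numeral_eq_Suc)
    moreover have "G m * f p = w m" by (simp add: w_def p_def)
    ultimately show ?thesis
      unfolding Suc tridiagonal_row_sum by simp
  qed
  hence "band_matrix_power (jacobi_matrix a b c) k 0 0 = w 0 $ k"
    by (rule band_matrix_power_eq_fps_nth)
  thus ?thesis by (simp add: w_def G_def f0)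
qed

unbundle no fps_syntax

section \<open>Convergence of the empirical measures\<close>

lemma path_in_mspaceI:
  assumes f: "continuous_map (top_of_set {0..T}) (mtopology_of m) f"
  shows "(\<lambda>t\<in>{0..T}. f t) \<in> mspace (path_metric T m)"
proof -
  interpret Metric_space "mspace m" "mdist m" by simp
  have f': "continuous_map (top_of_set {0..T}) mtopology f" using f by (simp add: mtopology_of_def)
  have "compactin (top_of_set {0..T}) {0..T}" by (simp add: compactin_subtopology)
  hence "mbounded (f ` {0..T})" by (intro compactin_imp_mbounded image_compactin[OF _ f'])
  moreover have "continuous_map (top_of_set {0..T}) mtopology (\<lambda>t\<in>{0..T}. f t)"
    by (rule continuous_map_eq[OF f']) auto
  moreover have "f t \<in> mspace m" if "t \<in> {0..T}" for t
    using continuous_map_funspace[OF f'] that by auto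
  ultimately show ?thesis by (auto simp: path_metric_def mtopology_of_def)
qed

text \<open>Closeness at all times off the event \<open>E\<close> is closeness in the path metric,
  so the deviation event is contained in \<open>E\<close>.\<close>

lemma converges_in_prob_pathI:
  assumes f: "continuous_map (top_of_set {0..T}) (mtopology_of m) f"
    and meas: "\<And>N. N \<ge> 1 \<Longrightarrow> (\<lambda>\<omega>. \<lambda>t\<in>{0..T}. X N t \<omega>) \<in> M N \<rightarrow>\<^sub>M metric_borel (path_metric T m)"
    and prob: "\<And>N. N \<ge> 1 \<Longrightarrow> prob_space (M N)"
    and close: "\<And>\<epsilon> \<eta>. \<epsilon> > 0 \<Longrightarrow> \<eta> > 0 \<Longrightarrow> \<forall>\<^sub>F N in sequentially. \<exists>E\<in>sets (M N). measure (M N) E \<le> \<eta> \<and>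
      (\<forall>\<omega>\<in>space (M N) - E. \<forall>t\<in>{0..T}. mdist m (X N t \<omega>) (f t) \<le> \<epsilon>)"
  shows "converges_in_prob (path_metric T m) M (\<lambda>N \<omega>. \<lambda>t\<in>{0..T}. X N t \<omega>) (\<lambda>t\<in>{0..T}. f t)"
  unfolding converges_in_prob_def
proof (intro conjI allI impI)
  show "(\<lambda>t\<in>{0..T}. f t) \<in> mspace (path_metric T m)" by (rule path_in_mspaceI[OF f])
  fix \<epsilon> :: real assume \<epsilon>: "\<epsilon> > 0"
  let ?A = "\<lambda>N. {\<omega> \<in> space (M N). mdist (path_metric T m) (\<lambda>t\<in>{0..T}. X N t \<omega>) (\<lambda>t\<in>{0..T}. f t) > \<epsilon>}"
  show "(\<lambda>N. measure (M N) (?A N)) \<longlonglongrightarrow> 0"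
  proof (rule tendstoI)
    fix \<eta> :: real assume \<eta>: "\<eta> > 0"
    hence "\<eta> / 2 > 0" by simp
    from close[OF \<epsilon> this] eventually_ge_at_top[of 1]
    show "\<forall>\<^sub>F N in sequentially. dist (measure (M N) (?A N)) 0 < \<eta>"
    proof eventually_elim
      case (elim N)
      from elim(1) obtain E where E: "E \<in> sets (M N)" "measure (M N) E \<le> \<eta> / 2"
        "\<forall>\<omega>\<in>space (M N) - E. \<forall>t\<in>{0..T}. mdist m (X N t \<omega>) (f t) \<le> \<epsilon>" by (elim bexE conjE)
      interpret prob_space "M N" by (rule prob[OF elim(2)])
      have "?A N \<subseteq> E"
      proof (rule ccontr)
        assume "\<not> ?A N \<subseteq> E"
        then obtain \<omega> where \<omega>: "\<omega> \<in> space (M N) - E"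
          and gt: "mdist (path_metric T m) (\<lambda>t\<in>{0..T}. X N t \<omega>) (\<lambda>t\<in>{0..T}. f t) > \<epsilon>" by auto
        have "mdist (path_metric T m) (\<lambda>t\<in>{0..T}. X N t \<omega>) (\<lambda>t\<in>{0..T}. f t) \<le> \<epsilon>"
          unfolding path_metric_def by (rule mdist_cfunspace_le) (use \<epsilon> E(3) \<omega> in auto)
        with gt show False by simp
      qed
      hence "measure (M N) (?A N) \<le> measure (M N) E" by (rule finite_measure_mono[OF _ E(1)])
      thus ?case using E(2) \<eta> by simp
    qed
  qed
qed (rule meas)

lemma continuous_map_prob01_metric:
  assumes \<mu>: "\<And>t. \<mu> t \<in> prob01" and cont: "\<And>k. continuous_on A (\<lambda>t. \<integral>x. x ^ k \<partial>\<mu> t)"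
  shows "continuous_map (top_of_set A) (mtopology_of prob01_metric) \<mu>"
proof -
  interpret Metric_space prob01 bl_dist by (rule Metric_space_bl_dist)
  have "continuous_map (top_of_set A) mtopology \<mu>"
    unfolding continuous_map_to_metric
  proof (intro ballI allI impI)
    fix t and \<epsilon> :: real assume "t \<in> topspace (top_of_set A)" and \<epsilon>: "\<epsilon> > 0"
    hence t: "t \<in> A" by simp
    have "((\<lambda>s. bl_dist (\<mu> s) (\<mu> t)) \<longlongrightarrow> 0) (at t within A)"
      by (rule bl_dist_tendsto_zero_of_moments[OF \<mu> \<mu>]) (use cont t in \<open>simp add: continuous_on_def\<close>)
    hence "\<forall>\<^sub>F s in at t within A. bl_dist (\<mu> s) (\<mu> t) < \<epsilon>" by (rule order_tendstoD(2)[OF _ \<epsilon>])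
    then obtain U where U: "open U" "t \<in> U" "\<And>s. s \<in> U \<Longrightarrow> s \<noteq> t \<Longrightarrow> s \<in> A \<Longrightarrow> bl_dist (\<mu> s) (\<mu> t) < \<epsilon>"
      unfolding eventually_at_topological by auto
    show "\<exists>U. openin (top_of_set A) U \<and> t \<in> U \<and> (\<forall>s\<in>U. \<mu> s \<in> mball (\<mu> t) \<epsilon>)"
    proof (intro exI conjI ballI)
      show "openin (top_of_set A) (A \<inter> U)" using U(1) by (rule openin_open_Int)
      show "t \<in> A \<inter> U" using t U(2) by simp
      fix s assume "s \<in> A \<inter> U"
      thus "\<mu> s \<in> mball (\<mu> t) \<epsilon>"
        using U(3)[of s] \<epsilon> \<mu> by (cases "s = t") (auto simp: commute)
    qed
  qed
  thus ?thesis by (simp add: mtopology_of_def)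
qed

lemma moment_empirical_measure: "(\<integral>x. x ^ k \<partial>empirical_measure N y) = power_sum N y k"
  by (subst integral_empirical_measure) (simp_all add: power_sum_def)

lemma power_sum_lipschitz:
  assumes N: "N \<ge> 1" and x: "\<forall>i<N. x i \<in> {0..1}" and y: "\<forall>i<N. y i \<in> {0..1}" and r: "\<forall>i<N. \<bar>x i - y i\<bar> \<le> r"
  shows "\<bar>power_sum N x k - power_sum N y k\<bar> \<le> real k * r"
proof -
  have "\<bar>x i ^ k - y i ^ k\<bar> \<le> real k * r" if "i < N" for i
  proof -
    have "\<bar>x i ^ k - y i ^ k\<bar> \<le> real k * \<bar>x i - y i\<bar>"
      using norm_power_diff[of "x i" "y i" k] x y that by simp
    also have "\<dots> \<le> real k * r" using r that by (intro mult_left_mono) auto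
    finally show ?thesis .
  qed
  hence "\<bar>\<Sum>i<N. x i ^ k - y i ^ k\<bar> \<le> (\<Sum>i<N. real k * r)"
    by (rule order_trans[OF sum_abs sum_mono]) simp
  hence "\<bar>(\<Sum>i<N. x i ^ k - y i ^ k) / real N\<bar> \<le> real k * r"
    using N by (simp add: abs_divide divide_le_eq mult.commute)
  thus ?thesis by (simp add: power_sum_def sum_subtractf diff_divide_distrib)
qed

text \<open>The limit law is given on the line, so powers are clipped to bounded continuous
  functions. On the empirical measures the clipping has no effect.\<close>

lemma initial_moments_converge:
  assumes x0: "\<And>N. N \<ge> 1 \<Longrightarrow> \<forall>i<N. x0 N i \<in> {0..1::real}" and \<mu>0: "real_distribution \<mu>0"
    and conv: "weak_conv_m (\<lambda>N. empirical_measure N (x0 N)) \<mu>0"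
  shows "(\<lambda>N. power_sum N (x0 N) k) \<longlonglongrightarrow> (\<integral>x. (min 1 (max 0 x)) ^ k \<partial>\<mu>0)"
proof -
  \<comment> \<open>The shift avoids N = 0, where the empirical measure is not a probability
    measure.\<close>
  define \<nu> where "\<nu> n = empirical_measure (Suc n) (x0 (Suc n))" for n
  have rd: "real_distribution (\<nu> n)" for n
    unfolding \<nu>_def by (rule prob01_imp_real_distribution, rule empirical_measure_prob01) (use x0 in auto)
  have wc: "weak_conv_m \<nu> \<mu>0"
    unfolding weak_conv_m_def weak_conv_def \<nu>_def
  proof (intro allI impI)
    fix x assume "isCont (cdf \<mu>0) x"
    hence "(\<lambda>N. cdf (empirical_measure N (x0 N)) x) \<longlonglongrightarrow> cdf \<mu>0 x"
      using conv unfolding weak_conv_m_def weak_conv_def by blast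
    thus "(\<lambda>n. cdf (empirical_measure (Suc n) (x0 (Suc n))) x) \<longlonglongrightarrow> cdf \<mu>0 x" by (rule LIMSEQ_Suc)
  qed
  have "(\<lambda>n. \<integral>x. (min 1 (max 0 x)) ^ k \<partial>\<nu> n) \<longlonglongrightarrow> (\<integral>x. (min 1 (max 0 x)) ^ k \<partial>\<mu>0)"
  proof (rule weak_conv_imp_integral_bdd_continuous_conv[OF rd \<mu>0 wc, where B = 1])
    show "isCont (\<lambda>x::real. (min 1 (max 0 x)) ^ k) x" for x by (intro continuous_intros)
    show "norm ((min 1 (max 0 x)) ^ k) \<le> 1" for x :: real by (simp add: power_abs power_le_one)
  qed
  moreover have "(\<integral>x. (min 1 (max 0 x)) ^ k \<partial>\<nu> n) = power_sum (Suc n) (x0 (Suc n)) k" for n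
  proof -
    have "(\<integral>x. (min 1 (max 0 x)) ^ k \<partial>\<nu> n) = (\<Sum>i<Suc n. (min 1 (max 0 (x0 (Suc n) i))) ^ k) / real (Suc n)"
      unfolding \<nu>_def by (rule integral_empirical_measure) measurable
    also have "(\<Sum>i<Suc n. (min 1 (max 0 (x0 (Suc n) i))) ^ k) = (\<Sum>i<Suc n. x0 (Suc n) i ^ k)"
      by (rule sum.cong[OF refl]) (use x0[of "Suc n"] in auto)
    finally show ?thesis by (simp add: power_sum_def)
  qed
  ultimately have "(\<lambda>n. power_sum (Suc n) (x0 (Suc n)) k) \<longlonglongrightarrow> (\<integral>x. (min 1 (max 0 x)) ^ k \<partial>\<mu>0)" by simp
  thus ?thesis by (rule LIMSEQ_imp_Suc)
qed

text \<open>The limits m k t form a moment sequence by sampling: outside an event of probability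
  below 1 there is a sample point whose empirical measure at time t has its first n moments within 1
  / (n + 1) of them. These measures feed the compactness argument.\<close>

lemma limit_law_exists:
  fixes m :: "nat \<Rightarrow> real \<Rightarrow> real"
  assumes proc: "\<And>N. N \<ge> 1 \<Longrightarrow> beta_jacobi_process a b (\<beta> N) N (x0 N) (M N) (F N) (B N) (\<Lambda> N)"
    and close: "\<And>\<epsilon> \<eta> T K. \<epsilon> > 0 \<Longrightarrow> \<eta> > 0 \<Longrightarrow> T > 0 \<Longrightarrow> \<forall>\<^sub>F N in sequentially. \<exists>E\<in>sets (M N). measure (M N) E
        \<le> \<eta> \<and>
      (\<forall>\<omega>\<in>space (M N) - E. \<forall>k\<le>K. \<forall>t\<in>{0..T}. \<bar>power_sum N (\<lambda>i. \<Lambda> N i t \<omega>) k - m k t\<bar> \<le> \<epsilon>)"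
    and t: "t \<ge> 0"
  shows "\<exists>\<nu>\<in>prob01. \<forall>k. (\<integral>x. x ^ k \<partial>\<nu>) = m k t"
proof -
  have "\<exists>\<rho>. \<rho> \<in> prob01 \<and> (\<forall>k\<le>n. \<bar>(\<integral>x. x ^ k \<partial>\<rho>) - m k t\<bar> \<le> 1 / real (Suc n))" for n
  proof -
    \<comment> \<open>The probability bound 1 / 2 leaves a sample point outside the event, and the
      horizon t + 1 is positive also for t = 0.\<close>
    have "1 / real (Suc n) > 0" "(1 / 2 :: real) > 0" "t + 1 > 0" using t by auto
    from eventually_conj[OF close[OF this, of n] eventually_ge_at_top[of 1]]
    have "\<exists>N. (\<exists>E\<in>sets (M N). measure (M N) E \<le> 1 / 2 \<and>
      (\<forall>\<omega>\<in>space (M N) - E. \<forall>k\<le>n. \<forall>t\<in>{0..t + 1}. \<bar>power_sum N (\<lambda>i. \<Lambda> N i t \<omega>) k - m k t\<bar> \<le> 1 / real (Suc n)))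
          \<and> N \<ge> 1"
      by (rule eventually_happens'[OF sequentially_bot])
    then obtain N where N: "N \<ge> 1" and ex: "\<exists>E\<in>sets (M N). measure (M N) E \<le> 1 / 2 \<and>
      (\<forall>\<omega>\<in>space (M N) - E. \<forall>k\<le>n. \<forall>t\<in>{0..t + 1}. \<bar>power_sum N (\<lambda>i. \<Lambda> N i t \<omega>) k - m k t\<bar> \<le> 1 / real (Suc n))"
      by (elim exE conjE)
    interpret jp: jacobi_process a b "\<beta> N" N "x0 N" "M N" "F N" "B N" "\<Lambda> N"
      by unfold_locales (use proc N in auto)
    from ex obtain E where E: "E \<in> sets (M N)" "measure (M N) E \<le> 1 / 2"
        "\<forall>\<omega>\<in>space (M N) - E. \<forall>k\<le>n. \<forall>t\<in>{0..t + 1}.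
        \<bar>power_sum N (\<lambda>i. \<Lambda> N i t \<omega>) k - m k t\<bar> \<le> 1 / real (Suc n)" by (elim bexE conjE)
    have "E \<noteq> space (M N)" using E(2) jp.prob_space by auto
    then obtain \<omega> where \<omega>: "\<omega> \<in> space (M N) - E" using sets.sets_into_space[OF E(1)] by auto
    have "empirical_measure N (\<lambda>i. \<Lambda> N i t \<omega>) \<in> prob01"
      using \<omega> t by (intro empirical_measure_prob01[OF N] jp.\<Lambda>_01) auto
    moreover have "\<bar>(\<integral>x. x ^ k \<partial>empirical_measure N (\<lambda>i. \<Lambda> N i t \<omega>)) - m k t\<bar> \<le> 1 / real (Suc n)" if "k \<le> n"
        for k
      unfolding moment_empirical_measure using E(3) \<omega> that t by auto
    ultimately show ?thesis by (intro exI[of _ "empirical_measure N (\<lambda>i. \<Lambda> N i t \<omega>)"] conjI allI impI)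
  qed
  hence "\<exists>\<rho>. \<forall>n. \<rho> n \<in> prob01 \<and> (\<forall>k\<le>n. \<bar>(\<integral>x. x ^ k \<partial>\<rho> n) - m k t\<bar> \<le> 1 / real (Suc n))"
    by (intro choice allI)
  then obtain \<rho> where \<rho>: "\<forall>n. \<rho> n \<in> prob01 \<and> (\<forall>k\<le>n. \<bar>(\<integral>x. x ^ k \<partial>\<rho> n) - m k t\<bar> \<le> 1 / real (Suc n))"
    by (rule exE)
  show ?thesis
  proof (rule prob01_limit_of_moments)
    show "\<rho> n \<in> prob01" for n using \<rho> by simp
    fix k
    have "(\<lambda>n. (\<integral>x. x ^ k \<partial>\<rho> n) - m k t) \<longlonglongrightarrow> 0"
    proof (rule Lim_null_comparison)
      show "\<forall>\<^sub>F n in sequentially. norm ((\<integral>x. x ^ k \<partial>\<rho> n) - m k t) \<le> 1 / real (Suc n)"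
        using eventually_ge_at_top[of k] by eventually_elim (use \<rho> in simp)
      show "(\<lambda>n. 1 / real (Suc n)) \<longlonglongrightarrow> 0" by (rule LIMSEQ_Suc[OF lim_1_over_n])
    qed
    thus "(\<lambda>n. \<integral>x. x ^ k \<partial>\<rho> n) \<longlonglongrightarrow> m k t" by (simp only: LIM_zero_iff)
  qed
qed

theorem theorem3p1:
  fixes a b c T :: real
    and \<beta> :: "nat \<Rightarrow> real"
    and x0 :: "nat \<Rightarrow> nat \<Rightarrow> real"
    and M :: "nat \<Rightarrow> 'w measure"
    and F :: "nat \<Rightarrow> real \<Rightarrow> 'w measure"
    and B \<Lambda> :: "nat \<Rightarrow> nat \<Rightarrow> real \<Rightarrow> 'w \<Rightarrow> real"
    and \<mu>0 :: "real measure"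
  assumes "a > -1" and "b > -1" and "c \<ge> 0" and "T > 0"
    and "\<And>N. N \<ge> 1 \<Longrightarrow> \<beta> N > 0"
    and "(\<lambda>N. \<beta> N * real N) \<longlonglongrightarrow> 2 * c"
    and "\<And>N. N \<ge> 1 \<Longrightarrow> mono_on {..<N} (x0 N) \<and> (\<forall>i<N. x0 N i \<in> {0..1})"
    and "\<And>N. N \<ge> 1 \<Longrightarrow> beta_jacobi_process a b (\<beta> N) N (x0 N) (M N) (F N) (B N) (\<Lambda> N)"
    and "real_distribution \<mu>0"
    and "weak_conv_m (\<lambda>N. empirical_measure N (x0 N)) \<mu>0"
  shows "\<exists>m. moment_ivp a b c (\<lambda>N k. \<integral>x. x ^ k \<partial>empirical_measure N (x0 N)) m \<and>
    (\<forall>m'. moment_ivp a b c (\<lambda>N k. \<integral>x. x ^ k \<partial>empirical_measure N (x0 N)) m' \<longrightarrow>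
       (\<forall>k. \<forall>t\<ge>0. m' k t = m k t)) \<and>
    (\<forall>k\<ge>1. converges_in_prob (path_metric T euclidean_metric) M
       (\<lambda>N \<omega>. \<lambda>t\<in>{0..T}. \<integral>x. x ^ k \<partial>empirical_measure N (\<lambda>i. \<Lambda> N i t \<omega>))
       (\<lambda>t\<in>{0..T}. m k t)) \<and>
    (\<forall>k. (m k \<longlongrightarrow> limit_moment a b c k) at_top) \<and>
    (\<exists>\<mu>. (\<forall>t\<ge>0. has_moments (\<mu> t) (\<lambda>k. m k t) \<and>
             (\<forall>\<nu>. has_moments \<nu> (\<lambda>k. m k t) \<longrightarrow> \<nu> = \<mu> t)) \<and>
       converges_in_prob (path_metric T prob01_metric) M
         (\<lambda>N \<omega>. \<lambda>t\<in>{0..T}. empirical_measure N (\<lambda>i. \<Lambda> N i t \<omega>))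
         (\<lambda>t\<in>{0..T}. \<mu> t) \<and>
       continuous_map (top_of_set {0..}) (mtopology_of prob01_metric) \<mu> \<and>
       (\<exists>!\<nu>. is_spectral_measure (jacobi_matrix a b c) \<nu>) \<and>
       (\<forall>s. filterlim s at_top sequentially \<longrightarrow>
          weak_conv_m (\<lambda>n. \<mu> (s n)) (nu_measure a b c)))"
proof -
  note ab = assms(1-3) and T = assms(4) and proc = assms(8)
  let ?S0 = "\<lambda>N k. \<integral>x. x ^ k \<partial>empirical_measure N (x0 N)"
  \<comment> \<open>The limits of the initial moments, expressed through \<mu>0 by clipped powers;
    they are the initial values of the hierarchy.\<close>
  define s where "s k = (\<integral>x. (min 1 (max 0 x)) ^ k \<partial>\<mu>0)" for k
  define m where "m = moment_sol a b c s"
  have x0: "\<And>N. N \<ge> 1 \<Longrightarrow> \<forall>i<N. x0 N i \<in> {0..1}" using assms(7) by simp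
  have S0s: "(\<lambda>N. ?S0 N k) \<longlonglongrightarrow> s k" for k
    unfolding moment_empirical_measure s_def by (rule initial_moments_converge[OF x0 assms(9,10)])
  have m: "moment_ivp a b c ?S0 m" unfolding m_def by (rule moment_ivp_exists[OF S0s])
  have init: "(\<lambda>N. power_sum N (x0 N) j) \<longlonglongrightarrow> m j 0" if "j \<ge> 1" for j
    using m that unfolding moment_ivp_def moment_empirical_measure by blast
  have mc: "continuous_on {0..} (m k)" for k by (rule moment_ivp_continuous_on[OF m])
  have prob: "prob_space (M N)" if "N \<ge> 1" for N using proc[OF that] by (simp add: beta_jacobi_process_def)
  have close: "\<forall>\<^sub>F N in sequentially. \<exists>E\<in>sets (M N). measure (M N) E \<le> \<eta> \<and>
      (\<forall>\<omega>\<in>space (M N) - E. \<forall>k\<le>K. \<forall>t\<in>{0..T}. \<bar>power_sum N (\<lambda>i. \<Lambda> N i t \<omega>) k - m k t\<bar> \<le> \<epsilon>)"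
    if "\<epsilon> > 0" "\<eta> > 0" "T > 0" for \<epsilon> \<eta> T :: real and K
    by (rule power_sums_converge[OF ab that(3) assms(6) proc m init that(1,2)])
  have ex: "\<exists>\<nu>\<in>prob01. \<forall>k. (\<integral>x. x ^ k \<partial>\<nu>) = m k t" if "t \<ge> 0" for t
    by (rule limit_law_exists[OF proc close that])
  \<comment> \<open>Negative times receive the measure of time 0, so that \<mu> t is a measure on
    the unit interval for every real t.\<close>
  have "\<exists>\<mu>. \<forall>t. \<mu> t \<in> prob01 \<and> (\<forall>k. (\<integral>x. x ^ k \<partial>\<mu> t) = m k (max 0 t))"
  proof (intro choice allI)
    fix t :: real
    show "\<exists>\<nu>. \<nu> \<in> prob01 \<and> (\<forall>k. (\<integral>x. x ^ k \<partial>\<nu>) = m k (max 0 t))"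
      using ex[of "max 0 t", unfolded Bex_def] by simp
  qed
  then obtain \<mu> where \<mu>': "\<forall>t. \<mu> t \<in> prob01 \<and> (\<forall>k. (\<integral>x. x ^ k \<partial>\<mu> t) = m k (max 0 t))" by (rule exE)
  have \<mu>: "\<mu> t \<in> prob01" for t using \<mu>' by simp
  have mom: "(\<integral>x. x ^ k \<partial>\<mu> t) = m k t" if "t \<ge> 0" for t k using \<mu>' that by (simp add: max_def)
  have lim: "(m k \<longlongrightarrow> limit_moment a b c k) at_top" for k by (rule moment_ivp_tendsto_limit_moment[OF ab m])
  have \<mu>c: "continuous_map (top_of_set {0..}) (mtopology_of prob01_metric) \<mu>"
  proof (rule continuous_map_prob01_metric[OF \<mu>])
    show "continuous_on {0..} (\<lambda>t. \<integral>x. x ^ k \<partial>\<mu> t)" for k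
      using mc[of k] by (rule continuous_on_eq) (simp add: mom)
  qed
  \<comment> \<open>The limit moments are limits of moments of measures on the unit interval, taken
    at integer times; so they are the moments of such a measure. This is the existence of the
    spectral measure.\<close>
  have "\<exists>\<nu>\<in>prob01. \<forall>k. (\<integral>x. x ^ k \<partial>\<nu>) = limit_moment a b c k"
  proof (rule prob01_limit_of_moments)
    show "\<mu> (real n) \<in> prob01" for n by (rule \<mu>)
    show "(\<lambda>n. \<integral>x. x ^ k \<partial>\<mu> (real n)) \<longlonglongrightarrow> limit_moment a b c k" for k
      using filterlim_compose[OF lim filterlim_real_sequentially] by (simp add: mom)
  qed
  then obtain \<nu> where \<nu>: "\<nu> \<in> prob01" "\<And>k. (\<integral>x. x ^ k \<partial>\<nu>) = limit_moment a b c k" by blast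
  \<comment> \<open>The entries of the matrix powers are the limit moments, so a spectral measure is
    the same as a measure with these moments, and those determine \<nu>.\<close>
  have spec: "is_spectral_measure (jacobi_matrix a b c) \<rho> \<longleftrightarrow> \<rho> = \<nu>" for \<rho>
  proof
    assume "is_spectral_measure (jacobi_matrix a b c) \<rho>"
    thus "\<rho> = \<nu>" unfolding is_spectral_measure_def band_matrix_power_jacobi[OF ab]
      by (intro has_moments_unique_prob01[OF \<nu>]) (erule conjunct2)
  next
    assume "\<rho> = \<nu>"
    thus "is_spectral_measure (jacobi_matrix a b c) \<rho>"
      unfolding is_spectral_measure_def band_matrix_power_jacobi[OF ab]
      using has_moments_prob01[OF \<nu>] prob01_imp_real_distribution[OF \<nu>(1)] by simp
  qed
  have nu: "nu_measure a b c = \<nu>" unfolding nu_measure_def spec by simp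
  have conv_m: "converges_in_prob (path_metric T euclidean_metric) M
       (\<lambda>N \<omega>. \<lambda>t\<in>{0..T}. \<integral>x. x ^ k \<partial>empirical_measure N (\<lambda>i. \<Lambda> N i t \<omega>))
           (\<lambda>t\<in>{0..T}. m k t)" if k: "k \<ge> 1" for k
    unfolding moment_empirical_measure
  proof (rule converges_in_prob_pathI[OF _ _ prob])
    show "continuous_map (top_of_set {0..T}) (mtopology_of euclidean_metric) (m k)"
      using continuous_on_subset[OF mc, of "{0..T}" k] by simp
    fix N :: nat assume N: "N \<ge> 1"
    interpret jp: jacobi_process a b "\<beta> N" N "x0 N" "M N" "F N" "B N" "\<Lambda> N"
      by unfold_locales (use proc N in auto)
    show "(\<lambda>\<omega>. \<lambda>t\<in>{0..T}. power_sum N (\<lambda>i. \<Lambda> N i t \<omega>) k)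
        \<in> M N \<rightarrow>\<^sub>M metric_borel (path_metric T euclidean_metric)"
    proof (rule lipschitz_image_path_measurable[where g = "\<lambda>x. power_sum N x k" and N = N and L = "real k"])
      show "mdist euclidean_metric (power_sum N x k) (power_sum N y k) \<le> real k * r"
        if "\<forall>i<N. x i \<in> {0..1}" "\<forall>i<N. y i \<in> {0..1}" "\<forall>i<N. \<bar>x i - y i\<bar> \<le> r" for x y r
        using power_sum_lipschitz[OF N that] by (simp add: dist_real_def)
      show "continuous_on {0..T} (\<lambda>t. \<Lambda> N i t \<omega>)" if "i < N" "\<omega> \<in> space (M N)" for i \<omega>
        by (rule continuous_on_subset[OF jp.\<Lambda>_continuous[OF that(2,1)]]) auto
      show "\<Lambda> N i t \<in> borel_measurable (M N)" if "i < N" "t \<ge> 0" for i t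
        by (rule jp.measurable_F_M[OF that(2) jp.\<Lambda>_measurable[OF that]])
      show "\<Lambda> N i t \<omega> \<in> {0..1}" if "i < N" "t \<in> {0..T}" "\<omega> \<in> space (M N)" for i t \<omega>
        using jp.\<Lambda>_01[OF that(3,1), of t] that(2) by simp
    qed (use k T in auto)
  next
    fix \<epsilon> \<eta> :: real assume "\<epsilon> > 0" "\<eta> > 0"
    from close[OF this T, of k] show "\<forall>\<^sub>F N in sequentially. \<exists>E\<in>sets (M N). measure (M N) E \<le> \<eta> \<and>
      (\<forall>\<omega>\<in>space (M N) - E. \<forall>t\<in>{0..T}. mdist euclidean_metric (power_sum N (\<lambda>i. \<Lambda> N i t \<omega>) k) (m k t) \<le> \<epsilon>)"
      by (rule eventually_mono) (auto simp: dist_real_def)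
  qed
  have conv_\<mu>: "converges_in_prob (path_metric T prob01_metric) M
         (\<lambda>N \<omega>. \<lambda>t\<in>{0..T}. empirical_measure N (\<lambda>i. \<Lambda> N i t \<omega>)) (\<lambda>t\<in>{0..T}. \<mu> t)"
  proof (rule converges_in_prob_pathI[OF _ _ prob])
    show "continuous_map (top_of_set {0..T}) (mtopology_of prob01_metric) \<mu>"
      by (rule continuous_map_from_subtopology_mono[OF \<mu>c]) auto
    fix N :: nat assume N: "N \<ge> 1"
    interpret jp: jacobi_process a b "\<beta> N" N "x0 N" "M N" "F N" "B N" "\<Lambda> N"
      by unfold_locales (use proc N in auto)
    show "(\<lambda>\<omega>. \<lambda>t\<in>{0..T}. empirical_measure N (\<lambda>i. \<Lambda> N i t \<omega>))
        \<in> M N \<rightarrow>\<^sub>M metric_borel (path_metric T prob01_metric)"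
    proof (rule lipschitz_image_path_measurable[where g = "empirical_measure N" and N = N and L = 1])
      show "mdist prob01_metric (empirical_measure N x) (empirical_measure N y) \<le> 1 * r"
        if "\<forall>i<N. x i \<in> {0..1}" "\<forall>i<N. y i \<in> {0..1}" "\<forall>i<N. \<bar>x i - y i\<bar> \<le> r" for x y r
        using bl_dist_empirical_measure_le[OF N, of x y r] that by simp
      show "empirical_measure N x \<in> mspace prob01_metric" if "\<forall>i<N. x i \<in> {0..1}" for x
        using empirical_measure_prob01[OF N, of x] that by simp
      show "continuous_on {0..T} (\<lambda>t. \<Lambda> N i t \<omega>)" if "i < N" "\<omega> \<in> space (M N)" for i \<omega>
        by (rule continuous_on_subset[OF jp.\<Lambda>_continuous[OF that(2,1)]]) auto
      show "\<Lambda> N i t \<in> borel_measurable (M N)" if "i < N" "t \<ge> 0" for i t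
        by (rule jp.measurable_F_M[OF that(2) jp.\<Lambda>_measurable[OF that]])
      show "\<Lambda> N i t \<omega> \<in> {0..1}" if "i < N" "t \<in> {0..T}" "\<omega> \<in> space (M N)" for i t \<omega>
        using jp.\<Lambda>_01[OF that(3,1), of t] that(2) by simp
    qed (use T in auto)
  next
    fix \<epsilon> \<eta> :: real assume \<epsilon>: "\<epsilon> > 0" and \<eta>: "\<eta> > 0"
    \<comment> \<open>The degree n and the tolerance \<delta> depend on \<epsilon> alone, hence one
      joint estimate of the first n moments controls the distance at all times of [0,T].\<close>
    from bl_dist_small_of_moments[OF \<epsilon>]
    obtain n \<delta> where \<delta>: "\<delta> > 0" and small: "\<forall>\<mu>\<in>prob01. \<forall>\<nu>\<in>prob01.
       (\<forall>k\<le>n. \<bar>(\<integral>x. x ^ k \<partial>\<mu>) - (\<integral>x. x ^ k \<partial>\<nu>)\<bar> \<le> \<delta>) \<longrightarrow> bl_dist \<mu> \<nu> \<le> \<epsilon>" by (elim exE conjE)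
    from close[OF \<delta> \<eta> T, of n] eventually_ge_at_top[of 1]
    show "\<forall>\<^sub>F N in sequentially. \<exists>E\<in>sets (M N). measure (M N) E \<le> \<eta> \<and>
      (\<forall>\<omega>\<in>space (M N) - E. \<forall>t\<in>{0..T}. mdist prob01_metric (empirical_measure N (\<lambda>i. \<Lambda> N i t \<omega>)) (\<mu> t) \<le> \<epsilon>)"
    proof eventually_elim
      case (elim N)
      interpret jp: jacobi_process a b "\<beta> N" N "x0 N" "M N" "F N" "B N" "\<Lambda> N"
        by unfold_locales (use proc elim(2) in auto)
      from elim(1) obtain E where E: "E \<in> sets (M N)" "measure (M N) E \<le> \<eta>"
        "\<forall>\<omega>\<in>space (M N) - E. \<forall>k\<le>n. \<forall>t\<in>{0..T}. \<bar>power_sum N (\<lambda>i. \<Lambda> N i t \<omega>) k - m k t\<bar> \<le> \<delta>"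
        by (elim bexE conjE)
      have "bl_dist (empirical_measure N (\<lambda>i. \<Lambda> N i t \<omega>)) (\<mu> t) \<le> \<epsilon>"
        if \<omega>: "\<omega> \<in> space (M N) - E" and t: "t \<in> {0..T}" for \<omega> t
      proof (rule small[rule_format])
        show "empirical_measure N (\<lambda>i. \<Lambda> N i t \<omega>) \<in> prob01"
          using \<omega> t by (intro empirical_measure_prob01[OF elim(2)] jp.\<Lambda>_01) auto
        show "\<mu> t \<in> prob01" by (rule \<mu>)
        show "\<bar>(\<integral>x. x ^ k \<partial>empirical_measure N (\<lambda>i. \<Lambda> N i t \<omega>)) - (\<integral>x. x ^ k \<partial>\<mu> t)\<bar> \<le> \<delta>" if "k \<le> n" for k
          unfolding moment_empirical_measure using E(3) \<omega> t that by (simp add: mom)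
      qed
      thus ?case using E(1,2) by (intro bexI[of _ E]) auto
    qed
  qed
  have weak: "weak_conv_m (\<lambda>n. \<mu> (s n)) \<nu>" if s: "filterlim s at_top sequentially" for s
  proof (rule weak_conv_m_of_bl_dist[OF \<mu> \<nu>(1)], rule bl_dist_tendsto_zero_of_moments[OF \<mu> \<nu>(1)])
    fix k
    have "\<forall>\<^sub>F n in sequentially. s n \<ge> 0" using s by (rule filterlim_at_top[THEN iffD1, rule_format])
    hence "\<forall>\<^sub>F n in sequentially. (\<integral>x. x ^ k \<partial>\<mu> (s n)) = m k (s n)" by eventually_elim (rule mom)
    moreover have "(\<lambda>n. m k (s n)) \<longlonglongrightarrow> limit_moment a b c k" by (rule filterlim_compose[OF lim s])
    ultimately show "(\<lambda>n. \<integral>x. x ^ k \<partial>\<mu> (s n)) \<longlonglongrightarrow> (\<integral>x. x ^ k \<partial>\<nu>)"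
      unfolding \<nu>(2) by (simp add: tendsto_cong)
  qed
  have hm: "has_moments (\<mu> t) (\<lambda>k. m k t)" "\<And>\<rho>. has_moments \<rho> (\<lambda>k. m k t) \<Longrightarrow> \<rho> = \<mu> t" if "t \<ge> 0" for t
    by (rule has_moments_prob01[OF \<mu> mom[OF that]], rule has_moments_unique_prob01[OF \<mu> mom[OF that]])
  show ?thesis
  proof (rule exI[of _ m], intro conjI)
    show "moment_ivp a b c ?S0 m" by (rule m)
    show "\<forall>m'. moment_ivp a b c ?S0 m' \<longrightarrow> (\<forall>k. \<forall>t\<ge>0. m' k t = m k t)"
      by (intro allI impI moment_ivp_unique[OF m])
    show "\<forall>k. (m k \<longlongrightarrow> limit_moment a b c k) at_top" using lim by blast
    show "\<forall>k\<ge>1. converges_in_prob (path_metric T euclidean_metric) M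
       (\<lambda>N \<omega>. \<lambda>t\<in>{0..T}. \<integral>x. x ^ k \<partial>empirical_measure N (\<lambda>i. \<Lambda> N i t \<omega>))
       (\<lambda>t\<in>{0..T}. m k t)" using conv_m by blast
    show "\<exists>\<mu>. (\<forall>t\<ge>0. has_moments (\<mu> t) (\<lambda>k. m k t) \<and>
             (\<forall>\<nu>. has_moments \<nu> (\<lambda>k. m k t) \<longrightarrow> \<nu> = \<mu> t)) \<and>
       converges_in_prob (path_metric T prob01_metric) M
         (\<lambda>N \<omega>. \<lambda>t\<in>{0..T}. empirical_measure N (\<lambda>i. \<Lambda> N i t \<omega>))
         (\<lambda>t\<in>{0..T}. \<mu> t) \<and>
       continuous_map (top_of_set {0..}) (mtopology_of prob01_metric) \<mu> \<and>
       (\<exists>!\<nu>. is_spectral_measure (jacobi_matrix a b c) \<nu>) \<and>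
       (\<forall>s. filterlim s at_top sequentially \<longrightarrow>
          weak_conv_m (\<lambda>n. \<mu> (s n)) (nu_measure a b c))"
    proof (rule exI[of _ \<mu>], intro conjI)
      show "\<exists>!\<nu>. is_spectral_measure (jacobi_matrix a b c) \<nu>" unfolding spec by simp
      show "\<forall>s. filterlim s at_top sequentially \<longrightarrow> weak_conv_m (\<lambda>n. \<mu> (s n)) (nu_measure a b c)"
        unfolding nu using weak by simp
    qed (use hm in simp, rule conv_\<mu>, rule \<mu>c)
  qed
qed

end
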